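(* There exist universal constants $\epsilon_0>0$ and $\alpha>0$ such that the following holds for every integer $k\ge 2$ and every $0<\epsilon\le\epsilon_0$. Set $I^\epsilon=\left[-\alpha/\epsilon^2,\ \alpha/\epsilon^2\right]$. (a) Suppose that $u_0\in H^k(\mathbb{R})$ satisfies $\|u_0\|_{H^2(\mathbb{R})}\le \epsilon$. Then there exists a solution $$u\in C\left(I^\epsilon;H^k(\mathbb{R})\right)\cap C^1\left(I^\epsilon;H^{k-1}(\mathbb{R})\right)$$ of the initial value problem $$u_t+uu_x=\mathbf{H}[u],\qquad u(0,x)=u_0(x),$$ defined on the time interval $I^\epsilon$, such that for every $0\le s\le k$ $$\|u\|_{L^\infty(I^\epsilon;H^s(\mathbb{R}))}\le C\,\|u(0)\|_{H^s(\mathbb{R})},$$ where $C$ depends at most on $k$ and $s$ (and not on $\epsilon$, $u_0$ or $u$). (b) Let $u_1,u_2$ be two solutions of $u_t+uu_x=\mathbf{H}[u]$ as in part (a), that is, with initial data $u_1(0),u_2(0)\in H^k(\mathbb{R})$ satisfying $\|u_j(0)\|_{H^2(\mathbb{R})}\le\epsilon$ for $j=1,2$, defined on $I^\epsilon$ and having the regularity and bounds stated in (a). Then $$\|u_1-u_2\|_{L^\infty(I^\epsilon;L^2(\mathbb{R}))}\le C'\,\|u_1(0)-u_2(0)\|_{L^2(\mathbb{R})},$$ where $C'$ depends at most on $k$ (and not on $\epsilon$, $u_1$ or $u_2$).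
   Context: All functions are real-valued; $u=u(t,x)$ with $t$ time and $x\in\mathbb{R}$, and subscripts denote partial derivatives. $\mathbf{H}$ is the Hilbert transform in the variable $x$ on $\mathbb{R}$, i.e. the Fourier multiplier with symbol $-i\,\mathrm{sgn}(\xi)$, so that $\mathbf{H}\circ\partial_x=|\partial_x|$ has symbol $|\xi|$. $H^s(\mathbb{R})$ denotes the standard $L^2$-based Sobolev space (for an integer $k$, functions with $k$ weak derivatives in $L^2$), and $H^0=L^2$. The smallness condition $\epsilon\ll1$ is expressed as $\epsilon\le\epsilon_0$, and estimates up to an implied multiplicative constant are written with explicit constants $C,C'$. *)

theory Defs
  imports "HOL-Analysis.Analysis" "HOL-Probability.Essential_Supremum"
begin

text \<open>
  Elements of \<open>L\<^sup>2\<close> and of the Sobolev spaces are represented by functions rather than by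
  classes modulo equality almost everywhere; every notion below is invariant under changing
  a function of the space variable on a null set.
\<close>

definition L2 :: "(real \<Rightarrow> 'a::real_normed_vector) set" where
  "L2 = {f. f \<in> borel_measurable lborel \<and> integrable lborel (\<lambda>x. (norm (f x))\<^sup>2)}"

definition truncated_fourier :: "nat \<Rightarrow> (real \<Rightarrow> complex) \<Rightarrow> real \<Rightarrow> complex" where
  "truncated_fourier n f \<xi> =
     complex_of_real (1 / sqrt (2 * pi)) *
       (LINT x:{- real n..real n}|lborel. cis (- (x * \<xi>)) * f x)"

text \<open>
  The Fourier--Plancherel transform on \<open>L\<^sup>2\<close>, with the unitary normalisation
  \<open>(2\<pi>)\<^bsup>-1/2\<^esup> \<integral> e\<^bsup>-ix\<xi>\<^esup> f(x) dx\<close> (so that \<open>\<partial>\<^sub>x\<close> has symbol \<open>i\<xi>\<close> and \<open>H\<^sup>0 = L\<^sup>2\<close> isometrically).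
  It is the \<open>L\<^sup>2\<close> limit of the transforms of the truncations of \<open>f\<close>, and is therefore determined
  only almost everywhere; the choice operator picks a representative.
\<close>

definition has_fourier_L2 :: "(real \<Rightarrow> complex) \<Rightarrow> (real \<Rightarrow> complex) \<Rightarrow> bool" where
  "has_fourier_L2 f g \<longleftrightarrow> f \<in> L2 \<and> g \<in> L2 \<and>
     (\<lambda>n. \<integral>\<^sup>+\<xi>. ennreal ((cmod (truncated_fourier n f \<xi> - g \<xi>))\<^sup>2) \<partial>lborel) \<longlonglongrightarrow> 0"

definition fourier_L2 :: "(real \<Rightarrow> real) \<Rightarrow> real \<Rightarrow> complex" where
  "fourier_L2 f = (SOME g. has_fourier_L2 (\<lambda>x. complex_of_real (f x)) g)"

definition Hs :: "real \<Rightarrow> (real \<Rightarrow> real) set" where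
  "Hs s = {f. f \<in> L2 \<and>
     integrable lborel (\<lambda>\<xi>. (1 + \<xi>\<^sup>2) powr s * (cmod (fourier_L2 f \<xi>))\<^sup>2)}"

text \<open>Meaningful for members of \<open>Hs s\<close> only, since non-convergent integrals are 0 by convention.\<close>

definition Hs_norm :: "real \<Rightarrow> (real \<Rightarrow> real) \<Rightarrow> real" where
  "Hs_norm s f = sqrt (LINT \<xi>|lborel. (1 + \<xi>\<^sup>2) powr s * (cmod (fourier_L2 f \<xi>))\<^sup>2)"

definition hilbert_transform :: "(real \<Rightarrow> real) \<Rightarrow> real \<Rightarrow> real" where
  "hilbert_transform f = (SOME g. g \<in> L2 \<and>
     (AE \<xi> in lborel. fourier_L2 g \<xi> = - \<i> * complex_of_real (sgn \<xi>) * fourier_L2 f \<xi>))"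

definition test_function :: "(real \<Rightarrow> real) \<Rightarrow> bool" where
  "test_function \<phi> \<longleftrightarrow>
     (\<forall>n x. (deriv ^^ n) \<phi> field_differentiable at x) \<and> compact (closure {x. \<phi> x \<noteq> 0})"

definition has_weak_deriv :: "(real \<Rightarrow> real) \<Rightarrow> (real \<Rightarrow> real) \<Rightarrow> bool" where
  "has_weak_deriv f g \<longleftrightarrow>
     (\<forall>a b. set_integrable lborel {a..b} f \<and> set_integrable lborel {a..b} g) \<and>
     (\<forall>\<phi>. test_function \<phi> \<longrightarrow>
        (LINT x|lborel. f x * deriv \<phi> x) = - (LINT x|lborel. g x * \<phi> x))"

definition weak_deriv :: "(real \<Rightarrow> real) \<Rightarrow> real \<Rightarrow> real" where
  "weak_deriv f = (SOME g. has_weak_deriv f g)"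

text \<open>A function \<open>u\<close> of time and space is curried, with the time variable first.\<close>

definition continuous_into_Hs :: "real set \<Rightarrow> real \<Rightarrow> (real \<Rightarrow> real \<Rightarrow> real) \<Rightarrow> bool" where
  "continuous_into_Hs I s u \<longleftrightarrow> (\<forall>t\<in>I. u t \<in> Hs s) \<and>
     (\<forall>t\<in>I. ((\<lambda>\<tau>. Hs_norm s (\<lambda>x. u \<tau> x - u t x)) \<longlongrightarrow> 0) (at t within I))"

text \<open>
  \<open>v\<close> is the derivative of the \<open>Hs s\<close>-valued curve \<open>u\<close> on \<open>I\<close> and is continuous
  (one-sided derivatives at the endpoints of \<open>I\<close>).
\<close>

definition C1_into_Hs ::
  "real set \<Rightarrow> real \<Rightarrow> (real \<Rightarrow> real \<Rightarrow> real) \<Rightarrow> (real \<Rightarrow> real \<Rightarrow> real) \<Rightarrow> bool" where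
  "C1_into_Hs I s u v \<longleftrightarrow> continuous_into_Hs I s u \<and> continuous_into_Hs I s v \<and>
     (\<forall>t\<in>I. ((\<lambda>\<tau>. Hs_norm s (\<lambda>x. (u \<tau> x - u t x) / (\<tau> - t) - v t x)) \<longlongrightarrow> 0) (at t within I))"

text \<open>
  \<open>u \<in> C(I; H\<^sup>k) \<inter> C\<^sup>1(I; H\<^bsup>k-1\<^esup>)\<close> solves \<open>u\<^sub>t + u u\<^sub>x = \<^bold>H[u]\<close>; \<open>v\<close> plays the role of \<open>u\<^sub>t\<close>.
\<close>

definition burgers_hilbert_solution ::
  "nat \<Rightarrow> real set \<Rightarrow> (real \<Rightarrow> real \<Rightarrow> real) \<Rightarrow> bool" where
  "burgers_hilbert_solution k I u \<longleftrightarrow>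
     continuous_into_Hs I (real k) u \<and>
     (\<exists>v. C1_into_Hs I (real k - 1) u v \<and>
        (\<forall>t\<in>I. AE x in lborel.
           v t x + u t x * weak_deriv (u t) x = hilbert_transform (u t) x))"

definition Linf_Hs_norm :: "real set \<Rightarrow> real \<Rightarrow> (real \<Rightarrow> real \<Rightarrow> real) \<Rightarrow> ereal" where
  "Linf_Hs_norm I s u = esssup (restrict_space lborel I) (\<lambda>t. ereal (Hs_norm s (u t)))"

definition Hs_bounds ::
  "nat \<Rightarrow> real set \<Rightarrow> (real \<Rightarrow> real) \<Rightarrow> (real \<Rightarrow> real \<Rightarrow> real) \<Rightarrow> bool" where
  "Hs_bounds k I C u \<longleftrightarrow>
     (\<forall>s. 0 \<le> s \<and> s \<le> real k \<longrightarrow> Linf_Hs_norm I s u \<le> ereal (C s * Hs_norm s (u 0)))"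

definition life_span :: "real \<Rightarrow> real \<Rightarrow> real set" where
  "life_span \<alpha> \<epsilon> = {- (\<alpha> / \<epsilon>\<^sup>2)..\<alpha> / \<epsilon>\<^sup>2}"

end

theory Submission
  imports Defs "HOL-Probability.Probability"
begin

text \<open>
  On the Fourier side the equation reads \<open>F' = sgnm F + Nl F\<close>. For frequencies with \<open>x + y + z = 0\<close> the phases of the
  linear flow add up to \<open>sgn x + sgn y + sgn z = \<plusminus>1\<close>, so the quadratic interaction is not resonant: adding a cubic
  correction to the energy \<open>\<parallel>\<partial>\<^sup>K u\<parallel>\<^sup>2\<close> removes the cubic part of its rate of change. The remaining quartic part loses no
  derivative, because after symmetrization the signs in its highest order part cancel (the transport structure). Hence
  energies double only after a time of order \<open>\<epsilon>\<^sup>-\<^sup>2\<close>.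

  For smooth data this bounds the band-limited solutions of the truncated equation, which are power series in time,
  uniformly in the truncation; they converge in \<open>L\<^sup>2\<close>, and by interpolation in every norm. The same correction, applied to
  the difference of two solutions, gives stability in \<open>L\<^sup>2\<close>. Comparing a solution with the one whose data are cut off
  at a frequency \<open>n\<close> bounds its tail beyond \<open>n\<close> by the tail of the data; integrating over \<open>n\<close> gives all norms of
  non-integer order, and the tails show that the solutions with truncated data converge in \<open>H\<^sup>k\<close> for rough data.
\<close>


section \<open>Square-integrable functions\<close>

text \<open>Two demands on the constants shape the proof. First, \<open>\<epsilon>0\<close> and
  \<open>\<alpha>\<close> must serve every \<open>k\<close>, although the smallness that makes the
  corrected energy of order \<open>J + 1\<close> comparable with the energy itself depends on
  \<open>J\<close>. Smallness is therefore imposed at order 2 only. At another order, data that are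
  not small enough for that order live for a time \<alpha>/\<epsilon>^2 bounded in terms of
  \<open>J\<close>, and there the uncorrected exponential estimate suffices. Second, the bound of
  part (a) at \<open>s = 2\<close> is a hypothesis of part (b) and decides how small the solutions
  are there, so its constant must be free of \<open>k\<close> as well. The correction needs no
  division by a small phase: the phase is 1 or -1, hence its own inverse. Its symbol costs no more
  than the energy, but differentiating it in time requires a space of about twice the order. For
  this reason all energy estimates are made on band-limited functions, which lie in every weighted
  space, and only the resulting bounds are passed to limits. Physical space returns only in the last
  section, through Plancherel, since the linear operator is a bounded multiplier and products are
  convolutions.\<close>

type_synonym cfun = "real => complex"
abbreviation AE_lborel :: "(real => bool) => bool" (binder "ae " 10) where "AE_lborel P == eventually P (ae_filter lborel)"
abbreviation nn_lborel :: "(real => ennreal) => ennreal" (binder "NN " 10) where "nn_lborel f == nn_integral lborel f"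
abbreviation cr :: "cfun" where "cr == complex_of_real"
abbreviation dq :: "(real => cfun) => (real => cfun) => real => real => cfun" where
 "dq f v t r == %x. (f r x - f t x) / cr (r - t) - v t x"
notation tendsto (infixr "--->" 55)
notation LIMSEQ ("((_)/ ----> (_))" [60, 60] 60)
lemmas bi_cong = Bochner_Integration.integral_cong and bi_bound = Bochner_Integration.integrable_bound
abbreviation (input) meas :: "cfun => bool" where
 "meas f \<equiv> f : borel_measurable borel"

lemma borel_measurable_cnj' [measurable (raw)]:
 "f : borel_measurable M ==> (%x. cnj (f x)) : borel_measurable M"
 using borel_measurable_continuous_on[of cnj f M] by (simp add: continuous_on_cnj)

text \<open>A divergent integral has the value 0 here, so a bound on \<open>n2 f\<close> carries
  information only together with \<open>f : L2\<close>. The lemmas below therefore deliver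
  membership and bound in pairs.\<close>

definition n2 :: "cfun => real" where
 "n2 f = sqrt (LBINT x. (cmod (f x))^2)"

abbreviation n2d :: "cfun => cfun => real" where "n2d f g == n2 (%x. f x - g x)"

lemma L2_iff: "f : L2 \<longleftrightarrow> f : borel_measurable borel \<and> integrable lborel (%x. (norm (f x))^2)"
 by (simp add: L2_def)

lemma L2_meas: "f : L2 ==> f : borel_measurable borel"
 by (simp add: L2_iff)

lemma L2_int: "f : L2 ==> integrable lborel (%x. (norm (f x))^2)"
 by (simp add: L2_iff)

lemma n2_nonneg [simp]: "0 <= n2 f"
 by (simp add: n2_def)

lemma n2_sq: "(n2 f)^2 = (LBINT x. (cmod (f x))^2)"
 by (simp add: n2_def)

lemma nn_n2: assumes "f : L2" shows "(NN x. ennreal ((cmod (f x))^2)) = ennreal ((n2 f)^2)"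
 unfolding n2_sq by (rule nn_integral_eq_integral) (use assms in "auto simp: L2_int")

text \<open>A nonnegative integral exists without any proof of integrability, so a single bound on
  it yields membership and norm together. Most memberships below rest on this lemma or on
  \<open>L2_bound\<close>.\<close>

lemma L2I_nn:
 assumes "meas f" "(NN x. ennreal ((cmod (f x))^2)) <= ennreal (c^2)" "0 <= c"
 shows "f : L2" "n2 f <= c"
proof -
 have m[measurable]: "meas f" by fact
 have "integrable lborel (%x. (norm (f x))^2)"
  using assms(2) by (subst integrable_iff_bounded) (auto simp: le_less_trans)
 then show f: "f : L2" using m by (simp add: L2_iff)
 have "ennreal ((n2 f)^2) <= ennreal (c^2)" using assms(2) nn_n2[OF f] by simp
 then show "n2 f <= c" using assms(3) by (simp add: abs_le_square_iff[symmetric])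
qed

lemma L2_bound:
 assumes "g : L2" "meas f" "ae x. cmod (f x) <= c * cmod (g x)" "0 <= c"
 shows "f : L2" "n2 f <= c * n2 g"
proof -
 have "(NN x. ennreal ((cmod (f x))^2)) <= (NN x. ennreal (c^2) * ennreal ((cmod (g x))^2))"
  using assms(3) by (intro nn_integral_mono_AE) 
   (auto simp: ennreal_mult[symmetric] power_mult_distrib[symmetric] elim!: eventually_mono intro!: power_mono ennreal_leI)
 also have "... = ennreal (c^2) * ennreal ((n2 g)^2)"
  using assms(1) L2_meas[OF assms(1)] by (subst nn_integral_cmult) (auto simp: nn_n2)
 also have "... = ennreal ((c * n2 g)^2)" by (simp add: ennreal_mult[symmetric] power_mult_distrib)
 finally show "f : L2" "n2 f <= c * n2 g"
  using L2I_nn[OF assms(2), of "c * n2 g"] assms(4) by auto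
qed

lemma L2_mono:
 assumes "g : L2" "meas f" "ae x. cmod (f x) <= cmod (g x)"
 shows "f : L2" "n2 f <= n2 g"
 using L2_bound[of g f 1] assms by auto

lemma n2_cong_AE: "meas f ==> meas g ==> ae x. f x = g x ==> n2 f = n2 g"
 unfolding n2_def by (intro arg_cong[where f=sqrt] integral_cong_AE) (auto elim: eventually_mono)

lemma L2_cong_AE: "f : L2 ==> meas g ==> ae x. f x = g x ==> g : L2"
 by (rule L2_mono(1)[of f]) (auto elim: eventually_mono)

lemma L2_zero [simp]: "(%x. 0::complex) : L2" by (simp add: L2_iff)

lemma n2_zero [simp]: "n2 (%x. 0) = 0" by (simp add: n2_def)

lemma L2_cmult: assumes "f : L2" shows "(%x. c * f x :: complex) : L2"
 using assms by (auto simp: L2_iff norm_mult power_mult_distrib)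

lemma n2_cmult: "n2 (%x. c * f x) = cmod c * n2 f"
 by (simp add: n2_def norm_mult power_mult_distrib real_sqrt_mult)

lemma L2_add: assumes "f : L2" "g : L2" shows "(%x. f x + g x :: complex) : L2"
proof -
 have [measurable]: "meas f" "meas g" using assms by (auto simp: L2_meas)
 have "integrable lborel (%x. (norm (f x + g x))^2)"
 proof (rule bi_bound)
  show "integrable lborel (%x. 2 * (norm (f x))^2 + 2 * (norm (g x))^2)"
   using assms by (auto simp: L2_int)
  show "ae x. norm ((norm (f x + g x))^2) <= norm (2 * (norm (f x))^2 + 2 * (norm (g x))^2)"
  proof (rule AE_I2)
   fix x
   have "(norm (f x + g x))^2 <= (norm (f x) + norm (g x))^2" by (simp add: norm_triangle_ineq power_mono)
   also have "... <= 2 * (norm (f x))^2 + 2 * (norm (g x))^2" by (smt (verit) power2_sum sum_squares_bound)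
   finally show "norm ((norm (f x + g x))^2) <= norm (2 * (norm (f x))^2 + 2 * (norm (g x))^2)" by simp
  qed
 qed simp
 then show ?thesis by (simp add: L2_iff)
qed

lemma L2_uminus: "f : L2 ==> (%x. - f x :: complex) : L2"
 by (auto simp: L2_iff)

lemma L2_diff: "f : L2 ==> g : L2 ==> (%x. f x - g x :: complex) : L2"
 using L2_add[of f "%x. - g x"] by (simp add: L2_uminus)

lemma L2_cnj: "f : L2 ==> (%x. cnj (f x)) : L2"
 by (auto simp: L2_iff)

lemma n2_cnj: "n2 (%x. cnj (f x)) = n2 f"
 by (simp add: n2_def)

lemma n2_uminus: "n2 (%x. - f x) = n2 f"
 by (simp add: n2_def)

lemma n2_minus_commute: "n2d f g = n2d g f"
 by (simp add: n2_def norm_minus_commute)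

lemma nn_CS:
 assumes "f : L2" "g : L2"
 shows "(NN x. ennreal (cmod (f x)) * ennreal (cmod (g x))) <= ennreal (n2 f * n2 g)"
proof -
 have [measurable]: "meas f" "meas g" using assms by (auto simp: L2_meas)
 let ?I = "(NN x. ennreal (cmod (f x)) * ennreal (cmod (g x)))"
 have "?I^2 <= ennreal ((n2 f)^2) * ennreal ((n2 g)^2)"
  using Cauchy_Schwarz_nn_integral[of "%x. ennreal (cmod (f x))" lborel "%x. ennreal (cmod (g x))"]
  by (simp add: ennreal_power nn_n2 assms)
 also have "... = (ennreal (n2 f * n2 g))^2"
  by (simp add: ennreal_mult[symmetric] ennreal_power power_mult_distrib)
 finally have *: "?I^2 <= (ennreal (n2 f * n2 g))^2" .
 show ?thesis
 \<comment> \<open>The squares in \<open>*\<close> are cancelled after an infinite value of the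
   integral has been ruled out.\<close>
 proof (rule ccontr)
  assume "\<not> ?I <= ennreal (n2 f * n2 g)"
  then have "ennreal (n2 f * n2 g) < ?I" by simp
  moreover from * have "?I \<noteq> \<top>" by (auto simp: ennreal_power top_unique)
  then obtain r where r: "0 <= r" "?I = ennreal r" by (cases ?I) auto
  ultimately have "n2 f * n2 g < r" by (simp add: ennreal_less_iff)
  then have "(n2 f * n2 g)^2 < r^2" by (simp add: power_strict_mono)
  moreover have "r^2 <= (n2 f * n2 g)^2" using * r by (simp add: ennreal_power)
  ultimately show False by simp
 qed
qed

lemma L2_mult_int:
 assumes "f : L2" "g : L2"
 shows "integrable lborel (%x. f x * g x :: complex)"
proof -
 have [measurable]: "meas f" "meas g" using assms by (auto simp: L2_meas)
 show ?thesis
  by (rule integrableI_bounded)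
   (use le_less_trans[OF nn_CS[OF assms] ennreal_less_top] in "auto simp: norm_mult ennreal_mult")
qed

lemma CS_abs:
 assumes "f : L2" "g : L2"
 shows "(LBINT x. cmod (f x) * cmod (g x)) <= n2 f * n2 g"
proof -
 have i: "integrable lborel (%x. cmod (f x) * cmod (g x))"
  using integrable_norm[OF L2_mult_int[OF assms]] by (simp add: norm_mult)
 have "ennreal (LBINT x. cmod (f x) * cmod (g x)) = (NN x. ennreal (cmod (f x) * cmod (g x)))"
  by (rule nn_integral_eq_integral[symmetric]) (use i in auto)
 also have "... <= ennreal (n2 f * n2 g)" using nn_CS[OF assms] by (simp add: ennreal_mult)
 finally show ?thesis by simp
qed

lemma CS:
 assumes "f : L2" "g : L2"
 shows "cmod (LBINT x. f x * g x) <= n2 f * n2 g"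
 using integral_norm_bound[of lborel "%x. f x * g x"] CS_abs[OF assms] by (simp add: norm_mult)

definition ip :: "cfun => cfun => complex" where
 "ip f g = (LBINT x. f x * cnj (g x))"

lemma ip_CS: "f : L2 ==> g : L2 ==> cmod (ip f g) <= n2 f * n2 g"
 unfolding ip_def using CS[of f "%x. cnj (g x)"] by (simp add: L2_cnj n2_cnj)

lemma ip_int: "f : L2 ==> g : L2 ==> integrable lborel (%x. f x * cnj (g x))"
 by (simp add: L2_mult_int L2_cnj)

lemma ip_add_left: "f : L2 ==> g : L2 ==> h : L2 ==> ip (%x. f x + g x) h = ip f h + ip g h"
 by (simp add: ip_def ring_distribs ip_int)

lemma ip_diff_left: "f : L2 ==> g : L2 ==> h : L2 ==> ip (%x. f x - g x) h = ip f h - ip g h"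
 by (simp add: ip_def left_diff_distrib ip_int)

lemma ip_cnj: "cnj (ip f g) = ip g f"
proof -
 have "cnj (ip f g) = (LBINT x. cnj (f x * cnj (g x)))" unfolding ip_def by (simp only: Bochner_Integration.integral_cnj)
 then show ?thesis by (simp add: ip_def mult.commute)
qed

lemma ip_self: "ip f f = cr ((n2 f)^2)"
 unfolding ip_def n2_sq integral_complex_of_real[symmetric]
 by (rule bi_cong) (simp_all only: complex_norm_square[symmetric] of_real_power)

lemma ip_add_right: "f : L2 ==> g : L2 ==> h : L2 ==> ip h (%x. f x + g x) = ip h f + ip h g"
 using ip_add_left[of f g h] by (metis ip_cnj complex_cnj_add)

lemma ip_diff_right: "f : L2 ==> g : L2 ==> h : L2 ==> ip h (%x. f x - g x) = ip h f - ip h g"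
 using ip_diff_left[of f g h] by (metis ip_cnj complex_cnj_diff)

lemma ip_cmult_left: "ip (%x. c * f x) g = c * ip f g"
 by (simp add: ip_def mult.assoc)

lemma ip_cmult_right: "ip g (%x. c * f x) = cnj c * ip g f"
 by (metis ip_cmult_left ip_cnj complex_cnj_mult)

lemma n2_add_sq:
 assumes "f : L2" "g : L2"
 shows "(n2 (%x. f x + g x))^2 = (n2 f)^2 + 2 * Re (ip f g) + (n2 g)^2"
proof -
 have "cr ((n2 (%x. f x + g x))^2) = ip (%x. f x + g x) (%x. f x + g x)" by (rule ip_self[symmetric])
 also have "... = ip f f + ip f g + (ip g f + ip g g)"
  using assms by (simp add: ip_add_left ip_add_right L2_add)
 finally have "Re (cr ((n2 (%x. f x + g x))^2)) = Re (ip f f + ip f g + (ip g f + ip g g))" by simp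
 moreover have "Re (ip g f) = Re (ip f g)" using ip_cnj[of f g] by (metis cnj.simps(1))
 ultimately show ?thesis by (simp add: ip_self)
qed

lemma n2_triangle:
 assumes "f : L2" "g : L2"
 shows "n2 (%x. f x + g x) <= n2 f + n2 g"
proof (rule power2_le_imp_le)
 have "Re (ip f g) <= n2 f * n2 g"
  using ip_CS[OF assms] complex_Re_le_cmod[of "ip f g"] by simp
 then show "(n2 (%x. f x + g x))^2 <= (n2 f + n2 g)^2"
  by (simp add: n2_add_sq assms power2_sum)
qed simp

lemma n2_triangle3:
 assumes "f : L2" "g : L2" "h : L2"
 shows "n2d f h <= n2d f g + n2d g h"
 using n2_triangle[of "%x. f x - g x" "%x. g x - h x"] assms by (simp add: L2_diff)

lemma n2_rev_triangle:
 assumes "f : L2" "g : L2"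
 shows "\<bar>n2 f - n2 g\<bar> <= n2d f g"
 using n2_triangle[of "%x. f x - g x" g] n2_triangle[of "%x. g x - f x" f] assms n2_minus_commute[of f g]
 by (simp add: L2_diff)

lemma n2_eq_0:
 assumes "f : L2" "n2 f = 0" shows "ae x. f x = 0"
proof -
 have "(LBINT x. (cmod (f x))^2) = 0" using assms(2) n2_sq[of f] by simp
 then show ?thesis
  by (subst (asm) integral_nonneg_eq_0_iff_AE) (use assms in "auto simp: L2_int")
qed

lemma n2_le_0_AE_eq:
 assumes "f : L2" "g : L2" "n2d f g <= 0" shows "ae x. f x = g x"
 using n2_eq_0[OF L2_diff[OF assms(1,2)]] assms(3) n2_nonneg[of "%x. f x - g x"]
 by (auto elim: eventually_mono)

text \<open>Lower semicontinuity under almost everywhere convergence: every uniform bound survives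
  in the limit, and the limit is square integrable without a separate argument.\<close>

lemma n2_Fatou:
 assumes "!!n. f n : L2" "!!n. n2 (f n) <= c" "meas g" "ae x. (%n. f n x) ----> g x" "0 <= c"
 shows "g : L2" "n2 g <= c"
proof -
 have [measurable]: "!!n. meas (f n)" "meas g" using assms L2_meas by auto
 have "(NN x. ennreal ((cmod (g x))^2)) = (NN x. liminf (%n. ennreal ((cmod (f n x))^2)))"
 proof (rule nn_integral_cong_AE)
  show "ae x. ennreal ((cmod (g x))^2) = liminf (%n. ennreal ((cmod (f n x))^2))"
   using assms(4)
  proof eventually_elim
   case (elim x)
   then have "(%n. ennreal ((cmod (f n x))^2)) ----> ennreal ((cmod (g x))^2)"
    by (intro tendsto_intros)
   then show ?case using lim_imp_Liminf by (metis trivial_limit_sequentially)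
  qed
 qed
 also have "... <= liminf (%n. (NN x. ennreal ((cmod (f n x))^2)))"
  by (rule nn_integral_liminf) simp
 also have "... = liminf (%n. ennreal ((n2 (f n))^2))" by (simp add: nn_n2 assms)
 also have "... <= liminf (%n::nat. ennreal (c^2))"
  by (intro Liminf_mono always_eventually allI ennreal_leI power_mono assms) simp
 also have "... = ennreal (c^2)" by (simp add: Liminf_const)
 finally show "g : L2" "n2 g <= c" using L2I_nn[OF assms(3), of c] assms(5) by auto
qed

text \<open>A strictly positive square-integrable weight; multiplication by it turns L2 convergence
  into L1 convergence and can be undone pointwise.\<close>

lemma L2_std_normal: "(%x. cr (std_normal_density x)) : L2"
proof -
 have "integrable lborel (%x. (std_normal_density x)^2)"
 proof (rule bi_bound[of _ "%x. std_normal_density x"])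
  show "ae x. norm ((std_normal_density x)^2) <= norm (std_normal_density x)"
  proof (rule AE_I2)
   fix x :: real
   have "std_normal_density x <= 1 / sqrt (2 * pi)"
    unfolding std_normal_density_def by (simp add: mult_le_cancel_left1 divide_simps)
   also have "... <= 1" using pi_gt3 by (simp add: divide_simps)
   finally have "std_normal_density x <= 1" .
   then show "norm ((std_normal_density x)^2) <= norm (std_normal_density x)"
    by (simp add: power2_eq_square mult_left_le normal_density_nonneg)
  qed
 qed auto
 then show ?thesis by (simp add: L2_iff)
qed

text \<open>After multiplication by the Gaussian weight the sequence is Cauchy in L1, so a
  subsequence converges almost everywhere; the weight is divided out and Fatou puts the limit into
  \<open>L2\<close>. The last clause holds at every point: it later yields initial values and
  frequency supports free of exceptional null sets.\<close>

lemma L2_complete: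
 assumes L: "!!n. f n : L2"
  and C: "!!e. e > 0 ==> \<exists>N. \<forall>i\<ge>N. \<forall>j\<ge>N. n2d (f i) (f j) < e"
 obtains g r where "g : L2" "strict_mono (r :: nat => nat)" "ae x. (%i. f (r i) x) ----> g x" "\<forall>x c. (\<forall>i. f i x = c) \<longrightarrow> g x = c"
proof -
 have [measurable]: "!!n. meas (f n)" using L L2_meas by auto
 let ?w = "%x. cr (std_normal_density x)"
 have "\<exists>N. \<forall>i\<ge>N. \<forall>j\<ge>N. (LBINT x. norm (f i x * ?w x - f j x * ?w x)) < e" if "e > 0" for e
 proof -
  have "e / (n2 ?w + 1) > 0" using that by (simp add: add_nonneg_pos)
  from C[OF this] obtain N where N: "!!i j. i \<ge> N ==> j \<ge> N ==> n2d (f i) (f j) < e / (n2 ?w + 1)"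
   by blast
  show ?thesis
  proof (intro exI allI impI)
   fix i j assume ij: "N <= i" "N <= j"
   have "(LBINT x. norm (f i x * ?w x - f j x * ?w x)) = (LBINT x. cmod (f i x - f j x) * cmod (?w x))"
    by (simp add: left_diff_distrib[symmetric] norm_mult)
   also have "... <= n2d (f i) (f j) * n2 ?w"
    by (rule CS_abs) (auto simp: L L2_diff L2_std_normal)
   also have "... <= n2d (f i) (f j) * (n2 ?w + 1)" by (simp add: mult_left_mono)
   also have "... < e" using N[OF ij] by (simp add: pos_less_divide_eq add_nonneg_pos)
   finally show "(LBINT x. norm (f i x * ?w x - f j x * ?w x)) < e" .
  qed
 qed
 moreover have "integrable lborel (%x. f n x * ?w x)" for n
  by (rule L2_mult_int) (auto simp: L L2_std_normal)
 ultimately obtain r where r: "strict_mono r" "ae x. Cauchy (%i. f (r i) x * ?w x)"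
  using cauchy_L1_AE_cauchy_subseq[of lborel "%n x. f n x * ?w x"] by blast
 have cv: "ae x. convergent (%i. f (r i) x)"
  using r(2)
 proof eventually_elim
  case (elim x)
  have "std_normal_density x \<noteq> 0" using normal_density_pos[of 1 0 x] by simp
  moreover have "convergent (%i. inverse (?w x) * (f (r i) x * ?w x))"
   by (rule convergent_mult[OF convergent_const]) (rule Cauchy_convergent[OF elim])
  moreover have "inverse (?w x) * (f (r i) x * ?w x) = f (r i) x" for i
   using calculation(1) by simp
  ultimately show ?case by (simp only:)
 qed
 define g where "g = (%x. if Cauchy (%i. f (r i) x) then lim (%i. f (r i) x) else 0)"
 have [measurable]: "meas g" unfolding g_def by (measurable; rule borel_measurable_lim_metric; simp)
 have lim: "ae x. (%i. f (r i) x) ----> g x"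
  using cv by eventually_elim (simp add: g_def convergent_LIMSEQ_iff Cauchy_convergent_iff)
 obtain N where N: "!!i j. i \<ge> N ==> j \<ge> N ==> n2d (f i) (f j) < 1"
  using C[of 1] by auto
 have b: "n2 (f i) <= n2 (f N) + 1" if "i \<ge> N" for i
  using n2_triangle[of "%x. f i x - f N x" "f N"] N[OF that order_refl] by (simp add: L L2_diff)
 have "g : L2"
 proof (rule n2_Fatou(1))
  show "f (r (i + N)) : L2" for i by (rule L)
  show "n2 (f (r (i + N))) <= n2 (f N) + 1" for i
   by (rule b) (meson le_add2 le_trans r(1) seq_suble)
  show "ae x. (%i. f (r (i + N)) x) ----> g x"
   using lim by eventually_elim (rule LIMSEQ_ignore_initial_segment)
 qed (auto simp: add_nonneg_nonneg)
 moreover have "\<forall>x c. (\<forall>i. f i x = c) \<longrightarrow> g x = c" by (simp add: g_def Cauchy_convergent_iff convergent_const)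
 ultimately show ?thesis by (rule that[OF _ r(1) lim])
qed

text \<open>Fatou for the differences from \<open>h\<close>. The shift by \<open>N\<close> is
  legitimate because a strictly increasing index sequence dominates the identity.\<close>

lemma n2_lim_le:
 assumes L: "!!n. f n : L2" "g : L2" "strict_mono (r :: nat => nat)" "ae x. (%i. f (r i) x) ----> g x"
  and le: "!!j. j \<ge> N ==> n2d (f j) h <= c" and "0 <= c" "h : L2"
 shows "n2d g h <= c"
proof (rule n2_Fatou(2))
 show "(%x. f (r (i + N)) x - h x) : L2" for i by (intro L2_diff assms)
 show "n2 (%x. f (r (i + N)) x - h x) <= c" for i
  by (rule le) (meson le_add2 le_trans assms(3) seq_suble)
 show "ae x. (%i. f (r (i + N)) x - h x) ----> g x - h x"
  using assms(4) by eventually_elim (intro tendsto_intros LIMSEQ_ignore_initial_segment)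
 show "meas (%x. g x - h x)" using assms(2,7)[THEN L2_meas] by simp
qed (auto simp: assms)

lemma L2_translate: assumes "f : L2" shows "(%x. f (x + w)) : L2" "n2 (%x. f (x + w)) = n2 f"
proof -
 have [measurable]: "meas f" using assms L2_meas by auto
 show "(%x. f (x + w)) : L2"
  using lborel_integrable_real_affine[OF L2_int[OF assms], of 1 w] by (simp add: L2_iff add.commute)
 show "n2 (%x. f (x + w)) = n2 f"
  unfolding n2_def using lborel_integral_real_affine[of 1 "%x. (cmod (f x))^2" w] by (simp add: add.commute)
qed

lemma L2_reflect: assumes "f : L2" shows "(%x. f (- x)) : L2" "n2 (%x. f (- x)) = n2 f"
proof -
 have [measurable]: "meas f" using assms L2_meas by auto
 show "(%x. f (- x)) : L2"
  using lborel_integrable_real_affine[OF L2_int[OF assms], of "-1" 0] by (simp add: L2_iff)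
 show "n2 (%x. f (- x)) = n2 f"
  unfolding n2_def using lborel_integral_real_affine[of "-1" "%x. (cmod (f x))^2" 0] by simp
qed

section \<open>Continuity of translations in L2\<close>

definition trans_cont :: "cfun => bool" where
 "trans_cont f \<longleftrightarrow> f : L2 \<and> ((%w. n2 (%x. f (x + w) - f x)) ---> 0) (at 0)"

lemma trans_cont_closed:
 assumes f: "f : L2" and *: "!!e. e > 0 ==> \<exists>g. trans_cont g \<and> n2d f g < e"
 shows "trans_cont f"
 unfolding trans_cont_def
proof (intro conjI f tendstoI)
 fix e :: real assume "e > 0"
 then obtain g where g: "trans_cont g" "n2d f g < e / 3" using *[of "e/3"] by auto
 have gL: "g : L2" using g by (simp add: trans_cont_def)
 have "eventually (%w. dist (n2 (%x. g (x + w) - g x)) 0 < e / 3) (at 0)"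
  using g \<open>e > 0\<close> by (auto simp: trans_cont_def dest: tendstoD[where e="e/3"])
 then show "eventually (%w. dist (n2 (%x. f (x + w) - f x)) 0 < e) (at 0)"
 proof eventually_elim
  case (elim w)
  have "n2 (%x. f (x + w) - f x) <= n2 (%x. f (x + w) - g (x + w)) + n2 (%x. g (x + w) - f x)"
   by (rule n2_triangle3) (auto simp: L2_translate f gL)
  also have "n2 (%x. g (x + w) - f x) <= n2 (%x. g (x + w) - g x) + n2d g f"
   by (rule n2_triangle3) (auto simp: L2_translate f gL)
  also have "n2 (%x. f (x + w) - g (x + w)) = n2d f g"
   using L2_translate(2)[of "%x. f x - g x" w] by (simp add: f gL L2_diff)
  also have "n2d g f = n2d f g" by (rule n2_minus_commute)
  finally show ?case using g(2) elim by simp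
 qed
qed

lemma trans_cont_add_cmult:
 assumes "trans_cont f" "trans_cont g"
 shows "trans_cont (%x. c * f x + g x)"
 unfolding trans_cont_def
proof
 have fg: "f : L2" "g : L2" using assms by (auto simp: trans_cont_def)
 then show "(%x. c * f x + g x) : L2" by (simp add: L2_add L2_cmult)
 have lim: "((%w. cmod c * n2 (%x. f (x + w) - f x) + n2 (%x. g (x + w) - g x)) ---> cmod c * 0 + 0) (at 0)"
  using assms by (intro tendsto_intros) (auto simp: trans_cont_def)
 show "((%w. n2 (%x. c * f (x + w) + g (x + w) - (c * f x + g x))) ---> 0) (at 0)"
 proof (rule tendsto_sandwich[OF _ _ tendsto_const])
  show "((%w. cmod c * n2 (%x. f (x + w) - f x) + n2 (%x. g (x + w) - g x)) ---> 0) (at 0)"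
   using lim by simp
  show "eventually (%w. n2 (%x. c * f (x + w) + g (x + w) - (c * f x + g x))
      <= cmod c * n2 (%x. f (x + w) - f x) + n2 (%x. g (x + w) - g x)) (at 0)"
  proof (intro always_eventually allI)
   fix w
   have "n2 (%x. c * f (x + w) + g (x + w) - (c * f x + g x))
     = n2 (%x. c * (f (x + w) - f x) + (g (x + w) - g x))" by (simp add: algebra_simps)
   also have "... <= n2 (%x. c * (f (x + w) - f x)) + n2 (%x. g (x + w) - g x)"
    by (rule n2_triangle) (auto intro!: L2_cmult L2_diff L2_translate fg)
   finally show "n2 (%x. c * f (x + w) + g (x + w) - (c * f x + g x))
     <= cmod c * n2 (%x. f (x + w) - f x) + n2 (%x. g (x + w) - g x)" by (simp add: n2_cmult)
  qed
 qed auto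
qed

lemma L2_indicator:
 assumes "A : sets borel" "emeasure lborel A < \<infinity>"
 shows "(%x. cr (indicator A x)) : L2" 
  "(n2 (%x. cr (indicator A x)))^2 = measure lborel A"
proof -
 have *: "(cmod (cr (indicator A x)))^2 = indicator A x" for x
  by (auto simp: indicator_def)
 show "(%x. cr (indicator A x)) : L2"
  unfolding L2_iff * using assms by (auto intro!: borel_measurable_of_real)
 show "(n2 (%x. cr (indicator A x)))^2 = measure lborel A"
  unfolding n2_sq * using assms by (simp add: less_top)
qed

text \<open>A point of an open set stays in the set under small shifts, so the overlap of the set
  with its translate tends to the full measure by dominated convergence. The squared distance is
  twice the measure minus twice the overlap.\<close>

lemma trans_cont_open:
 assumes "open U" "emeasure lborel U < \<infinity>"
 shows "trans_cont (%x. cr (indicator U x))"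
 unfolding trans_cont_def
proof
 let ?f = "%x. cr (indicator U x)"
 show f: "?f : L2" using assms by (auto intro: L2_indicator)
 have iU: "integrable lborel (indicator U :: real => real)" using assms by (simp add: less_top)
 show "((%w. n2 (%x. ?f (x + w) - ?f x)) ---> 0) (at 0)"
  unfolding tendsto_at_iff_sequentially comp_def
 proof (intro allI impI)
  fix X :: "nat => real" assume "\<forall>i. X i : UNIV - {0}" and X: "X ----> 0"
  have [measurable]: "U : sets borel" using assms by auto
  have lim: "(%n. LBINT x. indicator U (x + X n) * indicator U x) ----> (LBINT x. indicator U x :: real)"
  proof (rule integral_dominated_convergence[where w="indicator U"])
   show "ae x. (%n. indicator U (x + X n) * indicator U x :: real) ----> indicator U x"
   proof (rule AE_I2)
    fix x
    show "(%n. indicator U (x + X n) * indicator U x :: real) ----> indicator U x"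
    proof (cases "x : U")
     case True
     have "(%n. x + X n) ----> x + 0" by (intro tendsto_intros X)
     then have "eventually (%n. x + X n : U) sequentially"
      using assms(1) True by (simp add: topological_tendstoD)
     then have "eventually (%n. indicator U (x + X n) * indicator U x = (indicator U x :: real)) sequentially"
      by eventually_elim (simp add: True)
     then show ?thesis by (rule tendsto_eventually)
    qed simp
   qed
  qed (use iU in "auto simp: indicator_def")
  have sq: "(n2 (%x. ?f (x + w) - ?f x))^2 = 2 * measure lborel U - 2 * (LBINT x. indicator U (x + w) * indicator U x)" for w
  proof -
   have "(n2 (%x. ?f (x + w) + (- ?f x)))^2 = (n2 (%x. ?f (x + w)))^2 + 2 * Re (ip (%x. ?f (x + w)) (%x. - ?f x)) + (n2 (%x. - ?f x))^2"
    by (rule n2_add_sq) (auto intro: L2_translate[OF f] L2_uminus[OF f])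
   moreover have "ip (%x. ?f (x + w)) (%x. - ?f x) = cr (- (LBINT x. indicator U (x + w) * indicator U x))"
    unfolding ip_def by (simp flip: of_real_mult)
   ultimately show ?thesis using L2_translate(2)[OF f, of w] L2_indicator(2)[of U] assms
    by (simp add: n2_uminus)
  qed
  have "(%n. sqrt (2 * measure lborel U - 2 * (LBINT x. indicator U (x + X n) * indicator U x))) ----> sqrt (2 * measure lborel U - 2 * (LBINT x. indicator U x))"
   by (intro tendsto_intros lim)
  moreover have "n2 (%x. ?f (x + w) - ?f x) = sqrt (2 * measure lborel U - 2 * (LBINT x. indicator U (x + w) * indicator U x))" for w
   using sq[of w] by (metis n2_nonneg real_sqrt_unique)
  ultimately show "(%n. n2 (%x. ?f (x + X n) - ?f x)) ----> 0"
   using assms(2) by (simp add: less_top)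
 qed
qed

text \<open>Outer regularity supplies an open superset whose excess has measure below e^2, hence L2
  distance below \<open>e\<close>; \<open>trans_cont_closed\<close> does the rest.\<close>

lemma trans_cont_indicator:
 assumes A: "A : sets borel" "emeasure lborel A < \<infinity>"
 shows "trans_cont (%x. cr (indicator A x))"
proof (rule trans_cont_closed)
 show "(%x. cr (indicator A x)) : L2" using A by (rule L2_indicator)
 fix e :: real assume e: "e > 0"
 then have "e^2 > 0" by simp
 then obtain U where U: "open U" "A \<subseteq> U" "emeasure lborel (U - A) < ennreal (e^2)"
  using outer_regular_lborel[OF A(1)] by blast
 have fUA: "emeasure lborel (U - A) < \<infinity>" using order_less_trans[OF U(3) ennreal_less_top] by simp
 have UA: "U - A : sets borel" using A U by auto
 have fU: "emeasure lborel U < \<infinity>"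
 proof -
  have "emeasure lborel U <= emeasure lborel A + emeasure lborel (U - A)"
   using emeasure_subadditive[of A lborel "U - A"] A U by (simp add: Un_absorb1)
  also have "... < \<infinity>" using A(2) fUA by simp
  finally show ?thesis .
 qed
 have "(n2 (%x. cr (indicator A x) - cr (indicator U x)))^2
   = (n2 (%x. cr (indicator (U - A) x)))^2"
  unfolding n2_sq using U(2) by (intro bi_cong) (auto simp: indicator_def)
 also have "... = measure lborel (U - A)"
  by (rule L2_indicator(2)[OF UA fUA])
 also have "... < e^2" using U(3) e fUA by (simp add: emeasure_eq_ennreal_measure ennreal_less_iff)
 finally have "n2 (%x. cr (indicator A x) - cr (indicator U x)) < e"
  using e by (simp add: power2_less_imp_less)
 then show "\<exists>g. trans_cont g \<and> n2 (%x. cr (indicator A x) - g x) < e"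
  using trans_cont_open[OF U(1) fU] by blast
qed

lemma trans_cont_simple:
 assumes F: "simple_function lborel F" "F : L2"
 shows "trans_cont F"
proof -
 have [measurable]: "meas F" using F L2_meas by auto
 have fin: "finite (range F)" using F(1) by (simp add: simple_function_def)
 have t: "trans_cont (%x. cr (indicator {x. F x = c} x))" if "c \<noteq> 0" for c
 proof (rule trans_cont_indicator)
  have "integrable lborel (indicator {x. F x = c} :: real => real)"
  proof (rule bi_bound)
   show "integrable lborel (%x. (1 / (cmod c)^2) * (cmod (F x))^2)"
    using F(2) by (intro integrable_mult_right L2_int)
   show "ae x. norm (indicator {x. F x = c} x :: real) <= norm ((1 / (cmod c)^2) * (cmod (F x))^2)"
    using that by (auto simp: indicator_def)
  qed auto
  then show "emeasure lborel {x. F x = c} < \<infinity>" by (simp add: integrable_indicator_iff)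
 qed auto
 have *: "trans_cont (%x. \<Sum>c\<in>S. c * cr (indicator {x. F x = c} x))" if "finite S" "0 \<notin> S" for S
  using that
 proof (induction S)
  case empty
  then show ?case by (simp add: trans_cont_def)
 next
  case (insert c S)
  then show ?case using trans_cont_add_cmult[OF t[of c], of "%x. \<Sum>c\<in>S. c * cr (indicator {x. F x = c} x)" c]
   by simp
 qed
 have "F = (%x. \<Sum>c\<in>range F - {0}. c * cr (indicator {x. F x = c} x))"
 proof
  fix x
  have "(\<Sum>c\<in>range F - {0}. c * cr (indicator {x. F x = c} x)) = (\<Sum>c\<in>range F - {0}. if c = F x then c else 0)"
   by (intro sum.cong) auto
  then show "F x = (\<Sum>c\<in>range F - {0}. c * cr (indicator {x. F x = c} x))"
   using fin by (simp add: sum.delta)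
 qed
 then show ?thesis using *[of "range F - {0}"] fin by simp
qed

text \<open>End of the density chain: open sets, Borel sets of finite measure, simple functions, and
  now pointwise approximation by simple functions of at most twice the size of \<open>f\<close>. The
  dominating factor 9 is the square of 1 + 2.\<close>

lemma L2_trans_cont:
 assumes f: "f : L2"
 shows "trans_cont f"
proof (rule trans_cont_closed[OF f])
 have [measurable]: "meas f" using f L2_meas by auto
 fix e :: real assume e: "e > 0"
 obtain F where F: "!!i. simple_function lborel (F i)" "!!x. (%i. F i x) ----> f x"
  "!!i x. dist (F i x) 0 <= 2 * dist (f x) 0"
  using borel_measurable_implies_sequence_metric[of f lborel 0] by auto
 have [measurable]: "!!i. meas (F i)" using borel_measurable_simple_function[OF F(1)] by simp
 have FL: "F i : L2" for i using L2_bound(1)[OF f, of "F i" 2] F(3) by simp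
 have "(%i. LINT x|lborel. (cmod (f x - F i x))^2) ----> (LINT x|(lborel::real measure). 0::real)"
 proof (rule integral_dominated_convergence[where f="%_. 0::real" and w="%x. 9 * (cmod (f x))^2"])
  show "ae x. (%i. (cmod (f x - F i x))^2) ----> 0"
  proof (rule AE_I2)
   fix x
   have "(%i. (cmod (f x - F i x))^2) ----> (cmod (f x - f x))^2" by (intro tendsto_intros F)
   then show "(%i. (cmod (f x - F i x))^2) ----> 0" by simp
  qed
  fix i
  have "(cmod (f x - F i x))^2 <= 9 * (cmod (f x))^2" for x
  proof -
   have "cmod (f x - F i x) <= 3 * cmod (f x)" using norm_triangle_ineq4[of "f x" "F i x"] F(3)[of i x] by simp
   then show ?thesis using power_mono[of "cmod (f x - F i x)" "3 * cmod (f x)" 2] by (simp add: power_mult_distrib)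
  qed
  then show "ae x. norm ((cmod (f x - F i x))^2) <= 9 * (cmod (f x))^2" by simp
 qed (auto simp: L2_int[OF f])
 then have "eventually (%i. (LBINT x. (cmod (f x - F i x))^2) < e^2) sequentially"
  using e by (auto intro: order_tendstoD)
 then obtain i where "(n2d f (F i))^2 < e^2" unfolding n2_sq by (auto simp: eventually_sequentially)
 then have "n2d f (F i) < e" using e by (simp add: power2_less_imp_less)
 then show "\<exists>g. trans_cont g \<and> n2d f g < e"
  using trans_cont_simple[OF F(1) FL] by blast
qed

section \<open>Plancherel's theorem\<close>

definition FT :: "cfun => cfun" where
 "FT f w = cr (1 / sqrt (2 * pi)) * (LBINT x. cis (- (x * w)) * f x)"

lemma cis_measurable [measurable (raw)]:
 "f : borel_measurable M ==> (%x. cis (f x)) : borel_measurable M"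
 by (rule measurable_compose[of f M borel cis]) (assumption, rule borel_measurable_continuous_onI, rule continuous_on_cis, rule continuous_on_id)

lemma integrable_cis_mult:
 fixes f :: "cfun"
 assumes "integrable lborel f" and [measurable]: "g : borel_measurable borel"
 shows "integrable lborel (%x. cis (g x) * f x)"
proof -
 have [measurable]: "meas f" using assms(1) by auto
 show ?thesis
  by (rule bi_bound[OF assms(1)]) (auto simp: norm_mult)
qed

lemma FT_bound:
 shows "cmod (FT f w) <= (LBINT x. cmod (f x))"
proof -
 have *: "cmod (LBINT x. cis (- (x * w)) * f x) <= (LBINT x. cmod (f x))"
  using integral_norm_bound[of lborel "%x. cis (- (x * w)) * f x"] by (simp add: norm_mult)
 have "1 <= sqrt (2 * pi)" using pi_gt3 by simp
 then have "1 / sqrt (2 * pi) * cmod (LBINT x. cis (- (x * w)) * f x) <= 1 * (LBINT x. cmod (f x))"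
  using * by (intro mult_mono) auto
 then show ?thesis unfolding FT_def by (simp add: norm_mult norm_divide)
qed

lemma FT_meas [measurable]: assumes [measurable]: "meas f" shows "meas (FT f)"
 unfolding FT_def by measurable

text \<open>The kernel is symmetric in the two variables, so Fubini moves the transform from one
  factor to the other. This replaces an inversion formula in what follows.\<close>

lemma FT_mult:
 assumes f: "integrable lborel f" and g: "integrable lborel g"
 shows "(LBINT w. FT f w * g w) = (LBINT x. f x * FT g x)"
proof -
 have [measurable]: "meas f" "meas g" using f g by auto
 let ?h = "%x w. cis (- (x * w)) * (f x * g w)"
 have "integrable (lborel \<Otimes>\<^sub>M lborel) (%(x, w). ?h x w)"
 proof (rule lborel_pair.Fubini_integrable)
  show "integrable lborel (%x. LBINT w. norm (case (x, w) of (x, w) => ?h x w))" using f by (simp add: norm_mult)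
  show "ae x. integrable lborel (%w. case (x, w) of (x, w) => ?h x w)"
   using g by (auto intro!: integrable_cis_mult)
 qed measurable
 from lborel_pair.Fubini_integral[OF this]
 have "(LBINT w. (LBINT x. cis (- (x * w)) * f x) * g w) = (LBINT x. f x * (LBINT w. cis (- (w * x)) * g w))"
  unfolding integral_mult_left_zero[symmetric] integral_mult_right_zero[symmetric] by (simp add: mult_ac)
 then show ?thesis unfolding FT_def mult.assoc mult.left_commute[of _ "cr (1 / sqrt (2 * pi))"] integral_mult_right_zero by simp
qed

text \<open>The characteristic function of the standard normal distribution, rescaled by
  \<open>d\<close>.\<close>

lemma FT_gaussian:
 assumes d: "d > 0"
 shows "(LBINT w. cis (t * w) * cr (exp (- (d^2 * w^2 / 2)))) = cr (2 * pi * normal_density 0 d t)"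
proof -
 have "cr (exp (- ((t/d)^2) / 2)) = char std_normal_distribution (t/d)"
  by (simp add: char_std_normal_distribution)
 also have "... = (LBINT x. std_normal_density x *\<^sub>R iexp (t / d * x))"
  unfolding char_def by (subst integral_density) (auto simp: normal_density_nonneg)
 also have "... = d *\<^sub>R (LBINT x. std_normal_density (d * x) *\<^sub>R iexp (t / d * (d * x)))"
  using d by (subst lborel_integral_real_affine[where c=d and t=0]) auto
 also have "(%x. std_normal_density (d * x) *\<^sub>R iexp (t / d * (d * x)))
  = (%x. cr (1 / sqrt (2 * pi)) * (cis (t * x) * cr (exp (- (d^2 * x^2 / 2)))))"
  using d by (auto simp: std_normal_density_def cis_conv_exp scaleR_conv_of_real power_mult_distrib field_simps)
 finally have "cr (exp (- ((t/d)^2) / 2)) = cr (d / sqrt (2 * pi)) * (LBINT w. cis (t * w) * cr (exp (- (d^2 * w^2 / 2))))"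
  by (simp add: scaleR_conv_of_real)
 then have "(LBINT w. cis (t * w) * cr (exp (- (d^2 * w^2 / 2)))) = cr (sqrt (2 * pi) / d) * cr (exp (- ((t/d)^2) / 2))"
  using d by (simp add: field_simps)
 also have "sqrt (2 * pi) / d * exp (- ((t/d)^2) / 2) = 2 * pi * normal_density 0 d t"
 proof -
  have "sqrt (2 * pi) * sqrt (2 * pi) = 2 * pi" by simp
  then show ?thesis using d unfolding normal_density_def
   by (simp add: real_sqrt_mult power_divide field_simps)
 qed
 then have "cr (sqrt (2 * pi) / d) * cr (exp (- ((t/d)^2) / 2)) = cr (2 * pi * normal_density 0 d t)"
  by (metis of_real_mult)
 finally show ?thesis .
qed

lemma integrable_gaussian:
 assumes "d > 0" shows "integrable lborel (%w::real. exp (- (d^2 * w^2 / 2)))"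
proof -
 have "integrable lborel (%x. sqrt (2 * pi * (1/d)^2) * normal_density 0 (1/d) x)"
  using assms by (intro integrable_mult_right integrable_normal_density) auto
 moreover have "sqrt (2 * pi * (1/d)^2) * normal_density 0 (1/d) x = exp (- (d^2 * x^2 / 2))" for x
  using assms unfolding normal_density_def by (simp add: power_divide field_simps)
 ultimately show ?thesis by (simp only:)
qed

text \<open>Gaussian damping makes the energy integral of the transform absolutely convergent.
  Moving one transform across by \<open>FT_mult\<close> turns damping in frequency into averaging
  over translations by \<open>d * z\<close> with normally distributed \<open>z\<close>.\<close>

lemma gaussian_regularization:
 assumes f: "f : L2" "integrable lborel f" and d: "d > 0"
 shows "cr (LBINT w. exp (- (d^2 * w^2 / 2)) * (cmod (FT f w))^2)
  = (LBINT z. cr (std_normal_density z) * ip f (%x. f (x + d * z)))"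
proof -
 let ?G = "%w. cr (exp (- (d^2 * w^2 / 2)))"
 let ?m = "cr (1 / sqrt (2 * pi))"
 let ?K = "LBINT x. cmod (f x)" and ?H = "%w. ?G w * cnj (FT f w)"
 have [measurable]: "meas f" using f by auto
 have G: "integrable lborel ?G" using integrable_gaussian[OF d] by auto
 have GF: "integrable lborel ?H"
 proof (rule bi_bound)
  show "integrable lborel (%w. ?K * exp (- (d^2 * w^2 / 2)))" using integrable_gaussian[OF d] by auto
  show "ae w. norm (?H w) <= norm (?K * exp (- (d^2 * w^2 / 2)))"
   using FT_bound[of f] by (auto simp: norm_mult mult.commute intro!: mult_right_mono)
 qed simp
 \<comment> \<open>Regularized inversion: transforming the damped conjugate of the transform gives a
   Gaussian average of the conjugate of \<open>f\<close> around \<open>x\<close>.\<close>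
 have FH: "FT ?H x = (LBINT z. cr (std_normal_density z) * cnj (f (x + d * z)))" for x
 proof -
  let ?c = "%w. cis (x * w) * ?G w"
  have c: "FT ?c y = cr (sqrt (2 * pi) * normal_density 0 d (x - y))" for y
  proof -
   have "cis (- (w * y)) * ?c w = cis ((x - y) * w) * ?G w" for w
    unfolding mult.assoc[symmetric] cis_mult by (simp add: algebra_simps)
   then have "FT ?c y = ?m * cr (2 * pi * normal_density 0 d (x - y))" unfolding FT_def by (simp only: FT_gaussian[OF d])
   also have "1 / sqrt (2 * pi) * (2 * pi * normal_density 0 d (x - y)) = sqrt (2 * pi) * normal_density 0 d (x - y)"
    using arg_cong[OF real_div_sqrt[of "2 * pi"], of "%u. u * normal_density 0 d (x - y)"] by simp
   then have "?m * cr (2 * pi * normal_density 0 d (x - y)) = cr (sqrt (2 * pi) * normal_density 0 d (x - y))" by (metis of_real_mult)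
   finally show ?thesis .
  qed
  have e: "d * normal_density 0 d (d * z) = std_normal_density z" for z
   using d unfolding normal_density_def by (simp add: real_sqrt_mult power_mult_distrib field_simps)
  have ci: "integrable lborel ?c" by (rule integrable_cis_mult[OF G]) simp
  have "FT ?H x = cnj (?m * (LBINT w. FT f w * ?c w))"
   unfolding FT_def[of ?H] complex_cnj_mult Bochner_Integration.integral_cnj[symmetric] by (simp add: cis_cnj mult_ac)
  also have "... = cnj (LBINT y. f y * cr (normal_density 0 d (x - y)))"
   unfolding FT_mult[OF f(2) ci] c integral_mult_right_zero[symmetric]
   by (simp add: mult.left_commute)
  also have "... = (LBINT y. cnj (f y) * cr (normal_density 0 d (x - y)))"
   unfolding Bochner_Integration.integral_cnj[symmetric] by simp
  also have "... = d *\<^sub>R (LBINT z. cnj (f (x + d * z)) * cr (normal_density 0 d (x - (x + d * z))))"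
   using d by (subst lborel_integral_real_affine[where c=d and t=x]) auto
  also have "... = (LBINT z. cr (d * normal_density 0 d (d * z)) * cnj (f (x + d * z)))"
   unfolding scaleR_conv_of_real integral_mult_right_zero[symmetric]
   by (rule bi_cong) (simp_all add: mult_ac normal_density_def)
  finally show ?thesis unfolding e .
 qed
 have "cr (LBINT w. exp (- (d^2 * w^2 / 2)) * (cmod (FT f w))^2) = (LBINT w. FT f w * ?H w)"
  unfolding integral_complex_of_real[symmetric]
  by (rule bi_cong) (simp_all only: of_real_mult complex_norm_square mult_ac)
 also have "... = (LBINT x. LBINT z. f x * (cr (std_normal_density z) * cnj (f (x + d * z))))"
  unfolding FT_mult[OF f(2) GF] FH integral_mult_right_zero ..
 also have "... = (LBINT z. LBINT x. f x * (cr (std_normal_density z) * cnj (f (x + d * z))))"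
 proof (rule lborel_pair.Fubini_integral, rule integrableI_bounded)
  show "(%(z, x). f x * (cr (std_normal_density z) * cnj (f (x + d * z)))) : borel_measurable (lborel \<Otimes>\<^sub>M lborel)"
   by measurable
  have "(\<integral>\<^sup>+p. ennreal (norm (case p of (z, x) => f x * (cr (std_normal_density z) * cnj (f (x + d * z))))) \<partial>(lborel \<Otimes>\<^sub>M lborel))
   = (NN z. (NN x. ennreal (std_normal_density z) * (ennreal (cmod (f x)) * ennreal (cmod (f (x + d * z))))))"
   using lborel.nn_integral_fst[of "%(z, x). ennreal (norm (f x * (cr (std_normal_density z) * cnj (f (x + d * z)))))" lborel]
   by (simp add: norm_mult ennreal_mult normal_density_nonneg mult_ac case_prod_unfold)
  also have "... = (NN z. ennreal (std_normal_density z) * (NN x. (ennreal (cmod (f x)) * ennreal (cmod (f (x + d * z))))))"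
   by (intro nn_integral_cong nn_integral_cmult) simp
  also have "... <= (NN z. ennreal (std_normal_density z) * ennreal (n2 f * n2 f))"
   using nn_CS[OF f(1) L2_translate(1)[OF f(1)]] L2_translate(2)[OF f(1)]
   by (intro nn_integral_mono mult_left_mono) auto
  also have "... = (NN z. ennreal (std_normal_density z)) * ennreal (n2 f * n2 f)"
   by (rule nn_integral_multc) simp
  also have "(NN z. ennreal (std_normal_density z)) = ennreal 1"
   by (subst nn_integral_eq_integral) (auto simp: normal_density_nonneg)
  finally show "(\<integral>\<^sup>+p. ennreal (norm (case p of (z, x) => f x * (cr (std_normal_density z) * cnj (f (x + d * z))))) \<partial>(lborel \<Otimes>\<^sub>M lborel)) < \<infinity>"
   by (simp add: less_top[symmetric]) (metis ennreal_less_top infinity_ennreal_def leD top.not_eq_extremum)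
 qed
 also have "... = (LBINT z. cr (std_normal_density z) * ip f (%x. f (x + d * z)))"
  unfolding ip_def integral_mult_right_zero[symmetric]
  by (intro bi_cong refl) (simp add: mult_ac)
 finally show ?thesis .
qed

text \<open>Let \<open>d\<close> tend to 0 in \<open>gaussian_regularization\<close>. On one side
  translations are continuous in L2 and Cauchy-Schwarz dominates; on the other the damping factor
  increases to 1, so monotone convergence gives the limit and, with it, the square integrability of
  \<open>FT f\<close>.\<close>

lemma Plancherel_L1_L2:
 assumes f: "f : L2" "integrable lborel f"
 shows "FT f : L2" "n2 (FT f) = n2 f"
proof -
 have [measurable]: "meas f" using f by auto
 define d where "d = (%n::nat. 1 / real (Suc n))"
 have dpos: "d n > 0" for n by (simp add: d_def)
 have dlim: "d ----> 0" unfolding d_def by (rule LIMSEQ_Suc[OF lim_1_over_n])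
 let ?E = "%n v. exp (- ((d n)^2 * v^2 / 2)) * (cmod (FT f v))^2"
 have lim1: "(%n. LBINT z. cr (std_normal_density z) * ip f (%x. f (x + d n * z)))
   ----> (LBINT z. cr (std_normal_density z) * ip f f)"
 proof (rule integral_dominated_convergence[where w="%z. std_normal_density z * (n2 f * n2 f)"])
  show "ae z. (%n. cr (std_normal_density z) * ip f (%x. f (x + d n * z))) ----> cr (std_normal_density z) * ip f f"
  proof (intro AE_I2 tendsto_intros)
   fix z
   have t: "((%w. n2 (%x. f (x + w) - f x)) ---> 0) (nhds 0)"
    using L2_trans_cont[OF f(1)] tendsto_at_iff_tendsto_nhds[of "%w. n2 (%x. f (x + w) - f x)" 0]
    unfolding trans_cont_def by simp
   have "(%n. d n * z) ----> 0 * z" by (intro tendsto_intros dlim)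
   then have "(%n. n2 (%x. f (x + d n * z) - f x)) ----> 0"
    using filterlim_compose[OF t, of "%n. d n * z"] by simp
   then have "(%n. n2 f * n2 (%x. f (x + d n * z) - f x)) ----> n2 f * 0" by (intro tendsto_intros)
   then have "(%n. ip f (%x. f (x + d n * z)) - ip f f) ----> 0"
   proof (intro Lim_null_comparison[of "%n. ip f (%x. f (x + d n * z)) - ip f f" "%n. n2 f * n2 (%x. f (x + d n * z) - f x)"])
    show "eventually (%n. cmod (ip f (%x. f (x + d n * z)) - ip f f) <= n2 f * n2 (%x. f (x + d n * z) - f x)) sequentially"
     using f L2_translate(1)[OF f(1)] by (auto simp: ip_diff_right[symmetric] intro!: always_eventually ip_CS L2_diff)
   qed simp
   then show "(%n. ip f (%x. f (x + d n * z))) ----> ip f f" by (simp add: LIM_zero_iff)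
  qed
  show "ae z. norm (cr (std_normal_density z) * ip f (%x. f (x + d n * z))) <= std_normal_density z * (n2 f * n2 f)" for n
   using ip_CS[OF f(1) L2_translate(1)[OF f(1)]] L2_translate(2)[OF f(1)]
   by (auto simp: norm_mult normal_density_nonneg intro!: AE_I2 mult_left_mono)
  show "(%z. cr (std_normal_density z) * ip f (%x. f (x + d n * z))) : borel_measurable lborel" for n
   unfolding ip_def by measurable
 qed auto
 have "(LBINT z. cr (std_normal_density z) * ip f f) = cr ((n2 f)^2)"
  by (simp add: ip_self)
 with lim1 have "(%n. cr (LBINT v. ?E n v)) ----> cr ((n2 f)^2)"
  by (simp only: gaussian_regularization[OF f dpos])
 then have lim2: "(%n. LBINT v. ?E n v) ----> (n2 f)^2"
  by (simp only: tendsto_of_real_iff)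
 have int: "integrable lborel (%v. ?E n v)" for n
 proof (rule bi_bound)
  show "integrable lborel (%v. exp (- ((d n)^2 * v^2 / 2)) * (LBINT x. cmod (f x))^2)"
   using integrable_gaussian[OF dpos] by auto
  show "ae v. norm (?E n v) <= norm (exp (- ((d n)^2 * v^2 / 2)) * (LBINT x. cmod (f x))^2)"
   using FT_bound[of f] by (auto intro!: power_mono)
 qed simp
 have "(%n. (NN v. ennreal (?E n v))) ----> (NN v. ennreal ((cmod (FT f v))^2))"
 proof (rule nn_integral_LIMSEQ)
  show "incseq (%n v. ennreal (?E n v))"
  proof (intro incseq_SucI le_funI ennreal_leI mult_right_mono)
   fix n :: nat and v :: real
   have "d (Suc n) <= d n" by (simp add: d_def frac_le)
   then have "(d (Suc n))^2 <= (d n)^2" using dpos by (intro power_mono) (auto simp: less_imp_le)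
   then have "(d (Suc n))^2 * v^2 <= (d n)^2 * v^2" by (rule mult_right_mono) simp
   then show "exp (- ((d n)^2 * v^2 / 2)) <= exp (- ((d (Suc n))^2 * v^2 / 2))" by simp
  qed simp
  show "(%n. ennreal (?E n v)) ----> ennreal ((cmod (FT f v))^2)" for v
  proof (rule tendsto_ennrealI)
   have "(%n. ?E n v) ----> exp (- (0^2 * v^2 / 2)) * (cmod (FT f v))^2"
    by (intro tendsto_intros dlim) auto
   then show "(%n. ?E n v) ----> (cmod (FT f v))^2" by simp
  qed
 qed simp
 moreover have "(NN v. ennreal (?E n v)) = ennreal (LBINT v. ?E n v)" for n
  by (rule nn_integral_eq_integral[OF int]) simp
 moreover have "(%n. ennreal (LBINT v. ?E n v)) ----> ennreal ((n2 f)^2)"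
  by (intro tendsto_ennrealI lim2)
 ultimately have eq: "(NN v. ennreal ((cmod (FT f v))^2)) = ennreal ((n2 f)^2)"
  by (simp only:) (rule LIMSEQ_unique)
 show L: "FT f : L2" using L2I_nn(1)[of "FT f" "n2 f"] eq by simp
 show "n2 (FT f) = n2 f" using nn_n2[OF L] eq by (simp add: power2_eq_iff_nonneg)
qed

section \<open>The Fourier-Plancherel transform on L2\<close>

definition trunc :: "nat => cfun => cfun" where
 "trunc n f x = indicator {- real n..real n} x * f x"

lemma trunc_meas [measurable]: assumes [measurable]: "meas f" shows "meas (trunc n f)"
 unfolding trunc_def by measurable

lemma truncated_fourier_eq: "truncated_fourier n f = FT (trunc n f)"
 unfolding truncated_fourier_def FT_def trunc_def set_lebesgue_integral_def
 by (intro ext arg_cong2[where f="(*)"] refl bi_cong) (auto simp: indicator_def)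

lemma trunc_L2: assumes "f : L2" shows "trunc n f : L2"
 by (rule L2_mono(1)[OF assms]) (use L2_meas[OF assms] in "auto simp: trunc_def indicator_def")

lemma trunc_L1: assumes "f : L2" shows "integrable lborel (trunc n f)"
proof -
 have "(%x. cr (indicator {- real n..real n} x)) : L2"
  by (rule L2_indicator) auto
 from L2_mult_int[OF this assms] show ?thesis
  unfolding trunc_def by (rule back_subst[of "integrable lborel"]) (auto simp: indicator_def)
qed

lemma trunc_conv: assumes f: "f : L2" shows "(%n. n2d (trunc n f) f) ----> 0"
proof -
 have [measurable]: "meas f" using f L2_meas by auto
 have "(%n. LINT x|lborel. (cmod (trunc n f x - f x))^2) ----> (LINT x|(lborel::real measure). 0::real)"
 proof (rule integral_dominated_convergence[where w="%x. (cmod (f x))^2"])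
  show "ae x. (%n. (cmod (trunc n f x - f x))^2) ----> 0"
  proof (rule AE_I2)
   fix x :: real
   obtain N :: nat where N: "\<bar>x\<bar> <= real N" using real_arch_simple by blast
   show "(%n. (cmod (trunc n f x - f x))^2) ----> 0"
    by (rule tendsto_eventually, rule eventually_sequentiallyI[of N])
     (use N in "auto simp: trunc_def indicator_def")
  qed
  show "ae x. norm ((cmod (trunc n f x - f x))^2) <= (cmod (f x))^2" for n
   by (auto simp: trunc_def indicator_def)
 qed (auto simp: L2_int[OF f])
 then have "(%n. (LBINT x. (cmod (trunc n f x - f x))^2)) ----> 0" by simp
 from tendsto_real_sqrt[OF this] show ?thesis by (simp add: n2_def)
qed

lemma FT_add: "integrable lborel f ==> integrable lborel g ==> FT (%x. a * f x + b * g x) w = a * FT f w + b * FT g w"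
proof -
 assume *: "integrable lborel f" "integrable lborel g"
 have "(LBINT x. cis (- (x * w)) * (a * f x + b * g x)) = (LBINT x. a * (cis (- (x * w)) * f x) + b * (cis (- (x * w)) * g x))"
  by (rule bi_cong) (simp_all add: algebra_simps)
 also have "... = a * (LBINT x. cis (- (x * w)) * f x) + b * (LBINT x. cis (- (x * w)) * g x)"
  using * by (subst Bochner_Integration.integral_add) (auto intro!: integrable_mult_right integrable_cis_mult)
 finally show ?thesis unfolding FT_def by (simp add: algebra_simps)
qed

lemma FT_diff: "integrable lborel f ==> integrable lborel g ==> FT (%x. f x - g x) w = FT f w - FT g w"
 using FT_add[of f g 1 "-1"] by simp

text \<open>Replaces the limit of extended nonnegative integrals in the definition by a limit of
  norms, the form in which it is used from here on.\<close>

lemma has_fourier_iff: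
 "has_fourier_L2 f g \<longleftrightarrow> f : L2 \<and> g : L2 \<and> (%n. n2d (FT (trunc n f)) g) ----> 0"
proof -
 have "(%n. (NN x. ennreal ((cmod (truncated_fourier n f x - g x))^2))) ----> 0 \<longleftrightarrow>
  (%n. n2d (FT (trunc n f)) g) ----> 0" if fg: "f : L2" "g : L2"
 proof -
  have L: "(%x. FT (trunc n f) x - g x) : L2" for n
   by (intro L2_diff Plancherel_L1_L2 trunc_L2 trunc_L1 fg)
  have "(%n. (NN x. ennreal ((cmod (truncated_fourier n f x - g x))^2))) = (%n. ennreal ((n2d (FT (trunc n f)) g)^2))"
   unfolding truncated_fourier_eq using nn_n2[OF L] by simp
  moreover have "(%n. ennreal ((n2d (FT (trunc n f)) g)^2)) ----> 0 \<longleftrightarrow> (%n. (n2d (FT (trunc n f)) g)^2) ----> 0"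
   using tendsto_ennreal_iff[of "%n. (n2d (FT (trunc n f)) g)^2" sequentially 0] by simp
  moreover have "(%n. (n2d (FT (trunc n f)) g)^2) ----> 0 \<longleftrightarrow> (%n. n2d (FT (trunc n f)) g) ----> 0"
  proof
   assume "(%n. (n2d (FT (trunc n f)) g)^2) ----> 0"
   from tendsto_real_sqrt[OF this] show "(%n. n2d (FT (trunc n f)) g) ----> 0" by simp
  next
   assume "(%n. n2d (FT (trunc n f)) g) ----> 0"
   from tendsto_power[OF this, of 2] show "(%n. (n2d (FT (trunc n f)) g)^2) ----> 0" by simp
  qed
  ultimately show ?thesis by simp
 qed
 then show ?thesis unfolding has_fourier_L2_def by blast
qed

lemma has_fourier_L2D: "has_fourier_L2 f g ==> f : L2" "has_fourier_L2 f g ==> g : L2"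
 by (auto simp: has_fourier_iff)

lemma has_fourier_lim: "has_fourier_L2 f g ==> (%n. n2d (FT (trunc n f)) g) ----> 0"
 by (auto simp: has_fourier_iff)

lemma FT_trunc_L2: "f : L2 ==> FT (trunc n f) : L2" "f : L2 ==> n2 (FT (trunc n f)) = n2 (trunc n f)"
 by (auto intro!: Plancherel_L1_L2 trunc_L2 trunc_L1)

lemma n2_tendsto:
 assumes "!!n. f n : L2" "g : L2" "(%n. n2d (f n) g) ----> 0"
 shows "(%n. n2 (f n)) ----> n2 g"
proof -
 have "(%n. n2 (f n) - n2 g) ----> 0"
  by (rule Lim_null_comparison[OF _ assms(3)]) (use n2_rev_triangle assms in auto)
 then show ?thesis by (simp add: LIM_zero_iff)
qed

lemma ip_tendsto:
 assumes "!!n. f n : L2" "g : L2" "(%n. n2d (f n) g) ----> 0"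
  and "!!n. f' n : L2" "g' : L2" "(%n. n2d (f' n) g') ----> 0"
 shows "(%n. ip (f n) (f' n)) ----> ip g g'"
proof -
 have b: "(%n. n2d (f n) g * n2 (f' n) + n2 g * n2d (f' n) g') ----> 0 * n2 g' + n2 g * 0"
  by (intro tendsto_intros n2_tendsto assms)
 have "(%n. ip (f n) (f' n) - ip g g') ----> 0"
 proof (rule Lim_null_comparison)
  show "(%n. n2d (f n) g * n2 (f' n) + n2 g * n2d (f' n) g') ----> 0"
   using b by simp
  show "eventually (%n. norm (ip (f n) (f' n) - ip g g') <= n2d (f n) g * n2 (f' n) + n2 g * n2d (f' n) g') sequentially"
  proof (intro always_eventually allI)
   fix n
   have "ip (f n) (f' n) - ip g g' = ip (%x. f n x - g x) (f' n) + ip g (%x. f' n x - g' x)"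
    using assms by (simp add: ip_diff_left ip_diff_right)
   also have "norm ... <= norm (ip (%x. f n x - g x) (f' n)) + norm (ip g (%x. f' n x - g' x))"
    by (rule norm_triangle_ineq)
   also have "... <= n2d (f n) g * n2 (f' n) + n2 g * n2d (f' n) g'"
    by (intro add_mono ip_CS L2_diff assms)
   finally show "norm (ip (f n) (f' n) - ip g g') <= n2d (f n) g * n2 (f' n) + n2 g * n2d (f' n) g'" .
  qed
 qed
 then show ?thesis by (simp add: LIM_zero_iff)
qed

lemma has_fourier_norm: assumes "has_fourier_L2 f g" shows "n2 g = n2 f"
proof -
 note L = has_fourier_L2D[OF assms]
 have "(%n. n2 (FT (trunc n f))) ----> n2 g"
  by (rule n2_tendsto) (use assms L FT_trunc_L2 has_fourier_lim in auto)
 moreover have "(%n. n2 (trunc n f)) ----> n2 f"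
  by (rule n2_tendsto) (use L trunc_L2 trunc_conv in auto)
 ultimately show ?thesis using FT_trunc_L2(2)[OF L(1)] LIMSEQ_unique by auto
qed

lemma has_fourier_unique:
 assumes "has_fourier_L2 f g" "has_fourier_L2 f h" shows "ae x. g x = h x"
proof (rule n2_le_0_AE_eq)
 note L = has_fourier_L2D[OF assms(1)] has_fourier_L2D[OF assms(2)]
 show "g : L2" "h : L2" using L by auto
 have "(%n. n2d (FT (trunc n f)) g + n2d (FT (trunc n f)) h) ----> 0 + 0"
  by (intro tendsto_intros has_fourier_lim assms)
 then have "(%n. n2d (FT (trunc n f)) g + n2d (FT (trunc n f)) h) ----> 0" by simp
 then show "n2d g h <= 0"
 proof (rule tendsto_lowerbound)
  show "eventually (%n. n2d g h <= n2d (FT (trunc n f)) g + n2d (FT (trunc n f)) h) sequentially"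
   using n2_triangle3[OF L(2) FT_trunc_L2(1)[OF L(1)] L(4)]
   by (auto simp: n2_minus_commute[of g] intro!: always_eventually)
 qed simp
qed

lemma has_fourier_cong:
 assumes "has_fourier_L2 f g" "meas g'" "ae x. g x = g' x" shows "has_fourier_L2 f g'"
proof -
 note L = has_fourier_L2D[OF assms(1)]
 have [measurable]: "meas f" "meas g" "meas g'" using L L2_meas assms by auto
 have "n2d (FT (trunc n f)) g' = n2d (FT (trunc n f)) g" for n
  by (rule n2_cong_AE) (use assms(3) in auto)
 then show ?thesis using assms L L2_cong_AE[OF L(2)] by (simp add: has_fourier_iff)
qed

text \<open>By Plancherel the transforms of the truncations are as close to each other as the
  truncations are. The almost everywhere limit of a subsequence is then the L2 limit of the whole
  sequence, again by Fatou.\<close>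

lemma has_fourier_ex: assumes f: "f : L2" obtains g where "has_fourier_L2 f g"
proof -
 have d: "n2d (FT (trunc i f)) (FT (trunc j f)) = n2d (trunc i f) (trunc j f)" for i j
 proof -
  have "(%w. FT (trunc i f) w - FT (trunc j f) w) = FT (%x. trunc i f x - trunc j f x)"
   using f by (simp add: FT_diff trunc_L1 fun_eq_iff)
  then show ?thesis using f by (simp add: Plancherel_L1_L2 L2_diff trunc_L2 trunc_L1)
 qed
 have C: "\<exists>N. \<forall>i\<ge>N. \<forall>j\<ge>N. n2d (FT (trunc i f)) (FT (trunc j f)) < e" if e: "e > 0" for e
 proof -
  have "eventually (%n. n2d (trunc n f) f < e / 2) sequentially"
   using order_tendstoD(2)[OF trunc_conv[OF f], of "e/2"] e by simp
  then obtain N where N: "!!n. n \<ge> N ==> n2d (trunc n f) f < e / 2" by (auto simp: eventually_sequentially)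
  show ?thesis
  proof (intro exI allI impI)
   fix i j assume "N <= i" "N <= j"
   then show "n2d (FT (trunc i f)) (FT (trunc j f)) < e"
    using n2_triangle3[OF trunc_L2[OF f] f trunc_L2[OF f], of i j] N[of i] N[of j] n2_minus_commute[of f "trunc j f"]
    unfolding d by simp
  qed
 qed
 obtain g r where g: "g : L2" "strict_mono (r :: nat => nat)" "ae x. (%i. FT (trunc (r i) f) x) ----> g x" "\<forall>x c. (\<forall>i. FT (trunc i f) x = c) \<longrightarrow> g x = c"
  by (rule L2_complete[of "%n. FT (trunc n f)", OF FT_trunc_L2(1)[OF f] C])
 have "(%n. n2d (FT (trunc n f)) g) ----> 0"
 proof (rule LIMSEQ_I)
  fix e :: real assume e: "e > 0"
  then obtain N where N: "!!i j. i \<ge> N ==> j \<ge> N ==> n2d (FT (trunc i f)) (FT (trunc j f)) < e / 2"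
   using C[of "e/2"] by auto
  show "\<exists>N. \<forall>n\<ge>N. norm (n2d (FT (trunc n f)) g - 0) < e"
  proof (intro exI allI impI)
   fix n assume n: "n \<ge> N"
   have "n2d g (FT (trunc n f)) <= e / 2"
   proof (rule n2_lim_le)
    show "!!j. j \<ge> N ==> n2d (FT (trunc j f)) (FT (trunc n f)) <= e / 2"
     using N n by (simp add: less_imp_le)
   qed (use g FT_trunc_L2[OF f] e in auto)
   then show "norm (n2d (FT (trunc n f)) g - 0) < e"
    using e n2_minus_commute[of g "FT (trunc n f)"] by simp
  qed
 qed
 with f g(1) have "has_fourier_L2 f g" by (simp add: has_fourier_iff)
 with that show ?thesis .
qed

lemma trunc_lin: "trunc n (%x. a * f x + b * g x) = (%x. a * trunc n f x + b * trunc n g x)"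
 by (auto simp: trunc_def algebra_simps)

lemma has_fourier_lin:
 assumes "has_fourier_L2 f F" "has_fourier_L2 g G"
 shows "has_fourier_L2 (%x. a * f x + b * g x) (%w. a * F w + b * G w)"
proof -
 note L = has_fourier_L2D[OF assms(1)] has_fourier_L2D[OF assms(2)]
 have "(%n. cmod a * n2d (FT (trunc n f)) F + cmod b * n2d (FT (trunc n g)) G) ----> cmod a * 0 + cmod b * 0"
  by (intro tendsto_intros has_fourier_lim assms)
 then have "(%n. cmod a * n2d (FT (trunc n f)) F + cmod b * n2d (FT (trunc n g)) G) ----> 0" by simp
 then have "(%n. n2 (%w. FT (trunc n (%x. a * f x + b * g x)) w - (a * F w + b * G w))) ----> 0"
 proof (rule tendsto_sandwich[OF _ _ tendsto_const, rotated 2])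
  show "eventually (%n. n2 (%w. FT (trunc n (%x. a * f x + b * g x)) w - (a * F w + b * G w))
   <= cmod a * n2d (FT (trunc n f)) F + cmod b * n2d (FT (trunc n g)) G) sequentially"
  proof (intro always_eventually allI)
   fix n
   have "(%w. FT (trunc n (%x. a * f x + b * g x)) w - (a * F w + b * G w))
    = (%w. a * (FT (trunc n f) w - F w) + b * (FT (trunc n g) w - G w))"
    using L by (simp add: trunc_lin FT_add trunc_L1 fun_eq_iff algebra_simps)
   then show "n2 (%w. FT (trunc n (%x. a * f x + b * g x)) w - (a * F w + b * G w))
    <= cmod a * n2d (FT (trunc n f)) F + cmod b * n2d (FT (trunc n g)) G"
    using n2_triangle[of "%w. a * (FT (trunc n f) w - F w)" "%w. b * (FT (trunc n g) w - G w)"] L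
    by (simp add: n2_cmult L2_cmult L2_diff FT_trunc_L2)
  qed
 qed auto
 then show ?thesis using L by (simp add: has_fourier_iff L2_add L2_cmult)
qed

lemma has_fourier_FT:
 assumes f: "f : L2" "integrable lborel f" shows "has_fourier_L2 f (FT f)"
proof -
 have "(%w. FT (trunc n f) w - FT f w) = FT (%x. trunc n f x - f x)" for n
  using f by (simp add: FT_diff trunc_L1 fun_eq_iff)
 then have "n2d (FT (trunc n f)) (FT f) = n2d (trunc n f) f" for n
  using f by (simp add: Plancherel_L1_L2 L2_diff trunc_L2 trunc_L1)
 then show ?thesis using f trunc_conv[OF f(1)] by (simp add: has_fourier_iff Plancherel_L1_L2)
qed

lemma FT_cnj: "FT (%x. cnj (f x)) w = cnj (FT f (- w))"
 unfolding FT_def using Bochner_Integration.integral_cnj[of lborel "%x. cis (x * w) * f x"]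
 by (simp add: cis_cnj)

lemma has_fourier_cnj:
 assumes "has_fourier_L2 f g" shows "has_fourier_L2 (%x. cnj (f x)) (%w. cnj (g (- w)))"
proof -
 note L = has_fourier_L2D[OF assms]
 have t: "trunc n (%x. cnj (f x)) = (%x. cnj (trunc n f x))" for n
  by (auto simp: trunc_def indicator_def fun_eq_iff)
 have "n2 (%w. FT (trunc n (%x. cnj (f x))) w - cnj (g (- w))) = n2d (FT (trunc n f)) g" for n
  unfolding t FT_cnj complex_cnj_diff[symmetric] n2_cnj
  using L2_reflect(2)[of "%w. FT (trunc n f) w - g w"] L by (simp add: L2_diff FT_trunc_L2)
 then show ?thesis using assms L2_cnj[OF L(1)] L2_cnj[OF L2_reflect(1)[OF L(2)]] by (simp add: has_fourier_iff)
qed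

lemma FT_adjoint:
 assumes "integrable lborel f" "integrable lborel g"
 shows "ip (FT f) g = ip f (%x. FT g (- x))"
 unfolding ip_def using FT_mult[OF assms(1), of "%w. cnj (g w)"] assms(2) by (simp add: FT_cnj)

lemma has_fourier_adjoint:
 assumes "has_fourier_L2 f F" "has_fourier_L2 g G"
 shows "ip F g = ip f (%x. G (- x))"
proof -
 note L = has_fourier_L2D[OF assms(1)] has_fourier_L2D[OF assms(2)]
 have r: "n2 (%x. FT (trunc n g) (- x) - G (- x)) = n2d (FT (trunc n g)) G" for n
  using L2_reflect(2)[of "%w. FT (trunc n g) w - G w"] L by (simp add: L2_diff FT_trunc_L2)
 have "(%n. ip (FT (trunc n f)) (trunc n g)) ----> ip F g"
  by (intro ip_tendsto FT_trunc_L2 trunc_L2 L has_fourier_lim[OF assms(1)] trunc_conv)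
 moreover have "(%n. ip (trunc n f) (%x. FT (trunc n g) (- x))) ----> ip f (%x. G (- x))"
  by (intro ip_tendsto L2_reflect FT_trunc_L2 trunc_L2 L trunc_conv) (simp add: r has_fourier_lim[OF assms(2)])
 moreover have "ip (FT (trunc n f)) (trunc n g) = ip (trunc n f) (%x. FT (trunc n g) (- x))" for n
  by (intro FT_adjoint trunc_L1 L)
 ultimately show ?thesis using LIMSEQ_unique by auto
qed

text \<open>The adjoint of the isometry is again an isometry, hence it is the inverse.\<close>

lemma has_fourier_inverse:
 assumes "has_fourier_L2 g h"
 shows "has_fourier_L2 (%x. h (- x)) g"
proof -
 note L = has_fourier_L2D[OF assms]
 have L': "(%x. h (- x)) : L2" by (rule L2_reflect[OF L(2)])
 obtain G where G: "has_fourier_L2 (%x. h (- x)) G" using has_fourier_ex[OF L'] .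
 note LG = has_fourier_L2D[OF G]
 have n: "n2 h = n2 g" "n2 G = n2 g" "n2 (%x. h (- x)) = n2 g"
  using has_fourier_norm[OF assms] has_fourier_norm[OF G] L2_reflect(2)[OF L(2)] by auto
 have "ip G g = cr ((n2 g)^2)"
  using has_fourier_adjoint[OF G assms] n by (simp add: ip_self)
 then have "Re (ip G (%x. - g x)) = - (n2 g)\<^sup>2"
  using ip_cmult_right[of G "-1" g] by simp
 then have "(n2d G g)^2 = 0"
  using n2_add_sq[OF LG(2) L2_uminus[OF L(1)]] n by (simp add: n2_uminus)
 then have "ae x. G x = g x"
  by (intro n2_le_0_AE_eq LG L) simp
 then show ?thesis using has_fourier_cong[OF G L2_meas[OF L(1)]] by simp
qed

lemma L2_of_real: "(%x. cr (f x)) : L2 \<longleftrightarrow> f : L2"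
proof
 assume "(%x. cr (f x)) : L2"
 then have *: "(%x. cr (f x)) : borel_measurable borel" "integrable lborel (%x. (norm (f x))^2)"
  by (auto simp: L2_iff)
 have "(%x. Re (cr (f x))) : borel_measurable borel"
  by (rule measurable_compose[OF *(1)]) (auto intro!: borel_measurable_continuous_onI continuous_intros)
 then show "f : L2" using * by (simp add: L2_iff)
qed (auto simp: L2_iff)

lemma fourier_L2:
 assumes "f : L2" shows "has_fourier_L2 (%x. cr (f x)) (fourier_L2 f)"
proof -
 have "(%x. cr (f x)) : L2" using assms by (simp add: L2_of_real)
 from has_fourier_ex[OF this] show ?thesis unfolding fourier_L2_def by (metis someI_ex)
qed

lemma fourier_L2_eqI:
 assumes "has_fourier_L2 (%x. cr (f x)) g" shows "ae w. fourier_L2 f w = g w"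
 using fourier_L2[of f] has_fourier_L2D(1)[OF assms] has_fourier_unique[OF _ assms] by (simp add: L2_of_real)

lemma fourier_L2_in: "f : L2 ==> fourier_L2 f : L2"
 using fourier_L2 has_fourier_L2D by blast

lemma fourier_L2_norm: "f : L2 ==> n2 (fourier_L2 f) = n2 (%x. cr (f x))"
 using fourier_L2 has_fourier_norm by blast

lemma fourier_L2_hermitian:
 assumes "f : L2" shows "ae w. fourier_L2 f (- w) = cnj (fourier_L2 f w)"
proof -
 have "has_fourier_L2 (%x. cr (f x)) (%w. cnj (fourier_L2 f (- w)))"
  using has_fourier_cnj[OF fourier_L2[OF assms]] by simp
 from fourier_L2_eqI[OF this] show ?thesis
  by eventually_elim (metis complex_cnj_cnj)
qed

lemma fourier_L2_lin:
 assumes "f : L2" "g : L2"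
 shows "ae w. fourier_L2 (%x. a * f x + b * g x) w = cr a * fourier_L2 f w + cr b * fourier_L2 g w"
 by (rule fourier_L2_eqI)
  (use has_fourier_lin[OF fourier_L2[OF assms(1)] fourier_L2[OF assms(2)], of "cr a" "cr b"] in simp)

lemma fourier_L2_inj:
 assumes "f : L2" "g : L2" "ae w. fourier_L2 f w = fourier_L2 g w"
 shows "ae x. f x = g x"
proof -
 have "has_fourier_L2 (%x. 1 * cr (f x) + (-1) * cr (g x)) (%w. 1 * fourier_L2 f w + (-1) * fourier_L2 g w)"
  by (intro has_fourier_lin fourier_L2 assms)
 then have "n2 (%x. cr (f x) - cr (g x)) = n2d (fourier_L2 f) (fourier_L2 g)"
  using has_fourier_norm by fastforce
 also have "... = n2 (%w. 0)"
  by (rule n2_cong_AE) (use assms in "auto intro!: L2_meas L2_diff fourier_L2_in")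
 finally have "ae x. cr (f x) = cr (g x)"
  by (intro n2_le_0_AE_eq) (use assms in "auto simp: L2_of_real")
 then show ?thesis by simp
qed

text \<open>Inversion provides a complex preimage \<open>p\<close>. Hermitian symmetry says that
  \<open>p\<close> and its conjugate have the same transform, so \<open>p\<close> is real off a null
  set and may be replaced by its real part.\<close>

lemma fourier_L2_surj:
 assumes g: "g : L2" and h: "ae w. g (- w) = cnj (g w)"
 obtains f where "f : L2" "ae w. fourier_L2 f w = g w"
proof -
 obtain k where k: "has_fourier_L2 g k" using has_fourier_ex[OF g] .
 define p where "p = (%x. k (- x))"
 have p: "has_fourier_L2 p g" unfolding p_def by (rule has_fourier_inverse[OF k])
 have pc: "has_fourier_L2 (%x. cnj (p x)) (%w. cnj (g (- w)))" by (rule has_fourier_cnj[OF p])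
 note Lp = has_fourier_L2D[OF p] has_fourier_L2D[OF pc]
 have "has_fourier_L2 (%x. 1 * p x + (-1) * cnj (p x)) (%w. 1 * g w + (-1) * cnj (g (- w)))"
  by (intro has_fourier_lin p pc)
 then have "n2 (%x. p x - cnj (p x)) = n2 (%w. g w - cnj (g (- w)))"
  using has_fourier_norm by fastforce
 also have "... = n2 (%w. 0)"
  by (rule n2_cong_AE) (use h Lp in "auto intro!: L2_meas L2_diff")
 finally have "ae x. p x = cnj (p x)"
  by (intro n2_le_0_AE_eq) (use Lp in auto)
 then have re: "ae x. p x = cr (Re (p x))"
  by eventually_elim (simp add: complex_eq_iff)
 have [measurable]: "meas p" using Lp L2_meas by auto
 have RL: "(%x. cr (Re (p x))) : L2"
  by (rule L2_cong_AE[OF Lp(1) _ re]) simp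
 then obtain q where q: "has_fourier_L2 (%x. cr (Re (p x))) q" by (rule has_fourier_ex)
 have "has_fourier_L2 (%x. 1 * cr (Re (p x)) + (-1) * p x) (%w. 1 * q w + (-1) * g w)"
  by (intro has_fourier_lin p q)
 then have "n2d q g = n2 (%x. cr (Re (p x)) - p x)"
  using has_fourier_norm by fastforce
 also have "... = n2 (%w. 0)"
  by (rule n2_cong_AE) (use re in "auto elim: eventually_mono")
 finally have "ae x. q x = g x"
  by (intro n2_le_0_AE_eq) (use has_fourier_L2D[OF q] g in auto)
 with q have "has_fourier_L2 (%x. cr (Re (p x))) g"
  using has_fourier_cong L2_meas[OF g] by blast
 from fourier_L2_eqI[OF this] RL show ?thesis
  using that[of "%x. Re (p x)"] by (simp add: L2_of_real)
qed

section \<open>Weighted spaces and convolution\<close>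

text \<open>Power \<open>s\<close> of the Japanese bracket. The halved exponent makes the square of
  \<open>wt s\<close> the density that occurs in \<open>Hs_norm s\<close>.\<close>

definition wt :: "real => real => real" where "wt s x = (1 + x^2) powr (s / 2)"

lemma one_plus_sq_pos [simp]: "0 < 1 + (x::real)^2"
 by (simp add: add_pos_nonneg)

lemma one_plus_sq_ne0 [simp]: "1 + (x::real)^2 \<noteq> 0"
 using one_plus_sq_pos[of x] by linarith

lemma wt_pos [simp]: "0 < wt s x"
 by (simp add: wt_def)

lemma wt_nonneg [simp]: "0 <= wt s x" by (simp add: less_imp_le)

lemma wt_ne0 [simp]: "wt s x \<noteq> 0" by (rule less_imp_neq[symmetric]) (rule wt_pos)

lemma wt_0 [simp]: "wt 0 x = 1"
 by (simp add: wt_def)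

lemma wt_add: "wt (s + r) x = wt s x * wt r x"
 by (simp add: wt_def add_divide_distrib powr_add)

lemma wt_neg: "wt (- s) x = inverse (wt s x)"
 by (simp add: wt_def powr_minus)

lemma wt_even [simp]: "wt s (- x) = wt s x" by (simp add: wt_def)

lemma wt_ge1: "0 <= s ==> 1 <= wt s x"
 by (simp add: wt_def ge_one_powr_ge_zero)

lemma wt_mono: "r <= s ==> wt r x <= wt s x"
 by (simp add: wt_def powr_mono)

lemma wt_meas [measurable]: "wt s : borel_measurable borel" unfolding wt_def by measurable

lemma wt_even_power: "wt (2 * real n) x = (1 + x^2) ^ n"
 by (simp add: wt_def powr_realpow add_pos_nonneg)

lemma wt_sq: "(wt s x)^2 = (1 + x^2) powr s"
proof -
 have "(wt s x)^2 = (1 + x^2) powr (s / 2 + s / 2)" unfolding powr_add wt_def by (rule power2_eq_square)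
 then show ?thesis by simp
qed

lemma wt_sq': "(wt s x)^2 = wt (2 * s) x"
 by (subst wt_sq) (simp add: wt_def)

lemma abs_power_le_wt: "\<bar>x\<bar> ^ n <= wt (real n) x"
proof (rule power2_le_imp_le)
 have "(\<bar>x\<bar> ^ n)^2 = (x^2) ^ n" by (simp add: power_mult[symmetric] mult.commute power_even_abs)
 also have "... <= (1 + x^2) ^ n" by (intro power_mono) auto
 also have "... = (wt (real n) x)^2" by (simp add: wt_sq' wt_even_power)
 finally show "(\<bar>x\<bar> ^ n)^2 <= (wt (real n) x)^2" .
qed simp

lemma abs_le_wt: "\<bar>x\<bar> <= wt 1 x" using abs_power_le_wt[of x 1] by simp

text \<open>The quadratic estimate 1 + (x + y)^2 <= 2 (1 + x^2) (1 + y^2) already gives the constant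
  2 powr (s / 2), which is then enlarged.\<close>

lemma wt_peetre: assumes "0 <= s" shows "wt s (x + y) <= 2 powr s * (wt s x * wt s y)"
proof -
 have "1 + (x + y)^2 <= 2 * (1 + x^2) * (1 + y^2)"
 proof -
  have "0 <= (x - y)^2 + 1 + 2 * (x * y)^2" by simp
  then show ?thesis by (simp add: power2_eq_square algebra_simps)
 qed
 then have "wt s (x + y) <= (2 * (1 + x^2) * (1 + y^2)) powr (s / 2)"
  unfolding wt_def using assms by (intro powr_mono2) auto
 also have "... = 2 powr (s / 2) * (wt s x * wt s y)"
  unfolding wt_def using powr_mult[of "2 * (1 + x^2)" "1 + y^2" "s/2"] powr_mult[of 2 "1 + x^2" "s/2"]
  by simp
 also have "... <= 2 powr s * (wt s x * wt s y)"
  using assms by (intro mult_right_mono powr_mono) auto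
 finally show ?thesis .
qed

text \<open>\<open>X s\<close> is the image of \<open>H\<^sup>s\<close> under the Fourier transform.\<close>

definition X :: "real => cfun set" where
 "X s = {f. meas f \<and> (%x. cr (wt s x) * f x) : L2}"

definition nrm :: "real => cfun => real" where
 "nrm s f = n2 (%x. cr (wt s x) * f x)"

abbreviation nd :: "real => cfun => cfun => real" where "nd s f g == nrm s (%x. f x - g x)"

lemma X_meas: "f : X s ==> meas f" by (simp add: X_def)
lemma X_L2: "f : X s ==> (%x. cr (wt s x) * f x) : L2" by (simp add: X_def)

lemma X_0: "X 0 = L2" by (auto simp: X_def L2_meas)
lemma nrm_0: "nrm 0 f = n2 f" by (simp add: nrm_def)

lemma nrm_nonneg [simp]: "0 <= nrm s f" by (simp add: nrm_def)

lemma nrm_sq: "(nrm s f)^2 = (LBINT x. (1 + x^2) powr s * (cmod (f x))^2)"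
 unfolding nrm_def n2_sq by (simp add: norm_mult power_mult_distrib wt_sq)

lemma X_bound:
 assumes "g : X r" "meas f" "ae x. wt s x * cmod (f x) <= c * (wt r x * cmod (g x))" "0 <= c"
 shows "f : X s" "nrm s f <= c * nrm r g"
proof -
 have [measurable]: "meas f" by fact
 have "(%w. cr (wt s w) * f w) : L2 \<and> n2 (%w. cr (wt s w) * f w) <= c * n2 (%w. cr (wt r w) * g w)"
  using L2_bound[OF X_L2[OF assms(1)], of "%w. cr (wt s w) * f w" c] assms(3,4)
  by (simp add: norm_mult)
 then show "f : X s" "nrm s f <= c * nrm r g" by (auto simp: X_def nrm_def)
qed

lemma X_mono:
 assumes "f : X s" "r <= s" shows "f : X r" "nrm r f <= nrm s f"
proof -
 have "ae x. wt r x * cmod (f x) <= 1 * (wt s x * cmod (f x))"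
  by (auto intro!: mult_right_mono wt_mono assms)
 from X_bound[OF assms(1) X_meas[OF assms(1)] this] show "f : X r" "nrm r f <= nrm s f" by auto
qed

lemma X_zero [simp]: "(%x. 0) : X s" by (simp add: X_def)
lemma nrm_zero [simp]: "nrm s (%x. 0) = 0" by (simp add: nrm_def)

lemma X_cmult: assumes "f : X s" shows "(%x. c * f x) : X s"
proof -
 have [measurable]: "meas f" using assms by (rule X_meas)
 show ?thesis
  using L2_cmult[OF X_L2[OF assms], of c] by (simp add: X_def mult.left_commute)
qed

lemma nrm_cmult: "nrm s (%x. c * f x) = cmod c * nrm s f"
 using n2_cmult[of c "%x. cr (wt s x) * f x"] by (simp add: nrm_def mult.left_commute)

lemma X_add: "f : X s ==> g : X s ==> (%x. f x + g x) : X s"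
 using L2_add[of "%x. cr (wt s x) * f x" "%x. cr (wt s x) * g x"]
 by (auto simp: X_def distrib_left)

lemma X_diff: "f : X s ==> g : X s ==> (%x. f x - g x) : X s"
 using L2_diff[of "%x. cr (wt s x) * f x" "%x. cr (wt s x) * g x"]
 by (auto simp: X_def right_diff_distrib)

lemma X_uminus: "f : X s ==> (%x. - f x) : X s"
 using X_cmult[of f s "-1"] by simp

lemma nrm_triangle: "f : X s ==> g : X s ==> nrm s (%x. f x + g x) <= nrm s f + nrm s g"
 using n2_triangle[of "%x. cr (wt s x) * f x" "%x. cr (wt s x) * g x"]
 by (simp add: X_def nrm_def distrib_left)

lemma nrm_uminus: "nrm s (%x. - f x) = nrm s f"
 using nrm_cmult[of s "-1" f] by simp

lemma nrm_triangle_diff: "f : X s ==> g : X s ==> nd s f g <= nrm s f + nrm s g"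
 using nrm_triangle[of f s "%x. - g x"] by (simp add: X_uminus nrm_uminus)

lemma nrm_minus_commute: "nd s f g = nd s g f"
 using nrm_uminus[of s "%x. f x - g x"] by simp

lemma nrm_triangle3:
 "f : X s ==> g : X s ==> h : X s ==> nd s f h <= nd s f g + nd s g h"
 using nrm_triangle[of "%x. f x - g x" s "%x. g x - h x"] by (simp add: X_diff)

lemma nrm_rev_triangle: "f : X s ==> g : X s ==> \<bar>nrm s f - nrm s g\<bar> <= nd s f g"
 using nrm_triangle[of "%x. f x - g x" s g] nrm_triangle[of "%x. g x - f x" s f] nrm_minus_commute[of s f g]
 by (simp add: X_diff)

lemma X_cong_AE: "f : X s ==> meas g ==> ae x. f x = g x ==> g : X s"
 by (rule X_bound(1)[of f s g s 1]) (auto elim: eventually_mono)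

lemma nrm_cong_AE: "meas f ==> meas g ==> ae x. f x = g x ==> nrm s f = nrm s g"
 unfolding nrm_def by (intro n2_cong_AE) (auto elim: eventually_mono)

lemma X_mult_le1:
 assumes "f : X s" "meas k" "!!w. cmod (k w) <= 1"
 shows "(%w. k w * f w) : X s" "nrm s (%w. k w * f w) <= nrm s f"
proof -
 have m: "meas (%w. k w * f w)" using assms X_meas[OF assms(1)] by simp
 have "ae x. wt s x * cmod (k x * f x) <= 1 * (wt s x * cmod (f x))"
  using assms(3) by (auto simp: norm_mult intro!: mult_left_mono mult_left_le_one_le)
 from X_bound[OF assms(1) m this] show "(%w. k w * f w) : X s" "nrm s (%w. k w * f w) <= nrm s f" by auto
qed

lemma X_xi:
 assumes "f : X (s + 1)"
 shows "(%w. cr w * f w) : X s" "nrm s (%w. cr w * f w) <= nrm (s + 1) f"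
proof -
 have m: "meas (%w. cr w * f w)" using X_meas[OF assms(1)] by simp
 have "ae x. wt s x * cmod (cr x * f x) <= 1 * (wt (s + 1) x * cmod (f x))"
  using abs_le_wt by (auto simp: norm_mult wt_add mult.assoc intro!: mult_left_mono mult_right_mono)
 from X_bound[OF assms(1) m this] show "(%w. cr w * f w) : X s" "nrm s (%w. cr w * f w) <= nrm (s + 1) f" by auto
qed

text \<open>The embedding constant of \<open>X 1\<close> into L1, from Cauchy-Schwarz against the
  inverse bracket; its value is the square root of pi. In physical space this is the embedding of
  H^1 into the bounded functions.\<close>

definition c1 :: real where "c1 = n2 (%x. cr (wt (-1) x))"

lemma wt_m1_L2: "(%w. cr (wt (-1) w)) : L2"
proof -
 have "integrable lborel (%x::real. inverse (1 + x^2))"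
  using integrable_inverse_1_plus_square by (simp add: set_integrable_def)
 moreover have "(norm (cr (wt (-1) w)))^2 = inverse (1 + w^2)" for w
  using wt_even_power[of 1 w] wt_neg[of 2 w] by (simp add: wt_sq' del: wt_neg)
 ultimately show ?thesis by (simp add: L2_iff)
qed

lemma c1_nonneg [simp]: "0 <= c1" by (simp add: c1_def)

definition l1 :: "cfun => real" where "l1 f = (LBINT x. cmod (f x))"

lemma l1_nonneg [simp]: "0 <= l1 f" by (simp add: l1_def)

lemma nn_l1: "integrable lborel f ==> (NN x. ennreal (cmod (f x))) = ennreal (l1 f)"
 unfolding l1_def by (rule nn_integral_eq_integral) auto

lemma X_L1:
 assumes "f : X 1"
 shows "integrable lborel f" "l1 f <= c1 * nrm 1 f"
proof -
 have e: "cr (wt (-1) x) * (cr (wt 1 x) * f x) = f x" for x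
 proof -
  have "wt (-1) x * wt 1 x = 1" by (simp add: wt_neg)
  then show ?thesis by (simp add: mult.assoc[symmetric] of_real_mult[symmetric] del: of_real_mult)
 qed
 show "integrable lborel f" using L2_mult_int[OF wt_m1_L2 X_L2[OF assms]] unfolding e .
 have e2: "cmod (cr (wt (-1) x)) * cmod (cr (wt 1 x) * f x) = cmod (f x)" for x
  by (subst norm_mult[symmetric]) (simp only: e)
 show "l1 f <= c1 * nrm 1 f" 
  using CS_abs[OF wt_m1_L2 X_L2[OF assms]] unfolding e2 by (simp add: l1_def c1_def nrm_def)
qed

lemma X_wt:
 assumes "f : X (s + r)"
 shows "(%x. cr (wt s x) * f x) : X r" "nrm r (%x. cr (wt s x) * f x) = nrm (s + r) f"
 using assms X_meas[OF assms] by (auto simp: X_def nrm_def wt_add mult_ac)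

lemma X_wt_L1:
 assumes "f : X (s + 1)"
 shows "integrable lborel (%x. cr (wt s x) * f x)" "l1 (%x. cr (wt s x) * f x) <= c1 * nrm (s + 1) f"
 using X_L1[OF X_wt(1)[OF assms]] X_wt(2)[OF assms] by auto

section \<open>Convolution in the weighted spaces\<close>

definition conv :: "cfun => cfun => cfun" where
 "conv f g x = (LBINT y. f (x - y) * g y)"

lemma conv_meas [measurable]: assumes [measurable]: "meas f" "meas g" shows "meas (conv f g)"
 unfolding conv_def by measurable

lemma L2_shift: assumes "f : L2" shows "(%y. f (x - y)) : L2" "n2 (%y. f (x - y)) = n2 f"
 using L2_reflect[OF L2_translate(1)[OF assms, of x]] L2_translate(2)[OF assms, of x] by (simp_all add: add.commute)

lemma conv_int: fixes f g :: "cfun" assumes "f : L2" "g : L2" shows "integrable lborel (%y. f (x - y) * g y)"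
 by (rule L2_mult_int[OF L2_shift(1)[OF assms(1)] assms(2)])

lemma conv_sup: assumes "f : L2" "g : L2" shows "cmod (conv f g x) <= n2 f * n2 g"
 unfolding conv_def using CS[OF L2_shift(1)[OF assms(1)] assms(2)] L2_shift(2)[OF assms(1)] by metis

lemma conv_commute: "conv f g = conv g f"
proof
 fix x
 show "conv f g x = conv g f x" unfolding conv_def
  using lborel_integral_real_affine[of "-1" "%y. f (x - y) * g y" x] by (simp add: mult.commute)
qed

text \<open>The default value 0 of a divergent integral makes the bound true for arbitrary
  functions, with no hypothesis of convergence.\<close>

lemma conv_nn: "ennreal (cmod (conv f g x)) <= (NN y. ennreal (cmod (f (x - y))) * ennreal (cmod (g y)))"
proof (cases "integrable lborel (%y. f (x - y) * g y)")
 case True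
 then show ?thesis unfolding conv_def
  using integral_norm_bound_ennreal[OF True] by (simp add: norm_mult ennreal_mult)
next
 case False
 then show ?thesis unfolding conv_def by (simp add: not_integrable_integral_eq)
qed

lemma nn_reflect_shift:
 assumes [measurable]: "f : borel_measurable borel"
 shows "(NN y. f (x - y)) = (NN y. f (y::real))"
 using nn_integral_real_affine[of f "-1" x] by simp

lemma nn_shift:
 assumes [measurable]: "f : borel_measurable borel"
 shows "(NN y. f (y - x)) = (NN y. f (y::real))"
 using nn_integral_real_affine[of f "1" "-x"] by simp

text \<open>Young's inequality for L1 against L2. The L1 factor is split into two square roots
  before Cauchy-Schwarz: one half integrates to the L1 norm, the other accompanies the square of
  \<open>g\<close> through Fubini.\<close>

lemma young_nn:
 fixes f g :: "real => real"
 assumes [measurable]: "f : borel_measurable borel" "g : borel_measurable borel" and f: "!!x. 0 <= f x"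
 shows "(NN w. (NN y. ennreal (f (w - y)) * ennreal (g y))^2)
  <= (NN x. ennreal (f x))^2 * (NN x. (ennreal (g x))^2)"
proof -
 let ?F = "(NN x. ennreal (f x))" and ?G = "(NN x. (ennreal (g x))^2)"
 have sq: "(ennreal (sqrt (f x)))^2 = ennreal (f x)" for x using f by (simp add: ennreal_power)
 have "(NN y. ennreal (f (w - y)) * ennreal (g y))^2 <= ?F * (NN y. ennreal (f (w - y)) * (ennreal (g y))^2)" for w
 proof -
  have "(NN y. ennreal (f (w - y)) * ennreal (g y)) = (NN y. ennreal (sqrt (f (w - y))) * (ennreal (sqrt (f (w - y))) * ennreal (g y)))"
   using sq by (simp add: mult.assoc[symmetric] power2_eq_square)
  then have "(NN y. ennreal (f (w - y)) * ennreal (g y))^2 <= (NN y. (ennreal (sqrt (f (w - y))))^2) * (NN y. (ennreal (sqrt (f (w - y))) * ennreal (g y))^2)"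
   by (simp only:) (rule Cauchy_Schwarz_nn_integral; measurable)
  then show ?thesis unfolding power_mult_distrib sq using nn_reflect_shift[of "%x. ennreal (f x)" w] by simp
 qed
 then have "(NN w. (NN y. ennreal (f (w - y)) * ennreal (g y))^2) <= (NN w. ?F * (NN y. ennreal (f (w - y)) * (ennreal (g y))^2))"
  by (rule nn_integral_mono)
 also have "... = ?F * (NN w. (NN y. ennreal (f (w - y)) * (ennreal (g y))^2))"
  by (rule nn_integral_cmult) measurable
 also have "(NN w. (NN y. ennreal (f (w - y)) * (ennreal (g y))^2)) = (NN y. (NN w. ennreal (f (w - y)) * (ennreal (g y))^2))"
  by (rule lborel_pair.Fubini') measurable
 also have "... = (NN y. ?F * (ennreal (g y))^2)"
  using nn_shift[of "%x. ennreal (f x)"] by (simp add: nn_integral_multc)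
 also have "... = ?F * ?G" by (rule nn_integral_cmult) measurable
 finally show ?thesis by (simp add: power2_eq_square mult.assoc)
qed

text \<open>Peetre's inequality distributes the weight over both factors, after which Young's
  inequality applies to the weighted functions. Only one of them has to be integrable.\<close>

lemma conv_X:
 assumes s: "0 <= s" and f: "f : X s" "integrable lborel (%w. cr (wt s w) * f w)" and g: "g : X s"
 shows "conv f g : X s" "nrm s (conv f g) <= 2 powr s * l1 (%w. cr (wt s w) * f w) * nrm s g"
proof -
 have [measurable]: "meas f" "meas g" using f g X_meas by auto
 let ?f = "%x. wt s x * cmod (f x)" and ?g = "%x. wt s x * cmod (g x)" and ?c = "2 powr s"
 have "ennreal (wt s w * cmod (conv f g w)) <= ennreal ?c * (NN y. ennreal (?f (w - y)) * ennreal (?g y))" for w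
 proof -
  have "ennreal (wt s w * cmod (conv f g w)) <= ennreal (wt s w) * (NN y. ennreal (cmod (f (w - y))) * ennreal (cmod (g y)))"
   by (simp add: ennreal_mult) (intro mult_left_mono conv_nn zero_le)
  also have "... = (NN y. ennreal (wt s w) * (ennreal (cmod (f (w - y))) * ennreal (cmod (g y))))"
   by (rule nn_integral_cmult[symmetric]) measurable
  also have "... <= (NN y. ennreal ?c * (ennreal (?f (w - y)) * ennreal (?g y)))"
  proof (rule nn_integral_mono)
   fix y
   have "wt s w * (cmod (f (w - y)) * cmod (g y)) <= (?c * (wt s (w - y) * wt s y)) * (cmod (f (w - y)) * cmod (g y))"
    using wt_peetre[OF s, of "w - y" y] by (intro mult_right_mono) auto
   also have "... = ?c * (?f (w - y) * ?g y)" by simp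
   finally show "ennreal (wt s w) * (ennreal (cmod (f (w - y))) * ennreal (cmod (g y))) <= ennreal ?c * (ennreal (?f (w - y)) * ennreal (?g y))"
    by (simp add: ennreal_mult[symmetric] ennreal_leI)
  qed
  also have "... = ennreal ?c * (NN y. (ennreal (?f (w - y)) * ennreal (?g y)))"
   by (rule nn_integral_cmult) measurable
  finally show ?thesis .
 qed
 note * = this
 have "ennreal ((cmod (cr (wt s w) * conv f g w))^2) <= ennreal (?c^2) * (NN y. ennreal (?f (w - y)) * ennreal (?g y))^2" for w
 proof -
  let ?I = "(NN y. ennreal (?f (w - y)) * ennreal (?g y))"
  have "ennreal ((cmod (cr (wt s w) * conv f g w))^2) = (ennreal (wt s w * cmod (conv f g w)))^2"
   by (simp add: norm_mult ennreal_power)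
  also have "... <= (ennreal ?c * ?I)^2" by (rule power_mono_ennreal) (rule *)
  also have "... = ennreal (?c^2) * ?I^2" by (simp add: power_mult_distrib ennreal_power)
  finally show ?thesis .
 qed
 then have "(NN w. ennreal ((cmod (cr (wt s w) * conv f g w))^2))
  <= (NN w. ennreal (?c^2) * (NN y. ennreal (?f (w - y)) * ennreal (?g y))^2)"
  by (rule nn_integral_mono)
 also have "... = ennreal (?c^2) * (NN w. (NN y. ennreal (?f (w - y)) * ennreal (?g y))^2)"
  by (rule nn_integral_cmult) measurable
 also have "... <= ennreal (?c^2) * ((NN x. ennreal (?f x))^2 * (NN x. (ennreal (?g x))^2))"
  by (intro mult_left_mono young_nn) auto
 also have "(NN x. ennreal (?f x)) = ennreal (l1 (%w. cr (wt s w) * f w))"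
  using nn_l1[OF f(2)] by (simp add: norm_mult)
 also have "(NN x. (ennreal (?g x))^2) = ennreal ((nrm s g)^2)"
  using nn_n2[OF X_L2[OF g]] by (simp add: norm_mult ennreal_power nrm_def)
 also have "ennreal (?c^2) * ((ennreal (l1 (%w. cr (wt s w) * f w)))^2 * ennreal ((nrm s g)^2))
  = ennreal ((?c * l1 (%w. cr (wt s w) * f w) * nrm s g)^2)"
  by (simp add: ennreal_power ennreal_mult[symmetric] power_mult_distrib mult.assoc)
 finally have b: "(NN w. ennreal ((cmod (cr (wt s w) * conv f g w))^2))
  <= ennreal ((?c * l1 (%w. cr (wt s w) * f w) * nrm s g)^2)" .
 have "meas (%w. cr (wt s w) * conv f g w)" by measurable
 from L2I_nn[OF this b] show "conv f g : X s" "nrm s (conv f g) <= 2 powr s * l1 (%w. cr (wt s w) * f w) * nrm s g"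
  by (auto simp: X_def nrm_def)
qed

lemma conv_X':
 assumes s: "0 <= s" and f: "f : X (s + 1)" and g: "g : X s"
 shows "conv f g : X s" "nrm s (conv f g) <= 2 powr s * c1 * nrm (s + 1) f * nrm s g"
proof -
 have fs: "f : X s" using X_mono(1)[OF f] by simp
 show "conv f g : X s" by (rule conv_X(1)[OF s fs X_wt_L1(1)[OF f] g])
 have "nrm s (conv f g) <= 2 powr s * l1 (%x. cr (wt s x) * f x) * nrm s g"
  by (rule conv_X(2)[OF s fs X_wt_L1(1)[OF f] g])
 also have "... <= 2 powr s * (c1 * nrm (s + 1) f) * nrm s g"
  by (intro mult_right_mono mult_left_mono X_wt_L1(2)[OF f]) auto
 finally show "nrm s (conv f g) <= 2 powr s * c1 * nrm (s + 1) f * nrm s g" by (simp add: mult.assoc)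
qed

lemma conv_add_left: "f : L2 ==> f' : L2 ==> g : L2 ==> conv (%x. f x + f' x) g w = conv f g w + conv f' g w"
 by (simp add: conv_def ring_distribs conv_int)

lemma conv_diff_left: "f : L2 ==> f' : L2 ==> g : L2 ==> conv (%x. f x - f' x) g w = conv f g w - conv f' g w"
 by (simp add: conv_def left_diff_distrib conv_int)

lemma conv_add_right: "f : L2 ==> g : L2 ==> g' : L2 ==> conv f (%x. g x + g' x) w = conv f g w + conv f g' w"
 by (simp add: conv_def ring_distribs conv_int)

lemma conv_diff_right: "f : L2 ==> g : L2 ==> g' : L2 ==> conv f (%x. g x - g' x) w = conv f g w - conv f g' w"
 by (simp add: conv_def right_diff_distrib conv_int)

lemma conv_cmult_left: "conv (%x. c * f x) g w = c * conv f g w"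
 by (simp add: conv_def mult.assoc)

lemma conv_cmult_right: "conv f (%x. c * g x) w = c * conv f g w"
 by (simp add: conv_def mult.left_commute)

lemma conv_cong_AE:
 assumes "meas f" "meas g" "meas f'" "meas g'" "ae x. f x = f' x" "ae x. g x = g' x"
 shows "conv f g = conv f' g'"
proof
 fix w
 have [measurable]: "meas f" "meas g" "meas f'" "meas g'" by fact+
 have "ae y. f (w - y) = f' (w - y)"
  using AE_borel_affine[of "-1" "%x. f x = f' x" w] assms(5) by simp
 then show "conv f g w = conv f' g' w" unfolding conv_def
  using assms(6) by (intro integral_cong_AE) (auto elim: eventually_elim2)
qed

lemma conv_xi:
 assumes "f : L2" "g : L2" "(%x. cr x * f x) : L2" "(%x. cr x * g x) : L2"
 shows "cr w * conv f g w = conv (%x. cr x * f x) g w + conv f (%x. cr x * g x) w"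
proof -
 have "cr w * conv f g w = (LBINT y. cr (w - y) * f (w - y) * g y + f (w - y) * (cr y * g y))"
  unfolding conv_def integral_mult_right_zero[symmetric] 
  by (rule bi_cong) (simp_all add: algebra_simps)
 also have "... = conv (%x. cr x * f x) g w + conv f (%x. cr x * g x) w"
  unfolding conv_def by (rule Bochner_Integration.integral_add) (rule conv_int assms)+
 finally show ?thesis .
qed

section \<open>Weak derivatives and products on the Fourier side\<close>

definition bump :: "real => nat => real => real" where
 "bump d i y = (if y > 0 then exp (- (d / y)) / y ^ i else 0)"

text \<open>The exponential beats every power: exp t >= (t / k)^k with k = i + 2 leaves two powers
  of \<open>y\<close> after division by y^i. The quadratic bound is what makes the difference
  quotient at 0 vanish.\<close>

lemma bump_le: assumes "d > 0" shows "\<exists>C\<ge>0. \<forall>y. \<bar>bump d i y\<bar> <= C * y^2"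
proof (intro exI allI conjI)
 let ?k = "i + 2"
 let ?C = "(real ?k / d) ^ ?k"
 show "0 <= ?C" using assms by simp
 fix y
 show "\<bar>bump d i y\<bar> <= ?C * y^2"
 proof (cases "y > 0")
  case True
  have "(d / y / real ?k) ^ ?k <= (1 + d / y / real ?k) ^ ?k" using True assms by (intro power_mono) auto
  also have "... <= exp (d / y)"
   by (rule exp_ge_one_plus_x_over_n_power_n) (use True assms in "auto intro: order_trans[of _ 0]")
  finally have *: "(d / y / real ?k) ^ ?k <= exp (d / y)" .
  have pos: "0 < (d / y / real ?k) ^ ?k" using True assms by simp
  have "exp (- (d / y)) = 1 / exp (d / y)" by (simp add: exp_minus field_simps)
  also have "... <= 1 / (d / y / real ?k) ^ ?k" 
   by (rule divide_left_mono[OF * _ mult_pos_pos[OF exp_gt_zero pos]]) simp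
  also have "... = (1 / (d / y / real ?k)) ^ ?k" by (rule power_one_over[symmetric])
  also have "1 / (d / y / real ?k) = real ?k / d * y" using True assms by simp
  also have "(real ?k / d * y) ^ ?k = ?C * y ^ ?k" by (rule power_mult_distrib)
  finally have "exp (- (d / y)) / y ^ i <= (?C * y ^ ?k) / y ^ i" using True by (intro divide_right_mono) auto
  also have "... = ?C * y^2" using True by (simp add: power_add power2_eq_square)
  finally show ?thesis using True by (simp add: bump_def)
 qed (use assms in "simp add: bump_def")
qed

lemma bump_deriv:
 assumes d: "d > 0"
 shows "(bump d i has_field_derivative (d * bump d (i + 2) y - real i * bump d (i + 1) y)) (at y)"
proof -
 consider "y > 0" | "y < 0" | "y = 0" by linarith
 then show ?thesis
 proof cases
  case 1
  have "((%y. exp (- (d / y)) / y ^ i) has_field_derivative (d * bump d (i + 2) y - real i * bump d (i + 1) y)) (at y)"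
  proof (cases i)
   case 0
   then show ?thesis using 1 by (auto intro!: derivative_eq_intros simp: bump_def power2_eq_square field_simps)
  next
   case (Suc j)
   have e: "bump d (i + 2) y = exp (- (d / y)) / y ^ (i + 2)" "bump d (i + 1) y = exp (- (d / y)) / y ^ (i + 1)"
    using 1 by (auto simp: bump_def)
   show ?thesis unfolding e using 1 Suc
    by (auto intro!: derivative_eq_intros simp: power_add divide_simps) (cases j; simp add: algebra_simps power2_eq_square)
  qed
  then show ?thesis
   by (rule DERIV_cong_ev[THEN iffD1, rotated 3])
    (use 1 in \<open>auto simp: bump_def eventually_nhds intro!: exI[of _ "{0<..}"]\<close>)
 next
  case 2
  have "((%y. 0) has_field_derivative (d * bump d (i + 2) y - real i * bump d (i + 1) y)) (at y)"
   using 2 by (simp add: bump_def)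
  then show ?thesis
   by (rule DERIV_cong_ev[THEN iffD1, rotated 3])
    (use 2 in \<open>auto simp: bump_def eventually_nhds intro!: exI[of _ "{..<0}"]\<close>)
 next
  case 3
  obtain C where C: "C \<ge> 0" "!!y. \<bar>bump d i y\<bar> <= C * y^2" using bump_le[OF d] by blast
  have "(%h. bump d i h / h) \<midarrow>0\<rightarrow> 0"
  proof (rule Lim_null_comparison[where g="%h. C * \<bar>h\<bar>"])
   show "eventually (%h. norm (bump d i h / h) <= C * \<bar>h\<bar>) (at 0)"
   proof (rule always_eventually, rule allI)
    fix h :: real
    show "norm (bump d i h / h) <= C * \<bar>h\<bar>"
     using C(2)[of h] C(1) by (cases "h = 0") (auto simp: divide_simps power2_eq_square abs_mult_self_eq mult.assoc)
   qed
   have "((%h. C * \<bar>h\<bar>) ---> C * \<bar>0\<bar>) (at 0)" by (intro tendsto_intros)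
   then show "((%h. C * \<bar>h\<bar>) ---> 0) (at 0)" by simp
  qed
  then show ?thesis using 3 by (simp add: DERIV_def bump_def)
 qed
qed

text \<open>Contains what repeated differentiation of a cutoff can produce: the exponents of the two
  bumps record the negative powers that appear, so the span is closed under derivatives and
  smoothness follows by iteration.\<close>

inductive_set smooth_span :: "real => real => real => (real => real) set" for d a b where
 prod: "(%x. bump d i (x - a) * bump d j (b - x)) : smooth_span d a b"
| add: "f : smooth_span d a b ==> g : smooth_span d a b ==> (%x. f x + g x) : smooth_span d a b"
| scale: "f : smooth_span d a b ==> (%x. c * f x) : smooth_span d a b"

lemma smooth_span_deriv:
 assumes d: "d > 0" and f: "f : smooth_span d a b"
 shows "\<exists>f'\<in>smooth_span d a b. \<forall>x. (f has_field_derivative f' x) (at x)"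
 using f
proof induction
 case (prod i j)
 have D1: "((%x. bump d i (x - a)) has_field_derivative (d * bump d (i + 2) (x - a) - real i * bump d (i + 1) (x - a))) (at x)" for x
 proof -
  have h: "((%x. x - a) has_field_derivative 1) (at x)" by (auto intro!: derivative_eq_intros)
  show ?thesis using DERIV_chain2[where f="bump d i", OF bump_deriv[OF d] h] by simp
 qed
 have D2: "((%x. bump d j (b - x)) has_field_derivative - (d * bump d (j + 2) (b - x) - real j * bump d (j + 1) (b - x))) (at x)" for x
 proof -
  have h: "((%x. b - x) has_field_derivative -1) (at x)" by (auto intro!: derivative_eq_intros)
  show ?thesis using DERIV_chain2[where f="bump d j", OF bump_deriv[OF d] h] by simp
 qed
 let ?f' = "%x. (d * (bump d (i + 2) (x - a) * bump d j (b - x)) + (- real i) * (bump d (i + 1) (x - a) * bump d j (b - x)))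
  + ((- d) * (bump d i (x - a) * bump d (j + 2) (b - x)) + real j * (bump d i (x - a) * bump d (j + 1) (b - x)))"
 have "?f' : smooth_span d a b" by (intro smooth_span.intros)
 moreover have "((%x. bump d i (x - a) * bump d j (b - x)) has_field_derivative ?f' x) (at x)" for x
  by (rule DERIV_cong[OF DERIV_mult[OF D1 D2]]) (simp add: algebra_simps)
 ultimately show ?case by (intro bexI[of _ ?f'] allI)
next
 case (add f g)
 then obtain f' g' where "f' : smooth_span d a b" "g' : smooth_span d a b"
  "!!x. (f has_field_derivative f' x) (at x)" "!!x. (g has_field_derivative g' x) (at x)" by blast
 then show ?case by (intro bexI[of _ "%x. f' x + g' x"]) (auto intro: smooth_span.intros DERIV_add)
next
 case (scale f c)
 then obtain f' where "f' : smooth_span d a b" "!!x. (f has_field_derivative f' x) (at x)" by blast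
 then show ?case by (intro bexI[of _ "%x. c * f' x"]) (auto intro: smooth_span.intros DERIV_cmult)
qed

lemma smooth_span_derivs:
 assumes d: "d > 0" and f: "f : smooth_span d a b"
 shows "(deriv ^^ n) f : smooth_span d a b"
proof (induction n)
 case (Suc n)
 obtain f' where f': "f' : smooth_span d a b" "\<forall>x. ((deriv ^^ n) f has_field_derivative f' x) (at x)"
  using smooth_span_deriv[OF d Suc] by blast
 then have "deriv ((deriv ^^ n) f) = f'" by (auto intro!: DERIV_imp_deriv)
 then show ?case using f' by simp
qed (simp add: f)

definition cutoff :: "real => real => real => real => real" where
 "cutoff d a b x = bump d 0 (x - a) * bump d 0 (b - x)"

lemma cutoff_test: assumes d: "d > 0" shows "test_function (cutoff d a b)"
 unfolding test_function_def
proof (intro conjI allI)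
 have f: "cutoff d a b : smooth_span d a b" unfolding cutoff_def by (rule smooth_span.prod)
 show "(deriv ^^ n) (cutoff d a b) field_differentiable at x" for n x
  using smooth_span_deriv[OF d smooth_span_derivs[OF d f]] unfolding field_differentiable_def by blast
 have "closure {x. cutoff d a b x \<noteq> 0} \<subseteq> {a..b}"
  by (rule closure_minimal) (auto simp: cutoff_def bump_def)
 then show "compact (closure {x. cutoff d a b x \<noteq> 0})"
  by (meson bounded_closed_interval bounded_subset closed_closure compact_eq_bounded_closed)
qed

lemma cutoff_bounds: "d > 0 ==> 0 <= cutoff d a b x" "d > 0 ==> cutoff d a b x <= indicator {a..b} x"
 by (auto simp: cutoff_def bump_def indicator_def mult_le_one)

lemma cutoff_lim: "(%n. cutoff (1 / real (Suc n)) a b x) ----> indicator {a<..<b} x"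
proof (cases "x : {a<..<b}")
 case True
 have "(%n. exp (- (1 / real (Suc n) / (x - a))) * exp (- (1 / real (Suc n) / (b - x)))) ----> exp (- (0 / (x - a))) * exp (- (0 / (b - x)))"
  using True by (intro tendsto_intros LIMSEQ_Suc[OF lim_1_over_n]) auto
 then show ?thesis using True by (simp add: cutoff_def bump_def)
next
 case False
 then have "cutoff (1 / real (Suc n)) a b x = 0" for n by (auto simp: cutoff_def bump_def)
 then show ?thesis using False by simp
qed

lemma cutoff_meas [measurable]: "cutoff d a b : borel_measurable borel"
 unfolding cutoff_def bump_def by measurable

text \<open>Cutoffs converge to indicators of open intervals as their steepness parameter tends to
  0, so \<open>g\<close> has integral 0 over every such interval. On a bounded interval the positive
  and negative parts of \<open>g\<close> then give every ray the same measure, hence agree almost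
  everywhere as densities, hence both vanish.\<close>

lemma AE_zero_of_test:
 fixes g :: "real => real"
 assumes loc: "!!a b. set_integrable lborel {a..b} g" and meas: "g : borel_measurable borel"
  and z: "!!p. test_function p ==> (LBINT x. g x * p x) = 0"
 shows "ae x. g x = 0"
proof -
 note [measurable] = meas
 have int0: "(LBINT x. indicator {a<..<b} x * g x) = 0" for a b
 proof -
  have "(%n. LBINT x. g x * cutoff (1 / real (Suc n)) a b x) ----> (LBINT x. g x * indicator {a<..<b} x)"
  proof (rule integral_dominated_convergence[where w="%x. \<bar>indicator {a..b} x * g x\<bar>"])
   show "integrable lborel (%x. \<bar>indicator {a..b} x * g x\<bar>)"
    using loc[of a b] by (simp add: set_integrable_def integrable_abs)
   show "ae x. (%n. g x * cutoff (1 / real (Suc n)) a b x) ----> g x * indicator {a<..<b} x"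
    by (intro AE_I2 tendsto_intros cutoff_lim)
   show "ae x. norm (g x * cutoff (1 / real (Suc n)) a b x) <= \<bar>indicator {a..b} x * g x\<bar>" for n
    using cutoff_bounds[of "1 / real (Suc n)" a b]
    by (auto simp: abs_mult mult.commute[of _ "\<bar>g _\<bar>"] intro!: mult_left_mono)
  qed auto
  moreover have "(LBINT x. g x * cutoff (1 / real (Suc n)) a b x) = 0" for n
   by (rule z, rule cutoff_test) simp
  ultimately have "(LBINT x. g x * indicator {a<..<b} x) = 0" by (simp add: LIMSEQ_const_iff)
  then show ?thesis by (simp add: mult.commute)
 qed
 have "ae x. indicator {- real n<..<real n} x * g x = 0" for n
 proof -
  let ?D = "%x. indicator {- real n<..<real n} x * g x"
  have iD: "integrable lborel ?D"
  proof -
   have "set_integrable lborel {- real n<..<real n} g"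
    by (rule set_integrable_subset[OF loc[of "- real n" "real n"]]) auto
   then show ?thesis by (simp add: set_integrable_def)
  qed
  let ?P = "%x. ennreal (max 0 (?D x))" and ?N = "%x. ennreal (max 0 (- ?D x))"
  have e: "emeasure (density lborel (%x. ennreal (max 0 (c * ?D x)))) {y<..} = ennreal (LBINT x. indicator {y<..} x * max 0 (c * ?D x))" for y c
  proof -
   have i: "integrable lborel (%x. indicator {y<..} x * max 0 (c * ?D x))"
    by (rule bi_bound[OF integrable_mult_right[OF iD, of c]]) (auto simp: indicator_def)
   have "emeasure (density lborel (%x. ennreal (max 0 (c * ?D x)))) {y<..} = (NN x. ennreal (indicator {y<..} x * max 0 (c * ?D x)))"
    by (subst emeasure_density) (auto intro!: nn_integral_cong simp: indicator_def)
   also have "... = ennreal (LBINT x. indicator {y<..} x * max 0 (c * ?D x))"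
    by (rule nn_integral_eq_integral[OF i]) auto
   finally show ?thesis .
  qed
  have "density lborel ?P = density lborel ?N"
  proof (rule measure_eqI_lessThan)
   fix y
   show "emeasure (density lborel ?P) {y<..} < \<infinity>" using e[of 1 y] by simp
   have ip: "integrable lborel (%x. indicator {y<..} x * max 0 (?D x))"
    by (rule bi_bound[OF iD]) (auto simp: indicator_def)
   have im: "integrable lborel (%x. indicator {y<..} x * max 0 (- ?D x))"
    by (rule bi_bound[OF iD]) (auto simp: indicator_def)
   have "(LBINT x. indicator {y<..} x * max 0 (?D x)) - (LBINT x. indicator {y<..} x * max 0 (- ?D x))
    = (LBINT x. indicator {y<..} x * max 0 (?D x) - indicator {y<..} x * max 0 (- ?D x))"
    using ip im by simp
   also have "... = (LBINT x. indicator {max y (- real n)<..<real n} x * g x)"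
    by (rule bi_cong) (auto simp: indicator_def max_def)
   also have "... = 0" by (rule int0)
   finally show "emeasure (density lborel ?P) {y<..} = emeasure (density lborel ?N) {y<..}"
    using e[of 1 y] e[of "-1" y] by simp
  qed auto
  then have "ae x. ?P x = ?N x"
   by (subst (asm) sigma_finite_measure.density_unique_iff[OF lborel.sigma_finite_measure_axioms]) auto
  then show ?thesis
   by eventually_elim (auto simp: max_def split: if_splits)
 qed
 then have "ae x. \<forall>n. indicator {- real n<..<real n} x * g x = 0" unfolding AE_all_countable by blast
 then show ?thesis
 proof eventually_elim
  case (elim x)
  obtain n :: nat where "\<bar>x\<bar> < real n" using reals_Archimedean2 by blast
  then show ?case using elim[rule_format, of n] by (auto simp: indicator_def)
 qed
qed

lemma test_function_bounded:
 assumes "test_function p"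
 obtains R where "R > 0" "!!x. \<bar>x\<bar> \<ge> R ==> p x = 0" "!!x. \<bar>x\<bar> \<ge> R ==> deriv p x = 0"
proof -
 have "bounded {x. p x \<noteq> 0}" using assms unfolding test_function_def
  by (meson bounded_subset closure_subset compact_imp_bounded)
 then obtain B where B: "B > 0" "!!x. p x \<noteq> 0 ==> \<bar>x\<bar> <= B" by (auto simp: bounded_pos)
 have d0: "deriv p x = 0" if x1: "\<bar>x\<bar> \<ge> B + 1" for x
 proof -
  have "(p has_field_derivative 0) (at x)"
  proof (rule DERIV_cong_ev[THEN iffD2])
   have "eventually (%y. y : - {-B..B}) (nhds x)"
    by (rule eventually_nhds_in_open) (use x1 B(1) in auto)
   then show "eventually (%y. p y = (%_. 0) y) (nhds x)"
    by eventually_elim (metis B(2) Compl_iff abs_le_iff atLeastAtMost_iff minus_le_iff)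
  qed auto
  then show ?thesis by (rule DERIV_imp_deriv)
 qed
 have f0: "p x = 0" if "\<bar>x\<bar> \<ge> B + 1" for x
 proof (rule ccontr)
  assume "p x \<noteq> 0"
  then have "\<bar>x\<bar> <= B" by (rule B(2))
  with \<open>\<bar>x\<bar> \<ge> B + 1\<close> show False by linarith
 qed
 have "0 < B + 1" using B(1) by simp
 from that[OF this f0 d0] show ?thesis .
qed

lemma test_function_deriv:
 assumes "test_function p"
 shows "(p has_field_derivative deriv p x) (at x)" "continuous_on UNIV p" "continuous_on UNIV (deriv p)"
proof -
 have "(deriv ^^ 0) p field_differentiable at x" "(deriv ^^ 1) p field_differentiable at x" for x
  using assms unfolding test_function_def by blast+
 then have *: "p field_differentiable at x" "deriv p field_differentiable at x" for x by simp_all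
 show "(p has_field_derivative deriv p x) (at x)" using *(1) by (simp add: DERIV_deriv_iff_field_differentiable)
 show "continuous_on UNIV p" "continuous_on UNIV (deriv p)"
  using *(1)[THEN field_differentiable_imp_continuous_at] *(2)[THEN field_differentiable_imp_continuous_at]
  by (auto intro!: continuous_at_imp_continuous_on)
qed

lemma continuous_compact_support_L1_L2:
 fixes g :: "real => real"
 assumes c: "continuous_on UNIV g" and z: "!!x. \<bar>x\<bar> \<ge> R ==> g x = 0"
 shows "integrable lborel (%x. cr (g x))" "(%x. cr (g x)) : L2"
proof -
 have [measurable]: "g : borel_measurable borel" using c by (rule borel_measurable_continuous_onI)
 obtain C where C: "!!x. x : {-R..R} ==> \<bar>g x\<bar> <= C"
 proof -
  have "compact (g ` {-R..R})" by (intro compact_continuous_image continuous_on_subset[OF c]) auto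
  then obtain C where "\<forall>y\<in>g ` {-R..R}. norm y <= C" using compact_imp_bounded bounded_iff by blast
  then show ?thesis using that[of C] by auto
 qed
 have b: "\<bar>g x\<bar> <= \<bar>C\<bar> * indicator {-R..R} x" for x
  using C[of x] z[of x] by (cases "\<bar>x\<bar> \<ge> R") (auto simp: indicator_def)
 show "integrable lborel (%x. cr (g x))"
  by (rule bi_bound[where f="%x. \<bar>C\<bar> * indicator {-R..R} x"]) (use b emeasure_compact_finite[OF compact_Icc[of "-R" R]] in "auto intro!: integrable_mult_right integrable_real_indicator")
 show "(%x. cr (g x)) : L2"
 proof (rule L2_bound(1)[where g="%x. cr (indicator {-R..R} x)" and c="\<bar>C\<bar>"])
  show "(%x. cr (indicator {-R..R} x)) : L2"
   using emeasure_compact_finite[OF compact_Icc[of "-R" R]] by (intro L2_indicator) auto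
 qed (use b in auto)
qed

lemma FT_deriv:
 assumes t: "test_function p"
 shows "FT (%x. cr (deriv p x)) w = \<i> * cr w * FT (%x. cr (p x)) w"
proof -
 obtain R where R: "R > 0" "!!x. \<bar>x\<bar> \<ge> R ==> p x = 0" "!!x. \<bar>x\<bar> \<ge> R ==> deriv p x = 0"
  using test_function_bounded[OF t] by metis
 note td = test_function_deriv[OF t]
 have i1: "integrable lborel (%x. cr (p x))" by (rule continuous_compact_support_L1_L2[OF td(2) R(2)])
 have i2: "integrable lborel (%x. cr (deriv p x))" by (rule continuous_compact_support_L1_L2[OF td(3) R(3)])
 let ?F = "%x. cis (- (x * w)) * cr (p x)"
 let ?f = "%x. cis (- (x * w)) * cr (deriv p x) - \<i> * cr w * (cis (- (x * w)) * cr (p x))"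
 have dcis: "((%x. cis (- (x * w))) has_vector_derivative (- w) *\<^sub>R (\<i> * cis (- (x * w)))) (at x)" for x
 proof -
  have c: "(cis has_vector_derivative (\<i> * cis y)) (at y)" for y
   using has_vector_derivative_iexp[of y UNIV] by (simp only: cis_conv_exp[symmetric] cis_conv_exp[abs_def, symmetric] eta_contract_eq)
  have l: "((%x. - (x * w)) has_vector_derivative - w) (at x)"
   unfolding has_real_derivative_iff_has_vector_derivative[symmetric] by (auto intro!: derivative_eq_intros)
  show ?thesis using vector_diff_chain_at[OF l c] by (simp add: comp_def)
 qed
 have "(LBINT x. indicator {-R..R} x *\<^sub>R ?f x) = ?F R - ?F (- R)"
 proof (rule integral_FTC_Icc)
  show "-R <= R" using R by simp
  show "continuous_on {-R..R} ?f"
   by (intro continuous_intros continuous_on_subset[OF td(3)] continuous_on_subset[OF td(2)]) auto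
  fix x
  have "((%x. cr (p x)) has_vector_derivative cr (deriv p x)) (at x within {-R..R})"
   using td(1)[of x] has_vector_derivative_of_real by (metis has_field_derivative_at_within)
  from has_vector_derivative_mult[OF has_vector_derivative_at_within[OF dcis] this]
  show "(?F has_vector_derivative ?f x) (at x within {-R..R})"
   by (simp add: scaleR_conv_of_real algebra_simps)
 qed
 also have "... = 0" using R by simp
 also have "(LBINT x. indicator {-R..R} x *\<^sub>R ?f x) = (LBINT x. ?f x)"
  by (rule bi_cong) (use R in "auto simp: indicator_def")
 also have "... = (LBINT x. cis (- (x * w)) * cr (deriv p x)) - \<i> * cr w * (LBINT x. cis (- (x * w)) * cr (p x))"
  by (subst Bochner_Integration.integral_diff) (auto intro!: integrable_cis_mult integrable_mult_right i1 i2)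
 finally show ?thesis unfolding FT_def by (simp add: algebra_simps)
qed

lemma has_fourier_cong_left:
 assumes "has_fourier_L2 f g" "meas f'" "ae x. f x = f' x" shows "has_fourier_L2 f' g"
proof -
 note L = has_fourier_L2D[OF assms(1)]
 have fL: "f' : L2" using L2_cong_AE[OF L(1) assms(2,3)] .
 obtain g' where g': "has_fourier_L2 f' g'" using has_fourier_ex[OF fL] .
 have "has_fourier_L2 (%x. 1 * f x + (-1) * f' x) (%x. 1 * g x + (-1) * g' x)" by (intro has_fourier_lin assms g')
 then have "n2d g g' = n2d f f'" using has_fourier_norm by fastforce
 also have "... = n2 (%x. 0)"
  by (rule n2_cong_AE) (use assms(3) L fL in "auto intro!: L2_meas L2_diff elim: eventually_mono")
 finally have "ae x. g x = g' x" by (intro n2_le_0_AE_eq) (use L has_fourier_L2D[OF g'] in auto)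
 then show ?thesis by (intro has_fourier_cong[OF g']) (auto intro: L2_meas[OF L(2)] elim: eventually_mono)
qed

lemma has_fourier_inj:
 assumes "has_fourier_L2 f g" "has_fourier_L2 f' g" shows "ae x. f x = f' x"
proof -
 have "has_fourier_L2 (%x. 1 * f x + (-1) * f' x) (%x. 1 * g x + (-1) * g x)" by (intro has_fourier_lin assms)
 then have "n2d f f' = n2 (%x. 0)" using has_fourier_norm by fastforce
 then show ?thesis by (intro n2_le_0_AE_eq) (use has_fourier_L2D[OF assms(1)] has_fourier_L2D[OF assms(2)] in auto)
qed

text \<open>Parseval in polarized form: the adjoint identity is applied to the transform of
  \<open>g\<close>, whose reflection is \<open>v\<close> by inversion.\<close>

lemma has_fourier_ip:
 assumes "has_fourier_L2 u f" "has_fourier_L2 v g" shows "ip u v = ip f g"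
proof -
 note L = has_fourier_L2D[OF assms(1)] has_fourier_L2D[OF assms(2)]
 obtain h where h: "has_fourier_L2 g h" using has_fourier_ex[OF L(4)] .
 have "ae x. h (- x) = v x" by (rule has_fourier_inj[OF has_fourier_inverse[OF h] assms(2)])
 then have "ip u v = ip u (%x. h (- x))" unfolding ip_def
  using L2_meas[OF L(1)] L2_meas[OF L(3)] L2_meas[OF L2_reflect(1)[OF has_fourier_L2D(2)[OF h]]]
  by (intro integral_cong_AE) (auto elim: eventually_mono)
 then show ?thesis using has_fourier_adjoint[OF assms(1) h] by simp
qed

lemma set_integrable_L2: fixes f :: "real => real" assumes "f : L2" shows "set_integrable lborel {a..b} f"
proof -
 have "integrable lborel (%x. cr (indicator {a..b} x) * cr (f x))"
  by (rule L2_mult_int) (use assms L2_indicator(1)[of "{a..b}"] in "auto simp: L2_of_real emeasure_compact_finite[OF compact_Icc, simplified]")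
 then have "integrable lborel (%x. cr (indicator {a..b} x * f x))" by simp
 then show ?thesis by (simp only: set_integrable_def complex_of_real_integrable_eq real_scaleR_def)
qed

text \<open>Existence comes first: the transform times i v is Hermitian and square integrable, so it
  is the transform of some real \<open>w\<close>, and Parseval with test functions shows that
  \<open>w\<close> is a weak derivative. Since \<open>weak_deriv u\<close> is an arbitrary choice,
  uniqueness up to null sets must then identify it with \<open>w\<close>.\<close>

lemma weak_deriv_fourier:
 assumes u: "u : L2" and f: "fourier_L2 u : X 1"
 shows "weak_deriv u : L2" "ae v. fourier_L2 (weak_deriv u) v = \<i> * cr v * fourier_L2 u v"
proof -
 let ?f = "fourier_L2 u"
 let ?g = "%v. \<i> * (cr v * ?f v)"
 have gL: "?g : L2" using X_cmult[OF X_xi(1)[of ?f 0], of \<i>] f by (simp add: X_0)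
 have herm: "ae v. ?g (- v) = cnj (?g v)"
  using fourier_L2_hermitian[OF u] by eventually_elim simp
 obtain w where w: "w : L2" "ae v. fourier_L2 w v = ?g v" using fourier_L2_surj[OF gL herm] .
 have fw: "has_fourier_L2 (%x. cr (w x)) ?g"
  by (rule has_fourier_cong[OF fourier_L2[OF w(1)] L2_meas[OF gL] w(2)])
 have wd: "has_weak_deriv u w"
  unfolding has_weak_deriv_def
 proof (intro conjI allI impI set_integrable_L2 u w(1))
  fix q assume t: "test_function q"
  obtain R where R: "R > 0" "!!x. \<bar>x\<bar> \<ge> R ==> q x = 0" "!!x. \<bar>x\<bar> \<ge> R ==> deriv q x = 0"
   using test_function_bounded[OF t] by metis
  note td = test_function_deriv[OF t]
  let ?p = "%x. cr (q x)" and ?p' = "%x. cr (deriv q x)"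
  note i1 = continuous_compact_support_L1_L2[OF td(2) R(2)] and i2 = continuous_compact_support_L1_L2[OF td(3) R(3)]
  have fp: "has_fourier_L2 ?p (FT ?p)" and fp': "has_fourier_L2 ?p' (FT ?p')"
   using i1 i2 by (auto intro: has_fourier_FT)
  have "cr (LBINT x. u x * deriv q x) = ip (%x. cr (u x)) ?p'"
   unfolding ip_def integral_complex_of_real[symmetric] by simp
  also have "... = ip ?f (FT ?p')" by (rule has_fourier_ip[OF fourier_L2[OF u] fp'])
  also have "... = - ip ?g (FT ?p)"
   unfolding ip_def integral_minus[symmetric]
   by (rule bi_cong) (simp_all add: FT_deriv[OF t])
  also have "... = - ip (%x. cr (w x)) ?p" by (simp add: has_fourier_ip[OF fw fp])
  also have "... = cr (- (LBINT x. w x * q x))"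
   unfolding ip_def of_real_minus integral_complex_of_real[symmetric] by simp
  finally show "(LBINT x. u x * deriv q x) = - (LBINT x. w x * q x)" by (simp only: of_real_eq_iff)
 qed
 then have wd': "has_weak_deriv u (weak_deriv u)" unfolding weak_deriv_def by (rule someI[where P="has_weak_deriv u"])
 let ?d = "%x. weak_deriv u x - w x"
 \<comment> \<open>Local integrability is all that is known of the chosen derivative; it is
   measurable as the pointwise limit of its restrictions to growing intervals.\<close>
 have mu: "weak_deriv u : borel_measurable borel"
 proof -
  have "(%x. indicator {- real n..real n} x *\<^sub>R weak_deriv u x) : borel_measurable borel" for n
  proof -
   have "integrable lborel (%x. indicator {- real n..real n} x *\<^sub>R weak_deriv u x)"
    using wd' unfolding has_weak_deriv_def set_integrable_def by blast
   from borel_measurable_integrable[OF this] show ?thesis by simp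
  qed
  moreover have "(%n. indicator {- real n..real n} x *\<^sub>R weak_deriv u x) ----> weak_deriv u x" for x
  proof -
   obtain N :: nat where N: "\<bar>x\<bar> <= real N" using real_arch_simple by blast
   show ?thesis
    by (rule tendsto_eventually, rule eventually_sequentiallyI[of N]) (use N in "auto simp: indicator_def")
  qed
  ultimately show ?thesis by (rule borel_measurable_LIMSEQ_metric)
 qed
 have [measurable]: "w : borel_measurable borel" "weak_deriv u : borel_measurable borel" using w L2_meas mu by auto
 have "ae x. ?d x = 0"
 proof (rule AE_zero_of_test)
  show "set_integrable lborel {a..b} ?d" for a b
   using wd wd' unfolding has_weak_deriv_def by (auto intro: set_integral_diff)
  show "?d : borel_measurable borel" by measurable
  fix q assume t: "test_function q"
  obtain R where R: "R > 0" "!!x. \<bar>x\<bar> \<ge> R ==> q x = 0" using test_function_bounded[OF t] by metis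
  have ints: "integrable lborel (%x. g x * q x)" if g: "set_integrable lborel {-R..R} g" for g :: "real => real"
  proof -
   have [measurable]: "q : borel_measurable borel" using test_function_deriv(2)[OF t] by (rule borel_measurable_continuous_onI)
   obtain C where C: "!!x. x : {-R..R} ==> \<bar>q x\<bar> <= C"
   proof -
    have "compact (q ` {-R..R})" by (intro compact_continuous_image continuous_on_subset[OF test_function_deriv(2)[OF t]]) auto
    then obtain C where "\<forall>y\<in>q ` {-R..R}. norm y <= C" using compact_imp_bounded bounded_iff by blast
    then show ?thesis using that[of C] by auto
   qed
   have "integrable lborel (%x. (indicator {-R..R} x *\<^sub>R g x) * q x)"
   proof (rule bi_bound)
    show "integrable lborel (%x. C * (indicator {-R..R} x *\<^sub>R g x))" using g unfolding set_integrable_def by (rule integrable_mult_right)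
    show "(%x. (indicator {-R..R} x *\<^sub>R g x) * q x) : borel_measurable lborel"
    proof -
     have [measurable]: "(%x. indicator {-R..R} x *\<^sub>R g x) : borel_measurable borel"
      using borel_measurable_integrable[OF g[unfolded set_integrable_def]] by simp
     show ?thesis by measurable
    qed
    show "ae x. norm ((indicator {-R..R} x *\<^sub>R g x) * q x) <= norm (C * (indicator {-R..R} x *\<^sub>R g x))"
    proof (rule AE_I2)
     fix x
     show "norm ((indicator {-R..R} x *\<^sub>R g x) * q x) <= norm (C * (indicator {-R..R} x *\<^sub>R g x))"
      using C[of x] by (auto simp: indicator_def abs_mult mult.commute[of "\<bar>g x\<bar>"] intro!: mult_right_mono)
    qed
   qed
   moreover have "(%x. (indicator {-R..R} x *\<^sub>R g x) * q x) = (%x. g x * q x)"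
   proof
    fix x
    show "(indicator {-R..R} x *\<^sub>R g x) * q x = g x * q x"
    proof (cases "\<bar>x\<bar> \<ge> R")
     case False
     then have "x : {-R..R}" by auto
     then show ?thesis by simp
    qed (simp add: R(2))
   qed
   ultimately show ?thesis by (simp only:)
  qed
  have "(LBINT x. ?d x * q x) = (LBINT x. weak_deriv u x * q x - w x * q x)" by (simp only: left_diff_distrib)
  also have "... = (LBINT x. weak_deriv u x * q x) - (LBINT x. w x * q x)"
   using wd wd' unfolding has_weak_deriv_def by (intro Bochner_Integration.integral_diff ints) auto
  also have "... = 0"
  proof -
   have "(LBINT x. u x * deriv q x) = - (LBINT x. w x * q x)"
    "(LBINT x. u x * deriv q x) = - (LBINT x. weak_deriv u x * q x)"
    using wd wd' t unfolding has_weak_deriv_def by blast+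
   then show ?thesis by linarith
  qed
  finally show "(LBINT x. ?d x * q x) = 0" .
 qed
 then have ae: "ae x. cr (w x) = cr (weak_deriv u x)" by eventually_elim simp
 have "has_fourier_L2 (%x. cr (weak_deriv u x)) ?g"
  by (rule has_fourier_cong_left[OF fw _ ae]) measurable
 then show "weak_deriv u : L2" "ae v. fourier_L2 (weak_deriv u) v = \<i> * cr v * fourier_L2 u v"
  using fourier_L2_eqI[of "weak_deriv u" ?g] has_fourier_L2D(1)[of "%x. cr (weak_deriv u x)" ?g]
  by (simp_all add: L2_of_real mult.assoc)
qed

section \<open>Products and the Hilbert transform on the Fourier side\<close>

abbreviation m0 :: complex where "m0 \<equiv> cr (1 / sqrt (2 * pi))"

lemma FT_conv:
 assumes f: "integrable lborel f" and g: "integrable lborel g"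
 shows "FT (%w. m0 * conv f g w) x = FT f x * FT g x"
proof -
 define c where "c = m0 * m0"
 have [measurable]: "meas f" "meas g" using f g by auto
 have "FT (%w. m0 * conv f g w) x = (LBINT w. LBINT y. c * (cis (- (w * x)) * (f (w - y) * g y)))"
  unfolding FT_def conv_def c_def integral_mult_right_zero[symmetric] by (simp only: mult_ac)
 also have "... = (LBINT y. LBINT w. c * (cis (- (w * x)) * (f (w - y) * g y)))"
 proof (rule lborel_pair.Fubini_integral, rule integrableI_bounded)
  show "(%(y, w). c * (cis (- (w * x)) * (f (w - y) * g y))) : borel_measurable (lborel \<Otimes>\<^sub>M lborel)"
   by measurable
  have "(\<integral>\<^sup>+p. ennreal (norm (case p of (y, w) => c * (cis (- (w * x)) * (f (w - y) * g y)))) \<partial>(lborel \<Otimes>\<^sub>M lborel))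
   = (NN y. (NN w. ennreal (cmod c * cmod (g y)) * ennreal (cmod (f (w - y)))))"
   by (subst lborel.nn_integral_fst[symmetric], measurable)
    (simp add: norm_mult ennreal_mult[symmetric] mult_ac)
  also have "... = (NN y. ennreal (cmod c * cmod (g y)) * ennreal (l1 f))"
   using nn_shift[of "%x. ennreal (cmod (f x))"] nn_l1[OF f] by (simp add: nn_integral_cmult)
  also have "... = ennreal (cmod c) * ennreal (l1 g) * ennreal (l1 f)"
   using nn_l1[OF g] by (simp add: nn_integral_multc nn_integral_cmult ennreal_mult)
  also have "... < \<infinity>" by (simp add: ennreal_mult[symmetric])
  finally show "(\<integral>\<^sup>+p. ennreal (norm (case p of (y, w) => c * (cis (- (w * x)) * (f (w - y) * g y)))) \<partial>(lborel \<Otimes>\<^sub>M lborel)) < \<infinity>" .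
 qed
 also have "... = (LBINT y. (m0 * cis (- (y * x)) * g y) * FT f x)"
 proof (rule bi_cong[OF refl])
  fix y
  have "(LBINT w. c * (cis (- (w * x)) * (f (w - y) * g y)))
   = (LBINT z. c * (cis (- ((y + z) * x)) * (f z * g y)))"
   using lborel_integral_real_affine[of 1 "%w. c * (cis (- (w * x)) * (f (w - y) * g y))" y] by simp
  also have "... = (LBINT z. (m0 * cis (- (y * x)) * g y * m0) * (cis (- (z * x)) * f z))"
  proof (rule bi_cong[OF refl])
   fix z
   have "cis (- ((y + z) * x)) = cis (- (y * x)) * cis (- (z * x))" by (simp add: cis_mult algebra_simps)
   then show "c * (cis (- ((y + z) * x)) * (f z * g y)) = (m0 * cis (- (y * x)) * g y * m0) * (cis (- (z * x)) * f z)"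
    by (simp only: c_def mult_ac)
  qed
  also have "... = (m0 * cis (- (y * x)) * g y) * FT f x"
   unfolding FT_def by (simp only: integral_mult_right_zero mult.assoc)
  finally show "(LBINT w. c * (cis (- (w * x)) * (f (w - y) * g y))) = (m0 * cis (- (y * x)) * g y) * FT f x" .
 qed
 also have "... = (LBINT y. m0 * (cis (- (y * x)) * g y)) * FT f x"
  unfolding integral_mult_left_zero by (simp only: mult.assoc)
 also have "(LBINT y. m0 * (cis (- (y * x)) * g y)) = FT g x"
  unfolding integral_mult_right_zero FT_def by simp
 also have "FT g x * FT f x = FT f x * FT g x" by (rule mult.commute)
 finally show ?thesis .
qed

text \<open>The computation runs backwards. Both transforms and their convolution are integrable, so
  the inverse transform of the convolution is the product of the inverse transforms pointwise;
  injectivity identifies these with \<open>u\<close> and \<open>v\<close>. Two orders for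
  \<open>u\<close> keep the convolution in \<open>X 1\<close>.\<close>

lemma fourier_product:
 assumes u: "u : L2" "fourier_L2 u : X 2" and v: "v : L2" "fourier_L2 v : X 1"
 shows "(%x. u x * v x) : L2" "ae w. fourier_L2 (%x. u x * v x) w = m0 * conv (fourier_L2 u) (fourier_L2 v) w"
proof -
 let ?f = "fourier_L2 u" and ?g = "fourier_L2 v"
 let ?h = "%w. m0 * conv ?f ?g w"
 have fX: "?f : X 1" using X_mono(1)[OF u(2)] by simp
 have hX: "?h : X 1" using conv_X'(1)[of 1 ?f ?g] u v by (intro X_cmult) simp
 have L: "?f : L2" "?g : L2" "?h : L2"
  using X_mono(1)[OF fX, of 0] X_mono(1)[OF v(2), of 0] X_mono(1)[OF hX, of 0] by (auto simp: X_0)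
 note L1 = X_L1(1)[OF fX] X_L1(1)[OF v(2)] X_L1(1)[OF hX]
 have inv: "has_fourier_L2 (%x. FT p (- x)) p" if "p : L2" "integrable lborel p" for p
  by (rule has_fourier_inverse[OF has_fourier_FT[OF that]])
 have "ae x. FT ?f (- x) = cr (u x)"
  by (rule has_fourier_inj[OF inv[OF L(1) L1(1)] fourier_L2[OF u(1)]])
 moreover have "ae x. FT ?g (- x) = cr (v x)"
  by (rule has_fourier_inj[OF inv[OF L(2) L1(2)] fourier_L2[OF v(1)]])
 ultimately have ae: "ae x. FT ?h (- x) = cr (u x * v x)"
  by eventually_elim (simp add: FT_conv[OF L1(1,2)] del: of_real_divide)
 have [measurable]: "u : borel_measurable borel" "v : borel_measurable borel" using u v L2_meas by auto
 have "has_fourier_L2 (%x. cr (u x * v x)) ?h"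
  by (rule has_fourier_cong_left[OF inv[OF L(3) L1(3)] _ ae]) measurable
 then show "(%x. u x * v x) : L2" "ae w. fourier_L2 (%x. u x * v x) w = m0 * conv ?f ?g w"
  using fourier_L2_eqI[of "%x. u x * v x" ?h] has_fourier_L2D(1) L2_of_real[of "%x. u x * v x"] by auto
qed

lemma hilbert_transform_fourier:
 assumes u: "u : L2"
 shows "hilbert_transform u : L2"
  "ae x. fourier_L2 (hilbert_transform u) x = - \<i> * cr (sgn x) * fourier_L2 u x"
proof -
 let ?f = "fourier_L2 u"
 let ?g = "%x. - \<i> * cr (sgn x) * ?f x"
 have [measurable]: "meas ?f" using fourier_L2_in[OF u] L2_meas by auto
 have gL: "?g : L2"
  by (rule L2_mono(1)[OF fourier_L2_in[OF u]]) (auto simp: norm_mult sgn_if)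
 have herm: "ae x. ?g (- x) = cnj (?g x)"
  using fourier_L2_hermitian[OF u] by eventually_elim (simp add: sgn_minus)
 obtain w where "w : L2" "ae x. fourier_L2 w x = ?g x" using fourier_L2_surj[OF gL herm] .
 then have "\<exists>g. g : L2 \<and> (ae x. fourier_L2 g x = - \<i> * cr (sgn x) * fourier_L2 u x)" by blast
 from someI_ex[OF this] show "hilbert_transform u : L2"
  "ae x. fourier_L2 (hilbert_transform u) x = - \<i> * cr (sgn x) * fourier_L2 u x"
  unfolding hilbert_transform_def by blast+
qed

section \<open>Trilinear and quadrilinear forms\<close>

abbreviation M2 :: "(real \<times> real) measure" where "M2 \<equiv> lborel \<Otimes>\<^sub>M lborel"
abbreviation M3 :: "(real \<times> real \<times> real) measure" where "M3 \<equiv> lborel \<Otimes>\<^sub>M (lborel \<Otimes>\<^sub>M lborel)"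

lemma sigma_finite_M2: "sigma_finite_measure M2"
 by (simp add: lborel_prod lborel.sigma_finite_measure_axioms)

interpretation P3: pair_sigma_finite lborel M2
 by (intro pair_sigma_finite.intro sigma_finite_M2 lborel.sigma_finite_measure_axioms)

lemma nn_M2: "f : borel_measurable M2 ==> (\<integral>\<^sup>+z. f z \<partial>M2) = (NN x. (NN y. f (x, y)))"
 by (rule lborel.nn_integral_fst[symmetric])

lemma nn_fiber: "f : borel_measurable M3 ==> (\<integral>\<^sup>+z. f z \<partial>M3) = (NN h. \<integral>\<^sup>+w. f (h, w) \<partial>M2)"
 by (rule sigma_finite_measure.nn_integral_fst[OF sigma_finite_M2, symmetric])

lemma nn_M3: assumes [measurable]: "f : borel_measurable M3" shows "(\<integral>\<^sup>+z. f z \<partial>M3) = (NN h. (NN x. (NN y. f (h, x, y))))"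
 unfolding nn_fiber[OF assms] by (intro nn_integral_cong nn_M2) measurable

text \<open>Changes of variables as maps: permutations and shears of the frequencies then transport
  integrals, integrability and bounds uniformly, without a new Fubini argument each time.\<close>

definition mp :: "'a measure => ('a => 'a) => bool" where
 "mp M T \<longleftrightarrow> T : measurable M M \<and> distr M M T = M"

lemma mpI:
 assumes T[measurable]: "T : measurable M M" and f: "!!f::_ => ennreal. f : borel_measurable M ==> (\<integral>\<^sup>+z. f (T z) \<partial>M) = (\<integral>\<^sup>+z. f z \<partial>M)"
 shows "mp M T"
 unfolding mp_def
proof (intro conjI T measure_eqI)
 fix A assume "A : sets (distr M M T)"
 then have [measurable]: "A : sets M" by simp
 show "emeasure (distr M M T) A = emeasure M A"
  using f[of "indicator A"] by (subst nn_integral_indicator[symmetric], simp, subst nn_integral_distr) simp_all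
qed simp

lemma mp_nn: "mp M T ==> f : borel_measurable M ==> (\<integral>\<^sup>+z. f (T z) \<partial>M) = (\<integral>\<^sup>+z. f z \<partial>M)"
 using nn_integral_distr[of T M M f] by (simp add: mp_def)

lemma mp_int:
 fixes f :: "_ => complex"
 assumes "mp M T" "f : borel_measurable M"
 shows "(LINT z|M. f (T z)) = (LINT z|M. f z)" "integrable M (%z. f (T z)) \<longleftrightarrow> integrable M f"
 using assms integral_distr[of T M M f] integrable_distr_eq[of T M M f] by (simp_all add: mp_def)

lemma mp_swap: "mp M2 (%(x, y). (y, x))"
 unfolding mp_def using lborel_pair.distr_pair_swap[symmetric] by auto

text \<open>With the last frequency eliminated, exchanging it with \<open>y\<close> becomes a
  reflection in the second variable. Together with \<open>mp_swap\<close> it generates all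
  permutations of the three slots.\<close>

lemma mp_refl: "mp M2 (%(x, y). (x, - h - x - y))"
proof (rule mpI)
 fix f :: "_ => ennreal" assume [measurable]: "f : borel_measurable M2"
 have "(NN y. f (x, - h - x - y)) = (NN y. f (x, y))" for x
  using nn_reflect_shift[of "%y. f (x, y)" "- h - x"] by simp
 then show "(\<integral>\<^sup>+z. f (case z of (x, y) => (x, - h - x - y)) \<partial>M2) = (\<integral>\<^sup>+z. f z \<partial>M2)"
  by (simp add: nn_M2)
qed measurable

lemma mp_translate: "mp M2 ((+) w)"
 unfolding mp_def lborel_prod
 by (simp add: lborel_distr_plus[symmetric] cong: distr_cong) (metis distr_cong lborel_distr_plus sets_lborel)

lemma mp_fiber:
 assumes [measurable]: "(%(h, z). T h z) : measurable M3 M2" and T: "!!h. mp M2 (T h)"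
 shows "mp M3 (%(h, z). (h, T h z))"
proof (rule mpI)
 fix f :: "_ => ennreal" assume [measurable]: "f : borel_measurable M3"
 show "(\<integral>\<^sup>+z. f (case z of (h, z) => (h, T h z)) \<partial>M3) = (\<integral>\<^sup>+z. f z \<partial>M3)"
  by (subst (1 2) nn_fiber, measurable, simp, intro nn_integral_cong mp_nn[OF T]) measurable
qed measurable

lemma mp_swap12: "mp M3 (%(h, x, y). (x, h, y))"
proof (rule mpI)
 fix f :: "_ => ennreal" assume [measurable]: "f : borel_measurable M3"
 show "(\<integral>\<^sup>+z. f (case z of (h, x, y) => (x, h, y)) \<partial>M3) = (\<integral>\<^sup>+z. f z \<partial>M3)"
  by (subst (1 2) nn_M3, measurable, simp, rule lborel_pair.Fubini') measurable
qed measurable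

lemma mp_swap23: "mp M3 (%(h, x, y). (h, y, x))"
 using mp_fiber[of "%_ (x, y). (y, x)"] mp_swap by (simp add: case_prod_unfold)

lemma mp_swap34: "mp M3 (%(h, x, y). (h, x, - h - x - y))"
 using mp_fiber[of "%h (x, y). (x, - h - x - y)"] mp_refl by (simp add: case_prod_unfold)

abbreviation (input) F3 where "F3 b p q r \<equiv> (%(x, y). b x y * (p x * q y * r (- x - y)) :: complex)"
abbreviation (input) F4 where "F4 k a p q r \<equiv> (%(h, x, y). k h x y * (a h * p x * q y * r (- h - x - y)) :: complex)"
abbreviation (input) P3 where "P3 p q r \<equiv> (%(x, y). p x * q y * r (- x - y) :: complex)"
abbreviation (input) P4 where "P4 a p q r \<equiv> (%(h, x, y). a h * p x * q y * r (- h - x - y) :: complex)"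

definition ib :: "'a measure => ('a => complex) => real => bool" where
 "ib M g B \<longleftrightarrow> integrable M g \<and> (LINT z|M. cmod (g z)) <= B"

lemma ibI:
 assumes [measurable]: "g : borel_measurable M" and le: "(\<integral>\<^sup>+z. ennreal (cmod (g z)) \<partial>M) <= ennreal B" and B: "0 <= B"
 shows "ib M g B"
proof -
 have i: "integrable M g" by (rule integrableI_bounded) (use le in "auto intro: le_less_trans")
 then have "ennreal (LINT z|M. cmod (g z)) <= ennreal B" using le by (subst nn_integral_eq_integral[symmetric]) auto
 with i B show ?thesis by (simp add: ib_def)
qed

lemma ib_mp: assumes T: "mp M T" and g: "ib M g B" shows "ib M (%z. g (T z)) B"
proof -
 have [measurable]: "T : measurable M M" and [measurable]: "g : borel_measurable M" using T g by (auto simp: mp_def ib_def)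
 have "(LINT z|M. cmod (g (T z))) = (LINT z|distr M M T. cmod (g z))" by (rule integral_distr[symmetric]) measurable
 then show ?thesis using T g mp_int(2)[OF T, of g] by (simp add: ib_def mp_def)
qed

text \<open>All integrals below are estimated through this lemma, with at most one summand for each placement of the two unweighted factors.\<close>

lemma ib_dom:
 fixes F :: "_ => complex" and c B :: real
 assumes F: "F : borel_measurable M" and le: "!!z. cmod (F z) <= c * (\<Sum>g\<leftarrow>gs. cmod (g z))" and c: "0 <= c"
  and g: "\<forall>g\<in>set gs. ib M g B"
 shows "integrable M F" "cmod (LINT z|M. F z) <= c * (length gs * B)"
proof -
 have G: "integrable M (%z. \<Sum>g\<leftarrow>gs. cmod (g z)) \<and> (LINT z|M. (\<Sum>g\<leftarrow>gs. cmod (g z))) <= length gs * B"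
  using g by (induction gs) (auto simp: ib_def algebra_simps)
 then have i: "integrable M (%z. c * (\<Sum>g\<leftarrow>gs. cmod (g z)))" by simp
 show *: "integrable M F" by (rule bi_bound[OF i F]) (use le order_trans[OF le abs_ge_self] in auto)
 have "cmod (LINT z|M. F z) <= (LINT z|M. c * (\<Sum>g\<leftarrow>gs. cmod (g z)))"
  by (rule order_trans[OF integral_norm_bound integral_mono[OF _ i le]]) (use * in simp)
 also have "... <= c * (length gs * B)" using G c by (simp add: mult_left_mono)
 finally show "cmod (LINT z|M. F z) <= c * (length gs * B)" .
qed

lemma minus_diff_commute: "- y - x = - x - (y::real)" "- h - y - x = - h - x - (y::real)" "- x - h - y = - h - x - (y::real)" by simp_all

text \<open>The variable of the integrable factor is frozen and Cauchy-Schwarz is applied to the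
  other two; the remaining placements follow by permuting the slots.\<close>

lemma ib3:
 assumes a: "integrable lborel a" and p: "p : L2" and q: "q : L2"
 shows "ib M2 (P3 a p q) (l1 a * (n2 p * n2 q))" "ib M2 (P3 p a q) (l1 a * (n2 p * n2 q))" "ib M2 (P3 p q a) (l1 a * (n2 p * n2 q))"
proof -
 have [measurable]: "meas a" "meas p" "meas q" using assms L2_meas by auto
 show 1: "ib M2 (P3 a p q) (l1 a * (n2 p * n2 q))"
 proof (rule ibI)
  have "(\<integral>\<^sup>+z. ennreal (cmod (P3 a p q z)) \<partial>M2) = (NN x. ennreal (cmod (a x)) * (NN y. ennreal (cmod (p y)) * ennreal (cmod (q (- x - y)))))"
   by (subst nn_M2, measurable) (simp add: norm_mult ennreal_mult mult.assoc nn_integral_cmult)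
  also have "... <= (NN x. ennreal (cmod (a x)) * ennreal (n2 p * n2 q))"
  proof (intro nn_integral_mono mult_left_mono)
   fix x
   show "(NN y. ennreal (cmod (p y)) * ennreal (cmod (q (- x - y)))) <= ennreal (n2 p * n2 q)"
    using nn_CS[OF p L2_shift(1)[OF q, of "- x"]] L2_shift(2)[OF q, of "- x"] by simp
  qed simp
  also have "... = ennreal (l1 a * (n2 p * n2 q))" by (simp add: nn_integral_multc nn_l1[OF a] ennreal_mult)
  finally show "(\<integral>\<^sup>+z. ennreal (cmod (P3 a p q z)) \<partial>M2) <= ennreal (l1 a * (n2 p * n2 q))" .
 qed auto
 have "ib M2 (%z. P3 a p q (case z of (x, y) => (y, x))) (l1 a * (n2 p * n2 q))" by (rule ib_mp[OF mp_swap 1])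
 then show 2: "ib M2 (P3 p a q) (l1 a * (n2 p * n2 q))" by (simp add: case_prod_unfold minus_diff_commute mult_ac)
 show "ib M2 (P3 p q a) (l1 a * (n2 p * n2 q))" using ib_mp[OF mp_refl[of 0] 2] by (simp add: case_prod_unfold mult_ac)
qed

lemma ib4_perm:
 assumes "ib M3 (P4 a p q r) B" shows "ib M3 (P4 p a q r) B" "ib M3 (P4 a q p r) B" "ib M3 (P4 a p r q) B"
 using ib_mp[OF mp_swap12 assms] ib_mp[OF mp_swap23 assms] ib_mp[OF mp_swap34 assms]
 by (simp_all add: case_prod_unfold minus_diff_commute mult_ac)

lemma ib4:
 assumes a: "integrable lborel a" and b: "integrable lborel b" and c: "c : L2" and d: "d : L2"
 defines "B \<equiv> l1 a * l1 b * (n2 c * n2 d)"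
 shows "ib M3 (P4 a b c d) B" "ib M3 (P4 a c b d) B" "ib M3 (P4 a c d b) B" "ib M3 (P4 c a b d) B" "ib M3 (P4 c a d b) B" "ib M3 (P4 c d a b) B"
proof -
 have [measurable]: "meas a" "meas b" "meas c" "meas d" using a b c d L2_meas by auto
 show 1: "ib M3 (P4 a b c d) B"
 proof (rule ibI)
  have "(\<integral>\<^sup>+z. ennreal (cmod (P4 a b c d z)) \<partial>M3) = (NN h. (NN x. (ennreal (cmod (a h)) * ennreal (cmod (b x))) * (NN y. (ennreal (cmod (c y)) * ennreal (cmod (d (- h - x - y)))))))"
   by (subst nn_M3, measurable) (simp add: norm_mult ennreal_mult mult.assoc nn_integral_cmult)
  also have "... <= (NN h. (NN x. (ennreal (cmod (a h)) * ennreal (cmod (b x))) * ennreal (n2 c * n2 d)))"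
  proof (intro nn_integral_mono mult_left_mono)
   fix h x
   show "(NN y. ennreal (cmod (c y)) * ennreal (cmod (d (- h - x - y)))) <= ennreal (n2 c * n2 d)"
    using nn_CS[OF c L2_shift(1)[OF d, of "- h - x"]] L2_shift(2)[OF d, of "- h - x"] by simp
  qed simp
  also have "... = ennreal B"
   unfolding B_def by (simp add: nn_integral_multc nn_integral_cmult nn_l1[OF a] nn_l1[OF b] ennreal_mult)
  finally show "(\<integral>\<^sup>+z. ennreal (cmod (P4 a b c d z)) \<partial>M3) <= ennreal B" .
 qed (auto simp: B_def)
 show 2: "ib M3 (P4 a c b d) B" by (rule ib4_perm(2)[OF 1])
 show 3: "ib M3 (P4 a c d b) B" by (rule ib4_perm(3)[OF 2])
 show "ib M3 (P4 c a b d) B" by (rule ib4_perm(1)[OF 2])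
 show 5: "ib M3 (P4 c a d b) B" by (rule ib4_perm(1)[OF 3])
 show "ib M3 (P4 c d a b) B" by (rule ib4_perm(2)[OF 5])
qed

text \<open>Forms on the hyperplanes \<open>x + y + z = 0\<close> and \<open>h + x + y + z = 0\<close>; the last frequency is eliminated.\<close>

definition L3 :: "(real => cfun) => cfun => cfun => cfun => complex" where
 "L3 b p q r = (LINT z|M2. F3 b p q r z)"

definition L4 :: "(real => real => cfun) => cfun => cfun => cfun => cfun => complex" where
 "L4 k a p q r = (LINT z|M3. F4 k a p q r z)"

lemma F3_meas [measurable]:
 assumes m: "(%(x, y). b x y) : borel_measurable M2" and [measurable]: "meas p" "meas q" "meas r"
 shows "F3 b p q r : borel_measurable M2"
proof -
 have "P3 p q r : borel_measurable M2" by measurable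
 from borel_measurable_times[OF m this] show ?thesis by (simp add: case_prod_unfold)
qed

lemma F4_meas [measurable]:
 assumes m: "(%(h, x, y). k h x y) : borel_measurable M3" and [measurable]: "meas a" "meas p" "meas q" "meas r"
 shows "F4 k a p q r : borel_measurable M3"
proof -
 have "P4 a p q r : borel_measurable M3" by measurable
 from borel_measurable_times[OF m this] show ?thesis by (simp add: case_prod_unfold)
qed

lemma L3_swap12: "L3 b p q r = L3 (%x y. b y x) q p r" if "(%(x, y). b x y) : borel_measurable M2" "meas p" "meas q" "meas r"
 using mp_int(1)[OF mp_swap F3_meas[OF that]] by (simp add: L3_def case_prod_unfold minus_diff_commute mult_ac)

lemma L3_swap23: "L3 b p q r = L3 (%x y. b x (- x - y)) p r q" if "(%(x, y). b x y) : borel_measurable M2" "meas p" "meas q" "meas r"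
 using mp_int(1)[OF mp_refl[of 0] F3_meas[OF that]] by (simp add: L3_def case_prod_unfold mult_ac)

lemma L4_swap:
 assumes "(%(h, x, y). k h x y) : borel_measurable M3" "meas a" "meas p" "meas q" "meas r"
 shows "L4 k a p q r = L4 (%h x y. k h y x) a q p r" "integrable M3 (F4 (%h x y. k h y x) a q p r) \<longleftrightarrow> integrable M3 (F4 k a p q r)"
  "L4 k a p q r = L4 (%h x y. k h x (- h - x - y)) a p r q" "integrable M3 (F4 (%h x y. k h x (- h - x - y)) a p r q) \<longleftrightarrow> integrable M3 (F4 k a p q r)"
 using mp_int[OF mp_swap23 F4_meas[OF assms]] mp_int[OF mp_swap34 F4_meas[OF assms]]
 by (simp_all add: L4_def case_prod_unfold minus_diff_commute mult_ac)

lemma L4_add: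
 assumes "integrable M3 (F4 k a p q r)" "integrable M3 (F4 k' a p q r)"
 shows "L4 (%h x y. k h x y + k' h x y) a p q r = L4 k a p q r + L4 k' a p q r" "integrable M3 (F4 (%h x y. k h x y + k' h x y) a p q r)"
proof -
 have e: "F4 (%h x y. k h x y + k' h x y) a p q r = (%z. F4 k a p q r z + F4 k' a p q r z)"
  by (simp add: fun_eq_iff distrib_right)
 show "L4 (%h x y. k h x y + k' h x y) a p q r = L4 k a p q r + L4 k' a p q r" "integrable M3 (F4 (%h x y. k h x y + k' h x y) a p q r)"
  unfolding L4_def e using assms by simp_all
qed

text \<open>The two copies of the second form are relabelled differently: one by exchanging
  \<open>x\<close> and \<open>y\<close>, the other by a further exchange of \<open>y\<close> with
  the eliminated frequency, which is free because both of those slots carry \<open>q\<close>. The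
  sum of the three kernels is the place where cancellation between the slots can be seen.\<close>

lemma L4_symmetrize:
 assumes m: "(%(h, x, y). k h x y) : borel_measurable M3" "meas a" "meas p" "meas q"
  and i: "integrable M3 (F4 k a p q q)" "integrable M3 (F4 k a q p q)"
 shows "L4 k a p q q + 2 * L4 k a q p q = L4 (%h x y. k h x y + k h y x + k h (- h - x - y) x) a p q q"
proof -
 have m': "(%(h, x, y). k h y x) : borel_measurable M3"
  using measurable_compose[OF mp_swap23[unfolded mp_def, THEN conjunct1] m(1)] by (simp add: case_prod_unfold)
 note 2 = L4_swap(1,2)[OF m(1,2,4,3,4)] and 3 = L4_swap(3,4)[OF m' m(2,3,4,4)]
 show ?thesis using i 2 3 L4_add[of k a p q q "%h x y. k h y x"] L4_add[of "%h x y. k h x y + k h y x" a p q q "%h x y. k h (- h - x - y) x"] by simp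
qed

text \<open>The integration variable of the convolution becomes a fourth frequency \<open>h\<close>;
  translating \<open>x\<close> by \<open>h\<close> in each fiber makes the arguments of all factors
  independent.\<close>

lemma L3_slot:
 assumes b: "(%(x, y). b x y) : borel_measurable M2" and [measurable]: "meas a" "meas p" "meas q" "meas r"
  and i: "integrable M3 (F4 (%h x y. b (x + h) y) a p q r)"
 shows "L3 b (conv p a) q r = L4 (%h x y. b (x + h) y) a p q r"
proof -
 let ?K = "%(h::real, x, y). b x y * (a h * p (x - h) * q y * r (- x - y))"
 have [measurable]: "(%z. b (fst (snd z)) (snd (snd z))) : borel_measurable M3"
  using measurable_compose[OF measurable_snd[of lborel M2] b] by (simp add: case_prod_unfold)
 have K: "?K : borel_measurable M3" by measurable
 have T: "mp M3 (%(h, z). (h, (h, 0) + z))" by (rule mp_fiber[OF _ mp_translate]) (auto simp: lborel_prod split_beta intro!: borel_measurable_continuous_onI continuous_intros)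
 have e: "F4 (%h x y. b (x + h) y) a p q r = (%z. ?K (case z of (h, z) => (h, (h, 0) + z)))"
  by (auto simp: fun_eq_iff algebra_simps)
 have iK: "integrable M3 ?K" using i mp_int(2)[OF T K] unfolding e by simp
 have "L3 b (conv p a) q r = (LINT z|M2. LINT h|lborel. ?K (h, z))"
  unfolding L3_def conv_def
  by (intro bi_cong refl) (simp add: case_prod_unfold mult_ac flip: integral_mult_right_zero)
 also have "... = (LINT z|M3. ?K z)" using P3.Fubini_integral[of "%h z. ?K (h, z)"] P3.integral_fst[of "%h z. ?K (h, z)"] iK by (simp add: case_prod_unfold)
 also have "... = L4 (%h x y. b (x + h) y) a p q r" unfolding L4_def e by (rule mp_int(1)[OF T K, symmetric])
 finally show ?thesis .
qed

text \<open>The symbols for which the trilinear form is bounded on \<open>X s\<close>. The third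
  weight has one order less because that factor is measured in L1, which costs one order through
  \<open>X_wt_L1\<close>, while the other two are measured in L2.\<close>

definition sym3 :: "real => (real => cfun) => real => bool" where
 "sym3 s b c \<longleftrightarrow> (%(x, y). b x y) : borel_measurable M2 \<and> 0 <= c \<and> 
  (\<forall>x y. cmod (b x y) <= c * (wt s x * wt s y * wt (s - 1) (- x - y)))"

lemma sym3_meas: "sym3 s b c ==> (%(x, y). b x y) : borel_measurable M2" by (simp add: sym3_def)

lemma L3_bound:
 assumes b: "sym3 s b c" and X: "p : X s" "q : X s" "r : X s"
 shows "integrable M2 (F3 b p q r)" "cmod (L3 b p q r) <= c * (nrm s p * nrm s q * (c1 * nrm s r))"
proof -
 have c: "0 <= c" and le: "!!x y. cmod (b x y) <= c * (wt s x * wt s y * wt (s - 1) (- x - y))" using b by (auto simp: sym3_def)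
 let ?w = "%s p x. cr (wt s x) * p x"
 let ?P = "P3 (?w s p) (?w s q) (?w (s - 1) r)"
 have r: "integrable lborel (?w (s - 1) r)" "l1 (?w (s - 1) r) <= c1 * nrm s r" using X_wt_L1[of r "s - 1"] X(3) by auto
 have "l1 (?w (s - 1) r) * (nrm s p * nrm s q) <= nrm s p * nrm s q * (c1 * nrm s r)"
  using mult_right_mono[OF r(2), of "nrm s p * nrm s q"] by (simp add: mult_ac)
 then have ib: "\<forall>g\<in>set [?P]. ib M2 g (nrm s p * nrm s q * (c1 * nrm s r))"
  using ib3(3)[OF r(1) X_L2[OF X(1)] X_L2[OF X(2)]] by (auto simp: ib_def nrm_def)
 have F: "cmod (F3 b p q r z) <= c * (\<Sum>g\<leftarrow>[?P]. cmod (g z))" for z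
  using mult_right_mono[OF le[of "fst z" "snd z"], of "cmod (P3 p q r z)"] by (simp add: case_prod_unfold norm_mult mult_ac)
 note d = ib_dom[OF F3_meas[OF sym3_meas[OF b] X(1,2,3)[THEN X_meas]] F c ib]
 show "integrable M2 (F3 b p q r)" by (rule d)
 show "cmod (L3 b p q r) <= c * (nrm s p * nrm s q * (c1 * nrm s r))" unfolding L3_def using d(2) by simp
qed

lemma L3_add1: assumes "sym3 s b c" "p : X s" "p' : X s" "q : X s" "r : X s"
 shows "L3 b (%x. p x + p' x) q r = L3 b p q r + L3 b p' q r"
 unfolding L3_def using L3_bound(1)[OF assms(1,2,4,5)] L3_bound(1)[OF assms(1,3,4,5)]
 by (subst Bochner_Integration.integral_add[symmetric]) (auto simp: algebra_simps case_prod_unfold intro!: bi_cong)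

lemma L3_add2: assumes "sym3 s b c" "p : X s" "q : X s" "q' : X s" "r : X s"
 shows "L3 b p (%x. q x + q' x) r = L3 b p q r + L3 b p q' r"
 unfolding L3_def using L3_bound(1)[OF assms(1,2,3,5)] L3_bound(1)[OF assms(1,2,4,5)]
 by (subst Bochner_Integration.integral_add[symmetric]) (auto simp: algebra_simps case_prod_unfold intro!: bi_cong)

lemma L3_add3: assumes "sym3 s b c" "p : X s" "q : X s" "r : X s" "r' : X s"
 shows "L3 b p q (%x. r x + r' x) = L3 b p q r + L3 b p q r'"
 unfolding L3_def using L3_bound(1)[OF assms(1,2,3,4)] L3_bound(1)[OF assms(1,2,3,5)]
 by (subst Bochner_Integration.integral_add[symmetric]) (auto simp: algebra_simps case_prod_unfold intro!: bi_cong)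

lemma L3_cmult: "L3 b (%x. k * p x) q r = k * L3 b p q r" "L3 b p (%x. k * q x) r = k * L3 b p q r" "L3 b p q (%x. k * r x) = k * L3 b p q r"
 unfolding L3_def integral_mult_right_zero[symmetric] by (auto simp: case_prod_unfold mult_ac intro!: bi_cong)

lemma L3_diff:
 assumes "sym3 s b c" "p : X s" "p' : X s" "q : X s" "q' : X s" "r : X s" "r' : X s"
 shows "L3 b p q r - L3 b p' q' r' = L3 b (%x. p x - p' x) q r + L3 b p' (%x. q x - q' x) r + L3 b p' q' (%x. r x - r' x)"
 using L3_add1[OF assms(1) X_diff[OF assms(2,3)] assms(3,4,6)] L3_add2[OF assms(1,3) X_diff[OF assms(4,5)] assms(5,6)]
  L3_add3[OF assms(1,3,5) X_diff[OF assms(6,7)] assms(7)] by simp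

section \<open>Curves in the weighted spaces\<close>

definition Xcont :: "real set => real => (real => cfun) => bool" where
 "Xcont I s f \<longleftrightarrow> (\<forall>t\<in>I. f t : X s) \<and> (\<forall>t\<in>I. ((%r. nd s (f r) (f t)) ---> 0) (at t within I))"

definition Xderiv :: "real set => real => (real => cfun) => (real => cfun) => bool" where
 "Xderiv I s f v \<longleftrightarrow> (\<forall>t\<in>I. f t : X s \<and> v t : X s) \<and>
  (\<forall>t\<in>I. ((%r. nrm s (dq f v t r)) ---> 0) (at t within I))"

lemma X_divide: "f : X s ==> (%x. f x / k) : X s"
 using X_cmult[of f s "inverse k"] by (simp add: field_simps)

lemma nrm_divide: "nrm s (%x. f x / k) = nrm s f / cmod k"
 using nrm_cmult[of s "inverse k" f] by (simp add: divide_inverse norm_inverse mult.commute)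

lemma squeeze0: 
 fixes f g :: "'b => real"
 assumes "(g ---> 0) F" "eventually (%x. f x <= g x) F" "!!x. 0 <= f x" shows "(f ---> 0) F"
 by (rule tendsto_sandwich[OF _ assms(2) tendsto_const assms(1)]) (simp add: assms(3))

lemma eventually_within_in: "eventually (%r. r : I \<and> r \<noteq> t) (at t within I)"
 by (auto simp: eventually_at_filter)

lemma XcontD: "Xcont I s f ==> t : I ==> f t : X s" by (simp add: Xcont_def)
lemma XderivD: "Xderiv I s f v ==> t : I ==> f t : X s" "Xderiv I s f v ==> t : I ==> v t : X s"
 by (auto simp: Xderiv_def)

lemma Xcont_mono: assumes "Xcont I s f" "r <= s" shows "Xcont I r f"
 unfolding Xcont_def
proof (intro conjI ballI)
 fix t assume t: "t : I"
 show "f t : X r" using X_mono(1)[OF XcontD[OF assms(1) t] assms(2)] .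
 show "((%q. nd r (f q) (f t)) ---> 0) (at t within I)"
 proof (rule squeeze0[where g="%q. nd s (f q) (f t)"])
  show "((%q. nd s (f q) (f t)) ---> 0) (at t within I)" using assms t by (simp add: Xcont_def)
  show "eventually (%q. nd r (f q) (f t) <= nd s (f q) (f t)) (at t within I)"
   using eventually_within_in[of I t]
   by eventually_elim (auto intro!: X_mono(2) X_diff XcontD[OF assms(1)] t assms)
 qed simp
qed

lemma Xcont_nrm: assumes "Xcont I s f" shows "continuous_on I (%t. nrm s (f t))"
 unfolding continuous_on_def
proof
 fix t assume t: "t : I"
 have "((%r. nrm s (f r) - nrm s (f t)) ---> 0) (at t within I)"
 proof (rule Lim_null_comparison)
  show "((%r. nd s (f r) (f t)) ---> 0) (at t within I)" using assms t by (simp add: Xcont_def)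
  show "eventually (%r. norm (nrm s (f r) - nrm s (f t)) <= nd s (f r) (f t)) (at t within I)"
   using eventually_within_in[of I t]
   by eventually_elim (auto intro!: nrm_rev_triangle XcontD[OF assms(1)] t)
 qed
 then show "((%r. nrm s (f r)) ---> nrm s (f t)) (at t within I)" by (simp add: LIM_zero_iff)
qed

lemma Xcont_tendsto_nrm: "Xcont I s f ==> t : I ==> ((%r. nrm s (f r)) ---> nrm s (f t)) (at t within I)"
 using Xcont_nrm[of I s f] by (simp add: continuous_on_def)

lemma Xderiv_subset: "Xderiv I s f v ==> J \<subseteq> I ==> Xderiv J s f v"
 unfolding Xderiv_def by (auto intro: tendsto_within_subset)

lemma Xderiv_Xcont: assumes d: "Xderiv I s f v" shows "Xcont I s f"
 unfolding Xcont_def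
proof (intro conjI ballI)
 fix t assume t: "t : I"
 show ft: "f t : X s" using XderivD[OF d t] by simp
 have vt: "v t : X s" using XderivD[OF d t] by simp
 let ?Q = "%r x. (f r x - f t x) / cr (r - t)"
 have "((%r. \<bar>r - t\<bar> * (nd s (?Q r) (v t) + nrm s (v t))) ---> \<bar>t - t\<bar> * (0 + nrm s (v t))) (at t within I)"
  using d t by (intro tendsto_intros) (auto simp: Xderiv_def)
 then have l: "((%r. \<bar>r - t\<bar> * (nd s (?Q r) (v t) + nrm s (v t))) ---> 0) (at t within I)" by simp
 show "((%r. nd s (f r) (f t)) ---> 0) (at t within I)"
 proof (rule squeeze0[OF l])
  show "eventually (%r. nd s (f r) (f t) <= \<bar>r - t\<bar> * (nd s (?Q r) (v t) + nrm s (v t))) (at t within I)"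
   using eventually_within_in[of I t]
  proof eventually_elim
   case (elim r)
   then have fr: "f r : X s" using XderivD(1)[OF d] by simp
   have Q: "?Q r : X s" by (intro X_divide X_diff fr ft)
   have "nd s (f r) (f t) = \<bar>r - t\<bar> * nrm s (?Q r)"
    using elim nrm_divide[of s "%x. f r x - f t x" "cr (r - t)"]
    by (simp add: norm_of_real[of "r - t", simplified of_real_diff])
   also have "nrm s (?Q r) <= nd s (?Q r) (v t) + nrm s (v t)"
    using nrm_triangle[OF X_diff[OF Q vt] vt] by simp
   finally show ?case by (simp add: mult_left_mono)
  qed
 qed simp
qed

lemma Xderiv_mono: assumes d: "Xderiv I s f v" and "r <= s" shows "Xderiv I r f v"
 unfolding Xderiv_def
proof (intro conjI ballI)
 fix t assume t: "t : I"
 show "f t : X r" "v t : X r" using X_mono(1) XderivD[OF d t] assms(2) by blast+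
 show "((%q. nrm r (dq f v t q)) ---> 0) (at t within I)"
 proof (rule squeeze0)
  show "((%q. nrm s (dq f v t q)) ---> 0) (at t within I)"
   using d t by (simp add: Xderiv_def)
  show "eventually (%q. nrm r (dq f v t q)
   <= nrm s (dq f v t q)) (at t within I)"
   using eventually_within_in[of I t]
   by eventually_elim (intro X_mono(2) X_diff X_divide XderivD[OF d] t assms; simp)
 qed simp
qed

lemma Xderiv_lin:
 assumes d: "Xderiv I s f v" and e: "Xderiv I s g w"
 shows "Xderiv I s (%t x. a * f t x + b * g t x) (%t x. a * v t x + b * w t x)"
 unfolding Xderiv_def
proof (intro conjI ballI)
 fix t assume t: "t : I"
 note m = XderivD[OF d] XderivD[OF e]
 show "(%x. a * f t x + b * g t x) : X s" "(%x. a * v t x + b * w t x) : X s"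
  by (intro X_add X_cmult m t)+
 have "((%r. cmod a * nrm s (dq f v t r)
  + cmod b * nrm s (dq g w t r)) ---> cmod a * 0 + cmod b * 0) (at t within I)"
  using d e t by (intro tendsto_intros) (auto simp: Xderiv_def)
 then have l: "((%r. cmod a * nrm s (dq f v t r)
  + cmod b * nrm s (dq g w t r)) ---> 0) (at t within I)" by simp
 show "((%r. nrm s (%x. (a * f r x + b * g r x - (a * f t x + b * g t x)) / cr (r - t) - (a * v t x + b * w t x))) ---> 0) (at t within I)"
 proof (rule squeeze0[OF l])
  show "eventually (%r. nrm s (%x. (a * f r x + b * g r x - (a * f t x + b * g t x)) / cr (r - t) - (a * v t x + b * w t x))
   <= cmod a * nrm s (dq f v t r)
  + cmod b * nrm s (dq g w t r)) (at t within I)"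
   using eventually_within_in[of I t]
  proof eventually_elim
   case (elim r)
   let ?A = "%x. (f r x - f t x) / cr (r - t) - v t x"
   let ?B = "%x. (g r x - g t x) / cr (r - t) - w t x"
   have "(%x. (a * f r x + b * g r x - (a * f t x + b * g t x)) / cr (r - t) - (a * v t x + b * w t x))
    = (%x. a * ?A x + b * ?B x)"
    by (simp add: fun_eq_iff algebra_simps add_divide_distrib diff_divide_distrib)
   moreover have "?A : X s" "?B : X s" using elim t by (auto intro!: X_diff X_divide m)
   ultimately show ?case using nrm_triangle[of "%x. a * ?A x" s "%x. b * ?B x"]
    by (simp add: X_cmult nrm_cmult)
  qed
 qed simp
qed

lemma L3_tendsto:
 assumes b: "sym3 s b c" and lim: "p : X s" "q : X s" "r : X s"
  and ev: "eventually (%u. P u : X s \<and> Q u : X s \<and> R u : X s) F"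
  and P: "((%u. nd s (P u) p) ---> 0) F" and Q: "((%u. nd s (Q u) q) ---> 0) F"
  and R: "((%u. nd s (R u) r) ---> 0) F"
 shows "((%u. L3 b (P u) (Q u) (R u)) ---> L3 b p q r) F"
proof -
 have n: "((%u. nrm s (Z u)) ---> nrm s z) F" if "((%u. nd s (Z u) z) ---> 0) F" "z : X s" "eventually (%u. Z u : X s) F" for Z z
 proof -
  have "((%u. nrm s (Z u) - nrm s z) ---> 0) F"
   by (rule Lim_null_comparison[OF _ that(1)]) (use that(3) in eventually_elim, auto intro!: nrm_rev_triangle that(2))
  then show ?thesis by (simp add: LIM_zero_iff)
 qed
 have nQ: "((%u. nrm s (Q u)) ---> nrm s q) F" by (rule n[OF Q lim(2)]) (use ev in eventually_elim, simp)
 have nR: "((%u. nrm s (R u)) ---> nrm s r) F" by (rule n[OF R lim(3)]) (use ev in eventually_elim, simp)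
 let ?d = "%Z z. nd s Z z"
 let ?B = "%u. c * (?d (P u) p * nrm s (Q u) * (c1 * nrm s (R u))) + c * (nrm s p * ?d (Q u) q * (c1 * nrm s (R u))) + c * (nrm s p * nrm s q * (c1 * ?d (R u) r))"
 have "(?B ---> c * (0 * nrm s q * (c1 * nrm s r)) + c * (nrm s p * 0 * (c1 * nrm s r)) + c * (nrm s p * nrm s q * (c1 * 0))) F"
  by (intro tendsto_intros P Q R nQ nR)
 then have B: "(?B ---> 0) F" by simp
 have "((%u. L3 b (P u) (Q u) (R u) - L3 b p q r) ---> 0) F"
 proof (rule Lim_null_comparison[OF _ B])
  show "eventually (%u. norm (L3 b (P u) (Q u) (R u) - L3 b p q r) <= ?B u) F"
   using ev
  proof eventually_elim
   case (elim u)
   then have e: "P u : X s" "Q u : X s" "R u : X s" by auto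
   show ?case unfolding L3_diff[OF b e(1) lim(1) e(2) lim(2) e(3) lim(3)]
    by (intro order_trans[OF norm_triangle_ineq] add_mono L3_bound(2)[OF b] X_diff e lim)
  qed
 qed
 then show ?thesis by (simp add: LIM_zero_iff)
qed

lemma L3_deriv:
 assumes b: "sym3 s b c" and f: "Xderiv I s f f'" and g: "Xderiv I s g g'" and k: "Xderiv I s k k'" and t: "t : I"
 shows "((%t. Re (L3 b (f t) (g t) (k t))) has_field_derivative
  Re (L3 b (f' t) (g t) (k t) + L3 b (f t) (g' t) (k t) + L3 b (f t) (g t) (k' t))) (at t within I)"
 unfolding has_field_derivative_iff
proof -
 note m = XderivD[OF f] XderivD[OF g] XderivD[OF k]
 let ?Q = "%f r x. (f r x - f t x) / cr (r - t)"
 have lim: "((%r. Re (L3 b (?Q f r) (g r) (k r) + L3 b (f t) (?Q g r) (k r) + L3 b (f t) (g t) (?Q k r))) --->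
  Re (L3 b (f' t) (g t) (k t) + L3 b (f t) (g' t) (k t) + L3 b (f t) (g t) (k' t))) (at t within I)"
 proof (intro tendsto_intros L3_tendsto[OF b])
  have ev: "eventually (%r. f r : X s \<and> g r : X s \<and> k r : X s \<and> ?Q f r : X s \<and> ?Q g r : X s \<and> ?Q k r : X s) (at t within I)"
   using eventually_within_in[of I t] by eventually_elim (auto intro!: X_divide X_diff m t)
  show "eventually (%r. ?Q f r : X s \<and> g r : X s \<and> k r : X s) (at t within I)"
   "eventually (%r. f t : X s \<and> ?Q g r : X s \<and> k r : X s) (at t within I)"
   "eventually (%r. f t : X s \<and> g t : X s \<and> ?Q k r : X s) (at t within I)"
   using ev by (eventually_elim, use m t in auto)+
 qed (use f g k t m Xderiv_Xcont[OF f] Xderiv_Xcont[OF g] Xderiv_Xcont[OF k] in "auto simp: Xderiv_def Xcont_def")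
 show "((%y. (Re (L3 b (f y) (g y) (k y)) - Re (L3 b (f t) (g t) (k t))) / (y - t)) --->
  Re (L3 b (f' t) (g t) (k t) + L3 b (f t) (g' t) (k t) + L3 b (f t) (g t) (k' t))) (at t within I)"
 proof (rule Lim_transform_eventually[OF lim])
  show "eventually (%r. Re (L3 b (?Q f r) (g r) (k r) + L3 b (f t) (?Q g r) (k r) + L3 b (f t) (g t) (?Q k r))
   = (Re (L3 b (f r) (g r) (k r)) - Re (L3 b (f t) (g t) (k t))) / (r - t)) (at t within I)"
   using eventually_within_in[of I t]
  proof eventually_elim
   case (elim r)
   let ?i = "inverse (cr (r - t))"
   have q: "?Q f r = (%x. ?i * (f r x - f t x))" for f by (auto simp: field_simps)
   have "L3 b (?Q f r) (g r) (k r) + L3 b (f t) (?Q g r) (k r) + L3 b (f t) (g t) (?Q k r)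
    = ?i * (L3 b (f r) (g r) (k r) - L3 b (f t) (g t) (k t))"
    unfolding q L3_cmult using L3_diff[OF b, of "f r" "f t" "g r" "g t" "k r" "k t"] m elim t
    by (simp add: algebra_simps)
   also have "... = cr (1 / (r - t)) * (L3 b (f r) (g r) (k r) - L3 b (f t) (g t) (k t))"
    by (simp add: inverse_eq_divide)
   finally show ?case by simp
  qed
 qed
qed

section \<open>Weighted inner products along curves\<close>

definition mult_le :: "real => (real => real) => bool" where
 "mult_le s k \<longleftrightarrow> k : borel_measurable borel \<and> (\<forall>x. \<bar>k x\<bar> <= wt s x)"

lemma mult_le_L2:
 assumes "mult_le s k" "f : X s"
 shows "(%w. cr (k w) * f w) : L2" "n2 (%w. cr (k w) * f w) <= nrm s f"
proof -
 have [measurable]: "meas f" "k : borel_measurable borel" using assms X_meas by (auto simp: mult_le_def)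
 have "ae x. cmod (cr (k x) * f x) <= cmod (cr (wt s x) * f x)"
  using assms(1) by (auto simp: norm_mult mult_le_def intro!: mult_right_mono)
 from L2_mono[OF X_L2[OF assms(2)] _ this] 
 show "(%w. cr (k w) * f w) : L2" "n2 (%w. cr (k w) * f w) <= nrm s f"
  by (auto simp: nrm_def)
qed

definition kip :: "(real => real) => cfun => cfun => real" where
 "kip k f g = Re (ip (%x. cr (k x) * f x) (%x. cr (k x) * g x))"

lemma kip_bound: assumes "mult_le s k" "f : X s" "g : X s" shows "\<bar>kip k f g\<bar> <= nrm s f * nrm s g"
proof -
 have "\<bar>kip k f g\<bar> <= n2 (%x. cr (k x) * f x) * n2 (%x. cr (k x) * g x)"
  unfolding kip_def using abs_Re_le_cmod ip_CS[OF mult_le_L2(1)[OF assms(1,2)] mult_le_L2(1)[OF assms(1,3)]] by (rule order_trans)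
 also have "... <= nrm s f * nrm s g" by (intro mult_mono mult_le_L2 assms) auto
 finally show ?thesis .
qed

lemma kip_self: "kip k f f = (n2 (%x. cr (k x) * f x))^2"
 by (simp add: kip_def ip_self)

lemma kip_diff_left: assumes "mult_le s k" "f : X s" "f' : X s" "g : X s" shows "kip k (%x. f x - f' x) g = kip k f g - kip k f' g"
 unfolding kip_def using ip_diff_left[OF mult_le_L2(1)[OF assms(1,2)] mult_le_L2(1)[OF assms(1,3)] mult_le_L2(1)[OF assms(1,4)]]
 by (simp add: right_diff_distrib)

lemma kip_commute: "kip k f g = kip k g f"
 unfolding kip_def by (metis ip_cnj cnj.simps(1))

lemma kip_scale_left: "kip k (%x. cr a * f x) g = a * kip k f g"
 unfolding kip_def using ip_cmult_left[of "cr a" "%x. cr (k x) * f x" "%x. cr (k x) * g x"]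
 by (simp add: mult.left_commute)

lemma kip_deriv:
 assumes k: "mult_le s k" and f: "Xderiv I s f f'" and g: "Xderiv I s g g'" and t: "t : I"
 shows "((%t. kip k (f t) (g t)) has_field_derivative (kip k (f' t) (g t) + kip k (f t) (g' t))) (at t within I)"
 unfolding has_field_derivative_iff
proof -
 note m = XderivD[OF f] XderivD[OF g]
 let ?Q = "%f r w. (f r w - f t w) / cr (r - t)"
 have "((%r. nd s (?Q f r) (f' t) * nrm s (g r) + nrm s (f' t) * nd s (g r) (g t) + nrm s (f t) * nd s (?Q g r) (g' t))
  ---> 0 * nrm s (g t) + nrm s (f' t) * 0 + nrm s (f t) * 0) (at t within I)"
  using f g t Xcont_tendsto_nrm[OF Xderiv_Xcont[OF g] t] Xderiv_Xcont[OF g]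
  by (intro tendsto_intros) (auto simp: Xderiv_def Xcont_def)
 then have l: "((%r. nd s (?Q f r) (f' t) * nrm s (g r) + nrm s (f' t) * nd s (g r) (g t) + nrm s (f t) * nd s (?Q g r) (g' t))
  ---> 0) (at t within I)" by simp
 have "((%y. (kip k (f y) (g y) - kip k (f t) (g t)) / (y - t) - (kip k (f' t) (g t) + kip k (f t) (g' t))) ---> 0) (at t within I)"
 proof (rule Lim_null_comparison[OF _ l])
  show "eventually (%r. norm ((kip k (f r) (g r) - kip k (f t) (g t)) / (r - t) - (kip k (f' t) (g t) + kip k (f t) (g' t)))
   <= nd s (?Q f r) (f' t) * nrm s (g r) + nrm s (f' t) * nd s (g r) (g t) + nrm s (f t) * nd s (?Q g r) (g' t)) (at t within I)"
   using eventually_within_in[of I t]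
  proof eventually_elim
   case (elim r)
   have x: "f t : X s" "f' t : X s" "g t : X s" "g' t : X s" "f r : X s" "g r : X s" using m t elim by auto
   have Q: "?Q f r : X s" "?Q g r : X s" by (intro X_divide X_diff x)+
   have q: "?Q f r = (%w. cr (1 / (r - t)) * (f r w - f t w))" for f by auto
   have "(kip k (f r) (g r) - kip k (f t) (g t)) / (r - t) = kip k (?Q f r) (g r) + kip k (?Q g r) (f t)"
    unfolding q kip_scale_left using x
    by (simp add: kip_diff_left[OF k] kip_commute[of k "g r" "f t"] kip_commute[of k "g t" "f t"] diff_divide_distrib)
   then have "(kip k (f r) (g r) - kip k (f t) (g t)) / (r - t) - (kip k (f' t) (g t) + kip k (f t) (g' t))
    = kip k (%w. ?Q f r w - f' t w) (g r) + kip k (%w. g r w - g t w) (f' t) + kip k (%w. ?Q g r w - g' t w) (f t)"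
    using kip_diff_left[OF k Q(1) x(2,6)] kip_diff_left[OF k x(6,3,2)] kip_diff_left[OF k Q(2) x(4,1)]
     kip_commute[of k "g r" "f' t"] kip_commute[of k "g t" "f' t"] kip_commute[of k "g' t" "f t"] by simp
   moreover have "\<bar>kip k (%w. ?Q f r w - f' t w) (g r)\<bar> <= nd s (?Q f r) (f' t) * nrm s (g r)"
    by (intro kip_bound[OF k] X_diff Q x)
   moreover have "\<bar>kip k (%w. g r w - g t w) (f' t)\<bar> <= nrm s (f' t) * nd s (g r) (g t)"
    by (subst mult.commute) (intro kip_bound[OF k] X_diff Q x)
   moreover have "\<bar>kip k (%w. ?Q g r w - g' t w) (f t)\<bar> <= nrm s (f t) * nd s (?Q g r) (g' t)"
    by (subst mult.commute) (intro kip_bound[OF k] X_diff Q x)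
   ultimately show ?case unfolding real_norm_def by linarith
  qed
 qed
 then show "((%y. (kip k (f y) (g y) - kip k (f t) (g t)) / (y - t)) ---> kip k (f' t) (g t) + kip k (f t) (g' t)) (at t within I)"
  by (simp add: LIM_zero_iff)
qed

lemma Xderiv_const: "f : X s ==> Xderiv I s (%t. f) (%t x. 0)"
 by (simp add: Xderiv_def)

lemma Xderiv_scale:
 assumes c: "c : X s" and p: "!!t. t : I ==> (p has_field_derivative p' t) (at t within I)"
 shows "Xderiv I s (%t x. cr (p t) * c x) (%t x. cr (p' t) * c x)"
 unfolding Xderiv_def
proof (intro conjI ballI)
 fix t assume t: "t : I"
 show "(%x. cr (p t) * c x) : X s" "(%x. cr (p' t) * c x) : X s" by (intro X_cmult c)+
 have "((%r. \<bar>(p r - p t) / (r - t) - p' t\<bar> * nrm s c) ---> 0) (at t within I)"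
  using p[OF t] unfolding has_field_derivative_iff
  by (intro tendsto_mult_left_zero tendsto_rabs_zero) (simp add: LIM_zero_iff)
 moreover have "nrm s (%x. (cr (p r) * c x - cr (p t) * c x) / cr (r - t) - cr (p' t) * c x)
  = \<bar>(p r - p t) / (r - t) - p' t\<bar> * nrm s c" for r
 proof -
  have "(cr (p r) * c x - cr (p t) * c x) / cr (r - t) - cr (p' t) * c x
   = cr ((p r - p t) / (r - t) - p' t) * c x" for x
   by (simp add: left_diff_distrib)
  then show ?thesis by (simp only: nrm_cmult norm_of_real)
 qed
 ultimately show "((%r. nrm s (%x. (cr (p r) * c x - cr (p t) * c x) / cr (r - t) - cr (p' t) * c x)) ---> 0) (at t within I)"
  by simp
qed

lemma Xderiv_linear: assumes c: "c : X s" shows "Xderiv I s (%t x. cr t * c x) (%t. c)"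
 using Xderiv_scale[OF c DERIV_ident, of I] by simp

lemma mult_le_wt: "mult_le s (wt s)" by (simp add: mult_le_def)

text \<open>A scalar mean value inequality is applied to the inner product of the curve with its own
  total deviation \<open>p\<close>; division by the norm of \<open>p\<close> gives the bound for the
  vector-valued curve.\<close>

lemma X_mvt:
 assumes I: "closed_segment t q \<subseteq> I" and f: "Xderiv I s f v" and c: "c : X s"
  and M: "!!r. r : closed_segment t q ==> nd s (v r) c <= M"
 shows "nrm s (%x. f q x - f t x - cr (q - t) * c x) <= M * \<bar>q - t\<bar>"
proof -
 let ?S = "closed_segment t q"
 have tS: "t : I" "q : I" using I by auto
 define p where "p = (%x. f q x - f t x - cr (q - t) * c x)"
 have pX: "p : X s" unfolding p_def by (intro X_diff X_cmult c XderivD(1)[OF f] tS)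
 let ?F = "%r x. 1 * f r x + (-1) * (cr r * c x)" and ?F' = "%r x. 1 * v r x + (-1) * c x"
 have D: "Xderiv ?S s ?F ?F'" by (intro Xderiv_lin Xderiv_subset[OF f I] Xderiv_linear c)
 have d: "((%r. kip (wt s) (?F r) p) has_field_derivative (kip (wt s) (?F' r) p)) (at r within ?S)" if "r : ?S" for r
 proof -
  have "kip (wt s) (?F r) (%x. 0) = 0" by (simp add: kip_def ip_def)
  then show ?thesis using kip_deriv[OF mult_le_wt D Xderiv_const[OF pX] that] by simp
 qed
 have "norm (kip (wt s) (?F q) p - kip (wt s) (?F t) p) <= (M * nrm s p) * norm (q - t)"
 proof (rule field_differentiable_bound[where S="?S"])
  show "((%r. kip (wt s) (?F r) p) has_field_derivative (kip (wt s) (?F' r) p)) (at r within ?S)" if "r : ?S" for r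
   using d[OF that] .
  fix r assume r: "r : ?S"
  then have "\<bar>kip (wt s) (?F' r) p\<bar> <= nrm s (?F' r) * nrm s p"
   by (intro kip_bound[OF mult_le_wt] pX XderivD(2)[OF D])
  also have "... <= M * nrm s p" using M[OF r] by (intro mult_right_mono) auto
  finally show "norm (kip (wt s) (?F' r) p) <= M * nrm s p" by simp
 qed auto
 moreover have "kip (wt s) (?F q) p - kip (wt s) (?F t) p = kip (wt s) (%x. ?F q x - ?F t x) p"
  by (rule kip_diff_left[OF mult_le_wt, symmetric]) (use pX XderivD(1)[OF D] in auto)
 moreover have "(%x. ?F q x - ?F t x) = p" by (auto simp: p_def algebra_simps)
 moreover have "kip (wt s) p p = (nrm s p)^2" by (simp add: kip_self nrm_def)
 ultimately have "nrm s p * nrm s p <= (M * \<bar>q - t\<bar>) * nrm s p" by (simp add: power2_eq_square mult_ac)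
 moreover have "0 <= M * \<bar>q - t\<bar>" using M[of t] order_trans[OF nrm_nonneg] by auto
 ultimately have "nrm s p <= M * \<bar>q - t\<bar>" by (cases "nrm s p = 0") (auto simp: less_le)
 then show ?thesis by (simp add: p_def)
qed

lemma Xcont_lim:
 fixes f :: "nat => real => cfun"
 assumes f: "!!n. Xcont I s (f n)" and F: "!!t. t : I ==> F t : X s"
  and lim: "!!e. e > 0 ==> \<exists>N. \<forall>n\<ge>N. \<forall>t\<in>I. nd s (f n t) (F t) < e"
 shows "Xcont I s F"
 unfolding Xcont_def
proof (intro conjI ballI tendstoI)
 fix t and e :: real assume t: "t : I" and e: "0 < e"
 obtain N where N: "!!t. t : I ==> nd s (f N t) (F t) < e / 3"
  using lim[of "e/3"] e by (metis divide_pos_pos order_refl zero_less_numeral)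
 have "((%r. nd s (f N r) (f N t)) ---> 0) (at t within I)" using f[of N] t by (simp add: Xcont_def)
 then have "eventually (%r. dist (nd s (f N r) (f N t)) 0 < e / 3) (at t within I)"
  using e by (intro tendstoD) auto
 then show "eventually (%r. dist (nd s (F r) (F t)) 0 < e) (at t within I)"
  using eventually_within_in[of I t]
 proof eventually_elim
  case (elim r)
  have x: "F t : X s" "F r : X s" "f N t : X s" "f N r : X s" using F XcontD[OF f] t elim by auto
  show ?case using nrm_triangle3[OF x(2,4,1)] nrm_triangle3[OF x(4,3,1)] N[of t] N[of r] t elim
   nrm_minus_commute[of s "F r" "f N r"] by simp
 qed
qed (rule F)

text \<open>\<open>X_mvt\<close> with the fixed slope \<open>V t\<close> bounds the deviation of the
  approximating curves on the segment from \<open>t\<close> to \<open>q\<close>, uniformly in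
  \<open>n\<close>; continuity of \<open>V\<close> makes that deviation small relative to the length
  of the segment, and only then does \<open>n\<close> tend to infinity.\<close>

lemma Xderiv_lim:
 fixes f v :: "nat => real => cfun"
 assumes I: "convex I" and f: "!!n. Xderiv I s (f n) (v n)" and F: "!!t. t : I ==> F t : X s"
  and V: "Xcont I s V"
  and limf: "!!t e. t : I ==> e > 0 ==> \<exists>N. \<forall>n\<ge>N. nd s (f n t) (F t) < e"
  and limv: "!!e. e > 0 ==> \<exists>N. \<forall>n\<ge>N. \<forall>t\<in>I. nd s (v n t) (V t) < e"
 shows "Xderiv I s F V"
 unfolding Xderiv_def
proof (intro conjI ballI tendstoI)
 fix t and e :: real assume t: "t : I" and e: "0 < e"
 have Vt: "V t : X s" by (rule XcontD[OF V t])
 have "((%q. nd s (V q) (V t)) ---> 0) (at t within I)" using V t by (simp add: Xcont_def)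
 then have "eventually (%q. dist (nd s (V q) (V t)) 0 < e / 4) (at t within I)"
  using e by (intro tendstoD) auto
 then obtain d where d: "d > 0" "!!q. q : I ==> q \<noteq> t ==> dist q t < d ==> nd s (V q) (V t) < e / 4"
  by (auto simp: eventually_at)
 have "dist (nrm s (dq F V t q)) 0 < e"
  if q: "q : I" "q \<noteq> t" "dist q t < d" for q
 proof -
  have seg: "closed_segment t q \<subseteq> I" using I t q(1) by (rule closed_segment_subset[rotated 2])
  define a where "a = \<bar>q - t\<bar>"
  have a: "a > 0" using q by (simp add: a_def)
  obtain N where N: "!!n r. n \<ge> N ==> r : I ==> nd s (v n r) (V r) < e / 4"
   using limv[of "e/4"] e by auto
  have "0 < e * a / 8" using e a by simp
  \<comment> \<open>The index is chosen after \<open>q\<close>, with an error proportional to the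
    distance \<open>a\<close>, so pointwise convergence of the curves themselves suffices.\<close>
  obtain N1 where N1: "!!n. n \<ge> N1 ==> nd s (f n t) (F t) < e * a / 8" using limf[OF t \<open>0 < e * a / 8\<close>] by auto
  obtain N2 where N2: "!!n. n \<ge> N2 ==> nd s (f n q) (F q) < e * a / 8" using limf[OF q(1) \<open>0 < e * a / 8\<close>] by auto
  define n where "n = max N (max N1 N2)"
  have n: "n \<ge> N" "n \<ge> N1" "n \<ge> N2" by (auto simp: n_def)
  have x: "F t : X s" "F q : X s" "f n t : X s" "f n q : X s" using F XderivD(1)[OF f] t q by auto
  have mv: "nrm s (%w. f n q w - f n t w - cr (q - t) * V t w) <= (e / 2) * a"
   unfolding a_def
  proof (rule X_mvt[OF seg f Vt])
   fix r assume r: "r : closed_segment t q"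
   then have rI: "r : I" using seg by auto
   have "nd s (V r) (V t) < e / 4"
   proof (cases "r = t")
    case False
    have "dist r t <= dist q t" using r by (auto simp: closed_segment_eq_real_ivl dist_real_def split: if_splits)
    then show ?thesis using d(2)[OF rI False] q(3) by simp
   qed (use e in simp)
   moreover have "nd s (v n r) (V t) <= nd s (v n r) (V r) + nd s (V r) (V t)"
    by (rule nrm_triangle3[OF XderivD(2)[OF f rI] XcontD[OF V rI] Vt])
   ultimately show "nd s (v n r) (V t) <= e / 2" using N[OF n(1) rI] by simp
  qed
  let ?A = "%w. f n q w - f n t w - cr (q - t) * V t w"
  let ?B = "%w. f n t w - F t w" and ?C = "%w. F q w - f n q w"
  have ABC: "?A : X s" "?B : X s" "?C : X s" by (intro X_diff X_cmult x Vt)+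
  have "nrm s (%w. F q w - F t w - cr (q - t) * V t w) = nrm s (%w. (?A w + ?B w) + ?C w)"
   by (simp add: algebra_simps)
  also have "... <= nrm s ?A + nrm s ?B + nrm s ?C"
   using nrm_triangle[OF X_add[OF ABC(1,2)] ABC(3)] nrm_triangle[OF ABC(1,2)] by simp
  also have "... < (e / 2) * a + e * a / 8 + e * a / 8"
   using mv N1[OF n(2)] N2[OF n(3)] nrm_minus_commute[of s "f n q" "F q"] by linarith
  also have "... < e * a" using e a by (simp add: field_simps)
  finally have le: "nrm s (%w. F q w - F t w - cr (q - t) * V t w) < e * a" .
  have "(dq F V t q)
   = (%w. (F q w - F t w - cr (q - t) * V t w) / cr (q - t))"
   using q(2) by (simp add: diff_divide_distrib)
  then have "nrm s (dq F V t q) = nrm s (%w. F q w - F t w - cr (q - t) * V t w) / cmod (cr (q - t))"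
   by (simp only: nrm_divide)
  also have "cmod (cr (q - t)) = a" unfolding a_def by (rule norm_of_real)
  also have "nrm s (%w. F q w - F t w - cr (q - t) * V t w) / a < e" using le a by (simp add: pos_divide_less_eq)
  finally show ?thesis by simp
 qed
 then show "eventually (%q. dist (nrm s (dq F V t q)) 0 < e) (at t within I)"
  using d(1) by (auto simp: eventually_at)
qed (auto intro: F XcontD[OF V])

lemma AE_reflect:
 fixes P :: "real => bool"
 assumes "ae x. P x" shows "ae x. P (- x)"
proof -
 obtain N where N: "N : null_sets lborel" "{x. \<not> P x} \<subseteq> N"
  using assms by (auto simp: eventually_ae_filter)
 then have [measurable]: "N : sets borel" by auto
 have "ae x. x \<notin> N" using N(1) by (rule AE_not_in)
 then have "ae x. 0 + (-1) * x \<notin> N" by (intro AE_borel_affine) auto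
 then show ?thesis by eventually_elim (use N(2) in auto)
qed

text \<open>The limit is formed once, in L2, and bounds of any other order are inherited by Fatou
  along the same subsequence, so a single limit function serves all \<open>s\<close>. Hermitian
  symmetry compares values at w and -w, hence the reflected null set.\<close>

lemma X_complete:
 fixes f :: "nat => cfun"
 assumes L: "!!n. f n : X 0"
  and C: "!!e. e > 0 ==> \<exists>N. \<forall>i\<ge>N. \<forall>j\<ge>N. nd 0 (f i) (f j) < e"
 obtains F where "F : X 0"
  "!!s c h N. (!!j. j \<ge> N ==> f j : X s) ==> h : X s ==> 0 <= c ==> (!!j. j \<ge> N ==> nd s (f j) h <= c) ==>
   F : X s \<and> nd s F h <= c"
  "(!!n. ae w. f n (- w) = cnj (f n w)) ==> ae w. F (- w) = cnj (F w)"
  "\<forall>x c. (\<forall>i. f i x = c) \<longrightarrow> F x = c"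
proof -
 obtain F r where F: "F : L2" "strict_mono (r :: nat => nat)" "ae x. (%i. f (r i) x) ----> F x" "\<forall>x c. (\<forall>i. f i x = c) \<longrightarrow> F x = c"
  by (rule L2_complete[OF L[unfolded X_0] C[unfolded nrm_0]])
 show ?thesis
 proof (rule that)
  show "F : X 0" using F by (simp add: X_0)
  fix s c h N
  assume fX: "!!j. j \<ge> N ==> f j : X s" and h: "h : X s" and c: "0 <= c" and le: "!!j. j \<ge> N ==> nd s (f j) h <= c"
  have rN: "r (i + N) \<ge> N" for i by (meson le_add2 le_trans F(2) seq_suble)
  have [measurable]: "meas F" "meas h" using F h L2_meas X_meas by auto
  let ?G = "%w. cr (wt s w) * (F w - h w)"
  let ?g = "%i w. cr (wt s w) * (f (r (i + N)) w - h w)"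
  have g: "?g i : L2" "n2 (?g i) <= c" for i
   using X_L2[OF X_diff[OF fX[OF rN] h]] le[OF rN] by (auto simp: nrm_def)
  have l: "ae x. (%i. ?g i x) ----> ?G x"
   using F(3) by eventually_elim (intro tendsto_intros LIMSEQ_ignore_initial_segment)
  have Gm: "meas ?G" by measurable
  have 1: "?G : L2" by (rule n2_Fatou(1)[OF g Gm l c])
  have 2: "n2 ?G <= c" by (rule n2_Fatou(2)[OF g Gm l c])
  have D: "(%w. F w - h w) : X s" using 1 by (simp add: X_def)
  show "F : X s \<and> nd s F h <= c"
   using X_add[OF D h] 2 by (simp add: nrm_def)
 next
  assume "!!n. ae w. f n (- w) = cnj (f n w)"
  then have a: "ae w. \<forall>n. f n (- w) = cnj (f n w)" by (simp add: AE_all_countable)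
  have [measurable]: "!!n. meas (f n)" "meas F" using L F L2_meas X_meas by auto
  have b: "ae w. (%i. f (r i) (- w)) ----> F (- w)"
   by (rule AE_reflect[OF F(3)])
  show "ae w. F (- w) = cnj (F w)"
   using a b F(3)
  proof eventually_elim
   case (elim w)
   then have "(%i. cnj (f (r i) w)) ----> F (- w)" by simp
   moreover have "(%i. cnj (f (r i) w)) ----> cnj (F w)" using elim by (intro tendsto_intros)
   ultimately show ?case by (rule LIMSEQ_unique)
  qed
 qed (rule F(4))
qed

section \<open>Symbols\<close>

definition sg3 :: "real => real => real => real" where "sg3 x y z = sgn x + sgn y + sgn z"

lemma sg3_le: "\<bar>sg3 x y z\<bar> <= 3"
 by (auto simp: sg3_def sgn_if)

lemma sgn_change: "sgn (x + h) \<noteq> sgn x ==> \<bar>x\<bar> <= \<bar>h\<bar> \<and> \<bar>x + h\<bar> <= \<bar>h::real\<bar>"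
 by (auto simp: sgn_if split: if_splits)

lemma mult_sg3_le: "\<bar>c * sg3 x y z\<bar> <= 3 * \<bar>c\<bar>"
 using mult_left_mono[OF sg3_le[of x y z], of "\<bar>c\<bar>"] by (simp add: abs_mult mult.commute)

text \<open>The transport structure: when \<open>h\<close> is the frequency of the undifferentiated factor, the three
  signs agree unless one of the other frequencies is itself of size at most \<open>h\<close>.\<close>

lemma sg3_cancel:
 assumes 0: "h + x + y + z = (0::real)"
 shows "\<bar>(h + x) * sg3 (x + h) y z + (h + y) * sg3 x (y + h) z + (h + z) * sg3 x y (z + h)\<bar> <= 12 * \<bar>h\<bar>"
proof -
 define A B C where "A = (h + x) * sg3 (x + h) y z" and "B = (h + y) * sg3 x (y + h) z" and "C = (h + z) * sg3 x y (z + h)"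
 have a: "\<bar>A\<bar> <= 3 * \<bar>h + x\<bar>" and b: "\<bar>B\<bar> <= 3 * \<bar>h + y\<bar>" and c: "\<bar>C\<bar> <= 3 * \<bar>h + z\<bar>"
  unfolding A_def B_def C_def by (rule mult_sg3_le)+
 let ?s = "sg3 x y z"
 have ex: "sgn (x + h) = sgn x ==> A = (h + x) * ?s" and ey: "sgn (y + h) = sgn y ==> B = (h + y) * ?s" and ez: "sgn (z + h) = sgn z ==> C = (h + z) * ?s"
  by (simp_all add: A_def B_def C_def sg3_def)
 have "\<bar>A + B + C\<bar> <= 12 * \<bar>h\<bar>"
 \<comment> \<open>Without a sign change the three weights add up to 2 h. With one change the other
   two weights combine to a frequency of size at most 2 |h| and the exceptional term is at most 3
   |h|. With two changes the two exceptional terms give 3 |h| each and the third weight is at most 2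
   |h|, contributing 6 |h|: this is the worst case and the origin of 12.\<close>
 proof (cases "sgn (x + h) = sgn x"; cases "sgn (y + h) = sgn y"; cases "sgn (z + h) = sgn z")
  assume *: "sgn (x + h) = sgn x" "sgn (y + h) = sgn y" "sgn (z + h) = sgn z"
  have "A + B + C = (3 * h + (x + y + z)) * ?s" using ex ey ez * by (simp add: algebra_simps)
  also have "3 * h + (x + y + z) = 2 * h" using 0 by simp
  finally show ?thesis using mult_sg3_le[of "2 * h" x y z] by simp
 next
  assume *: "sgn (x + h) = sgn x" "sgn (y + h) = sgn y" "sgn (z + h) \<noteq> sgn z"
  have "A + B = (2 * h + (x + y)) * ?s" using ex ey * by (simp add: algebra_simps)
  then have "\<bar>A + B\<bar> <= 3 * \<bar>2 * h + (x + y)\<bar>" by (simp only: mult_sg3_le)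
  then show ?thesis using c sgn_change[OF *(3), THEN conjunct1] sgn_change[OF *(3), THEN conjunct2] 0 by (smt (verit))
 next
  assume *: "sgn (x + h) = sgn x" "sgn (y + h) \<noteq> sgn y" "sgn (z + h) = sgn z"
  have "A + C = (2 * h + (x + z)) * ?s" using ex ez * by (simp add: algebra_simps)
  then have "\<bar>A + C\<bar> <= 3 * \<bar>2 * h + (x + z)\<bar>" by (simp only: mult_sg3_le)
  then show ?thesis using b sgn_change[OF *(2), THEN conjunct1] sgn_change[OF *(2), THEN conjunct2] 0 by (smt (verit))
 next
  assume *: "sgn (x + h) \<noteq> sgn x" "sgn (y + h) = sgn y" "sgn (z + h) = sgn z"
  have "B + C = (2 * h + (y + z)) * ?s" using ey ez * by (simp add: algebra_simps)
  then have "\<bar>B + C\<bar> <= 3 * \<bar>2 * h + (y + z)\<bar>" by (simp only: mult_sg3_le)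
  then show ?thesis using a sgn_change[OF *(1), THEN conjunct1] sgn_change[OF *(1), THEN conjunct2] 0 by (smt (verit))
 next
  assume *: "sgn (x + h) = sgn x" "sgn (y + h) \<noteq> sgn y" "sgn (z + h) \<noteq> sgn z"
  then show ?thesis using a b c sgn_change[OF *(2), THEN conjunct1] sgn_change[OF *(2), THEN conjunct2] sgn_change[OF *(3), THEN conjunct1] sgn_change[OF *(3), THEN conjunct2] 0 by (smt (verit))
 next
  assume *: "sgn (x + h) \<noteq> sgn x" "sgn (y + h) = sgn y" "sgn (z + h) \<noteq> sgn z"
  then show ?thesis using a b c sgn_change[OF *(1), THEN conjunct1] sgn_change[OF *(1), THEN conjunct2] sgn_change[OF *(3), THEN conjunct1] sgn_change[OF *(3), THEN conjunct2] 0 by (smt (verit))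
 next
  assume *: "sgn (x + h) \<noteq> sgn x" "sgn (y + h) \<noteq> sgn y" "sgn (z + h) = sgn z"
  then show ?thesis using a b c sgn_change[OF *(1), THEN conjunct1] sgn_change[OF *(1), THEN conjunct2] sgn_change[OF *(2), THEN conjunct1] sgn_change[OF *(2), THEN conjunct2] 0 by (smt (verit))
 next
  assume *: "sgn (x + h) \<noteq> sgn x" "sgn (y + h) \<noteq> sgn y" "sgn (z + h) \<noteq> sgn z"
  then show ?thesis using a b c sgn_change[OF *(1), THEN conjunct1] sgn_change[OF *(1), THEN conjunct2] sgn_change[OF *(2), THEN conjunct1] sgn_change[OF *(2), THEN conjunct2] sgn_change[OF *(3), THEN conjunct1] sgn_change[OF *(3), THEN conjunct2] 0 by (smt (verit))
 qed
 then show ?thesis by (simp add: A_def B_def C_def)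
qed

text \<open>Nonzero frequencies with sum 0 cannot all have the same sign, so two of the signs
  cancel. This is the absence of resonances.\<close>

lemma sg3_sq:
 assumes "x + y + z = 0" "x \<noteq> 0" "y \<noteq> 0" "z \<noteq> 0" shows "(sg3 x y z)^2 = 1"
proof -
 have "sg3 x y z = 1 \<or> sg3 x y z = -1" using assms by (auto simp: sg3_def sgn_if)
 then show ?thesis by auto
qed

text \<open>Newton's recursion for the quotient of \<open>x\<^sup>2\<^sup>K\<^sup>+\<^sup>1 + y\<^sup>2\<^sup>K\<^sup>+\<^sup>1 + z\<^sup>2\<^sup>K\<^sup>+\<^sup>1\<close> by \<open>x y z\<close> on \<open>x + y + z = 0\<close>.\<close>

fun SP :: "nat => real => real => real => real" where
 "SP 0 x y z = 0"
| "SP (Suc K) x y z = (x^2 + y^2 + z^2) / 2 * SP K x y z + (x ^ (2 * K) + y ^ (2 * K) + z ^ (2 * K))"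

lemma SP_newton:
 assumes 0: "x + y + z = 0"
 shows "x ^ (2 * K + 1) + y ^ (2 * K + 1) + z ^ (2 * K + 1) = x * y * z * SP K x y z"
proof (induction K)
 case 0
 then show ?case using assms by simp
next
 case (Suc K)
 define D where "D = (x^2 + y^2 + z^2) / 2"
 define e where "e = x * y * z"
 have z: "z = - x - y" using 0 by simp
 have c: "x ^ 3 = D * x + e" "y ^ 3 = D * y + e" "z ^ 3 = D * z + e"
  unfolding D_def e_def z by (simp_all add: power2_eq_square power3_eq_cube field_simps)
 have p: "w ^ (2 * Suc K + 1) = D * w ^ (2 * K + 1) + e * w ^ (2 * K)" if "w ^ 3 = D * w + e" for w
 proof -
  have "w ^ (2 * Suc K + 1) = w ^ (2 * K) * w ^ 3" by (simp add: power_add[symmetric] numeral_3_eq_3)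
  then show ?thesis unfolding that by (simp add: algebra_simps)
 qed
 have "x ^ (2 * Suc K + 1) + y ^ (2 * Suc K + 1) + z ^ (2 * Suc K + 1)
  = D * (x ^ (2 * K + 1) + y ^ (2 * K + 1) + z ^ (2 * K + 1)) + e * (x ^ (2 * K) + y ^ (2 * K) + z ^ (2 * K))"
  unfolding p[OF c(1)] p[OF c(2)] p[OF c(3)] by (simp add: algebra_simps)
 also have "... = e * (D * SP K x y z + (x ^ (2 * K) + y ^ (2 * K) + z ^ (2 * K)))"
  unfolding Suc e_def by (simp add: algebra_simps)
 finally show ?case by (simp add: D_def e_def)
qed

lemma SP_measurable [measurable (raw)]:
 assumes [measurable]: "f : borel_measurable M" "g : borel_measurable M" "h : borel_measurable M"
 shows "(%w. SP K (f w) (g w) (h w)) : borel_measurable M"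
 by (induction K) simp_all

lemma sg3_measurable [measurable (raw)]:
 assumes [measurable]: "f : borel_measurable M" "g : borel_measurable M" "h : borel_measurable M"
 shows "(%w. sg3 (f w) (g w) (h w)) : borel_measurable M"
 unfolding sg3_def by measurable

section \<open>Size and Lipschitz bounds of the power-sum quotient\<close>

fun BS :: "nat => real" where "BS 0 = 3" | "BS (Suc J) = 3 / 2 * BS J + 3"

lemma BS_nonneg [simp]: "0 <= BS J" by (induction J) auto

lemma power_abs_le: "\<bar>x\<bar> <= M ==> \<bar>x ^ n\<bar> <= (M::real) ^ n"
 by (simp add: power_abs power_mono)

lemma SP_bound:
 assumes "\<bar>x\<bar> <= M" "\<bar>y\<bar> <= M" "\<bar>z\<bar> <= M"
 shows "\<bar>SP (Suc J) x y z\<bar> <= BS J * M ^ (2 * J)"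
proof (induction J)
 case 0
 then show ?case by simp
next
 case (Suc J)
 let ?n = "2 * Suc J"
 have sq: "x^2 <= M^2" "y^2 <= M^2" "z^2 <= M^2" using assms by (simp_all add: abs_le_square_iff[symmetric])
 have D: "\<bar>(x^2 + y^2 + z^2) / 2\<bar> <= 3 / 2 * M^2" using sq by simp
 have "\<bar>SP (Suc (Suc J)) x y z\<bar> <= \<bar>(x^2 + y^2 + z^2) / 2\<bar> * \<bar>SP (Suc J) x y z\<bar> + (\<bar>x ^ ?n\<bar> + \<bar>y ^ ?n\<bar> + \<bar>z ^ ?n\<bar>)"
  unfolding SP.simps(2)[of "Suc J"] abs_mult[symmetric] by linarith
 also have "... <= (3 / 2 * M^2) * (BS J * M ^ (2 * J)) + (M ^ ?n + M ^ ?n + M ^ ?n)"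
  by (intro add_mono mult_mono D Suc power_abs_le assms) auto
 also have "... = BS (Suc J) * M ^ ?n" by (simp add: algebra_simps power2_eq_square)
 finally show ?case .
qed

text \<open>The factor \<open>M\<close> on the left keeps \<open>M ^ n\<close> on the right, where a
  quotient would involve the exponent n - 1.\<close>

lemma power_diff_le:
 assumes "\<bar>x\<bar> <= M" "\<bar>x'\<bar> <= M" "\<bar>x - x'\<bar> <= d"
 shows "\<bar>x ^ n - x' ^ n\<bar> * M <= real n * M ^ n * (d::real)"
proof (induction n)
 case (Suc n)
 have M: "0 <= M" "0 <= d" using assms by auto
 have "x ^ Suc n - x' ^ Suc n = x * (x ^ n - x' ^ n) + (x - x') * x' ^ n" by (simp add: algebra_simps)
 then have "\<bar>x ^ Suc n - x' ^ Suc n\<bar> <= \<bar>x\<bar> * \<bar>x ^ n - x' ^ n\<bar> + \<bar>x - x'\<bar> * \<bar>x' ^ n\<bar>"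
  by (metis abs_mult abs_triangle_ineq)
 also have "... <= M * \<bar>x ^ n - x' ^ n\<bar> + d * M ^ n" using assms M by (intro add_mono mult_mono power_abs_le) auto
 finally have "\<bar>x ^ Suc n - x' ^ Suc n\<bar> * M <= (M * \<bar>x ^ n - x' ^ n\<bar> + d * M ^ n) * M" using M by (simp add: mult_right_mono)
 also have "... = M * (\<bar>x ^ n - x' ^ n\<bar> * M) + d * M ^ Suc n" by (simp add: algebra_simps)
 also have "... <= M * (real n * M ^ n * d) + d * M ^ Suc n" using Suc M by (intro add_mono mult_left_mono) auto
 finally show ?case by (simp add: algebra_simps)
qed simp

fun BD :: "nat => real" where "BD 0 = 0" | "BD (Suc J) = 3 / 2 * BD J + 3 * BS J + 3 * real (2 * Suc J)"

lemma BD_nonneg [simp]: "0 <= BD J" by (induction J) auto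

lemma SP_lip:
 assumes b: "\<bar>x\<bar> <= M" "\<bar>y\<bar> <= M" "\<bar>z\<bar> <= M" "\<bar>x'\<bar> <= M" "\<bar>y'\<bar> <= M" "\<bar>z'\<bar> <= M"
  and d: "\<bar>x - x'\<bar> <= d" "\<bar>y - y'\<bar> <= d" "\<bar>z - z'\<bar> <= d"
 shows "\<bar>SP (Suc J) x y z - SP (Suc J) x' y' z'\<bar> * M <= BD J * M ^ (2 * J) * d"
proof (induction J)
 case 0
 then show ?case by simp
next
 case (Suc J)
 let ?n = "2 * Suc J"
 have M: "0 <= M" "0 <= d" using order_trans[OF abs_ge_zero b(1)] order_trans[OF abs_ge_zero d(1)] by auto
 define D D' S S' where "D = (x^2 + y^2 + z^2) / 2" "D' = (x'^2 + y'^2 + z'^2) / 2" "S = SP (Suc J) x y z" "S' = SP (Suc J) x' y' z'"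
 note defs = this
 have sq: "x^2 <= M^2" "y^2 <= M^2" "z^2 <= M^2" using b by (simp_all add: abs_le_square_iff[symmetric])
 have D: "\<bar>D\<bar> <= 3 / 2 * M^2" using sq by (simp add: defs)
 have DD: "\<bar>D - D'\<bar> * M <= 3 * M^2 * d"
 proof -
  have "\<bar>D - D'\<bar> <= (\<bar>x^2 - x'^2\<bar> + \<bar>y^2 - y'^2\<bar> + \<bar>z^2 - z'^2\<bar>) / 2" 
  proof -
   have *: "\<bar>(a + b + c) / 2\<bar> <= (\<bar>a\<bar> + \<bar>b\<bar> + \<bar>c\<bar>) / 2" for a b c :: real
    using abs_triangle_ineq[of "a + b" c] abs_triangle_ineq[of a b] by (simp add: abs_divide)
   have "D - D' = ((x^2 - x'^2) + (y^2 - y'^2) + (z^2 - z'^2)) / 2" unfolding defs by (simp add: field_simps)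
   then show ?thesis by (simp only: *)
  qed
  then have "\<bar>D - D'\<bar> * M <= (\<bar>x^2 - x'^2\<bar> + \<bar>y^2 - y'^2\<bar> + \<bar>z^2 - z'^2\<bar>) / 2 * M" using M(1) by (rule mult_right_mono)
  also have "... = (\<bar>x^2 - x'^2\<bar> * M + \<bar>y^2 - y'^2\<bar> * M + \<bar>z^2 - z'^2\<bar> * M) / 2" by (simp add: algebra_simps)
  also have "... <= 3 * M^2 * d"
   using power_diff_le[OF b(1,4) d(1), of 2] power_diff_le[OF b(2,5) d(2), of 2] power_diff_le[OF b(3,6) d(3), of 2] by simp
  finally show ?thesis .
 qed
 have S': "\<bar>S'\<bar> <= BS J * M ^ (2 * J)" unfolding defs by (rule SP_bound) (rule b)+
 have SS: "\<bar>S - S'\<bar> * M <= BD J * M ^ (2 * J) * d" unfolding defs by (rule Suc)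
 let ?P = "\<bar>x ^ ?n - x' ^ ?n\<bar>" and ?Q = "\<bar>y ^ ?n - y' ^ ?n\<bar>" and ?R = "\<bar>z ^ ?n - z' ^ ?n\<bar>"
 have "SP (Suc (Suc J)) x y z - SP (Suc (Suc J)) x' y' z' = D * (S - S') + (D - D') * S' + ((x ^ ?n - x' ^ ?n) + (y ^ ?n - y' ^ ?n) + (z ^ ?n - z' ^ ?n))"
  unfolding SP.simps(2)[of "Suc J"] defs by (simp only: left_diff_distrib right_diff_distrib)
 then have "\<bar>SP (Suc (Suc J)) x y z - SP (Suc (Suc J)) x' y' z'\<bar> <= \<bar>D\<bar> * \<bar>S - S'\<bar> + \<bar>D - D'\<bar> * \<bar>S'\<bar> + (?P + ?Q + ?R)"
  unfolding abs_mult[symmetric] by linarith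
 then have "\<bar>SP (Suc (Suc J)) x y z - SP (Suc (Suc J)) x' y' z'\<bar> * M <= (\<bar>D\<bar> * \<bar>S - S'\<bar> + \<bar>D - D'\<bar> * \<bar>S'\<bar> + (?P + ?Q + ?R)) * M"
  using M(1) by (rule mult_right_mono)
 also have "... = \<bar>D\<bar> * (\<bar>S - S'\<bar> * M) + (\<bar>D - D'\<bar> * M) * \<bar>S'\<bar> + (?P * M + ?Q * M + ?R * M)"
  by (simp add: algebra_simps)
 also have "... <= (3 / 2 * M^2) * (BD J * M ^ (2 * J) * d) + (3 * M^2 * d) * (BS J * M ^ (2 * J))
   + (real ?n * M ^ ?n * d + real ?n * M ^ ?n * d + real ?n * M ^ ?n * d)"
  by (intro add_mono mult_mono D SS DD S' power_diff_le b d mult_nonneg_nonneg M zero_le_power) auto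
 also have "... = BD (Suc J) * M ^ ?n * d" by (simp add: algebra_simps power2_eq_square)
 finally show ?case .
qed

text \<open>If two frequencies each control the largest one up to the factor \<open>L\<close>, the
  even power of the largest can be shared equally between them.\<close>

lemma top_pair:
 assumes "0 <= b" "0 <= c" "0 <= m" "m <= L * b" "m <= L * (c::real)" "1 <= L"
 shows "b * c * m ^ (2 * J) <= L ^ (2 * J) * (b ^ Suc J * c ^ Suc J)"
proof -
 have "m ^ (2 * J) = m ^ J * m ^ J" by (simp add: mult_2 power_add)
 also have "... <= (L * b) ^ J * (L * c) ^ J" using assms by (intro mult_mono power_mono) auto
 also have "... = L ^ (2 * J) * (b ^ J * c ^ J)" by (simp add: power_mult_distrib mult_2 power_add)
 finally have "b * c * m ^ (2 * J) <= b * c * (L ^ (2 * J) * (b ^ J * c ^ J))" using assms by (intro mult_left_mono) auto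
 then show ?thesis by (simp add: algebra_simps)
qed

definition TK :: "nat => real => real => real" where
 "TK K x y = x * y * (- x - y) * SP K x y (- x - y)"

definition up3 :: "nat => real => real => real => real" where
 "up3 K a b c = a * (b ^ K * c ^ K) + b * (a ^ K * c ^ K) + c * (a ^ K * b ^ K)"

text \<open>The smallest frequency keeps a single power. As the three sum to 0, each of the other
  two is at least half of the largest, so they can carry \<open>Suc J\<close> powers each: exactly
  what an energy of order \<open>Suc J\<close> offers.\<close>

lemma TK_bound: "\<bar>TK (Suc J) x y\<bar> <= BS J * 2 ^ (2 * J) * up3 (Suc J) \<bar>x\<bar> \<bar>y\<bar> \<bar>- x - y\<bar>"
proof -
 define a b c where "a = \<bar>x\<bar>" "b = \<bar>y\<bar>" "c = \<bar>- x - y\<bar>"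
 note d = this
 define m where "m = max a (max b c)"
 have nn: "0 <= a" "0 <= b" "0 <= c" "0 <= m" by (auto simp: d m_def)
 have tri: "a <= b + c" "b <= a + c" "c <= a + b" by (auto simp: d)
 have "\<bar>SP (Suc J) x y (- x - y)\<bar> <= BS J * m ^ (2 * J)"
  by (rule SP_bound) (auto simp: m_def d)
 then have "\<bar>TK (Suc J) x y\<bar> <= (a * b * c) * (BS J * m ^ (2 * J))"
  unfolding TK_def abs_mult d by (intro mult_left_mono) (auto simp: abs_mult)
 also have "... = BS J * (a * b * c * m ^ (2 * J))" by simp
 also have "a * b * c * m ^ (2 * J) <= 2 ^ (2 * J) * up3 (Suc J) a b c"
 proof -
  have up: "a * (b ^ Suc J * c ^ Suc J) <= up3 (Suc J) a b c" "b * (a ^ Suc J * c ^ Suc J) <= up3 (Suc J) a b c" "c * (a ^ Suc J * b ^ Suc J) <= up3 (Suc J) a b c"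
   unfolding up3_def using nn by (auto simp del: power_Suc)
  consider "a <= b" "a <= c" | "b <= a" "b <= c" | "c <= a" "c <= b" by linarith
  then show ?thesis
  proof cases
   case 1
   then have "m <= 2 * b" "m <= 2 * c" using tri nn by (auto simp: m_def)
   from top_pair[OF nn(2,3,4) this] have "a * (b * c * m ^ (2 * J)) <= a * (2 ^ (2 * J) * (b ^ Suc J * c ^ Suc J))" using nn by (intro mult_left_mono) auto
   also have "... = 2 ^ (2 * J) * (a * (b ^ Suc J * c ^ Suc J))" by (simp only: mult_ac)
   also have "... <= 2 ^ (2 * J) * up3 (Suc J) a b c" using up by (intro mult_left_mono) auto
   finally show ?thesis by (simp only: mult_ac)
  next
   case 2
   then have "m <= 2 * a" "m <= 2 * c" using tri nn by (auto simp: m_def)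
   from top_pair[OF nn(1,3,4) this] have "b * (a * c * m ^ (2 * J)) <= b * (2 ^ (2 * J) * (a ^ Suc J * c ^ Suc J))" using nn by (intro mult_left_mono) auto
   also have "... = 2 ^ (2 * J) * (b * (a ^ Suc J * c ^ Suc J))" by (simp only: mult_ac)
   also have "... <= 2 ^ (2 * J) * up3 (Suc J) a b c" using up by (intro mult_left_mono) auto
   finally show ?thesis by (simp only: mult_ac)
  next
   case 3
   then have "m <= 2 * a" "m <= 2 * b" using tri nn by (auto simp: m_def)
   from top_pair[OF nn(1,2,4) this] have "c * (a * b * m ^ (2 * J)) <= c * (2 ^ (2 * J) * (a ^ Suc J * b ^ Suc J))" using nn by (intro mult_left_mono) auto
   also have "... = 2 ^ (2 * J) * (c * (a ^ Suc J * b ^ Suc J))" by (simp only: mult_ac)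
   also have "... <= 2 ^ (2 * J) * up3 (Suc J) a b c" using up by (intro mult_left_mono) auto
   finally show ?thesis by (simp only: mult_ac)
  qed
 qed
 finally show ?thesis by (simp add: d mult_left_mono mult.assoc)
qed

definition up4 :: "nat => real => real => real => real => real" where
 "up4 K a b c d = a * b * c ^ K * d ^ K + a * c * b ^ K * d ^ K + a * d * b ^ K * c ^ K
  + b * c * a ^ K * d ^ K + b * d * a ^ K * c ^ K + c * d * a ^ K * b ^ K"

lemma up4_perm: "up4 K a b c d = up4 K b a c d" "up4 K a b c d = up4 K a c b d" "up4 K a b c d = up4 K a b d c"
 by (simp_all add: up4_def mult_ac)

text \<open>The two largest of four ordered lengths share the high powers; the factor 3 comes from d
  <= a + b + c <= 3 c.\<close>

lemma up4_top:
 assumes nn: "0 <= a" "0 <= b" "0 <= c" "0 <= d" and o: "a <= b" "b <= c" "c <= d" "d <= a + b + c"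
 shows "a * b * c * d * d ^ (2 * J) <= 3 ^ (2 * J) * up4 (Suc J) a b c d"
proof -
 have "c * d * d ^ (2 * J) <= 3 ^ (2 * J) * (c ^ Suc J * d ^ Suc J)"
  by (rule top_pair) (use assms in auto)
 then have "a * b * (c * d * d ^ (2 * J)) <= a * b * (3 ^ (2 * J) * (c ^ Suc J * d ^ Suc J))" using nn by (intro mult_left_mono) auto
 also have "... = 3 ^ (2 * J) * (a * b * c ^ Suc J * d ^ Suc J)" by (simp only: mult_ac)
 also have "... <= 3 ^ (2 * J) * up4 (Suc J) a b c d"
  unfolding up4_def using nn by (intro mult_left_mono) (auto simp del: power_Suc)
 finally show ?thesis by (simp only: mult_ac)
qed

lemma up4_max:
 assumes nn: "0 <= a" "0 <= b" "0 <= c" "0 <= d"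
  and t: "a <= b + c + d" "b <= a + c + d" "c <= a + b + d" "d <= a + b + c"
  and m: "m = max (max a b) (max c d)"
 shows "a * b * c * d * m ^ (2 * J) <= 3 ^ (2 * J) * up4 (Suc J) a b c d"
proof -
 have P: "a * b * c * d * m ^ (2 * J) <= 3 ^ (2 * J) * up4 (Suc J) a b c d"
  if "0 <= a" "0 <= b" "0 <= c" "0 <= d" "a <= b + c + d" "b <= a + c + d" "c <= a + b + d" "d <= a + b + c"
   "m = max (max a b) (max c d)" "a <= d" "b <= d" "c <= d" for a b c d
 proof -
  have md: "m = d" using that by auto
  consider "a <= b" "b <= c" | "a <= c" "c <= b" | "b <= a" "a <= c" | "b <= c" "c <= a" | "c <= a" "a <= b" | "c <= b" "b <= a" by linarith
  then show ?thesis
  proof cases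
   case 1 then show ?thesis using up4_top[of a b c d J] that md by simp
  next
   case 2 then show ?thesis using up4_top[of a c b d J] that md up4_perm(2)[of "Suc J" a b c d] by (simp add: mult_ac)
  next
   case 3 then show ?thesis using up4_top[of b a c d J] that md up4_perm(1)[of "Suc J" a b c d] by (simp add: mult_ac)
  next
   case 4 then show ?thesis using up4_top[of b c a d J] that md up4_perm(1)[of "Suc J" a b c d] up4_perm(2)[of "Suc J" b a c d] by (simp add: mult_ac)
  next
   case 5 then show ?thesis using up4_top[of c a b d J] that md up4_perm(2)[of "Suc J" a b c d] up4_perm(1)[of "Suc J" a c b d] by (simp add: mult_ac)
  next
   case 6 then show ?thesis using up4_top[of c b a d J] that md up4_perm(1)[of "Suc J" a b c d] up4_perm(2)[of "Suc J" b a c d] up4_perm(1)[of "Suc J" b c a d] by (simp add: mult_ac)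
  qed
 qed
 consider "a <= d" "b <= d" "c <= d" | "a <= c" "b <= c" "d <= c" | "a <= b" "c <= b" "d <= b" | "b <= a" "c <= a" "d <= a" by linarith
 then show ?thesis
 proof cases
  case 1 then show ?thesis using P[of a b c d] assms by simp
 next
  case 2 then show ?thesis using P[of a b d c] assms up4_perm(3)[of "Suc J" a b c d] by (simp add: mult_ac max.commute)
 next
  case 3
  have "up4 (Suc J) a b c d = up4 (Suc J) a c d b" using up4_perm(2)[of "Suc J" a b c d] up4_perm(3)[of "Suc J" a c b d] by simp
  moreover have "m = max (max a c) (max d b)" using m by (auto simp: max_def)
  ultimately show ?thesis using P[of a c d b] 3 assms by (simp add: mult_ac)
 next
  case 4
  have "up4 (Suc J) a b c d = up4 (Suc J) b c d a" using up4_perm(1)[of "Suc J" a b c d] up4_perm(2)[of "Suc J" b a c d] up4_perm(3)[of "Suc J" b c a d] by simp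
  moreover have "m = max (max b c) (max d a)" using m by (auto simp: max_def)
  ultimately show ?thesis using P[of b c d a] 4 assms by (simp add: mult_ac)
 qed
qed

text \<open>The symbol of the quartic rate, symmetrized in \<open>x\<close>, \<open>y\<close>, \<open>z\<close>: only the symmetrization gains the factor \<open>h\<close>.\<close>

definition QK :: "nat => real => real => real => real => real" where
 "QK K h x y z = x * y * z * ((h + x) * (sg3 (x + h) y z * SP K (x + h) y z) + (h + y) * (sg3 x (y + h) z * SP K x (y + h) z)
   + (h + z) * (sg3 x y (z + h) * SP K x y (z + h)))"

text \<open>The 12 comes from \<open>sg3_cancel\<close>; the 9 collects three deviations with a sign
  sum of at most 3 each; the power of 2 enters because shifted frequencies may be twice as large as
  the maximum, and the power of 3 is that of \<open>up4_max\<close>.\<close>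

definition CQ :: "nat => real" where "CQ J = (12 * BS J + 9 * BD J) * 2 ^ (2 * J) * 3 ^ (2 * J)"

lemma CQ_nonneg [simp]: "0 <= CQ J" by (simp add: CQ_def)

lemma QK_bound:
 assumes 0: "h + x + y + z = 0"
 shows "\<bar>QK (Suc J) h x y z\<bar> <= CQ J * up4 (Suc J) \<bar>h\<bar> \<bar>x\<bar> \<bar>y\<bar> \<bar>z\<bar>"
proof -
 define m where "m = max (max \<bar>h\<bar> \<bar>x\<bar>) (max \<bar>y\<bar> \<bar>z\<bar>)"
 define M where "M = 2 * m"
 have m: "\<bar>h\<bar> <= m" "\<bar>x\<bar> <= m" "\<bar>y\<bar> <= m" "\<bar>z\<bar> <= m" "0 <= m" by (simp_all add: m_def le_max_iff_disj)
 have M: "\<bar>x\<bar> <= M" "\<bar>y\<bar> <= M" "\<bar>z\<bar> <= M" "\<bar>x + h\<bar> <= M" "\<bar>y + h\<bar> <= M" "\<bar>z + h\<bar> <= M" "0 <= M"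
  using m by (auto simp: M_def)
 let ?S = "SP (Suc J) x y z"
 have l: "\<bar>SP (Suc J) (x + h) y z - ?S\<bar> * M <= BD J * M ^ (2 * J) * \<bar>h\<bar>"
  "\<bar>SP (Suc J) x (y + h) z - ?S\<bar> * M <= BD J * M ^ (2 * J) * \<bar>h\<bar>"
  "\<bar>SP (Suc J) x y (z + h) - ?S\<bar> * M <= BD J * M ^ (2 * J) * \<bar>h\<bar>"
  by (intro SP_lip M; simp)+
 have e: "\<bar>(h + w) * (s * D)\<bar> <= 3 * (BD J * M ^ (2 * J) * \<bar>h\<bar>)"
  if "\<bar>w + h\<bar> <= M" "\<bar>s\<bar> <= 3" "\<bar>D\<bar> * M <= BD J * M ^ (2 * J) * \<bar>h\<bar>" for w s D
 proof -
  have "\<bar>(h + w) * (s * D)\<bar> = \<bar>s\<bar> * (\<bar>D\<bar> * \<bar>w + h\<bar>)" by (simp add: abs_mult add.commute mult_ac)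
  also have "... <= 3 * (\<bar>D\<bar> * M)" using that by (intro mult_mono) auto
  also have "... <= 3 * (BD J * M ^ (2 * J) * \<bar>h\<bar>)" using that by simp
  finally show ?thesis .
 qed
 define A B C where "A = (h + x) * (sg3 (x + h) y z * (SP (Suc J) (x + h) y z - ?S))"
  "B = (h + y) * (sg3 x (y + h) z * (SP (Suc J) x (y + h) z - ?S))"
  "C = (h + z) * (sg3 x y (z + h) * (SP (Suc J) x y (z + h) - ?S))"
 note ABC = this
 have abc: "\<bar>A\<bar> <= 3 * (BD J * M ^ (2 * J) * \<bar>h\<bar>)" "\<bar>B\<bar> <= 3 * (BD J * M ^ (2 * J) * \<bar>h\<bar>)" "\<bar>C\<bar> <= 3 * (BD J * M ^ (2 * J) * \<bar>h\<bar>)"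
  unfolding ABC by (rule e, rule M, rule sg3_le, rule l)+
 define G where "G = (h + x) * sg3 (x + h) y z + (h + y) * sg3 x (y + h) z + (h + z) * sg3 x y (z + h)"
 have "\<bar>?S * G\<bar> <= (BS J * M ^ (2 * J)) * (12 * \<bar>h\<bar>)"
  unfolding abs_mult G_def by (intro mult_mono SP_bound M sg3_cancel 0) auto
 then have "\<bar>?S * G + A + B + C\<bar> <= (12 * BS J + 9 * BD J) * M ^ (2 * J) * \<bar>h\<bar>"
  using abc abs_triangle_ineq[of "?S * G + A + B" C] abs_triangle_ineq[of "?S * G + A" B] abs_triangle_ineq[of "?S * G" A]
  by (simp add: algebra_simps del: SP.simps)
 moreover have "QK (Suc J) h x y z = x * y * z * (?S * G + A + B + C)"
  unfolding QK_def ABC G_def by (simp only: right_diff_distrib distrib_left mult_ac)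
 ultimately have "\<bar>QK (Suc J) h x y z\<bar> <= \<bar>x * y * z\<bar> * ((12 * BS J + 9 * BD J) * M ^ (2 * J) * \<bar>h\<bar>)"
  by (simp add: abs_mult mult_left_mono del: SP.simps)
 also have "... = (12 * BS J + 9 * BD J) * 2 ^ (2 * J) * (\<bar>h\<bar> * \<bar>x\<bar> * \<bar>y\<bar> * \<bar>z\<bar> * m ^ (2 * J))"
  unfolding M_def power_mult_distrib abs_mult by (simp only: mult_ac)
 also have "... <= (12 * BS J + 9 * BD J) * 2 ^ (2 * J) * (3 ^ (2 * J) * up4 (Suc J) \<bar>h\<bar> \<bar>x\<bar> \<bar>y\<bar> \<bar>z\<bar>)"
  by (intro mult_left_mono up4_max) (use 0 in "auto simp: m_def")
 finally show ?thesis by (simp add: CQ_def mult.assoc)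
qed

section \<open>The cubic rate and its correction\<close>

definition XS :: "cfun set" where "XS = {f. \<forall>s. f : X s}"
definition herm :: "cfun => bool" where "herm f \<longleftrightarrow> (ae x. f (- x) = cnj (f x))"
definition mx :: "cfun => cfun" where "mx f x = cr x * f x"
definition pw :: "nat => cfun => cfun" where "pw K f x = cr (x ^ K) * f x"
definition m1 :: real where "m1 = 1 / sqrt (2 * pi)"
text \<open>The transform of - u u_x: the unitary normalization turns a product into
  \<open>m1\<close> times a convolution, and the derivative contributes the factor i in front of
  \<open>mx\<close>.\<close>

definition Nl :: "cfun => cfun" where "Nl f x = - (\<i> * cr m1 * conv f (mx f) x)"
definition sgnm :: "cfun => cfun" where "sgnm f x = - (\<i> * cr (sgn x) * f x)"

lemma m1_pos: "0 < m1" "m1 <= 1"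
proof -
 have "1 <= sqrt (2 * pi)" using pi_gt3 by simp
 then show "0 < m1" "m1 <= 1" by (simp_all add: m1_def divide_simps)
qed

lemma XSD: "f : XS ==> f : X s" by (simp add: XS_def)
lemma XSI: "(!!s. f : X s) ==> f : XS" by (simp add: XS_def)

lemma mx_X: "f : X (s + 1) ==> mx f : X s" "f : X (s + 1) ==> nrm s (mx f) <= nrm (s + 1) f"
 using X_xi[of f s] by (simp_all add: mx_def[abs_def])

lemma mx_X': "f : X r ==> s + 1 <= r ==> mx f : X s"
 using mx_X(1)[of f s] X_mono(1)[of f r "s + 1"] by blast

lemma mx_XS: assumes "f : XS" shows "mx f : XS" by (rule XSI) (rule mx_X(1)[OF XSD[OF assms]])

lemma norm_mx: "cmod (mx f x) = \<bar>x\<bar> * cmod (f x)"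
 unfolding mx_def norm_mult norm_of_real ..

lemma norm_pw: "cmod (pw K f x) = \<bar>x\<bar> ^ K * cmod (f x)"
 unfolding pw_def norm_mult norm_of_real power_abs ..

lemma mx_meas [measurable]: assumes [measurable]: "meas f" shows "meas (mx f)" unfolding mx_def[abs_def] by measurable

lemma pw_mult_le: "mult_le (real K) (%x. x ^ K)"
 using abs_power_le_wt by (auto simp: mult_le_def power_abs)

lemma pw_L2: "f : X s ==> real K <= s ==> pw K f : L2" "f : X s ==> real K <= s ==> n2 (pw K f) <= nrm s f"
proof -
 assume "f : X s" "real K <= s"
 then have f: "f : X (real K)" "nrm (real K) f <= nrm s f" using X_mono by auto
 show "pw K f : L2" "n2 (pw K f) <= nrm s f"
  using mult_le_L2[OF pw_mult_le f(1)] f(2) by (simp_all add: pw_def[abs_def])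
qed

lemma mx_L1: "f : X 2 ==> integrable lborel (mx f)" "f : X 2 ==> l1 (mx f) <= c1 * nrm 2 f"
proof -
 assume f: "f : X 2"
 have m: "mx f : X 1" "nrm 1 (mx f) <= nrm 2 f" using mx_X[of f 1] f by simp_all
 show "integrable lborel (mx f)" by (rule X_L1(1)[OF m(1)])
 show "l1 (mx f) <= c1 * nrm 2 f" using X_L1(2)[OF m(1)] mult_left_mono[OF m(2), of c1] by simp
qed

lemma sgnm_X: "f : X s ==> sgnm f : X s" "f : X s ==> nrm s (sgnm f) <= nrm s f"
 using X_mult_le1[of f s "%x. - (\<i> * cr (sgn x))"] unfolding sgnm_def[abs_def]
 by (auto simp: norm_mult sgn_if)

lemma sgnm_lin: "sgnm (%x. a * f x + b * g x) = (%x. a * sgnm f x + b * sgnm g x)"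
 by (auto simp: sgnm_def algebra_simps)

lemma conv_mx:
 assumes "f : X 1" "g : X 1" shows "mx (conv f g) x = conv (mx f) g x + conv f (mx g) x"
 unfolding mx_def by (rule conv_xi) (use X_mono(1)[OF assms(1), of 0] X_mono(1)[OF assms(2), of 0] X_xi(1)[of f 0] X_xi(1)[of g 0] assms in "auto simp: X_0")

text \<open>The conservative form, the derivative of - u^2 / 2. With the derivative outside the
  convolution, pairing with \<open>f\<close> produces a symbol in one frequency alone.\<close>

lemma Nl_alt: assumes "f : X 1" shows "Nl f x = - (\<i> * cr (m1 / 2) * mx (conv f f) x)"
 using conv_mx[OF assms assms, of x] by (simp add: Nl_def conv_commute[of "mx f" f])

lemma Nl_X: assumes s: "0 <= s" and f: "f : X (s + 1)"
 shows "Nl f : X s" "nrm s (Nl f) <= 2 powr s * c1 * (nrm (s + 1) f)^2"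
proof -
 have c: "conv f (mx f) : X s" by (rule conv_X'(1)[OF s f mx_X(1)[OF f]])
 have e: "Nl f = (%x. (- (\<i> * cr m1)) * conv f (mx f) x)" by (auto simp: Nl_def)
 show "Nl f : X s" unfolding e by (rule X_cmult[OF c])
 have "nrm s (Nl f) = m1 * nrm s (conv f (mx f))" unfolding e nrm_cmult using m1_pos by (simp add: norm_mult)
 also have "... <= 1 * nrm s (conv f (mx f))" using m1_pos by (intro mult_right_mono) auto
 also have "... <= 2 powr s * c1 * nrm (s + 1) f * nrm s (mx f)" using conv_X'(2)[OF s f mx_X(1)[OF f]] by simp
 also have "... <= 2 powr s * c1 * nrm (s + 1) f * nrm (s + 1) f" by (intro mult_left_mono mx_X f) simp
 finally show "nrm s (Nl f) <= 2 powr s * c1 * (nrm (s + 1) f)^2" by (simp add: power2_eq_square mult.assoc)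
qed

lemma Nl_XS: "f : XS ==> Nl f : XS"
proof (rule XSI)
 fix s assume "f : XS"
 then have "Nl f : X \<bar>s\<bar>" by (intro Nl_X XSD) auto
 then show "Nl f : X s" by (rule X_mono(1)) simp
qed

lemma L3_iter: "integrable M2 (F3 b p q r) ==> L3 b p q r = (LBINT x. LBINT y. b x y * (p x * q y * r (- x - y)))"
 unfolding L3_def using lborel_pair.integral_fst[of "%x y. b x y * (p x * q y * r (- x - y))"] by simp

lemma L3_symb_cmult: "L3 (%x y. k * b x y) p q r = k * L3 b p q r"
 unfolding L3_def integral_mult_right_zero[symmetric] by (auto simp: case_prod_unfold mult_ac intro!: bi_cong)

lemma conv_factor: "k * conv p a x = (LBINT h. k * (p (x - h) * a h))"
 by (simp add: conv_def)

lemma conv_pair: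
 assumes [measurable]: "k : borel_measurable borel" "meas g" "meas p" "meas q"
  and i: "integrable M2 (%(x, y). k (- x) * (g x * q y * p (- x - y)))"
 shows "(LBINT w. k w * conv p q w * g (- w)) = L3 (%x y. k (- x)) g q p"
proof -
 have "(LBINT w. k w * conv p q w * g (- w)) = (LBINT x. k (- x) * conv p q (- x) * g x)"
  using lborel_integral_real_affine[of "-1" "%w. k w * conv p q w * g (- w)" 0] by simp
 also have "... = (LBINT x. LBINT y. k (- x) * (g x * q y * p (- x - y)))"
 proof (rule bi_cong[OF refl])
  fix x
  have "k (- x) * conv p q (- x) * g x = (k (- x) * g x) * conv p q (- x)" by simp
  also have "... = (LBINT y. k (- x) * (g x * q y * p (- x - y)))"
   unfolding conv_factor by (simp only: mult_ac)
  finally show "k (- x) * conv p q (- x) * g x = (LBINT y. k (- x) * (g x * q y * p (- x - y)))" .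
 qed
 also have "... = L3 (%x y. k (- x)) g q p" by (rule L3_iter[OF i, symmetric])
 finally show ?thesis .
qed

lemma sym3_I:
 assumes "(%(x, y). b x y) : borel_measurable M2" "0 <= c"
  "!!x y. cmod (b x y) <= c * (wt (s - 1) x * wt (s - 1) y * wt (s - 1) (- x - y))"
 shows "sym3 s b c"
 unfolding sym3_def
proof (intro conjI allI assms)
 fix x y
 have "c * (wt (s - 1) x * wt (s - 1) y * wt (s - 1) (- x - y)) <= c * (wt s x * wt s y * wt (s - 1) (- x - y))"
  by (intro mult_left_mono mult_right_mono mult_mono wt_mono assms(2)) auto
 then show "cmod (b x y) <= c * (wt s x * wt s y * wt (s - 1) (- x - y))" using assms(3)[of x y] by simp
qed

lemma three_wts:
 assumes "0 <= r" shows "wt r x <= wt r x * wt r y * wt r z" "wt r y <= wt r x * wt r y * wt r z" "wt r z <= wt r x * wt r y * wt r z"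
proof -
 have g: "1 <= wt r x" "1 <= wt r y" "1 <= wt r z" using assms by (auto intro: wt_ge1)
 have m: "1 <= a * b" if "1 <= a" "1 <= b" for a b :: real using mult_mono[OF that] that by simp
 show "wt r x <= wt r x * wt r y * wt r z" using mult_left_mono[OF m[OF g(2,3)], of "wt r x"] by (simp add: mult.assoc)
 show "wt r y <= wt r x * wt r y * wt r z" using mult_left_mono[OF m[OF g(1,3)], of "wt r y"] by (simp add: mult_ac)
 show "wt r z <= wt r x * wt r y * wt r z" using mult_left_mono[OF m[OF g(1,2)], of "wt r z"] by (simp add: mult_ac)
qed

lemma power_le_three_wts:
 assumes "\<bar>w\<bar> : {\<bar>x\<bar>, \<bar>y\<bar>, \<bar>z\<bar>}" "real n <= r" shows "\<bar>w\<bar> ^ n <= wt r x * wt r y * wt r z"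
proof -
 have "\<bar>v\<bar> ^ n <= wt r v" for v using abs_power_le_wt[of v n] wt_mono[OF assms(2), of v] by linarith
 moreover have r: "0 <= r" using assms(2) by (meson of_nat_0_le_iff order_trans)
 moreover consider "\<bar>w\<bar> = \<bar>x\<bar>" | "\<bar>w\<bar> = \<bar>y\<bar>" | "\<bar>w\<bar> = \<bar>z\<bar>" using assms(1) by auto
 ultimately show ?thesis using three_wts[OF r, where x=x and y=y and z=z]
  by cases (metis order_trans)+
qed

lemma SP_three_wts: "\<bar>SP (Suc J) x y z\<bar> <= BS J * (wt (real (2 * J)) x * wt (real (2 * J)) y * wt (real (2 * J)) z)"
proof -
 define m where "m = max \<bar>x\<bar> (max \<bar>y\<bar> \<bar>z\<bar>)"
 have "\<bar>SP (Suc J) x y z\<bar> <= BS J * m ^ (2 * J)" by (rule SP_bound) (simp_all add: m_def le_max_iff_disj)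
 also have "m ^ (2 * J) <= wt (real (2 * J)) x * wt (real (2 * J)) y * wt (real (2 * J)) z"
  using power_le_three_wts[of m x y z "2 * J" "real (2 * J)"] by (auto simp: m_def max_def split: if_splits)
 finally show ?thesis by (simp add: mult_left_mono)
qed

text \<open>The cubic rate has the symbol \<open>x y z SP\<close>. The linear flow multiplies a trilinear symbol by \<open>sg3 = \<plusminus>1\<close>, so the
  correction that cancels this rate has the symbol times \<open>sg3\<close>.\<close>

definition SS :: "nat => real" where "SS J = real (2 * J + 2)"

definition bK :: "nat => real => cfun" where
 "bK J x y = cr (x * y * (- x - y) * (sg3 x y (- x - y) * SP (Suc J) x y (- x - y)))"

lemma sym3_bK: "sym3 (SS J) (bK J) (3 * BS J)"
proof (rule sym3_I)
 show "(%(x, y). bK J x y) : borel_measurable M2" unfolding bK_def by measurable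
 fix x y :: real
 let ?z = "- x - y" and ?w = "wt (real (2 * J))"
 have "cmod (bK J x y) = (\<bar>x\<bar> * \<bar>y\<bar> * \<bar>?z\<bar>) * (\<bar>sg3 x y ?z\<bar> * \<bar>SP (Suc J) x y ?z\<bar>)"
  unfolding bK_def norm_of_real abs_mult ..
 also have "... <= (wt 1 x * wt 1 y * wt 1 ?z) * (3 * (BS J * (?w x * ?w y * ?w ?z)))"
  by (intro mult_mono sg3_le abs_le_wt SP_three_wts) auto
 also have "... = 3 * BS J * (wt (SS J - 1) x * wt (SS J - 1) y * wt (SS J - 1) ?z)"
  using wt_add[of 1 "real (2 * J)"] by (simp add: SS_def mult_ac)
 finally show "cmod (bK J x y) <= 3 * BS J * (wt (SS J - 1) x * wt (SS J - 1) y * wt (SS J - 1) ?z)" .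
qed simp

text \<open>Each summand of \<open>up3\<close> gives one factor a single derivative and the other
  two \<open>Suc J\<close> derivatives. The first is measured in L1, which bounds the maximum of
  u_x, and the other two by the energy.\<close>

lemma L3_up3:
 assumes f: "f : X (SS J)" and m: "(%(x, y). b x y) : borel_measurable M2"
  and b: "!!x y. cmod (b x y) <= c * up3 (Suc J) \<bar>x\<bar> \<bar>y\<bar> \<bar>- x - y\<bar>" and c: "0 <= c"
 shows "cmod (L3 b f f f) <= c * (3 * (l1 (mx f) * (n2 (pw (Suc J) f))^2))"
proof -
 let ?A = "mx f" and ?B = "pw (Suc J) f"
 have A: "integrable lborel ?A" by (rule mx_L1, rule X_mono(1)[OF f]) (simp add: SS_def)
 have B: "?B : L2" by (rule pw_L2[OF f]) (simp add: SS_def)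
 have le: "cmod (F3 b f f f z) <= c * (\<Sum>g\<leftarrow>[P3 ?A ?B ?B, P3 ?B ?A ?B, P3 ?B ?B ?A]. cmod (g z))" for z
 proof -
  obtain x y where z: "z = (x, y)" by (cases z)
  have "cmod (b x y * (f x * f y * f (- x - y))) <= c * up3 (Suc J) \<bar>x\<bar> \<bar>y\<bar> \<bar>- x - y\<bar> * cmod (f x * f y * f (- x - y))"
   unfolding norm_mult[of "b x y"] by (intro mult_right_mono b) auto
  then show ?thesis
   by (simp add: z up3_def norm_mx norm_pw norm_mult algebra_simps del: power_Suc)
 qed
 show ?thesis
  using ib_dom(2)[OF F3_meas[OF m X_meas X_meas X_meas, OF f f f] le c] ib3[OF A B B] by (simp add: L3_def power2_eq_square)
qed

lemma L4_up4:
 assumes f: "f : X (SS J)" and m: "(%(h, x, y). k h x y) : borel_measurable M3"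
  and b: "!!h x y. cmod (k h x y) <= c * up4 (Suc J) \<bar>h\<bar> \<bar>x\<bar> \<bar>y\<bar> \<bar>- h - x - y\<bar>" and c: "0 <= c"
 shows "cmod (L4 k f f f f) <= c * (6 * ((l1 (mx f))^2 * (n2 (pw (Suc J) f))^2))"
proof -
 let ?A = "mx f" and ?B = "pw (Suc J) f"
 have A: "integrable lborel ?A" by (rule mx_L1, rule X_mono(1)[OF f]) (simp add: SS_def)
 have B: "?B : L2" by (rule pw_L2[OF f]) (simp add: SS_def)
 have le: "cmod (F4 k f f f f z) <= c * (\<Sum>g\<leftarrow>[P4 ?A ?A ?B ?B, P4 ?A ?B ?A ?B, P4 ?A ?B ?B ?A, P4 ?B ?A ?A ?B, P4 ?B ?A ?B ?A, P4 ?B ?B ?A ?A]. cmod (g z))" for z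
 proof -
  obtain h x y where z: "z = (h, x, y)" by (cases z)
  have "cmod (k h x y * (f h * f x * f y * f (- h - x - y))) <= c * up4 (Suc J) \<bar>h\<bar> \<bar>x\<bar> \<bar>y\<bar> \<bar>- h - x - y\<bar> * cmod (f h * f x * f y * f (- h - x - y))"
   unfolding norm_mult[of "k h x y"] by (intro mult_right_mono b) auto
  then show ?thesis
   by (simp add: z up4_def norm_mx norm_pw norm_mult algebra_simps del: power_Suc)
 qed
 show ?thesis
  using ib_dom(2)[OF F4_meas[OF m X_meas X_meas X_meas X_meas, OF f f f f] le c] ib4[OF A A B B] by (simp add: L4_def power2_eq_square)
qed

lemma shift_int:
 assumes b: "sym3 s b c" and s: "0 <= s" and X: "a : X (s + 1)" "p : X (s + 1)" "q : X (s + 1)" "r : X (s + 1)"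
 shows "(%(h, x, y). b (x + h) y) : borel_measurable M3" "integrable M3 (F4 (%h x y. b (x + h) y) a p q r)"
proof -
 let ?w = "%f v. cr (wt s v) * f v"
 have "(%(h, x, y). (x + h, y)) : measurable M3 M2" by measurable
 from measurable_compose[OF this sym3_meas[OF b]] show m: "(%(h, x, y). b (x + h) y) : borel_measurable M3" by (simp add: case_prod_unfold)
 have c: "0 <= c" and le: "!!x y. cmod (b x y) <= c * (wt s x * wt s y * wt (s - 1) (- x - y))" using b by (auto simp: sym3_def)
 have ib: "\<forall>g\<in>set [P4 (?w a) (?w p) (?w q) (?w r)]. ib M3 g (l1 (?w a) * l1 (?w p) * (n2 (?w q) * n2 (?w r)))"
  using ib4(1)[OF X_wt_L1(1)[OF X(1)] X_wt_L1(1)[OF X(2)] X_L2[OF X_mono(1)[OF X(3)]] X_L2[OF X_mono(1)[OF X(4)]]] by simp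
 have F: "cmod (F4 (%h x y. b (x + h) y) a p q r z) <= (c * 2 powr s) * (\<Sum>g\<leftarrow>[P4 (?w a) (?w p) (?w q) (?w r)]. cmod (g z))" for z
 proof -
  obtain h x y where z: "z = (h, x, y)" by (cases z)
  have e: "- (x + h) - y = - h - x - y" by simp
  have "cmod (b (x + h) y) <= c * (wt s (x + h) * wt s y * wt (s - 1) (- h - x - y))" using le[of "x + h" y] unfolding e .
  also have "... <= c * ((2 powr s * (wt s x * wt s h)) * wt s y * wt s (- h - x - y))"
   using wt_peetre[OF s, of x h] by (intro mult_left_mono mult_mono wt_mono c) (auto simp: mult_ac)
  finally have l: "cmod (b (x + h) y) <= c * ((2 powr s * (wt s x * wt s h)) * wt s y * wt s (- h - x - y))" .
  show ?thesis using mult_right_mono[OF l norm_ge_zero[of "a h * p x * q y * r (- h - x - y)"]]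
   by (simp add: z norm_mult mult_ac)
 qed
 show "integrable M3 (F4 (%h x y. b (x + h) y) a p q r)"
  by (rule ib_dom(1)[OF F4_meas[OF m X(1-4)[THEN X_meas]] F _ ib]) (use c in simp)
qed

lemma QK_meas: "(%(h, x, y). cr (QK (Suc J) h x y (- h - x - y))) : borel_measurable M3"
 unfolding QK_def by measurable

lemma SP_perm: "SP K y x z = SP K x y z" "SP K x z y = SP K x y z"
 by (induction K) (simp_all add: add_ac)

lemma sg3_perm: "sg3 y x z = sg3 x y z" "sg3 x z y = sg3 x y z"
 by (simp_all add: sg3_def)

lemma bK_sym: "bK J y x = bK J x y" "bK J x (- x - y) = bK J x y"
proof -
 have "- y - x = - x - y" "- x - (- x - y) = y" by simp_all
 then show "bK J y x = bK J x y" "bK J x (- x - y) = bK J x y"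
  unfolding bK_def by (simp_all only: SP_perm[of _ y x] SP_perm(2)[of _ x "- x - y" y] sg3_perm[of y x] sg3_perm(2)[of x "- x - y" y] mult_ac)
qed

lemma bK_swap: assumes "f : XS" "g : XS" shows "L3 (bK J) f g f = L3 (bK J) g f f" "L3 (bK J) f f g = L3 (bK J) g f f"
proof -
 note m = sym3_meas[OF sym3_bK] X_meas[OF XSD[OF assms(1)]] X_meas[OF XSD[OF assms(2)]]
 show "L3 (bK J) f g f = L3 (bK J) g f f" using L3_swap12[OF m(1,2,3,2)] by (simp add: bK_sym)
 moreover have "L3 (bK J) f f g = L3 (bK J) f g f" using L3_swap23[OF m(1,2,2,3)] by (simp add: bK_sym)
 ultimately show "L3 (bK J) f f g = L3 (bK J) g f f" by simp
qed

text \<open>Inserting the nonlinearity into one slot creates the symbol x bK(x + h, y), in which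
  \<open>h\<close> belongs to the undifferentiated factor. All arguments coincide, so the factor 3
  can be spent on summing over the three choices of the differentiated frequency, which is
  \<open>QK\<close>.\<close>

lemma quartic_id:
 assumes f: "f : XS"
 shows "3 * L3 (bK J) (Nl f) f f = - (\<i> * cr m1) * L4 (%h x y. cr (QK (Suc J) h x y (- h - x - y))) f f f f"
proof -
 have X: "f : X s" "mx f : X s" for s by (auto intro!: XSD f mx_XS)
 let ?k = "%h x y. cr x * bK J (x + h) y"
 have "0 <= SS J" by (simp add: SS_def)
 note sh = shift_int[OF sym3_bK this X(1) X(2) X(1) X(1)]
 have e: "F4 (%h x y. bK J (x + h) y) f (mx f) f f = F4 ?k f f f f" by (simp add: fun_eq_iff mx_def mult_ac)
 have i: "integrable M3 (F4 ?k f f f f)" using sh(2) unfolding e .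
 have m: "(%(h, x, y). ?k h x y) : borel_measurable M3" unfolding bK_def by measurable
 have "L3 (bK J) (Nl f) f f = - (\<i> * cr m1) * L3 (bK J) (conv (mx f) f) f f"
  unfolding L3_cmult(1)[symmetric] by (rule arg_cong[where f="%g. L3 (bK J) g f f"]) (simp add: fun_eq_iff Nl_def conv_commute[of f])
 also have "L3 (bK J) (conv (mx f) f) f f = L4 ?k f f f f"
  unfolding L3_slot[OF sym3_meas[OF sym3_bK] X(1,2,1,1)[THEN X_meas] sh(2)] L4_def e ..
 finally have "3 * L3 (bK J) (Nl f) f f = - (\<i> * cr m1) * (L4 ?k f f f f + 2 * L4 ?k f f f f)" by simp
 also have "L4 ?k f f f f + 2 * L4 ?k f f f f = L4 (%h x y. ?k h x y + ?k h y x + ?k h (- h - x - y) x) f f f f"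
  by (rule L4_symmetrize[OF m X(1,1,1)[THEN X_meas] i i])
 also have "(%h x y. ?k h x y + ?k h y x + ?k h (- h - x - y) x) = (%h x y. cr (QK (Suc J) h x y (- h - x - y)))"
 proof (intro ext)
  fix h x y :: real
  define z where "z = - h - x - y"
  have e: "- (x + h) - y = z" "- (y + h) - x = z" "- (z + h) - x = y" by (simp_all add: z_def)
  have "cr x * bK J (x + h) y + cr y * bK J (y + h) x + cr z * bK J (z + h) x
   = cr (x * ((x + h) * y * z * (sg3 (x + h) y z * SP (Suc J) (x + h) y z)) + y * ((y + h) * x * z * (sg3 x (y + h) z * SP (Suc J) x (y + h) z))
     + z * ((z + h) * x * y * (sg3 x y (z + h) * SP (Suc J) x y (z + h))))"
   unfolding bK_def e of_real_add of_real_mult[of x "_ * _"] of_real_mult[of y "_ * _"] of_real_mult[of z "_ * _"]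
   by (simp only: SP_perm[of _ "y + h" x] SP_perm(1)[of _ "z + h" x] SP_perm(2)[of _ x "z + h" y] sg3_perm[of "y + h" x] sg3_perm(1)[of "z + h" x] sg3_perm(2)[of x "z + h" y])
  also have "... = cr (QK (Suc J) h x y z)"
   unfolding QK_def by (rule arg_cong[where f=cr]) (simp add: algebra_simps del: SP.simps)
  finally show "cr x * bK J (x + h) y + cr y * bK J (y + h) x + cr (- h - x - y) * bK J (- h - x - y + h) x
   = cr (QK (Suc J) h x y (- h - x - y))" by (simp only: z_def)
 qed
 finally show ?thesis .
qed

lemma quartic_bound:
 assumes f: "f : XS"
 shows "cmod (3 * L3 (bK J) (Nl f) f f) <= CQ J * (6 * ((l1 (mx f))^2 * (n2 (pw (Suc J) f))^2))"
proof -
 have "cmod (L4 (%h x y. cr (QK (Suc J) h x y (- h - x - y))) f f f f) <= CQ J * (6 * ((l1 (mx f))^2 * (n2 (pw (Suc J) f))^2))"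
  by (rule L4_up4[OF XSD[OF f] QK_meas]) (simp_all only: norm_of_real CQ_nonneg, rule QK_bound, simp)
 moreover have "m1 * a <= b" if "a <= b" "0 <= a" for a b :: real
  using mult_right_mono[OF m1_pos(2) that(2)] that(1) by simp
 ultimately show ?thesis unfolding quartic_id[OF f] using m1_pos by (simp add: norm_mult)
qed

lemma sym3_le1:
 assumes b: "sym3 s b c" and m: "(%(x, y). a x y) : borel_measurable M2" and a: "!!x y. cmod (a x y) <= 1"
 shows "sym3 s (%x y. a x y * b x y) c"
 unfolding sym3_def
proof (intro conjI allI)
 show "(%(x, y). a x y * b x y) : borel_measurable M2"
  using borel_measurable_times[OF m sym3_meas[OF b]] by (simp add: case_prod_unfold)
 show "0 <= c" using b by (simp add: sym3_def)
 fix x y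
 have "cmod (a x y * b x y) <= 1 * cmod (b x y)" unfolding norm_mult by (intro mult_right_mono a) simp
 also have "... <= c * (wt s x * wt s y * wt (s - 1) (- x - y))" using b by (simp add: sym3_def)
 finally show "cmod (a x y * b x y) <= c * (wt s x * wt s y * wt (s - 1) (- x - y))" .
qed

lemma L3_cong: "(!!x y. b x y * (p x * q y * r (- x - y)) = b' x y * (p' x * q' y * r' (- x - y))) ==> L3 b p q r = L3 b' p' q' r'"
 unfolding L3_def by (intro bi_cong) (auto simp: case_prod_unfold)

lemma L3_sym:
 fixes g :: "cfun"
 assumes f: "f : X s" and m[measurable]: "g : borel_measurable borel" and g: "!!x. cmod (g x) <= c * wt (s - 1) x" and s: "1 <= s" and c: "0 <= c"
 shows "sym3 s (%x y. g x) c" "sym3 s (%x y. g y) c" "sym3 s (%x y. g (- x - y)) c"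
  "L3 (%x y. g y) f f f = L3 (%x y. g x) f f f" "L3 (%x y. g (- x - y)) f f f = L3 (%x y. g x) f f f"
proof -
 have [measurable]: "meas f" using f by (rule X_meas)
 have s': "0 <= s - 1" using s by simp
 have *: "cmod (g w) <= c * (wt (s - 1) x * wt (s - 1) y * wt (s - 1) z)" if "w : {x, y, z}" for w x y z
 proof -
  have "wt (s - 1) w <= wt (s - 1) x * wt (s - 1) y * wt (s - 1) z"
   using that three_wts[OF s', where x=x and y=y and z=z] by auto
  then show ?thesis using g[of w] mult_left_mono[OF _ c] by (meson order_trans)
 qed
 show 1: "sym3 s (%x y. g x) c" by (rule sym3_I[OF _ c *]) auto
 show 2: "sym3 s (%x y. g y) c" by (rule sym3_I[OF _ c *]) auto
 show 3: "sym3 s (%x y. g (- x - y)) c" by (rule sym3_I[OF _ c *]) auto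
 show 4: "L3 (%x y. g y) f f f = L3 (%x y. g x) f f f"
  by (rule L3_swap12) (auto intro: sym3_meas[OF 2, simplified])
 have "L3 (%x y. g y) f f f = L3 (%x y. g (- x - y)) f f f"
  by (rule L3_swap23[OF sym3_meas[OF 2]]) auto
 with 4 show "L3 (%x y. g (- x - y)) f f f = L3 (%x y. g x) f f f" by simp
qed

lemma L3_symb_add3:
 assumes b: "sym3 s b c" "sym3 s b' c'" "sym3 s b'' c''" and f: "p : X s" "q : X s" "r : X s"
 shows "L3 b p q r + L3 b' p q r + L3 b'' p q r = L3 (%x y. b x y + b' x y + b'' x y) p q r"
proof -
 note i = L3_bound(1)[OF b(1) f] L3_bound(1)[OF b(2) f] L3_bound(1)[OF b(3) f]
 show ?thesis
  unfolding L3_def Bochner_Integration.integral_add[OF i(1,2), symmetric]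
   Bochner_Integration.integral_add[OF Bochner_Integration.integrable_add[OF i(1,2)] i(3), symmetric]
  by (intro bi_cong refl) (simp only: case_prod_unfold distrib_right)
qed

text \<open>With three equal arguments the power of \<open>x\<close> may be exchanged for that of
  \<open>y\<close> or of -x-y; Newton's identity evaluates the sum of the three.\<close>

lemma TK_sym3: 
 assumes f: "f : X (real (2 * K + 2))"
 shows "3 * L3 (%x y. cr (x ^ (2 * K + 1))) f f f = L3 (%x y. cr (TK K x y)) f f f"
proof -
 let ?g = "%x. cr (x ^ (2 * K + 1))"
 let ?s = "real (2 * K + 2)"
 have g: "cmod (?g x) <= 1 * wt (?s - 1) x" for x
  using abs_power_le_wt[of x "2 * K + 1"] unfolding norm_of_real power_abs by simp
 note S = L3_sym[OF f _ g]
 have s: "sym3 ?s (%x y. ?g x) 1" "sym3 ?s (%x y. ?g y) 1" "sym3 ?s (%x y. ?g (- x - y)) 1"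
  and e: "L3 (%x y. ?g y) f f f = L3 (%x y. ?g x) f f f" "L3 (%x y. ?g (- x - y)) f f f = L3 (%x y. ?g x) f f f"
  by (rule S; simp)+
 have "3 * L3 (%x y. ?g x) f f f = L3 (%x y. ?g x) f f f + L3 (%x y. ?g y) f f f + L3 (%x y. ?g (- x - y)) f f f"
  unfolding e by simp
 also have "... = L3 (%x y. cr (TK K x y)) f f f"
  unfolding L3_symb_add3[OF s f f f]
 proof (rule arg_cong[where f="%b. L3 b f f f"], intro ext)
  fix x y
  have "x ^ (2 * K + 1) + y ^ (2 * K + 1) + (- x - y) ^ (2 * K + 1) = TK K x y"
   unfolding TK_def by (rule SP_newton) simp
  then show "?g x + ?g y + ?g (- x - y) = cr (TK K x y)" by (simp only: of_real_add[symmetric])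
 qed
 finally show ?thesis .
qed

text \<open>In conservative form, and by Hermitian symmetry, the pairing is a trilinear form whose
  symbol is the odd power 2 K + 1 of one frequency. Symmetrization accounts for the 3 and exposes
  the factor x y z.\<close>

lemma cubic_id:
 assumes f: "f : X (real (2 * K + 2))" and h: "herm f"
 shows "2 * kip (%w. w ^ K) (Nl f) f = Re (\<i> * cr (m1 / 3) * L3 (%x y. cr (TK K x y)) f f f)"
proof -
 have [measurable]: "meas f" using f by (rule X_meas)
 have f1: "f : X 1" by (rule X_mono(1)[OF f]) simp
 let ?n = "2 * K + 1"
 let ?k = "%w. cr (w ^ ?n)"
 have km: "?k : borel_measurable borel" by simp
 have g: "cmod (?k (- x)) <= 1 * wt (real (2 * K + 2) - 1) x" for x
  using abs_power_le_wt[of x "2 * K + 1"] unfolding norm_of_real power_abs by simp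
 have s: "sym3 (real (2 * K + 2)) (%x y. ?k (- x)) 1"
  by (rule L3_sym(1)[OF f _ g]) simp_all
 have "2 * ip (%w. cr (w ^ K) * Nl f w) (%w. cr (w ^ K) * f w)
  = 2 * (LBINT w. - (\<i> * cr (m1 / 2)) * (?k w * conv f f w * f (- w)))"
  unfolding ip_def
 proof (rule arg_cong[where f="%z. 2 * z"], rule integral_cong_AE)
  have m: "meas (Nl f)" unfolding Nl_def[abs_def] by measurable
  then show "(%w. cr (w ^ K) * Nl f w * cnj (cr (w ^ K) * f w)) : borel_measurable lborel"
   by measurable
  show "(%w. - (\<i> * cr (m1 / 2)) * (?k w * conv f f w * f (- w))) : borel_measurable lborel" by measurable
  show "ae w. cr (w ^ K) * Nl f w * cnj (cr (w ^ K) * f w)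
    = - (\<i> * cr (m1 / 2)) * (?k w * conv f f w * f (- w))"
   using h[unfolded herm_def]
  proof eventually_elim
   case (elim w)
   have k: "?k w = cr (w ^ K) * cr w * cr (w ^ K)"
    unfolding of_real_mult[symmetric] by (simp add: power_add mult_2)
   show ?case unfolding Nl_alt[OF f1] mx_def elim k complex_cnj_mult complex_cnj_complex_of_real
    by (simp only: mult_ac mult_minus_left mult_minus_right)
  qed
 qed
 also have "... = - (\<i> * cr m1) * (LBINT w. ?k w * conv f f w * f (- w))"
  by (subst integral_mult_right_zero) (simp add: field_simps)
 also have "(LBINT w. ?k w * conv f f w * f (- w)) = L3 (%x y. ?k (- x)) f f f"
  by (rule conv_pair[OF km]) (use L3_bound(1)[OF s f f f] in auto)
 also have "... = - L3 (%x y. ?k x) f f f"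
  using L3_symb_cmult[of "-1" "%x y. ?k x" f f f] by simp
 also have "L3 (%x y. ?k x) f f f = L3 (%x y. cr (TK K x y)) f f f / 3"
  unfolding TK_sym3[OF f, symmetric] by (rule nonzero_mult_div_cancel_left[symmetric]) simp
 finally have e: "2 * ip (%w. cr (w ^ K) * Nl f w) (%w. cr (w ^ K) * f w)
  = \<i> * cr (m1 / 3) * L3 (%x y. cr (TK K x y)) f f f" by simp
 show ?thesis unfolding kip_def e[symmetric] by simp
qed

text \<open>The symbol of the linear operator is purely imaginary, so the operator is skew-adjoint
  and leaves every weighted energy unchanged.\<close>

lemma kip_sgnm: "kip k (sgnm f) f = 0"
proof -
 have "kip k (sgnm f) f = Re (LBINT x. - \<i> * cr ((k x)^2 * sgn x * (cmod (f x))^2))"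
  unfolding kip_def ip_def sgnm_def
 proof (rule arg_cong[where f=Re], rule bi_cong[OF refl])
  fix x
  have "cr ((cmod (f x))^2) = f x * cnj (f x)" by (simp only: complex_norm_square[symmetric] of_real_power)
  then show "cr (k x) * - (\<i> * cr (sgn x) * f x) * cnj (cr (k x) * f x)
   = - \<i> * cr ((k x)^2 * sgn x * (cmod (f x))^2)"
   by (simp only: of_real_mult complex_cnj_mult complex_cnj_complex_of_real power2_eq_square mult_ac mult_minus_left mult_minus_right)
 qed
 also have "... = Re (- \<i> * cr (LBINT x. (k x)^2 * sgn x * (cmod (f x))^2))"
  by (subst integral_mult_right_zero) (simp only: integral_complex_of_real)
 finally show ?thesis by simp
qed

text \<open>Off the axes the sign sum squares to 1; on the axes, where it need not, the product of
  the three frequencies vanishes. Hence an identity at every point.\<close>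

lemma TK_sg3: "x * y * (- x - y) * (sg3 x y (- x - y) * SP K x y (- x - y)) * sg3 x y (- x - y) = TK K x y"
proof (cases "x = 0 \<or> y = 0 \<or> - x - y = 0")
 case True
 then show ?thesis by (auto simp: TK_def)
next
 case False
 then have "(sg3 x y (- x - y))^2 = 1" by (intro sg3_sq) auto
 then have "sg3 x y (- x - y) * sg3 x y (- x - y) = 1" by (simp only: power2_eq_square)
 moreover have "x * y * (- x - y) * (sg3 x y (- x - y) * SP K x y (- x - y)) * sg3 x y (- x - y)
  = x * y * (- x - y) * SP K x y (- x - y) * (sg3 x y (- x - y) * sg3 x y (- x - y))" by (simp only: mult_ac)
 ultimately show ?thesis by (simp only: TK_def mult_1_right)
qed

lemma L3_sgnm:
 assumes b: "sym3 s b c" and X: "p : X s" "q : X s" "r : X s"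
 shows "L3 b (sgnm p) q r + L3 b p (sgnm q) r + L3 b p q (sgnm r) = - \<i> * L3 (%x y. b x y * cr (sg3 x y (- x - y))) p q r"
proof -
 let ?s = "%x. - \<i> * cr (sgn x)"
 have s: "sym3 s (%x y. ?s x * b x y) c" "sym3 s (%x y. ?s y * b x y) c" "sym3 s (%x y. ?s (- x - y) * b x y) c"
  by (rule sym3_le1[OF b]; measurable; simp add: norm_mult sgn_if)+
 have "L3 b (sgnm p) q r = L3 (%x y. ?s x * b x y) p q r" "L3 b p (sgnm q) r = L3 (%x y. ?s y * b x y) p q r"
  "L3 b p q (sgnm r) = L3 (%x y. ?s (- x - y) * b x y) p q r"
  by (rule L3_cong, simp add: sgnm_def mult_ac)+
 then have "L3 b (sgnm p) q r + L3 b p (sgnm q) r + L3 b p q (sgnm r)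
  = L3 (%x y. ?s x * b x y + ?s y * b x y + ?s (- x - y) * b x y) p q r"
  using L3_symb_add3[OF s X] by simp
 also have "... = L3 (%x y. - \<i> * (b x y * cr (sg3 x y (- x - y)))) p q r"
  by (rule L3_cong) (simp add: sg3_def algebra_simps)
 finally show ?thesis unfolding L3_symb_cmult .
qed

lemma linear_id:
 assumes f: "f : X (SS J)"
 shows "L3 (bK J) (sgnm f) f f + L3 (bK J) f (sgnm f) f + L3 (bK J) f f (sgnm f) = - \<i> * L3 (%x y. cr (TK (Suc J) x y)) f f f"
proof -
 have "bK J x y * cr (sg3 x y (- x - y)) = cr (TK (Suc J) x y)" for x y
  unfolding bK_def of_real_mult[symmetric] TK_sg3 ..
 then show ?thesis unfolding L3_sgnm[OF sym3_bK f f f] by presburger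
qed

text \<open>The 3 is the crude bound of |sg3|, so that one constant covers both the cubic rate and
  the correction.\<close>

definition CB :: "nat => real" where "CB J = 3 * BS J * 2 ^ (2 * J)"

lemma CB_nonneg [simp]: "0 <= CB J" by (simp add: CB_def)

lemma cubic_bound:
 assumes f: "f : X (SS J)"
 shows "cmod (L3 (%x y. cr (TK (Suc J) x y)) f f f) <= CB J * (3 * (l1 (mx f) * (n2 (pw (Suc J) f))^2))"
  "cmod (L3 (bK J) f f f) <= CB J * (3 * (l1 (mx f) * (n2 (pw (Suc J) f))^2))"
proof -
 have c: "0 <= BS J * 2 ^ (2 * J)" by simp
 have up: "0 <= up3 (Suc J) \<bar>x\<bar> \<bar>y\<bar> \<bar>z\<bar>" for x y z by (simp add: up3_def)
 have T: "\<bar>TK (Suc J) x y\<bar> <= CB J * up3 (Suc J) \<bar>x\<bar> \<bar>y\<bar> \<bar>- x - y\<bar>" for x y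
 proof -
  have "\<bar>TK (Suc J) x y\<bar> <= BS J * 2 ^ (2 * J) * up3 (Suc J) \<bar>x\<bar> \<bar>y\<bar> \<bar>- x - y\<bar>" by (rule TK_bound)
  also have "... <= CB J * up3 (Suc J) \<bar>x\<bar> \<bar>y\<bar> \<bar>- x - y\<bar>" unfolding CB_def mult.assoc[of 3] using mult_nonneg_nonneg[OF c up, of x y "- x - y"] by linarith
  finally show ?thesis .
 qed
 show "cmod (L3 (%x y. cr (TK (Suc J) x y)) f f f) <= CB J * (3 * (l1 (mx f) * (n2 (pw (Suc J) f))^2))"
 proof (rule L3_up3[OF f])
  show "(%(x, y). cr (TK (Suc J) x y)) : borel_measurable M2" unfolding TK_def by measurable
 qed (use T in "auto simp: norm_of_real")
 show "cmod (L3 (bK J) f f f) <= CB J * (3 * (l1 (mx f) * (n2 (pw (Suc J) f))^2))"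
 proof (rule L3_up3[OF f sym3_meas[OF sym3_bK]])
  fix x y
  have "cmod (bK J x y) = \<bar>sg3 x y (- x - y)\<bar> * \<bar>TK (Suc J) x y\<bar>"
   unfolding bK_def norm_of_real TK_def abs_mult by (simp only: mult_ac)
  also have "... <= 3 * (BS J * 2 ^ (2 * J) * up3 (Suc J) \<bar>x\<bar> \<bar>y\<bar> \<bar>- x - y\<bar>)"
   by (intro mult_mono sg3_le TK_bound) auto
  finally show "cmod (bK J x y) <= CB J * up3 (Suc J) \<bar>x\<bar> \<bar>y\<bar> \<bar>- x - y\<bar>" by (simp add: CB_def mult.assoc)
 qed simp
qed

section \<open>Energies, their rates of change, and the correction\<close>

definition en :: "nat => cfun => real" where "en K f = (n2 (pw K f))^2"
text \<open>The coefficient \<open>m1 / 3\<close> and the sign are dictated by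
  \<open>cubic_id\<close> and \<open>linear_id\<close>: the rate of this form under the linear flow
  is the negative of the cubic rate of the energy.\<close>

definition cor :: "nat => cfun => real" where "cor J f = m1 / 3 * Re (L3 (bK J) f f f)"

lemma en_nonneg [simp]: "0 <= en K f" by (simp add: en_def)

lemma en_kip: "en K f = kip (%x. x ^ K) f f"
 by (simp add: en_def kip_self pw_def[abs_def])

lemma m1_small: "0 <= a ==> m1 / 3 * (3 * a) <= a"
 using mult_right_mono[OF m1_pos(2), of a] by simp

lemma cor_bound: assumes f: "f : X (SS J)" shows "\<bar>cor J f\<bar> <= CB J * l1 (mx f) * en (Suc J) f"
proof -
 have "\<bar>cor J f\<bar> <= m1 / 3 * cmod (L3 (bK J) f f f)"
  unfolding cor_def abs_mult using m1_pos abs_Re_le_cmod by (intro mult_mono) auto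
 also have "... <= m1 / 3 * (CB J * (3 * (l1 (mx f) * (n2 (pw (Suc J) f))^2)))"
  using m1_pos by (intro mult_left_mono cubic_bound f) auto
 also have "... = m1 / 3 * (3 * (CB J * l1 (mx f) * en (Suc J) f))" by (simp add: en_def)
 also have "... <= CB J * l1 (mx f) * en (Suc J) f" by (rule m1_small) simp
 finally show ?thesis .
qed

text \<open>The rate without correction, of first order in u_x. It is sufficient on time intervals
  of bounded length, and for bounds that are allowed to grow with time.\<close>

lemma crude_rate:
 assumes f: "f : X (SS J)" "f : X (real (2 * Suc J + 2))" and h: "herm f"
 shows "\<bar>2 * kip (%w. w ^ Suc J) (Nl f) f\<bar> <= CB J * l1 (mx f) * en (Suc J) f"
proof -
 have "\<bar>2 * kip (%w. w ^ Suc J) (Nl f) f\<bar> <= cmod (\<i> * cr (m1 / 3) * L3 (%x y. cr (TK (Suc J) x y)) f f f)"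
  unfolding cubic_id[OF f(2) h] by (rule abs_Re_le_cmod)
 also have "... = m1 / 3 * cmod (L3 (%x y. cr (TK (Suc J) x y)) f f f)"
  using m1_pos by (simp add: norm_mult norm_divide)
 also have "... <= m1 / 3 * (CB J * (3 * (l1 (mx f) * (n2 (pw (Suc J) f))^2)))"
  using m1_pos by (intro mult_left_mono cubic_bound f) auto
 also have "... = m1 / 3 * (3 * (CB J * l1 (mx f) * en (Suc J) f))" by (simp add: en_def)
 also have "... <= CB J * l1 (mx f) * en (Suc J) f" by (rule m1_small) simp
 finally show ?thesis .
qed

text \<open>The quotient \<open>SP 0\<close> is 0: conservation of the L2 norm.\<close>

lemma crude_rate0: assumes f: "f : X 2" and h: "herm f" shows "kip (%w. 1) (Nl f) f = 0"
proof -
 have "2 * kip (%w. w ^ 0) (Nl f) f = Re (\<i> * cr (m1 / 3) * L3 (%x y. cr (TK 0 x y)) f f f)"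
  by (rule cubic_id) (use f h in auto)
 then show ?thesis by (simp add: TK_def L3_def case_prod_unfold)
qed

text \<open>The correction \<open>cor\<close> removes the cubic rate; \<open>w\<close> is a perturbation of the equation.\<close>

lemma modified_rate:
 assumes f: "f : XS" and h: "herm f" and w: "w : XS"
  and v: "v = (%z. sgnm f z + Nl f z + w z)"
 shows "\<bar>2 * kip (%z. z ^ Suc J) (Nl f) f + m1 / 3 * Re (L3 (bK J) v f f + L3 (bK J) f v f + L3 (bK J) f f v)\<bar>
  <= 2 * CQ J * (l1 (mx f))^2 * en (Suc J) f + 3 * BS J * c1 * (nrm (SS J) f)^2 * nrm (SS J) w"
proof -
 note Xf = XSD[OF f] and Xw = XSD[OF w]
 have XN: "Nl f : X s" "sgnm f : X s" for s by (auto intro: XSD Nl_XS f sgnm_X)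
 have XsN: "(%z. sgnm f z + Nl f z) : X s" for s by (intro X_add XN)
 note b = sym3_bK[of J]
 let ?L = "%v. L3 (bK J) v f f + L3 (bK J) f v f + L3 (bK J) f f v"
 have "?L v = ?L (%z. sgnm f z + Nl f z) + ?L w"
  unfolding v using L3_add1[OF b XsN Xw Xf Xf] L3_add2[OF b Xf XsN Xw Xf] L3_add3[OF b Xf Xf XsN Xw] by simp
 also have "?L (%z. sgnm f z + Nl f z) = ?L (sgnm f) + ?L (Nl f)"
  using L3_add1[OF b XN(2) XN(1) Xf Xf] L3_add2[OF b Xf XN(2) XN(1) Xf] L3_add3[OF b Xf Xf XN(2) XN(1)] by simp
 also have "?L (sgnm f) = - \<i> * L3 (%x y. cr (TK (Suc J) x y)) f f f" by (rule linear_id[OF Xf])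
 finally have L: "?L v = - \<i> * L3 (%x y. cr (TK (Suc J) x y)) f f f + ?L (Nl f) + ?L w" .
 have "2 * kip (%z. z ^ Suc J) (Nl f) f + m1 / 3 * Re (?L v) = m1 / 3 * Re (?L (Nl f) + ?L w)"
  unfolding cubic_id[OF Xf h] L by (simp add: algebra_simps)
 moreover have "\<bar>m1 / 3 * Re (?L (Nl f) + ?L w)\<bar> <= m1 / 3 * (cmod (?L (Nl f)) + cmod (?L w))"
 proof -
  have "\<bar>Re (?L (Nl f) + ?L w)\<bar> <= cmod (?L (Nl f)) + cmod (?L w)"
   by (rule order_trans[OF abs_Re_le_cmod norm_triangle_ineq])
  then show ?thesis using m1_pos by (simp add: abs_mult mult_left_mono)
 qed
 moreover have "cmod (?L (Nl f)) <= CQ J * (6 * ((l1 (mx f))^2 * en (Suc J) f))"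
  unfolding en_def bK_swap[OF f Nl_XS[OF f]] using quartic_bound[OF f, of J] by simp
 moreover have "cmod (?L w) <= 3 * (3 * BS J * (nrm (SS J) f * nrm (SS J) f * (c1 * nrm (SS J) w)))"
 proof -
  have "cmod (?L w) <= cmod (L3 (bK J) w f f) + cmod (L3 (bK J) f w f) + cmod (L3 (bK J) f f w)"
   by (rule order_trans[OF norm_triangle_ineq add_right_mono[OF norm_triangle_ineq]])
  also have "... <= 3 * BS J * (nrm (SS J) w * nrm (SS J) f * (c1 * nrm (SS J) f)) + 3 * BS J * (nrm (SS J) f * nrm (SS J) w * (c1 * nrm (SS J) f))
   + 3 * BS J * (nrm (SS J) f * nrm (SS J) f * (c1 * nrm (SS J) w))"
   by (intro add_mono L3_bound(2)[OF b] Xf Xw)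
  finally show ?thesis by (simp add: mult_ac)
 qed
 ultimately have "\<bar>2 * kip (%z. z ^ Suc J) (Nl f) f + m1 / 3 * Re (?L v)\<bar>
  <= m1 / 3 * (CQ J * (6 * ((l1 (mx f))^2 * en (Suc J) f)) + 3 * (3 * BS J * (nrm (SS J) f * nrm (SS J) f * (c1 * nrm (SS J) w))))"
  using m1_pos by (smt (verit) mult_left_mono divide_nonneg_nonneg)
 also have "... = m1 / 3 * (3 * (2 * CQ J * (l1 (mx f))^2 * en (Suc J) f + 3 * BS J * c1 * (nrm (SS J) f)^2 * nrm (SS J) w))"
  by (simp add: algebra_simps power2_eq_square)
 also have "... <= 2 * CQ J * (l1 (mx f))^2 * en (Suc J) f + 3 * BS J * c1 * (nrm (SS J) f)^2 * nrm (SS J) w"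
  by (rule m1_small) simp
 finally show ?thesis .
qed

section \<open>Gronwall's inequality in both directions of time\<close>

lemma gronwall_pos:
 fixes y :: "real => real"
 assumes d: "!!t. t : {0..T} ==> (y has_field_derivative y' t) (at t within {0..T})"
  and le: "!!t. t : {0..T} ==> y' t <= c * y t + e" and c: "0 < c" and e: "0 <= e" and T: "0 <= T"
 shows "y T <= (y 0 + e / c) * exp (c * T)"
proof -
 let ?g = "%r. exp (- (c * r)) * (y r + e / c)"
 have dg: "(?g has_field_derivative (exp (- (c * t)) * (y' t - (c * y t + e)))) (at t within {0..T})" if "t : {0..T}" for t
  by (rule derivative_eq_intros d[OF that] refl)+ (use c in "simp add: field_simps")
 have "?g T <= ?g 0"
 proof (rule DERIV_nonpos_imp_decreasing_open[OF T])
  fix x assume x: "0 < x" "x < T"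
  then have "at x within {0..T} = at x" by (intro at_within_interior) simp
  with dg[of x] x have "DERIV ?g x :> exp (- (c * x)) * (y' x - (c * y x + e))" by simp
  moreover have "exp (- (c * x)) * (y' x - (c * y x + e)) <= 0"
   using le[of x] x by (simp add: mult_nonneg_nonpos)
  ultimately show "\<exists>z. DERIV ?g x :> z \<and> z <= 0" by blast
 next
  show "continuous_on {0..T} ?g" using dg by (rule DERIV_continuous_on)
 qed
 then have "exp (- (c * T)) * (y T + e / c) * exp (c * T) <= (y 0 + e / c) * exp (c * T)"
  by (intro mult_right_mono) auto
 moreover have "exp (- (c * T)) * z * exp (c * T) = z" for z :: real by (simp add: exp_minus)
 ultimately have "y T + e / c <= (y 0 + e / c) * exp (c * T)" by metis
 with e c show ?thesis by (smt (verit) divide_nonneg_pos)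
qed

lemma gronwall:
 fixes y :: "real => real"
 assumes d: "!!t. t : {- A..A} ==> (y has_field_derivative y' t) (at t within {- A..A})"
  and le: "!!t. t : {- A..A} ==> \<bar>y' t\<bar> <= c * y t + e" and c: "0 < c" and e: "0 <= e" and t: "t : {- A..A}"
 shows "y t <= (y 0 + e / c) * exp (c * \<bar>t\<bar>)"
proof (cases "0 <= t")
 case True
 have "y t <= (y 0 + e / c) * exp (c * t)"
 proof (rule gronwall_pos[where y'=y'])
  fix r assume r: "r : {0..t}"
  with t True have "r : {- A..A}" by auto
  then show "(y has_field_derivative y' r) (at r within {0..t})"
   by (intro DERIV_subset[OF d]) (use t True in auto)
  show "y' r <= c * y r + e" using le[OF \<open>r : {- A..A}\<close>] by linarith
 qed (use e c True in auto)
 with True show ?thesis by simp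
next
 case False
 have "(%r. y (- r)) (- t) <= ((%r. y (- r)) 0 + e / c) * exp (c * (- t))"
 proof (rule gronwall_pos[where y'="%r. - y' (- r)"])
  fix r assume r: "r : {0..- t}"
  with t False have r': "- r : {- A..A}" by auto
  have "(y has_field_derivative y' (- r)) (at (- r) within uminus ` {0..- t})"
   by (rule DERIV_subset[OF d[OF r']]) (use t False in auto)
  then have "((y \<circ> uminus) has_field_derivative (y' (- r) * (- 1))) (at r within {0..- t})"
   by (rule DERIV_image_chain) (rule derivative_eq_intros refl | simp)+
  then show "((%r. y (- r)) has_field_derivative - y' (- r)) (at r within {0..- t})" by (simp add: o_def)
  show "- y' (- r) <= c * y (- r) + e" using le[OF r'] by linarith
 qed (use e c False in auto)
 with False show ?thesis by simp
qed

section \<open>The truncated equation\<close>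

definition ct :: "real => cfun => cfun" where
 "ct n f x = (if \<bar>x\<bar> <= n then f x else 0)"

lemma ct_eq: "ct n f = (%x. cr (indicator {- n..n} x) * f x)"
 by (rule ext) (auto simp: ct_def indicator_def abs_le_iff)

lemma ct_meas [measurable]: "meas f ==> meas (ct n f)" unfolding ct_eq by measurable

lemma ct_X: assumes "f : X s" shows "ct n f : X s" "nrm s (ct n f) <= nrm s f"
 unfolding ct_eq by (rule X_mult_le1[OF assms]; auto simp: indicator_def)+

lemma ct_ct [simp]: "ct n (ct n f) = ct n f" by (auto simp: ct_def)

lemma ct_up: assumes f: "f : X 0" and n: "0 <= n" and s: "0 <= s"
 shows "ct n f : X s" "nrm s (ct n f) <= wt s n * nrm 0 f"
proof -
 have "wt s x * cmod (ct n f x) <= wt s n * (wt 0 x * cmod (f x))" for x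
 proof (cases "\<bar>x\<bar> <= n")
  case True
  then have "x^2 <= n^2" using n by (simp add: abs_le_square_iff[symmetric])
  then have "wt s x <= wt s n" unfolding wt_def using s by (intro powr_mono2) (auto intro: add_nonneg_nonneg)
  then show ?thesis using True by (simp add: ct_def mult_right_mono)
 qed (simp add: ct_def)
 then show "ct n f : X s" "nrm s (ct n f) <= wt s n * nrm 0 f"
  using X_bound[OF f ct_meas[OF X_meas[OF f]], of s n "wt s n"] X_bound[OF f ct_meas[OF X_meas[OF f]], of s "wt s n" n] by auto
qed

lemma ct_XS: assumes f: "f : X 0" and n: "0 <= n" shows "ct n f : XS"
proof (rule XSI)
 fix s show "ct n f : X s" using ct_up(1)[OF f n, of "max s 0"] X_mono(1) by fastforce
qed

definition cn :: "real => real" where "cn n = n2 (%x. cr (indicator {- n..n} x))"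

lemma cn_nonneg [simp]: "0 <= cn n" by (simp add: cn_def)

lemma ct_bounded:
 assumes m: "meas f" and b: "!!w. \<bar>w\<bar> <= n ==> cmod (f w) <= b" and b0: "0 <= b"
 shows "ct n f : X 0" "nrm 0 (ct n f) <= b * cn n"
proof -
 have g: "(%x. cr (indicator {- n..n} x)) : L2" by (rule L2_indicator) (auto simp: emeasure_lborel_Icc_eq)
 have "ae x. cmod (ct n f x) <= b * cmod (cr (indicator {- n..n} x))"
  using b by (auto simp: ct_def indicator_def abs_le_iff)
 from L2_bound[OF g ct_meas[OF m] this b0] show "ct n f : X 0" "nrm 0 (ct n f) <= b * cn n"
  by (auto simp: X_0 nrm_0 cn_def)
qed

text \<open>Cutting off at frequency \<open>n\<close> bounds the derivative, so the truncated
  equation is an ordinary differential equation in \<open>X 0\<close> with a bounded quadratic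
  right-hand side. The bilinear form is needed for its power series.\<close>

definition BG :: "real => cfun => cfun => cfun" where
 "BG n f g = ct n (%x. - (\<i> * cr (m1 / 2) * mx (conv f g) x))"

lemma BG_bound:
 assumes f: "f : X 0" and g: "g : X 0" and n: "0 <= n"
 shows "BG n f g : X 0" "nrm 0 (BG n f g) <= n * cn n * (nrm 0 f * nrm 0 g)"
proof -
 have fg: "f : L2" "g : L2" using f g by (simp_all add: X_0)
 have [measurable]: "meas f" "meas g" using f g by (auto intro: X_meas)
 have b: "cmod (- (\<i> * cr (m1 / 2) * mx (conv f g) x)) <= n * (n2 f * n2 g)" if "\<bar>x\<bar> <= n" for x
 proof -
  have "cmod (- (\<i> * cr (m1 / 2) * mx (conv f g) x)) = (m1 / 2) * (\<bar>x\<bar> * cmod (conv f g x))"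
   using m1_pos by (simp add: norm_mult norm_mx norm_divide)
  also have "... <= 1 * (n * (n2 f * n2 g))"
   using m1_pos that n by (intro mult_mono conv_sup fg) auto
  finally show ?thesis by simp
 qed
 have m: "meas (%x. - (\<i> * cr (m1 / 2) * mx (conv f g) x))" unfolding mx_def by measurable
 have "0 <= n * (n2 f * n2 g)" using n by simp
 from ct_bounded[OF m b this] show "BG n f g : X 0" "nrm 0 (BG n f g) <= n * cn n * (nrm 0 f * nrm 0 g)"
  unfolding BG_def by (auto simp: nrm_0 mult_ac)
qed

lemma BG_diff:
 assumes "f : X 0" "g : X 0"
 shows "(%x. BG n f f x - BG n g g x) = BG n (%x. f x - g x) (%x. f x + g x)"
proof
 fix x
 note L = assms[unfolded X_0]
 have "conv (%x. f x - g x) (%x. f x + g x) x = conv f f x - conv g g x"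
  using conv_diff_left[OF L(1) L(2) L2_add[OF L]] conv_add_right[OF L(1) L(1) L(2)] conv_add_right[OF L(2) L(1) L(2)]
   conv_commute[of f g] by simp
 then show "BG n f f x - BG n g g x = BG n (%x. f x - g x) (%x. f x + g x) x"
  by (simp add: BG_def ct_def mx_def right_diff_distrib diff_divide_distrib)
qed

section \<open>Power series in time for the truncated equation\<close>

lemma X_sum: "finite A ==> (!!i. i : A ==> f i : X s) ==> (%x. \<Sum>i\<in>A. f i x) : X s"
 by (induction A rule: finite_induct) (auto intro: X_add)

lemma nrm_sum: "finite A ==> (!!i. i : A ==> f i : X s) ==> nrm s (%x. \<Sum>i\<in>A. f i x) <= (\<Sum>i\<in>A. nrm s (f i))"
proof (induction A rule: finite_induct)
 case (insert a A)
 then have "nrm s (%x. f a x + (\<Sum>i\<in>A. f i x)) <= nrm s (f a) + nrm s (%x. \<Sum>i\<in>A. f i x)"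
  by (intro nrm_triangle X_sum) auto
 with insert show ?case by simp
qed simp

lemma conv_sum_left:
 "finite A ==> (!!i. i : A ==> f i : L2) ==> g : L2 ==> conv (%x. \<Sum>i\<in>A. f i x) g x = (\<Sum>i\<in>A. conv (f i) g x)"
proof (induction A rule: finite_induct)
 case empty
 then show ?case by (simp add: conv_def)
next
 case (insert a A)
 have "(%x. \<Sum>i\<in>A. f i x) : L2" using X_sum[of A f 0] insert by (simp add: X_0)
 with insert show ?case by (simp add: conv_add_left)
qed

lemma BG_sum:
 assumes A: "finite A" "finite B" and f: "!!i. i : A ==> f i : X 0" and g: "!!i. i : B ==> g i : X 0"
 shows "BG n (%x. \<Sum>i\<in>A. cr (a i) * f i x) (%x. \<Sum>i\<in>B. cr (b i) * g i x) x
  = (\<Sum>i\<in>A. \<Sum>j\<in>B. cr (a i * b j) * BG n (f i) (g j) x)"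
proof -
 let ?f = "%i x. cr (a i) * f i x" and ?g = "%i x. cr (b i) * g i x"
 have f': "?f i : L2" if "i : A" for i using X_cmult[OF f[OF that]] by (simp add: X_0)
 have g': "?g i : L2" if "i : B" for i using X_cmult[OF g[OF that]] by (simp add: X_0)
 have sg: "(%x. \<Sum>i\<in>B. ?g i x) : L2" using X_sum[OF A(2), of ?g 0] g' by (simp add: X_0)
 have "conv (%x. \<Sum>i\<in>A. ?f i x) (%x. \<Sum>i\<in>B. ?g i x) x = (\<Sum>i\<in>A. conv (?f i) (%x. \<Sum>i\<in>B. ?g i x) x)"
  by (rule conv_sum_left[OF A(1) f' sg])
 also have "... = (\<Sum>i\<in>A. \<Sum>j\<in>B. cr (a i * b j) * conv (f i) (g j) x)"
 proof (rule sum.cong[OF refl])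
  fix i assume i: "i : A"
  have "conv (?f i) (%x. \<Sum>i\<in>B. ?g i x) x = (\<Sum>j\<in>B. conv (?g j) (?f i) x)"
   unfolding conv_commute[of "?f i"] by (rule conv_sum_left[OF A(2) g' f'[OF i]])
  also have "... = (\<Sum>j\<in>B. cr (a i * b j) * conv (f i) (g j) x)"
   by (intro sum.cong refl) (simp add: conv_cmult_left conv_cmult_right conv_commute[of "f i"] mult_ac)
  finally show "conv (?f i) (%x. \<Sum>i\<in>B. ?g i x) x = (\<Sum>j\<in>B. cr (a i * b j) * conv (f i) (g j) x)" .
 qed
 finally have c: "conv (%x. \<Sum>i\<in>A. ?f i x) (%x. \<Sum>i\<in>B. ?g i x) x = (\<Sum>i\<in>A. \<Sum>j\<in>B. cr (a i * b j) * conv (f i) (g j) x)" .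
 show ?thesis
  unfolding BG_def ct_def mx_def c by (simp add: sum_distrib_left sum_negf[symmetric] mult_ac)
qed

lemma conv_herm: assumes "herm f" "herm g" and [measurable]: "meas f" "meas g" shows "conv f g (- w) = cnj (conv f g w)"
proof -
 let ?f = "%x. cnj (f (- x))" and ?g = "%x. cnj (g (- x))"
 have "conv f g = conv ?f ?g"
  using assms(1,2) by (intro conv_cong_AE) (auto simp: herm_def elim: eventually_mono)
 then have "conv f g (- w) = (LBINT y. cnj (f (w + y) * g (- y)))" by (simp add: conv_def add.commute)
 also have "... = cnj (LBINT y. f (w + y) * g (- y))" by (simp only: Bochner_Integration.integral_cnj)
 also have "(LBINT y. f (w + y) * g (- y)) = conv f g w"
  unfolding conv_def using lborel_integral_real_affine[of "-1" "%y. f (w - y) * g y" 0] by simp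
 finally show ?thesis .
qed

lemma sgnm_herm: "herm f ==> herm (sgnm f)"
 unfolding herm_def by (elim eventually_mono) (simp add: sgnm_def)

lemma BG_herm: assumes "herm f" "herm g" "meas f" "meas g" shows "herm (BG n f g)"
 unfolding herm_def BG_def ct_def mx_def using conv_herm[OF assms] by simp

lemma ct_herm: "herm f ==> herm (ct n f)"
 unfolding herm_def by (elim eventually_mono) (simp add: ct_def)

lemma herm_add: assumes "herm f" "herm g" shows "herm (%x. f x + g x)"
 using assms unfolding herm_def by eventually_elim simp

lemma herm_cmult: assumes "herm f" shows "herm (%x. cr a * f x)"
 using assms unfolding herm_def by eventually_elim simp

lemma herm_sum: "finite A ==> (!!i. i : A ==> herm (f i)) ==> herm (%x. \<Sum>i\<in>A. f i x)"
 by (induction A rule: finite_induct) (auto intro: herm_add simp: herm_def[of "%x. 0"])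

text \<open>Taylor coefficients in time of the solution of the truncated equation.\<close>

fun tc :: "real => cfun => nat => cfun" where
 "tc n f0 0 = f0"
| "tc n f0 (Suc j) = (%x. cr (1 / real (Suc j)) * (sgnm (tc n f0 j) x + (\<Sum>i\<le>j. BG n (tc n f0 i) (tc n f0 (j - i)) x)))"

text \<open>The Cauchy product behind coefficient j + 1 has j + 1 terms of equal size, and the
  factor 1 / (j + 1) absorbs their number. Growth is therefore geometric, with a ratio that depends
  on the data only through \<open>M\<close>.\<close>

lemma tc_bound:
 assumes f0: "f0 : X 0" and n: "0 <= n" and M: "nrm 0 f0 <= M"
 shows "tc n f0 j : X 0 \<and> nrm 0 (tc n f0 j) <= M * (1 + n * cn n * M) ^ j"
proof (induction j rule: less_induct)
 case (less j)
 define k where "k = n * cn n"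
 have k0: "0 <= k" using n by (simp add: k_def)
 have M0: "0 <= M" using nrm_nonneg[of 0 f0] M by linarith
 define K where "K = 1 + k * M"
 have K0: "0 <= K" unfolding K_def using k0 M0 by simp
 show ?case
 proof (cases j)
  case 0
  then show ?thesis using f0 M by simp
 next
  case (Suc i)
  have IH: "tc n f0 l : X 0" "nrm 0 (tc n f0 l) <= M * K ^ l" if "l <= i" for l
   using less[of l] that Suc by (simp_all add: K_def k_def)
  have x: "sgnm (tc n f0 i) : X 0" "nrm 0 (sgnm (tc n f0 i)) <= M * K ^ i"
   using sgnm_X[OF IH(1)[of i]] IH(2)[of i] by auto
  have y: "BG n (tc n f0 l) (tc n f0 (i - l)) : X 0" "nrm 0 (BG n (tc n f0 l) (tc n f0 (i - l))) <= k * M * (M * K ^ i)" if "l <= i" for l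
  proof -
   note b = BG_bound[OF IH(1)[OF that] IH(1)[of "i - l"] n]
   show "BG n (tc n f0 l) (tc n f0 (i - l)) : X 0" using b(1) by simp
   have "nrm 0 (BG n (tc n f0 l) (tc n f0 (i - l))) <= k * (nrm 0 (tc n f0 l) * nrm 0 (tc n f0 (i - l)))"
    using b(2) by (simp add: k_def)
   also have "... <= k * ((M * K ^ l) * (M * K ^ (i - l)))"
    using k0 M0 K0 IH(2)[OF that] IH(2)[of "i - l"] by (intro mult_left_mono mult_mono) auto
   also have "... = k * M * (M * (K ^ l * K ^ (i - l)))" by (simp only: mult_ac)
   also have "K ^ l * K ^ (i - l) = K ^ i" using that by (simp add: power_add[symmetric])
   finally show "nrm 0 (BG n (tc n f0 l) (tc n f0 (i - l))) <= k * M * (M * K ^ i)" .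
  qed
  let ?S = "%w. \<Sum>l\<le>i. BG n (tc n f0 l) (tc n f0 (i - l)) w"
  have S: "?S : X 0" by (rule X_sum) (auto intro: y)
  have "nrm 0 ?S <= (\<Sum>l\<le>i. nrm 0 (BG n (tc n f0 l) (tc n f0 (i - l))))" by (rule nrm_sum) (auto intro: y)
  also have "... <= (\<Sum>l\<le>i. k * M * (M * K ^ i))" by (intro sum_mono y) auto
  finally have S2: "nrm 0 ?S <= real (Suc i) * (k * M * (M * K ^ i))" by simp
  have t: "tc n f0 j : X 0" unfolding Suc tc.simps by (intro X_cmult X_add x S)
  have "nrm 0 (tc n f0 j) = (1 / real (Suc i)) * nrm 0 (%w. sgnm (tc n f0 i) w + ?S w)"
   unfolding Suc tc.simps nrm_cmult norm_of_real by (simp del: of_nat_Suc)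
  also have "... <= (1 / real (Suc i)) * (real (Suc i) * (M * K ^ i) + real (Suc i) * (k * M * (M * K ^ i)))"
  proof (rule mult_left_mono)
   have "M * K ^ i <= real (Suc i) * (M * K ^ i)" using M0 K0 mult_right_mono[of 1 "real (Suc i)" "M * K ^ i"] by simp
   with nrm_triangle[OF x(1) S] x(2) S2 show "nrm 0 (%w. sgnm (tc n f0 i) w + ?S w) <= real (Suc i) * (M * K ^ i) + real (Suc i) * (k * M * (M * K ^ i))"
    by linarith
  qed simp
  also have "... = (1 / real (Suc i) * real (Suc i)) * (M * K ^ i + k * M * (M * K ^ i))" by (simp only: distrib_left mult.assoc)
  also have "... = M * K ^ Suc i" by (simp add: K_def algebra_simps)
  finally show ?thesis using t Suc by (simp add: K_def k_def)
 qed
qed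

lemma tc_herm: assumes "herm f0" "f0 : X 0" "0 <= n" shows "herm (tc n f0 j)"
proof (induction j rule: less_induct)
 case (less j)
 have m: "meas (tc n f0 i)" for i using tc_bound[OF assms(2,3) order_refl] X_meas by blast
 show ?case
 proof (cases j)
  case (Suc i)
  then have "herm (tc n f0 l)" if "l <= i" for l using less that by simp
  then show ?thesis unfolding Suc tc.simps by (intro herm_cmult herm_add sgnm_herm herm_sum BG_herm m) auto
 qed (use assms in simp)
qed

lemma tc_ct: "ct n f0 = f0 ==> ct n (tc n f0 j) = tc n f0 j"
proof (induction j)
 case (Suc j)
 then have "!!x. n < \<bar>x\<bar> ==> tc n f0 j x = 0" by (metis ct_def not_le)
 then show ?case by (auto simp: ct_def sgnm_def BG_def)
qed simp

lemma Xderiv_sum: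
 assumes "finite A" "!!i. i : A ==> Xderiv I s (f i) (v i)"
 shows "Xderiv I s (%t x. \<Sum>i\<in>A. f i t x) (%t x. \<Sum>i\<in>A. v i t x)"
 using assms
proof (induction A rule: finite_induct)
 case empty
 show ?case using Xderiv_const[of "%x. 0" s I] by simp
next
 case (insert a A)
 then show ?case using Xderiv_lin[of I s "f a" "v a" "%t x. \<Sum>i\<in>A. f i t x" "%t x. \<Sum>i\<in>A. v i t x" 1 1] by simp
qed

text \<open>One passage to the limit for three schemes: Taylor polynomials, band-limited solutions,
  and smooth solutions with truncated data. The approximations may solve the equation up to the
  error in \<open>err\<close>; the Lipschitz bound of \<open>P\<close> converts convergence in
  \<open>X r\<close> into convergence of the derivatives in \<open>X s\<close>, where s < r absorbs
  a derivative lost by \<open>P\<close>.\<close>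

lemma Xderiv_limit:
 fixes G :: "nat => real => cfun"
 assumes I: "convex I" and s: "0 <= s" "s <= r" and Gc: "!!i. Xcont I r (G i)" and GB: "!!i t. t : I ==> nrm r (G i t) <= B" and B: "0 <= B"
  and Gh: "!!i t. t : I ==> herm (G i t)" and GD: "!!i. Xderiv I s (G i) (v i)"
  and P: "!!f. f : X r ==> P f : X s"
  and PL: "!!f g. f : X r ==> g : X r ==> nrm r f <= B ==> nrm r g <= B ==> nd s (P f) (P g) <= L * nd r f g"
  and err: "!!d. 0 < d ==> \<exists>K. \<forall>i\<ge>K. \<forall>t\<in>I. nd s (v i t) (P (G i t)) < d"
  and C: "!!d. 0 < d ==> \<exists>K. \<forall>i\<ge>K. \<forall>j\<ge>K. \<forall>t\<in>I. nd r (G i t) (G j t) < d"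
 obtains F where "Xcont I r F" "Xderiv I s F (%t. P (F t))" "Xcont I s (%t. P (F t))" "!!t. t : I ==> herm (F t)"
  "!!d. 0 < d ==> \<exists>K. \<forall>i\<ge>K. \<forall>t\<in>I. nd r (G i t) (F t) < d"
  "!!t q h c N. t : I ==> (!!i. G i t : X q) ==> h : X q ==> 0 <= c ==> (!!j. j \<ge> N ==> nd q (G j t) h <= c) ==> F t : X q \<and> nd q (F t) h <= c"
  "!!t w c. t : I ==> (!!i. G i t w = c) ==> F t w = c"
proof -
 have GX: "G i t : X r" if "t : I" for i t by (rule XcontD[OF Gc that])
 let ?Q = "%t H. herm H \<and> (\<forall>q h c N. (\<forall>i. G i t : X q) \<longrightarrow> h : X q \<longrightarrow> 0 <= c \<longrightarrow> (\<forall>j\<ge>N. nd q (G j t) h <= c) \<longrightarrow> H : X q \<and> nd q H h <= c)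
  \<and> (\<forall>w c. (\<forall>i. G i t w = c) \<longrightarrow> H w = c)"
 have "\<forall>t\<in>I. \<exists>H. ?Q t H"
 proof
  fix t assume t: "t : I"
  have G0: "G i t : X 0" for i using X_mono(1)[OF GX[OF t], of 0 i] s by simp
  have G00: "nd 0 (G i t) (G j t) <= nd r (G i t) (G j t)" for i j
   using s by (intro X_mono(2)[OF X_diff[OF GX[OF t] GX[OF t]]]) simp
  have Cd: "\<exists>N. \<forall>i\<ge>N. \<forall>j\<ge>N. nd 0 (G i t) (G j t) < d" if "0 < d" for d
   using C[OF that] G00 t by (meson order_le_less_trans)
  obtain H where lim: "!!q c h N. (!!j. j \<ge> N ==> G j t : X q) ==> h : X q ==> 0 <= c ==> (!!j. j \<ge> N ==> nd q (G j t) h <= c) ==>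
    H : X q \<and> nd q H h <= c"
   and h: "(!!N. ae w. G N t (- w) = cnj (G N t w)) ==> ae w. H (- w) = cnj (H w)"
   and e: "\<forall>x c. (\<forall>i. G i t x = c) \<longrightarrow> H x = c"
  proof (rule X_complete[of "%N. G N t"])
  qed (use G0 Cd in auto)
  have "herm H" using h Gh[OF t] unfolding herm_def by blast
  have "\<forall>q h c N. (\<forall>i. G i t : X q) \<longrightarrow> h : X q \<longrightarrow> 0 <= c \<longrightarrow> (\<forall>j\<ge>N. nd q (G j t) h <= c) \<longrightarrow> H : X q \<and> nd q H h <= c"
   using lim by blast
  with e \<open>herm H\<close> show "\<exists>H. ?Q t H" by blast
 qed
 from bchoice[OF this] obtain F where "\<forall>t\<in>I. ?Q t (F t)" ..
 then have FQ: "?Q t (F t)" if "t : I" for t using that by (rule bspec)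
 have fat: "F t : X q \<and> nd q (F t) h <= c" if "t : I" "!!i. G i t : X q" "h : X q" "0 <= c" "!!j. j \<ge> N ==> nd q (G j t) h <= c" for t q h c N
  using FQ[OF that(1), THEN conjunct2, THEN conjunct1, rule_format, of q h c N] that by blast
 have FX: "F t : X r" and FB: "nrm r (F t) <= B" if "t : I" for t
  using fat[OF that GX[OF that] X_zero B, of 0] GB[OF that] by simp_all
 have lim: "\<exists>K. \<forall>i\<ge>K. \<forall>t\<in>I. nd r (G i t) (F t) < d" if d: "0 < d" for d
 proof -
  obtain K where K: "\<forall>i\<ge>K. \<forall>j\<ge>K. \<forall>t\<in>I. nd r (G i t) (G j t) < d / 2" using C[of "d / 2"] d by auto
  have "nd r (G i t) (F t) < d" if i: "K <= i" and t: "t : I" for i t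
   using fat[OF t GX[OF t] GX[OF t, of i], of "d / 2" K] K i t d nrm_minus_commute[of r "F t" "G i t"] by (fastforce simp: less_imp_le)
  then show ?thesis by blast
 qed
 have Fc: "Xcont I r F" by (rule Xcont_lim[OF Gc FX lim])
 have Vc: "Xcont I s (%t. P (F t))"
  unfolding Xcont_def
 proof (intro conjI ballI P FX)
  fix t assume t: "t : I"
  have "((%p. L * nd r (F p) (F t)) ---> 0) (at t within I)"
   using Fc t by (intro tendsto_mult_right_zero) (simp add: Xcont_def)
  then show "((%p. nd s (P (F p)) (P (F t))) ---> 0) (at t within I)"
   by (rule squeeze0) (use eventually_within_in[of I t] PL[OF FX FX FB FB] t in "auto elim: eventually_mono")
 qed
 have X0: "f : X r ==> f : X s" "f : X r ==> nrm s f <= nrm r f" for f using X_mono[of f r s] s by auto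
 have "Xderiv I s F (%t. P (F t))"
 proof (rule Xderiv_lim[OF I GD X0(1)[OF FX] Vc])
  fix d :: real assume d: "0 < d"
  show "\<exists>N. \<forall>n\<ge>N. nd s (G n t) (F t) < d" if t: "t : I" for t
   using lim[OF d] X0(2)[OF X_diff[OF GX[OF t] FX[OF t]]] t by (meson order_le_less_trans)
  define M where "M = \<bar>L\<bar> + 1"
  have M: "0 < M" "L <= M" by (simp_all add: M_def)
  obtain K where K: "\<forall>i\<ge>K. \<forall>t\<in>I. nd r (G i t) (F t) < d / (2 * M)"
   using lim[of "d / (2 * M)"] d M by auto
  obtain K' where K': "\<forall>i\<ge>K'. \<forall>t\<in>I. nd s (v i t) (P (G i t)) < d / 2"
   using err[of "d / 2"] d by auto
  have "nd s (v i t) (P (F t)) < d" if i: "max K K' <= i" and t: "t : I" for i t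
  proof -
   let ?D = "nd r (G i t) (F t)"
   have "nd s (v i t) (P (F t)) <= nd s (v i t) (P (G i t)) + nd s (P (G i t)) (P (F t))"
    by (intro nrm_triangle3 P XderivD(2)[OF GD] GX FX t)
   moreover have "nd s (P (G i t)) (P (F t)) <= M * ?D"
    using PL[OF GX FX GB FB] M(2) t by (meson mult_right_mono nrm_nonneg order_trans)
   moreover have "?D < d / (2 * M)" "nd s (v i t) (P (G i t)) < d / 2" using K K' i t by auto
   moreover have "M * ?D < d / 2" using calculation(3) M by (simp add: field_simps)
   ultimately show ?thesis by linarith
  qed
  then show "\<exists>N. \<forall>n\<ge>N. \<forall>t\<in>I. nd s (v n t) (P (F t)) < d" by blast
 qed simp
 then show ?thesis by (rule that[OF Fc _ Vc _ lim fat]) (use FQ in blast)+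
qed

lemma sum_half: "N <= N' ==> (\<Sum>j\<in>{N..<N'}. (1/2::real) ^ j) <= 2 * (1/2) ^ N"
proof -
 assume "N <= N'"
 then have "(\<Sum>j\<in>{N..<N'}. (1/2::real) ^ j) = 2 * (1/2) ^ N - 2 * (1/2) ^ N'"
  by (induction N' rule: dec_induct) auto
 then show ?thesis by simp
qed

text \<open>The partial sums solve the equation up to the terms \<open>R\<close> of the product of
  two partial sums whose total degree is \<open>N\<close> or more. There are at most N^2 <= 4^N of
  them, each of size 8^(-N) up to a constant, which is why the ratio is required to be at most
  1/8.\<close>

lemma gal_local:
 assumes f0: "f0 : X 0" "ct n f0 = f0" "herm f0" and n: "0 <= n" and M: "nrm 0 f0 <= M"
  and T: "(1 + n * cn n * M) * T <= 1/8" "0 <= T"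
 obtains F where "F 0 = f0" "Xderiv {- T..T} 0 F (%t x. sgnm (F t) x + BG n (F t) (F t) x)"
  "!!t. t : {- T..T} ==> ct n (F t) = F t" "!!t. t : {- T..T} ==> herm (F t)"
proof -
 define k where "k = n * cn n"
 have k0: "0 <= k" using n by (simp add: k_def)
 have M0: "0 <= M" using nrm_nonneg[of 0 f0] M by linarith
 define K where "K = 1 + k * M"
 have K0: "0 <= K" unfolding K_def using k0 M0 by simp
 let ?a = "tc n f0"
 note tb = tc_bound[OF f0(1) n M, folded k_def, folded K_def]
 have a: "?a j : X 0" "nrm 0 (?a j) <= M * K ^ j" for j using tb by auto
 define S where "S N t x = (\<Sum>j<N. cr (t ^ j) * ?a j x)" for N t x
 have SX: "S N t : X 0" for N t unfolding S_def by (intro X_sum X_cmult a) auto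
 have Kt: "(K * \<bar>t\<bar>) ^ j <= (1/8) ^ j" if "t : {- T..T}" for t j
 proof (rule power_mono)
  have "K * \<bar>t\<bar> <= K * T" using that K0 by (intro mult_left_mono) auto
  also have "... <= 1/8" using T by (simp add: K_def k_def)
  finally show "K * \<bar>t\<bar> <= 1/8" .
 qed (use K0 in simp)
 have le8: "(1/8::real) ^ j <= (1/2) ^ j" for j by (rule power_mono) auto
 have at: "nrm 0 (%x. cr (t ^ j) * ?a j x) <= M * (1/2) ^ j" if t: "t : {- T..T}" for t j
 proof -
  have "nrm 0 (%x. cr (t ^ j) * ?a j x) = \<bar>t\<bar> ^ j * nrm 0 (?a j)"
   unfolding nrm_cmult norm_of_real power_abs ..
  also have "... <= \<bar>t\<bar> ^ j * (M * K ^ j)" by (intro mult_left_mono a) auto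
  also have "... = M * (K * \<bar>t\<bar>) ^ j" by (simp add: power_mult_distrib)
  also have "... <= M * (1/2) ^ j" using Kt[OF t, of j] le8[of j] M0 by (intro mult_left_mono) auto
  finally show ?thesis .
 qed
 have SS: "nd 0 (S N' t) (S N t) <= 2 * M * (1/2) ^ N" if t: "t : {- T..T}" and N: "N <= N'" for t N N'
 proof -
  have "{..<N'} = {..<N} \<union> {N..<N'}" using N by auto
  then have "S N' t x = S N t x + (\<Sum>j\<in>{N..<N'}. cr (t ^ j) * ?a j x)" for x
   unfolding S_def by (simp add: sum.union_disjoint ivl_disj_int)
  then have "nd 0 (S N' t) (S N t) = nrm 0 (%x. \<Sum>j\<in>{N..<N'}. cr (t ^ j) * ?a j x)" by simp
  also have "... <= (\<Sum>j\<in>{N..<N'}. nrm 0 (%x. cr (t ^ j) * ?a j x))"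
   by (intro nrm_sum X_cmult a) auto
  also have "... <= (\<Sum>j\<in>{N..<N'}. M * (1/2) ^ j)" by (intro sum_mono at t)
  also have "... <= M * (2 * (1/2) ^ N)" unfolding sum_distrib_left[symmetric] using M0 N by (intro mult_left_mono sum_half)
  finally show ?thesis by simp
 qed
 have pow0: "\<exists>N. \<forall>i\<ge>N. c * (1/2) ^ i < e" if "0 < e" "0 <= c" for c e :: real
 proof -
  have "0 < e / (c + 1)" using that by (intro divide_pos_pos) auto
  then have "\<exists>N. (1/2::real) ^ N < e / (c + 1)" by (rule real_arch_pow_inv) simp
  then obtain N where N: "(1/2::real) ^ N < e / (c + 1)" by blast
  have "c * (1/2) ^ i < e" if "N <= i" for i
  proof -
   have "(1/2::real) ^ i <= (1/2) ^ N" using that by (intro power_decreasing) auto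
   then have "(c + 1) * (1/2) ^ i < (c + 1) * (e / (c + 1))"
    using \<open>0 <= c\<close> by (intro mult_strict_left_mono order_le_less_trans[OF _ N]) simp_all
   then have "(c + 1) * (1/2) ^ i < e" using \<open>0 <= c\<close> by simp
   moreover have "c * (1/2) ^ i <= (c + 1) * (1/2) ^ i" by (intro mult_right_mono) auto
   ultimately show ?thesis by linarith
  qed
  then show ?thesis by blast
 qed
 have hS: "herm (S N t)" for N t unfolding S_def by (intro herm_sum herm_cmult tc_herm f0 n) auto
 \<comment> \<open>The derivative of the partial sum with \<open>Suc N\<close> terms, so that it
   matches the equation for \<open>N\<close> terms. At j = 0 the truncated exponent
   \<open>j - 1\<close> does no harm because the factor \<open>real j\<close> is 0.\<close>
 define v where "v N t x = (\<Sum>j<Suc N. cr (real j * t ^ (j - 1)) * ?a j x)" for N t x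
 have D: "Xderiv {- T..T} 0 (S (Suc N)) (v N)" for N
  unfolding S_def[abs_def] v_def[abs_def]
 proof (intro Xderiv_sum Xderiv_scale a)
  fix j t show "((%t. t ^ j) has_field_derivative real j * t ^ (j - 1)) (at t within {- T..T})"
   by (rule derivative_eq_intros refl)+ simp
 qed simp
 let ?B = "%i j. BG n (?a i) (?a j)"
 have B: "?B i j : X 0" "nrm 0 (?B i j) <= k * (nrm 0 (?a i) * nrm 0 (?a j))" for i j
  using BG_bound[OF a(1) a(1) n] by (auto simp: k_def)
 define R where "R N t x = (\<Sum>p\<in>{..<N} \<times> {..<N} - {(i, j). i + j < N}. cr (t ^ fst p * t ^ snd p) * ?B (fst p) (snd p) x)" for N t x
 have v_eq: "v N t x = sgnm (S N t) x + (BG n (S N t) (S N t) x - R N t x)" for N t x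
 proof -
  have "v N t x = (\<Sum>j<N. cr (real (Suc j) * t ^ j) * ?a (Suc j) x)"
   unfolding v_def sum.lessThan_Suc_shift by simp
  also have "... = (\<Sum>j<N. cr (t ^ j) * (sgnm (?a j) x + (\<Sum>i\<le>j. ?B i (j - i) x)))"
  proof (rule sum.cong[OF refl])
   fix j
   have "cr (real (Suc j) * t ^ j) * cr (1 / real (Suc j)) = cr (t ^ j)"
    unfolding of_real_mult[symmetric] by (simp del: of_nat_Suc)
   then show "cr (real (Suc j) * t ^ j) * ?a (Suc j) x = cr (t ^ j) * (sgnm (?a j) x + (\<Sum>i\<le>j. ?B i (j - i) x))"
    unfolding tc.simps mult.assoc[symmetric] by simp
  qed
  also have "... = (\<Sum>j<N. cr (t ^ j) * sgnm (?a j) x) + (\<Sum>j<N. \<Sum>i\<le>j. cr (t ^ i * t ^ (j - i)) * ?B i (j - i) x)"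
   by (simp add: distrib_left sum.distrib sum_distrib_left power_add[symmetric] del: of_real_power)
  also have "(\<Sum>j<N. cr (t ^ j) * sgnm (?a j) x) = sgnm (S N t) x"
   by (simp add: sgnm_def S_def sum_distrib_left sum_negf[symmetric] mult_ac)
  also have "(\<Sum>j<N. \<Sum>i\<le>j. cr (t ^ i * t ^ (j - i)) * ?B i (j - i) x)
   = (\<Sum>p\<in>{(i, j). i + j < N}. cr (t ^ fst p * t ^ snd p) * ?B (fst p) (snd p) x)"
   using sum.triangle_reindex[of "%i j. cr (t ^ i * t ^ j) * ?B i j x" N] by (simp add: case_prod_unfold)
  also have "... = (\<Sum>p\<in>{..<N} \<times> {..<N}. cr (t ^ fst p * t ^ snd p) * ?B (fst p) (snd p) x) - R N t x"
   unfolding R_def by (subst sum_diff) auto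
  also have "(\<Sum>p\<in>{..<N} \<times> {..<N}. cr (t ^ fst p * t ^ snd p) * ?B (fst p) (snd p) x)
   = (\<Sum>i<N. \<Sum>j<N. cr (t ^ i * t ^ j) * ?B i j x)"
   unfolding sum.cartesian_product by (simp add: case_prod_unfold)
  also have "... = BG n (S N t) (S N t) x"
   unfolding S_def by (rule BG_sum[symmetric]) (auto intro: a)
  finally show ?thesis .
 qed
 have RX: "R N t : X 0" for N t unfolding R_def by (intro X_sum X_cmult B) auto
 have R: "nrm 0 (R N t) <= k * M^2 * (1/2) ^ N" if t: "t : {- T..T}" for N t
 proof -
  let ?A = "{..<N} \<times> {..<N} - {(i, j). i + j < N}"
  have "nrm 0 (R N t) <= (\<Sum>p\<in>?A. nrm 0 (%x. cr (t ^ fst p * t ^ snd p) * ?B (fst p) (snd p) x))"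
   unfolding R_def by (intro nrm_sum X_cmult B) auto
  also have "... <= (\<Sum>p\<in>?A. k * M^2 * (1/8) ^ N)"
  proof (rule sum_mono)
   fix p assume "p : ?A"
   then have p: "N <= fst p + snd p" by auto
   have "nrm 0 (%x. cr (t ^ fst p * t ^ snd p) * ?B (fst p) (snd p) x) = \<bar>t\<bar> ^ fst p * \<bar>t\<bar> ^ snd p * nrm 0 (?B (fst p) (snd p))"
    unfolding nrm_cmult norm_of_real abs_mult power_abs ..
   also have "... <= \<bar>t\<bar> ^ fst p * \<bar>t\<bar> ^ snd p * (k * ((M * K ^ fst p) * (M * K ^ snd p)))"
    using k0 M0 K0 by (intro mult_left_mono order_trans[OF B(2)] mult_mono a) auto
   also have "... = k * M^2 * (K * \<bar>t\<bar>) ^ (fst p + snd p)"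
    by (simp add: power_mult_distrib power_add power2_eq_square mult_ac)
   also have "... <= k * M^2 * (1/8) ^ N"
   proof (rule mult_left_mono)
    have "(1/8::real) ^ (fst p + snd p) <= (1/8) ^ N" using p by (intro power_decreasing) auto
    with Kt[OF t, of "fst p + snd p"] show "(K * \<bar>t\<bar>) ^ (fst p + snd p) <= (1/8) ^ N" by linarith
   qed (use k0 in simp)
   finally show "nrm 0 (%x. cr (t ^ fst p * t ^ snd p) * ?B (fst p) (snd p) x) <= k * M^2 * (1/8) ^ N" .
  qed
  also have "... = real (card ?A) * (k * M^2 * (1/8) ^ N)" by simp
  also have "... <= (2 ^ N * 2 ^ N) * (k * M^2 * (1/8) ^ N)"
  proof (rule mult_right_mono)
   have "card ?A <= card ({..<N} \<times> {..<N})" by (intro card_mono) auto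
   then have "real (card ?A) <= real N * real N" by (simp add: card_cartesian_product flip: of_nat_mult)
   also have "... <= 2 ^ N * 2 ^ N" by (intro mult_mono less_imp_le[OF of_nat_less_two_power]) auto
   finally show "real (card ?A) <= 2 ^ N * 2 ^ N" .
  qed (use k0 in simp)
  also have "... = k * M^2 * (2 * 2 * (1/8)) ^ N" unfolding power_mult_distrib by (simp only: mult_ac)
  finally show ?thesis by simp
 qed
 let ?P = "%f x. sgnm f x + BG n f f x"
 define L where "L = 1 + k * (4 * M)"
 have PL: "nd 0 (?P f) (?P g) <= L * nd 0 f g"
  if fg: "f : X 0" "g : X 0" "nrm 0 f <= 2 * M" "nrm 0 g <= 2 * M" for f g
 proof -
  let ?D = "%x. f x - g x" and ?S = "%x. f x + g x"
  have DX: "?D : X 0" "?S : X 0" by (intro X_diff X_add fg)+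
  have "nrm 0 (BG n ?D ?S) <= k * (nrm 0 ?D * nrm 0 ?S)" using BG_bound(2)[OF DX n] by (simp add: k_def)
  also have "... <= k * (nrm 0 ?D * (4 * M))" using k0 nrm_triangle[OF fg(1,2)] fg(3,4) by (intro mult_left_mono) auto
  finally have "nrm 0 (sgnm ?D) + nrm 0 (BG n ?D ?S) <= L * nrm 0 ?D"
   using sgnm_X(2)[OF DX(1)] by (simp add: L_def algebra_simps)
  moreover have "(%x. ?P f x - ?P g x) = (%x. sgnm ?D x + BG n ?D ?S x)"
   unfolding BG_diff[OF fg(1,2), symmetric] by (auto simp: sgnm_def algebra_simps)
  ultimately show ?thesis using nrm_triangle[OF sgnm_X(1)[OF DX(1)] BG_bound(1)[OF DX n]] by simp
 qed
 have PX: "?P f : X 0" if "f : X 0" for f by (intro X_add sgnm_X BG_bound that n)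
 have Sn: "nrm 0 (S N t) <= 2 * M" if "t : {- T..T}" for N t using SS[OF that, of 0 N] by (simp add: S_def[of 0])
 define C where "C = L * (2 * M) + k * M^2"
 have L0: "0 <= L" using k0 M0 by (simp add: L_def)
 have C0: "0 <= C" using k0 M0 L0 by (simp add: C_def)
 have vV: "nrm 0 (%x. v N t x - ?P (S (Suc N) t) x) <= C * (1/2) ^ N" if t: "t : {- T..T}" for N t
 proof -
  let ?E = "%x. ?P (S N t) x - ?P (S (Suc N) t) x"
  have "(%x. v N t x - ?P (S (Suc N) t) x) = (%x. ?E x - R N t x)" by (auto simp: v_eq)
  then have "nrm 0 (%x. v N t x - ?P (S (Suc N) t) x) <= nrm 0 ?E + nrm 0 (R N t)"
   using nrm_triangle_diff[OF X_diff[OF PX[OF SX[of N t]] PX[OF SX[of "Suc N" t]]] RX[of N t]] by simp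
  also have "... <= L * (2 * M * (1/2) ^ N) + k * M^2 * (1/2) ^ N"
   using SS[OF t, of N "Suc N"] nrm_minus_commute[of 0 "S (Suc N) t" "S N t"] L0
   by (intro add_mono R t order_trans[OF PL[OF SX SX Sn[OF t] Sn[OF t]]] mult_left_mono) auto
  finally show ?thesis by (simp add: C_def algebra_simps)
 qed
 obtain F where F: "Xderiv {- T..T} 0 F (%t. ?P (F t))" "!!t. t : {- T..T} ==> herm (F t)"
  and Fe: "!!t x c. t : {- T..T} ==> (!!i. S (Suc i) t x = c) ==> F t x = c"
 proof (rule Xderiv_limit[where G="%N. S (Suc N)" and P="?P" and I="{- T..T}", OF _ order_refl order_refl Xderiv_Xcont[OF D] Sn _ hS D PX PL])
  fix e :: real assume e: "0 < e"
  show "\<exists>N. \<forall>i\<ge>N. \<forall>t\<in>{- T..T}. nrm 0 (%x. v i t x - ?P (S (Suc i) t) x) < e"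
   using pow0[OF e C0] vV by (meson order_le_less_trans)
  obtain N where N: "\<forall>i\<ge>N. 2 * M * (1/2) ^ i < e" using pow0[OF e, of "2 * M"] M0 by auto
  have "nd 0 (S (Suc i) t) (S (Suc j) t) < e" if "t : {- T..T}" "N <= i" "N <= j" for i j t
   using SS[OF that(1), of "Suc i" "Suc j"] SS[OF that(1), of "Suc j" "Suc i"] N[rule_format, of "Suc i"] N[rule_format, of "Suc j"] that
    nrm_minus_commute[of 0 "S (Suc i) t" "S (Suc j) t"] by (cases "i <= j") auto
  then show "\<exists>N. \<forall>i\<ge>N. \<forall>j\<ge>N. \<forall>t\<in>{- T..T}. nd 0 (S (Suc i) t) (S (Suc j) t) < e" by blast
 qed (use M0 in auto)
 \<comment> \<open>At time 0 every partial sum with at least one term equals \<open>f0\<close> at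
   every point, and such constant values pass to the limit exactly; the index \<open>Suc N\<close>
   avoids the empty sum.\<close>
 have "F 0 = f0"
  by (rule ext, rule Fe) (use T in "auto simp: S_def sum.lessThan_Suc_shift simp del: sum.lessThan_Suc")
 moreover have "ct n (F t) = F t" if "t : {- T..T}" for t
 proof
  fix x
  have "n < \<bar>x\<bar> ==> ?a j x = 0" for j using tc_ct[OF f0(2), of j] by (metis ct_def not_le)
  then show "ct n (F t) x = F t x" using Fe[OF that, of x 0] by (auto simp: ct_def S_def)
 qed
 ultimately show ?thesis using that[of F] F by simp
qed

section \<open>Global solutions of the truncated equation\<close>

definition gal :: "real => real set => (real => cfun) => bool" where
 "gal n I F \<longleftrightarrow> Xderiv I 0 F (%t x. sgnm (F t) x + BG n (F t) (F t) x) \<and> (\<forall>t\<in>I. ct n (F t) = F t \<and> herm (F t))"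

lemma galD:
 assumes "gal n I F"
 shows "Xderiv I 0 F (%t x. sgnm (F t) x + BG n (F t) (F t) x)" "t : I ==> ct n (F t) = F t" "t : I ==> herm (F t)" "t : I ==> F t : X 0"
 using assms XderivD by (auto simp: gal_def)

lemma Xderiv_glue:
 assumes f: "Xderiv {a..b} s f v" and g: "Xderiv {b..c} s g w" and ab: "a <= b" "b <= c" and e: "f b = g b" "v b = w b"
 shows "Xderiv {a..c} s (%t. if t <= b then f t else g t) (%t. if t <= b then v t else w t)"
proof -
 let ?D = "%I f v t. ((%r. nrm s (dq f v t r)) ---> 0) (at t within I)"
 let ?f = "%t. if t <= b then f t else g t" and ?v = "%t. if t <= b then v t else w t"
 have D: "?D I ?f ?v t" if x: "Xderiv I s h u" and h: "!!t. t : I ==> ?f t = h t \<and> ?v t = u t" and I: "closed I" for I h u t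
 proof (cases "t : I")
  case True
  with x have "?D I h u t" by (simp add: Xderiv_def)
  then show ?thesis
  proof (rule Lim_transform_eventually)
   show "\<forall>\<^sub>F r in at t within I. nrm s (dq h u t r) = nrm s (dq ?f ?v t r)"
    using eventually_within_in[of I t]
   proof eventually_elim
    case (elim r)
    then have "?f r = h r" using h[of r] by blast
    moreover have "?f t = h t" "?v t = u t" using h[OF True] by blast+
    ultimately show ?case by (simp only:)
   qed
  qed
 next
  case False
  then have "at t within I = bot" using I by (metis at_within_eq_bot_iff closed_limpt islimpt_def trivial_limit_within)
  then show ?thesis by simp
 qed
 have "{a..c} = {a..b} \<union> {b..c}" using ab by auto
 moreover have "?D {a..b} ?f ?v t" for t by (rule D[OF f]) auto
 moreover have "?D {b..c} ?f ?v t" for t by (rule D[OF g]) (use e in "auto dest!: order_antisym")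
 ultimately have "?D {a..c} ?f ?v t" for t unfolding at_within_union by (simp only: at_within_union filterlim_sup)
 then show ?thesis unfolding Xderiv_def using XderivD[OF f] XderivD[OF g] by auto
qed

lemma Xderiv_shift:
 assumes f: "Xderiv {a..b} s f v" shows "Xderiv {a + r..b + r} s (%t. f (t - r)) (%t. v (t - r))"
 unfolding Xderiv_def
proof (intro conjI ballI)
 fix t assume "t : {a + r..b + r}"
 then have t: "t - r : {a..b}" by auto
 show "f (t - r) : X s" "v (t - r) : X s" using XderivD[OF f t] by auto
 have l: "filterlim (%q. q - r) (at (t - r) within {a..b}) (at t within {a + r..b + r})"
  unfolding filterlim_at
 proof
  show "((%q. q - r) ---> t - r) (at t within {a + r..b + r})" by (intro tendsto_intros)
  show "\<forall>\<^sub>F x in at t within {a + r..b + r}. x - r : {a..b} \<and> x - r \<noteq> t - r"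
   using eventually_within_in[of "{a + r..b + r}" t] by eventually_elim auto
 qed
 have "((%q. nrm s (%w. (f q w - f (t - r) w) / cr (q - (t - r)) - v (t - r) w)) ---> 0) (at (t - r) within {a..b})"
  using f t unfolding Xderiv_def by blast
 from filterlim_compose[OF this l]
 show "((%q. nrm s (%w. (f (q - r) w - f (t - r) w) / cr (q - t) - v (t - r) w)) ---> 0) (at t within {a + r..b + r})"
  by simp
qed

lemma gal_subset: "gal n I F ==> J \<subseteq> I ==> gal n J F"
 unfolding gal_def using Xderiv_subset by blast

lemma gal_shift: "gal n {a..b} F ==> gal n {a + r..b + r} (%t. F (t - r))"
 unfolding gal_def using Xderiv_shift[of a b 0 F "%t x. sgnm (F t) x + BG n (F t) (F t) x" r] by (simp add: algebra_simps)

lemma gal_glue: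
 assumes F: "gal n {a..b} F" and G: "gal n {b..c} G" and ab: "a <= b" "b <= c" and e: "F b = G b"
 shows "gal n {a..c} (%t. if t <= b then F t else G t)"
 unfolding gal_def
proof (intro conjI ballI)
 have "Xderiv {a..c} 0 (%t. if t <= b then F t else G t) (%t. if t <= b then (%x. sgnm (F t) x + BG n (F t) (F t) x) else (%x. sgnm (G t) x + BG n (G t) (G t) x))"
  by (rule Xderiv_glue[OF galD(1)[OF F] galD(1)[OF G] ab e]) (simp add: e)
 moreover have "(%t. if t <= b then (%x. sgnm (F t) x + BG n (F t) (F t) x) else (%x. sgnm (G t) x + BG n (G t) (G t) x))
  = (%t x. sgnm (if t <= b then F t else G t) x + BG n (if t <= b then F t else G t) (if t <= b then F t else G t) x)"
  by (auto simp: fun_eq_iff)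
 ultimately show "Xderiv {a..c} 0 (%t. if t <= b then F t else G t) (%t x. sgnm (if t <= b then F t else G t) x + BG n (if t <= b then F t else G t) (if t <= b then F t else G t) x)"
  by simp
 fix t assume "t : {a..c}"
 then show "ct n (if t <= b then F t else G t) = (if t <= b then F t else G t)" "herm (if t <= b then F t else G t)"
  using galD(2,3)[OF F] galD(2,3)[OF G] by auto
qed

lemma kip_ct:
 assumes "ct n f = f" shows "kip k (ct n g) f = kip k g f"
proof -
 have "f x = 0" if "\<not> \<bar>x\<bar> <= n" for x using assms that by (metis ct_def)
 then show ?thesis unfolding kip_def ip_def by (intro arg_cong[where f=Re] bi_cong) (auto simp: ct_def)
qed

lemma kip_add_left: assumes "mult_le s k" "f : X s" "f' : X s" "g : X s" shows "kip k (%x. f x + f' x) g = kip k f g + kip k f' g"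
 unfolding kip_def using ip_add_left[OF mult_le_L2(1)[OF assms(1,2)] mult_le_L2(1)[OF assms(1,3)] mult_le_L2(1)[OF assms(1,4)]]
 by (simp add: distrib_left)

lemma BG_Nl: "f : X 1 ==> BG n f f = ct n (Nl f)"
 by (auto simp: BG_def Nl_alt fun_eq_iff ct_def)

lemma gal_XS: assumes F: "gal n I F" and n: "0 <= n" and t: "t : I" shows "F t : XS"
 using ct_XS[OF galD(4)[OF F t] n] galD(2)[OF F t] by simp

text \<open>The solution is band-limited, so the cutoff in the equation is invisible when paired
  with it, and conservation of the L2 norm survives truncation.\<close>

lemma gal_L2:
 assumes F: "gal n {a..b} F" and n: "0 <= n" and t: "t : {a..b}" "r : {a..b}" shows "nrm 0 (F t) = nrm 0 (F r)"
proof -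
 let ?k = "%x::real. 1::real"
 have k: "mult_le 0 ?k" by (simp add: mult_le_def)
 have "\<exists>c. \<forall>t\<in>{a..b}. kip ?k (F t) (F t) = c"
 proof (rule has_field_derivative_zero_constant)
  fix t assume t: "t : {a..b}"
  note X = XSD[OF gal_XS[OF F n t]]
  have "kip ?k (%x. sgnm (F t) x + BG n (F t) (F t) x) (F t) = 0"
   using kip_add_left[OF k sgnm_X(1)[OF X] BG_bound(1)[OF X X n] X]
    kip_sgnm[of ?k "F t"] crude_rate0[OF X galD(3)[OF F t]] kip_ct[OF galD(2)[OF F t], of ?k "Nl (F t)"]
   by (simp add: BG_Nl[OF X])
  then show "((%t. kip ?k (F t) (F t)) has_field_derivative 0) (at t within {a..b})"
   using kip_deriv[OF k galD(1)[OF F] galD(1)[OF F] t] kip_commute[of ?k "F t"] by simp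
 qed simp
 with t have "kip ?k (F t) (F t) = kip ?k (F r) (F r)" by metis
 then show ?thesis by (simp add: kip_self nrm_0)
qed

text \<open>The local time of existence depends on the data only through the L2 norm, which is
  conserved; steps of one fixed length can therefore be attached at both ends as often as
  needed.\<close>

lemma gal_global:
 assumes f0: "f0 : X 0" "ct n f0 = f0" "herm f0" and n: "0 <= n"
 obtains F where "F 0 = f0" "gal n {- A..A} F"
proof -
 define M where "M = nrm 0 f0"
 define K where "K = 1 + n * cn n * M"
 have K: "0 < K" using n by (simp add: K_def M_def add_pos_nonneg)
 define T where "T = 1 / (8 * K)"
 have T: "K * T <= 1/8" "0 < T" using K by (auto simp: T_def)
 have loc: "\<exists>G. G 0 = g \<and> gal n {- T..T} G" if g: "g : X 0" "ct n g = g" "herm g" "nrm 0 g <= M" for g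
 proof (rule gal_local[OF g(1-3) n g(4), of T])
  show "(1 + n * cn n * M) * T <= 1 / 8" "0 <= T" using T by (simp_all add: K_def)
 qed (auto simp: gal_def)
 have "\<exists>F. F 0 = f0 \<and> gal n {- (real m * T)..real m * T} F" for m
 proof (induction m)
  case 0
  obtain G where "G 0 = f0" "gal n {- T..T} G" using loc[of f0] f0 by (auto simp: M_def)
  then show ?case using gal_subset[of n "{- T..T}" G "{0}"] T by auto
 next
  case (Suc m)
  define b where "b = real m * T"
  have b: "0 <= b" using T by (simp add: b_def)
  obtain F where F: "F 0 = f0" "gal n {- b..b} F" using Suc by (auto simp: b_def)
  have le: "nrm 0 (F t) <= M" if "t : {- b..b}" for t
   using gal_L2[OF F(2) n that, of 0] b F(1) by (simp add: M_def)
  obtain G where G: "G 0 = F b" "gal n {- T..T} G"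
   using loc[of "F b"] galD(2-4)[OF F(2), of b] le[of b] b by auto
  obtain H where H: "H 0 = F (- b)" "gal n {- T..T} H"
   using loc[of "F (- b)"] galD(2-4)[OF F(2), of "- b"] le[of "- b"] b by auto
  have G': "gal n {b..b + T} (%t. G (t - b))"
   by (rule gal_subset[OF gal_shift[OF G(2), of b]]) (use T in auto)
  have H': "gal n {- (b + T)..- b} (%t. H (t - (- b)))"
   by (rule gal_subset[OF gal_shift[OF H(2), of "- b"]]) (use T in auto)
  define P where "P t = (if t <= b then F t else G (t - b))" for t
  have P: "gal n {- b..b + T} P"
   unfolding P_def[abs_def] by (rule gal_glue[OF F(2) G']) (use b T G in auto)
  define Q where "Q t = (if t <= - b then H (t - (- b)) else P t)" for t
  have Q: "gal n {- (b + T)..b + T} Q"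
   unfolding Q_def[abs_def] by (rule gal_glue[OF H' P]) (use b T H in "auto simp: P_def")
  have "Q 0 = f0"
  proof (cases "b = 0")
   case True
   then show ?thesis using F H by (simp add: Q_def)
  qed (use b F in "simp add: Q_def P_def")
  moreover have "b + T = real (Suc m) * T" by (simp add: b_def algebra_simps)
  ultimately show ?case using Q by metis
 qed
 moreover obtain m where "A < real m * T" using ex_less_of_nat_mult[OF T(2)] by blast
 ultimately obtain F where "F 0 = f0" "gal n {- (real m * T)..real m * T} F" by blast
 moreover have "{- A..A} \<subseteq> {- (real m * T)..real m * T}" using \<open>A < real m * T\<close> by auto
 ultimately show ?thesis using that gal_subset by blast
qed

section \<open>Bilinear estimates and differences of solutions\<close>

definition Bl :: "cfun => cfun => cfun" where
 "Bl f g x = - (\<i> * cr (m1 / 2) * mx (conv f g) x)"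

definition cA :: "real => real" where "cA s = 2 powr s * c1"

lemma cA_nonneg [simp]: "0 <= cA s" by (simp add: cA_def)

lemma mx_conv_X:
 assumes s: "0 <= s" and f: "f : X (s + 1)" and g: "g : X (s + 1)"
 shows "mx (conv f g) : X s" "nrm s (mx (conv f g)) <= 2 * (cA s * (nrm (s + 1) f * nrm (s + 1) g))"
proof -
 have 1: "f : X 1" "g : X 1" using X_mono(1)[OF f, of 1] X_mono(1)[OF g, of 1] s by auto
 have e: "mx (conv f g) = (%x. conv g (mx f) x + conv f (mx g) x)" by (simp add: fun_eq_iff conv_mx[OF 1] conv_commute[of "mx f"])
 note c = conv_X'[OF s g mx_X(1)[OF f]] conv_X'[OF s f mx_X(1)[OF g]]
 show "mx (conv f g) : X s" unfolding e by (intro X_add c)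
 have "cA s * (nrm (s + 1) g * nrm s (mx f)) <= cA s * (nrm (s + 1) g * nrm (s + 1) f)"
  "cA s * (nrm (s + 1) f * nrm s (mx g)) <= cA s * (nrm (s + 1) f * nrm (s + 1) g)"
  by (intro mult_left_mono mx_X f g; simp)+
 then show "nrm s (mx (conv f g)) <= 2 * (cA s * (nrm (s + 1) f * nrm (s + 1) g))"
  unfolding e using nrm_triangle[OF c(1,3)] c(2,4) by (simp add: cA_def mult_ac)
qed

lemma Bl_X:
 assumes s: "0 <= s" and f: "f : X (s + 1)" and g: "g : X (s + 1)"
 shows "Bl f g : X s" "nrm s (Bl f g) <= cA s * (nrm (s + 1) f * nrm (s + 1) g)"
proof -
 note c = mx_conv_X[OF assms]
 have B: "Bl f g = (%x. (- (\<i> * cr (m1 / 2))) * mx (conv f g) x)" by (auto simp: Bl_def)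
 show "Bl f g : X s" unfolding B by (intro X_cmult c)
 have "nrm s (Bl f g) = m1 * nrm s (mx (conv f g)) / 2"
  unfolding B nrm_cmult using m1_pos by (simp add: norm_mult norm_divide)
 also have "... <= 1 * nrm s (mx (conv f g)) / 2" using m1_pos by (intro divide_right_mono mult_right_mono) auto
 finally show "nrm s (Bl f g) <= cA s * (nrm (s + 1) f * nrm (s + 1) g)" using c(2) by simp
qed

lemma Nl_diff_Bl:
 assumes "f : X 1" "g : X 1" shows "(%x. Nl f x - Nl g x) = Bl (%x. f x - g x) (%x. f x + g x)"
proof
 fix x
 have L: "f : L2" "g : L2" using X_mono(1)[of _ 1 0] assms by (auto simp: X_0[symmetric])
 have "conv (%x. f x - g x) (%x. f x + g x) x = conv f f x - conv g g x"
  using conv_diff_left[OF L(1) L(2) L2_add[OF L]] conv_add_right[OF L(1) L(1) L(2)] conv_add_right[OF L(2) L(1) L(2)]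
   conv_commute[of f g] by simp
 then show "Nl f x - Nl g x = Bl (%x. f x - g x) (%x. f x + g x) x"
  by (simp add: Nl_alt assms Bl_def mx_def right_diff_distrib diff_divide_distrib)
qed

lemma Nl_diff:
 assumes s: "0 <= s" and f: "f : X (s + 1)" and g: "g : X (s + 1)"
 shows "nd s (Nl f) (Nl g) <= cA s * (nd (s + 1) f g * (nrm (s + 1) f + nrm (s + 1) g))"
proof -
 have "f : X 1" "g : X 1" using X_mono(1)[OF f, of 1] X_mono(1)[OF g, of 1] s by auto
 then have "nd s (Nl f) (Nl g) <= cA s * (nd (s + 1) f g * nrm (s + 1) (%x. f x + g x))"
  unfolding Nl_diff_Bl[OF \<open>f : X 1\<close> \<open>g : X 1\<close>] by (intro Bl_X s X_diff X_add f g)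
 also have "... <= cA s * (nd (s + 1) f g * (nrm (s + 1) f + nrm (s + 1) g))"
  by (intro mult_left_mono nrm_triangle f g) auto
 finally show ?thesis .
qed

text \<open>Both slots of \<open>g\<close> are alike, so the symbol \<open>y\<close> may be
  exchanged for -x-y. Since the three frequencies sum to 0, the symbol \<open>y\<close> equals minus
  half the symbol \<open>x\<close>: the derivative moves to \<open>f\<close>, and the difference
  \<open>g\<close> loses none.\<close>

lemma diff_cubic:
 assumes f: "f : X 2" and g: "g : X 2" and h: "herm g"
 shows "2 * kip (%v. 1) (Bl g f) g = Re (- (\<i> * cr (m1 / 2)) * L3 (%x y. cr x) f g g)"
proof -
 have [measurable]: "meas f" "meas g" using f g by (auto intro: X_meas)
 have b: "cmod (cr w) <= 1 * (wt (2 - 1) x * wt (2 - 1) y * wt (2 - 1) z)" if "w = x \<or> w = - x \<or> w = y \<or> w = - x - y \<and> z = - x - y" for w x y z :: real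
 proof -
  have "\<bar>w\<bar> <= wt 1 w" by (rule abs_le_wt)
  also have "... <= wt 1 x * wt 1 y * wt 1 z" using that three_wts[where r=1 and x=x and y=y and z=z] by (elim disjE conjE) (simp_all only: wt_even zero_le_one)
  finally show ?thesis by simp
 qed
 have s1: "sym3 2 (%x y. cr x) 1" by (rule sym3_I[OF _ _ b]) auto
 have s1': "sym3 2 (%x y. cr (- x)) 1" by (rule sym3_I[OF _ _ b]) auto
 have s2: "sym3 2 (%x y. cr y) 1" by (rule sym3_I[OF _ _ b]) auto
 have s3: "sym3 2 (%x y. cr (- x - y)) 1" by (rule sym3_I[OF _ _ b]) auto
 let ?C = "\<i> * cr (m1 / 2)"
 have "2 * ip (%v. cr 1 * Bl g f v) (%v. cr 1 * g v) = 2 * (LBINT v. - ?C * (cr v * conv g f v * g (- v)))"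
  unfolding ip_def
 proof (rule arg_cong[where f="%z. 2 * z"], rule integral_cong_AE)
  show "(%v. cr 1 * Bl g f v * cnj (cr 1 * g v)) : borel_measurable lborel" unfolding Bl_def mx_def by measurable
  show "(%v. - ?C * (cr v * conv g f v * g (- v))) : borel_measurable lborel" by measurable
  show "ae v. cr 1 * Bl g f v * cnj (cr 1 * g v) = - ?C * (cr v * conv g f v * g (- v))"
   using h[unfolded herm_def] by eventually_elim (simp add: Bl_def mx_def)
 qed
 also have "... = - (2 * ?C) * (LBINT v. cr v * conv g f v * g (- v))"
  by (subst integral_mult_right_zero) simp
 also have "(LBINT v. cr v * conv g f v * g (- v)) = L3 (%x y. cr (- x)) g f g"
  by (rule conv_pair) (use L3_bound(1)[OF s1' g f g] in auto)
 also have "... = - L3 (%x y. cr x) g f g"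
  using L3_symb_cmult[of "-1" "%x y. cr x" g f g] by simp
 also have "L3 (%x y. cr x) g f g = L3 (%x y. cr y) f g g"
  by (rule L3_swap12) (auto intro: sym3_meas[OF s1])
 also have "L3 (%x y. cr y) f g g = - (L3 (%x y. cr x) f g g / 2)"
 proof -
  have "L3 (%x y. cr y) f g g = L3 (%x y. cr (- x - y)) f g g"
   by (rule L3_swap23[OF sym3_meas[OF s2]]) auto
  moreover have "L3 (%x y. cr x) f g g + L3 (%x y. cr y) f g g + L3 (%x y. cr (- x - y)) f g g
   = L3 (%x y. cr x + cr y + cr (- x - y)) f g g"
   by (rule L3_symb_add3[OF s1 s2 s3 f g g])
  moreover have "... = 0" by (simp add: L3_def case_prod_unfold)
  moreover have "b = - (a / 2)" if "b = c" "a + b + c = d" "d = 0" for a b c d :: complex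
  proof -
   from that have "a + b + b = 0" by metis
   then have "a = - (2 * b)" by (simp only: mult_2 add.assoc eq_neg_iff_add_eq_0)
   then show ?thesis by simp
  qed
  ultimately show ?thesis by blast
 qed
 finally have e: "2 * ip (%v. cr 1 * Bl g f v) (%v. cr 1 * g v) = - ?C * L3 (%x y. cr x) f g g"
  by (simp only: mult_minus_left mult_minus_right minus_minus) simp
 show ?thesis unfolding kip_def e[symmetric] by simp
qed

lemma L3_l1_bound:
 assumes a: "integrable lborel a" and p: "p : L2" and q: "q : L2" and m: "(%(x, y). b x y) : borel_measurable M2"
  and f: "meas f" and b: "!!x y. cmod (b x y * f x) <= c * cmod (a x)" and c: "0 <= c"
 shows "cmod (L3 b f p q) <= c * (l1 a * (n2 p * n2 q))"
proof -
 have "cmod (F3 b f p q z) <= c * (\<Sum>g\<leftarrow>[P3 a p q]. cmod (g z))" for z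
  using mult_right_mono[OF b[of "fst z" "snd z"] norm_ge_zero[of "p (snd z) * q (- fst z - snd z)"]] by (simp add: case_prod_unfold norm_mult mult_ac)
 from ib_dom(2)[OF F3_meas[OF m f L2_meas[OF p] L2_meas[OF q]] this c] ib3(1)[OF a p q] show ?thesis by (simp add: L3_def)
qed

lemma diff_cubic_bound:
 assumes f: "f : X 2" and g: "g : X 2" and h: "herm g"
 shows "\<bar>2 * kip (%w. 1) (Bl g f) g\<bar> <= c1 * nrm 2 f * (nrm 0 g)^2"
proof -
 have g0: "g : L2" using X_mono(1)[OF g, of 0] by (simp add: X_0)
 have "\<bar>2 * kip (%w. 1) (Bl g f) g\<bar> <= cmod (- (\<i> * cr (m1 / 2)) * L3 (%x y. cr x) f g g)"
  unfolding diff_cubic[OF assms] by (rule abs_Re_le_cmod)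
 also have "... = m1 / 2 * cmod (L3 (%x y. cr x) f g g)" using m1_pos by (simp add: norm_mult norm_divide)
 also have "... <= 1 * (1 * (l1 (mx f) * (n2 g * n2 g)))"
  using m1_pos by (intro mult_mono L3_l1_bound mx_L1 f g0 X_meas[OF f]) (auto simp: mx_def)
 also have "... <= c1 * nrm 2 f * (nrm 0 g)^2"
  using mult_right_mono[OF mx_L1(2)[OF f], of "n2 g * n2 g"] by (simp add: nrm_0 power2_eq_square)
 finally show ?thesis .
qed

lemma nrm_interp: assumes s: "0 <= s" and f: "f : X (2 * s)" shows "(nrm s f)^2 <= nrm 0 f * nrm (2 * s) f"
proof -
 have f0: "f : L2" using X_mono(1)[OF f, of 0] s by (simp add: X_0)
 note F = X_L2[OF f]
 have "(nrm s f)^2 = (LBINT x. cmod (f x) * cmod (cr (wt (2 * s) x) * f x))"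
  unfolding nrm_def n2_sq by (intro bi_cong) (auto simp: norm_mult power_mult_distrib wt_sq'[symmetric] power2_eq_square)
 also have "... <= n2 f * n2 (%x. cr (wt (2 * s) x) * f x)" by (rule CS_abs[OF f0 F])
 finally show ?thesis by (simp add: nrm_0 nrm_def)
qed

section \<open>Modified energies\<close>

lemma gal_V:
 assumes F: "gal n I F" and n: "0 <= n" and t: "t : I"
 shows "(%x. sgnm (F t) x + BG n (F t) (F t) x) = (%x. sgnm (F t) x + ct n (Nl (F t)) x)"
 by (simp add: BG_Nl[OF XSD[OF gal_XS[OF F n t]]])

text \<open>The defect of the difference quotient is supported in the band, where every weighted
  norm is bounded by a multiple of the L2 norm; differentiability in L2 thus lifts to all
  orders.\<close>

lemma gal_Xderiv:
 assumes F: "gal n I F" and n: "0 <= n" and s: "0 <= s"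
 shows "Xderiv I s F (%t x. sgnm (F t) x + ct n (Nl (F t)) x)"
 unfolding Xderiv_def
proof (intro conjI ballI)
 fix t assume t: "t : I"
 let ?V = "%x. sgnm (F t) x + ct n (Nl (F t)) x"
 note X = gal_XS[OF F n t]
 show "F t : X s" "?V : X s" by (intro X_add sgnm_X ct_X XSD[OF X] XSD[OF Nl_XS[OF X]])+
 let ?Q = "%q x. (F q x - F t x) / cr (q - t) - ?V x"
 have z: "F r x = 0" if "r : I" "\<not> \<bar>x\<bar> <= n" for r x using galD(2)[OF F that(1)] that(2) by (metis ct_def)
 have "((%q. wt s n * nrm 0 (?Q q)) ---> wt s n * 0) (at t within I)"
 proof (rule tendsto_mult_left)
  have "((%q. nrm 0 (%x. (F q x - F t x) / cr (q - t) - (sgnm (F t) x + BG n (F t) (F t) x))) ---> 0) (at t within I)"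
   using galD(1)[OF F] t unfolding Xderiv_def by blast
  then show "((%q. nrm 0 (?Q q)) ---> 0) (at t within I)" unfolding fun_cong[OF gal_V[OF F n t]] .
 qed
 then have l: "((%q. wt s n * nrm 0 (?Q q)) ---> 0) (at t within I)" by simp
 have "eventually (%q. nrm s (?Q q) <= wt s n * nrm 0 (?Q q)) (at t within I)"
  using eventually_within_in[of I t]
 proof eventually_elim
  case (elim q)
  have "?Q q = ct n (?Q q)" using z[OF t] z[of q] elim by (auto simp: ct_def sgnm_def fun_eq_iff)
  moreover have "?Q q : X 0"
   by (intro X_diff X_divide X_add sgnm_X ct_X XSD[OF X] XSD[OF Nl_XS[OF X]] XSD[OF gal_XS[OF F n]]) (use elim in auto)
  ultimately show ?case using ct_up(2)[of "?Q q" n s] n s by simp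
 qed
 with l show "((%q. nrm s (?Q q)) ---> 0) (at t within I)" by (rule squeeze0) simp
qed

lemma en_deriv:
 assumes F: "Xderiv I (real K) F v" and t: "t : I"
 shows "((%t. en K (F t)) has_field_derivative 2 * kip (%x. x ^ K) (v t) (F t)) (at t within I)"
 using kip_deriv[OF pw_mult_le F F t] by (simp add: en_kip[abs_def] kip_commute[of _ "F t"])

lemma cor_deriv:
 assumes F: "Xderiv I (SS J) F v" and t: "t : I"
 shows "((%t. cor J (F t)) has_field_derivative m1 / 3 * Re (L3 (bK J) (v t) (F t) (F t) + L3 (bK J) (F t) (v t) (F t) + L3 (bK J) (F t) (F t) (v t))) (at t within I)"
 unfolding cor_def[abs_def] by (intro DERIV_cmult L3_deriv[OF sym3_bK F F F t])

lemma gal_en_deriv: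
 assumes F: "gal n I F" and n: "0 <= n" and t: "t : I"
 shows "((%t. en K (F t)) has_field_derivative 2 * kip (%x. x ^ K) (Nl (F t)) (F t)) (at t within I)"
proof -
 note X = gal_XS[OF F n t]
 have "kip (%x. x ^ K) (%x. sgnm (F t) x + ct n (Nl (F t)) x) (F t) = kip (%x. x ^ K) (Nl (F t)) (F t)"
  using kip_add_left[OF pw_mult_le[of K] sgnm_X(1)[OF XSD[OF X]] ct_X(1)[OF XSD[OF Nl_XS[OF X]]] XSD[OF X]]
  by (simp add: kip_sgnm kip_ct[OF galD(2)[OF F t]])
 then show ?thesis using en_deriv[OF gal_Xderiv[OF F n, of "real K"] t] by simp
qed

lemma gal_crude:
 assumes F: "gal n {- T..T} F" and n: "0 <= n" and b: "!!t. t : {- T..T} ==> nrm 2 (F t) <= b" and b0: "0 <= b" and t: "t : {- T..T}"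
 shows "en (Suc J) (F t) <= en (Suc J) (F 0) * exp ((CB J * (c1 * b) + 1) * \<bar>t\<bar>)"
proof -
 let ?c = "CB J * (c1 * b) + 1"
 have c: "0 < ?c" using b0 by (simp add: add_nonneg_pos)
 have "en (Suc J) (F t) <= (en (Suc J) (F 0) + 0 / ?c) * exp (?c * \<bar>t\<bar>)"
 proof (rule gronwall[OF gal_en_deriv[OF F n] _ c order_refl t])
  fix t assume t: "t : {- T..T}"
  note X = gal_XS[OF F n t]
  have "\<bar>2 * kip (%x. x ^ Suc J) (Nl (F t)) (F t)\<bar> <= CB J * l1 (mx (F t)) * en (Suc J) (F t)"
   by (rule crude_rate[OF XSD[OF X] XSD[OF X] galD(3)[OF F t]])
  also have "... <= ?c * en (Suc J) (F t)"
  proof (rule mult_right_mono)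
   have "l1 (mx (F t)) <= c1 * b"
    using mx_L1(2)[OF XSD[OF X]] mult_left_mono[OF b[OF t] c1_nonneg] by linarith
   then have "CB J * l1 (mx (F t)) <= CB J * (c1 * b)" by (intro mult_left_mono) auto
   then show "CB J * l1 (mx (F t)) <= ?c" by simp
  qed simp
  finally show "\<bar>2 * kip (%x. x ^ Suc J) (Nl (F t)) (F t)\<bar> <= ?c * en (Suc J) (F t) + 0" by simp
 qed
 then show ?thesis by simp
qed

lemma nrm_en:
 assumes f: "f : X (real K)"
 shows "(nrm (real K) f)^2 <= 2 ^ K * ((nrm 0 f)^2 + en K f)" "en K f <= (nrm (real K) f)^2"
proof -
 have f0: "f : L2" using X_mono(1)[OF f, of 0] by (simp add: X_0)
 have p: "pw K f : L2" "n2 (pw K f) <= nrm (real K) f" by (rule pw_L2[OF f order_refl])+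
 show "en K f <= (nrm (real K) f)^2" unfolding en_def using p by (intro power_mono) auto
 have "(nrm (real K) f)^2 = (LBINT x. (cmod (cr (wt (real K) x) * f x))^2)" unfolding nrm_def n2_sq ..
 also have "... <= (LBINT x. 2 ^ K * ((cmod (f x))^2 + (cmod (pw K f x))^2))"
 proof (rule integral_mono)
  show "integrable lborel (%x. (cmod (cr (wt (real K) x) * f x))^2)" using L2_int[OF X_L2[OF f]] by simp
  show "integrable lborel (%x. 2 ^ K * ((cmod (f x))^2 + (cmod (pw K f x))^2))" using L2_int[OF f0] L2_int[OF p(1)] by simp
  fix x :: real
  have "(1 + x^2) ^ K <= (2 * max 1 (x^2)) ^ K" by (intro power_mono) (auto simp: max_def)
  also have "... <= 2 ^ K * (1 + (x^2) ^ K)" by (auto simp: power_mult_distrib max_def)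
  finally have "(wt (real K) x)^2 <= 2 ^ K * (1 + (x ^ K)^2)"
   unfolding wt_sq' wt_even_power by (simp add: power_mult[symmetric] mult.commute)
  then have "(wt (real K) x)^2 * (cmod (f x))^2 <= 2 ^ K * (1 + (x ^ K)^2) * (cmod (f x))^2" by (rule mult_right_mono) simp
  then show "(cmod (cr (wt (real K) x) * f x))^2 <= 2 ^ K * ((cmod (f x))^2 + (cmod (pw K f x))^2)"
   unfolding norm_mult norm_of_real power_mult_distrib pw_def power2_abs by (simp add: algebra_simps)
 qed
 also have "... = 2 ^ K * ((nrm 0 f)^2 + en K f)"
  using L2_int[OF f0] L2_int[OF p(1)] by (simp add: nrm_0 en_def n2_sq)
 finally show "(nrm (real K) f)^2 <= 2 ^ K * ((nrm 0 f)^2 + en K f)" .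
qed

lemma ct_tail:
 assumes f: "f : X (s + 1)" and n: "0 < n"
 shows "nd s (ct n f) f <= 1 / n * nrm (s + 1) f"
proof (rule X_bound(2)[OF f])
 have [measurable]: "meas f" using f by (rule X_meas)
 show "meas (%w. ct n f w - f w)" by measurable
 show "ae x. wt s x * cmod (ct n f x - f x) <= 1 / n * (wt (s + 1) x * cmod (f x))"
 proof (rule AE_I2)
  fix x
  show "wt s x * cmod (ct n f x - f x) <= 1 / n * (wt (s + 1) x * cmod (f x))"
  proof (cases "\<bar>x\<bar> <= n")
   case False
   have "wt s x * n <= wt s x * wt 1 x" using abs_le_wt[of x] False by (intro mult_left_mono) auto
   then have "wt s x * n * cmod (f x) <= wt (s + 1) x * cmod (f x)" unfolding wt_add by (rule mult_right_mono) simp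
   then show ?thesis using False n by (simp add: ct_def field_simps)
  qed (use n in "simp add: ct_def")
 qed
qed (use n in simp)

text \<open>The error that cutting off the nonlinearity causes in the rate of the correction, before
  division by the cutoff frequency.\<close>

definition eW :: "nat => real => real" where
 "eW J M = 3 * BS J * c1 * M^2 * (2 powr (SS J + 1) * c1 * M^2)"

text \<open>Twice the constant of the quartic rate, because the energy is at most twice the
  corrected energy; the added 1 keeps the Gronwall exponent positive.\<close>

definition cK :: "nat => real" where "cK J = 4 * CQ J * c1^2 + 1"

lemma eW_nonneg [simp]: "0 <= eW J M" by (simp add: eW_def)
lemma cK_pos [simp]: "0 < cK J" by (simp add: cK_def add_nonneg_pos)

text \<open>Smallness keeps the corrected energy between one half and three halves of the energy,
  whence the factor 3 at time 0. The cutoff disappears from the rate of the energy, where it meets a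
  band-limited function, but not from that of the correction; this leaves an error proportional to 1
  / n.\<close>

lemma gal_modified:
 assumes F: "gal n {- T..T} F" and n: "0 < n" and b: "!!t. t : {- T..T} ==> nrm 2 (F t) <= b" and b0: "0 < b" and t: "t : {- T..T}"
  and small: "CB J * (c1 * b) <= 1 / 2" and M: "!!t. t : {- T..T} ==> nrm (SS J + 2) (F t) <= M"
 shows "en (Suc J) (F t) <= (3 * en (Suc J) (F 0) + 2 * (eW J M / n) / (cK J * b^2)) * exp (cK J * b^2 * \<bar>t\<bar>)"
proof -
 have n0: "0 <= n" using n by simp
 let ?e = "eW J M / n" and ?c = "cK J * b^2"
 have c: "0 < ?c" using b0 by simp
 define v where "v t q = sgnm (F t) q + ct n (Nl (F t)) q" for t q
 let ?Y = "%t. en (Suc J) (F t) + cor J (F t)"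
 let ?Y' = "%t. 2 * kip (%q. q ^ Suc J) (Nl (F t)) (F t) + m1 / 3 * Re (L3 (bK J) (v t) (F t) (F t) + L3 (bK J) (F t) (v t) (F t) + L3 (bK J) (F t) (F t) (v t))"
 have l: "l1 (mx (F t)) <= c1 * b" if t: "t : {- T..T}" for t
  using mx_L1(2)[OF XSD[OF gal_XS[OF F n0 t]]] mult_left_mono[OF b[OF t] c1_nonneg] by linarith
 have cb: "\<bar>cor J (F t)\<bar> <= 1 / 2 * en (Suc J) (F t)" if t: "t : {- T..T}" for t
 proof -
  have "\<bar>cor J (F t)\<bar> <= CB J * l1 (mx (F t)) * en (Suc J) (F t)" by (rule cor_bound[OF XSD[OF gal_XS[OF F n0 t]]])
  also have "... <= 1 / 2 * en (Suc J) (F t)"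
   using mult_left_mono[OF l[OF t], of "CB J"] small by (intro mult_right_mono) auto
  finally show ?thesis .
 qed
 have "?Y t <= (?Y 0 + ?e / ?c) * exp (?c * \<bar>t\<bar>)"
 proof (rule gronwall[OF _ _ c _ t])
  fix t assume t: "t : {- T..T}"
  note X = gal_XS[OF F n0 t]
  have v: "Xderiv {- T..T} s F v" if "0 <= s" for s unfolding v_def[abs_def] by (rule gal_Xderiv[OF F n0 that])
  show "(?Y has_field_derivative ?Y' t) (at t within {- T..T})"
   by (intro DERIV_add gal_en_deriv[OF F n0 t] cor_deriv[OF v t]) (simp add: SS_def)
  let ?w = "%q. ct n (Nl (F t)) q - Nl (F t) q"
  have w: "?w : XS" by (rule XSI) (intro X_diff ct_X XSD[OF Nl_XS[OF X]])
  have "nrm (SS J) ?w <= 1 / n * nrm (SS J + 1) (Nl (F t))" by (rule ct_tail[OF XSD[OF Nl_XS[OF X]] n])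
  also have "... <= 1 / n * (2 powr (SS J + 1) * c1 * (nrm (SS J + 2) (F t))^2)"
   using Nl_X(2)[of "SS J + 1" "F t"] XSD[OF X] n by (intro mult_left_mono) (auto simp: SS_def add.assoc)
  also have "... <= 1 / n * (2 powr (SS J + 1) * c1 * M^2)"
   using M[OF t] n by (intro mult_left_mono power_mono) auto
  finally have wn: "nrm (SS J) ?w <= 1 / n * (2 powr (SS J + 1) * c1 * M^2)" .
  have fn: "nrm (SS J) (F t) <= M"
   using X_mono(2)[OF XSD[OF X], of "SS J" "SS J + 2"] M[OF t] by simp
  have "\<bar>?Y' t\<bar> <= 2 * CQ J * (l1 (mx (F t)))^2 * en (Suc J) (F t) + 3 * BS J * c1 * (nrm (SS J) (F t))^2 * nrm (SS J) ?w"
   by (rule modified_rate[OF X galD(3)[OF F t] w]) (simp add: v_def fun_eq_iff)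
  also have "... <= 2 * CQ J * (c1 * b)^2 * (2 * ?Y t) + 3 * BS J * c1 * M^2 * (1 / n * (2 powr (SS J + 1) * c1 * M^2))"
  proof (intro add_mono mult_mono mult_left_mono power_mono l[OF t] fn wn)
   show "en (Suc J) (F t) <= 2 * ?Y t" using abs_le_D2[OF cb[OF t]] by (simp add: field_simps)
  qed auto
  also have "... <= ?c * ?Y t + ?e"
  proof (rule add_mono)
   have Y0: "0 <= ?Y t" using cb[OF t] en_nonneg[of "Suc J" "F t"] by linarith
   have "2 * CQ J * (c1 * b)^2 * (2 * ?Y t) = (4 * CQ J * c1^2) * b^2 * ?Y t" by (simp add: power_mult_distrib)
   also have "... <= ?c * ?Y t" using Y0 by (intro mult_right_mono) (auto simp: cK_def)
   finally show "2 * CQ J * (c1 * b)^2 * (2 * ?Y t) <= ?c * ?Y t" .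
   show "3 * BS J * c1 * M^2 * (1 / n * (2 powr (SS J + 1) * c1 * M^2)) <= ?e" by (simp add: eW_def)
  qed
  finally show "\<bar>?Y' t\<bar> <= ?c * ?Y t + ?e" .
 qed (use n in simp)
 moreover have "en (Suc J) (F t) <= 2 * ?Y t" using abs_le_D2[OF cb[OF t]] by (simp add: field_simps)
 moreover have "(?Y 0 + ?e / ?c) * exp (?c * \<bar>t\<bar>) <= (3 / 2 * en (Suc J) (F 0) + ?e / ?c) * exp (?c * \<bar>t\<bar>)"
  using abs_le_D1[OF cb[of 0]] t by (intro mult_right_mono) auto
 moreover have "e <= 2 * z" if "y <= x" "e <= 2 * y" "x <= z" for e x y z :: real using that by linarith
 ultimately have "en (Suc J) (F t) <= 2 * ((3 / 2 * en (Suc J) (F 0) + ?e / ?c) * exp (?c * \<bar>t\<bar>))" by blast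
 also have "... = (3 * en (Suc J) (F 0) + 2 * ?e / ?c) * exp (?c * \<bar>t\<bar>)" by (simp add: algebra_simps)
 finally show ?thesis .
qed

text \<open>A continuity argument in both directions of time. The radii at which the bound
  \<open>A\<close> is reached form a compact set, so there is a first one, where the maximum over
  both signs equals \<open>A\<close>; up to that radius \<open>step\<close> improves the bound to B
  < A, a contradiction.\<close>

lemma bootstrap:
 fixes y :: "real => real"
 assumes c: "continuous_on {- T..T} y" and T: "0 <= T" and BA: "B < A" and y0: "y 0 <= B"
  and step: "!!r. 0 <= r ==> r <= T ==> (!!t. t : {- r..r} ==> y t <= A) ==> (!!t. t : {- r..r} ==> y t <= B)"
  and t: "t : {- T..T}"
 shows "y t <= A"
proof (rule ccontr)
 assume "\<not> y t <= A"
 define g where "g r = max (y r) (y (- r))" for r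
 have gc: "continuous_on {0..T} g"
  unfolding g_def by (intro continuous_on_max continuous_on_subset[OF c] continuous_on_compose2[OF c] continuous_intros) auto
 define S where "S = {r : {0..T}. A <= g r}"
 have "S = {0..T} \<inter> g -` {A..}" by (auto simp: S_def)
 then have "closed S" using continuous_closed_preimage[OF gc closed_atLeastAtMost closed_atLeast] by metis
 moreover have "bounded S" unfolding S_def by (rule bounded_subset[OF bounded_closed_interval[of 0 T]]) auto
 ultimately have "compact S" by (simp add: compact_eq_bounded_closed)
 moreover have "\<bar>t\<bar> : S" using \<open>\<not> y t <= A\<close> t by (auto simp: S_def g_def abs_if)
 ultimately obtain r0 where r0: "r0 : S" "!!r. r : S ==> r0 <= r" using compact_attains_inf[of S] by auto
 have r0T: "0 <= r0" "r0 <= T" "A <= g r0" using r0(1) by (auto simp: S_def)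
 have "g 0 <= A" using y0 BA by (simp add: g_def)
 then obtain r where r: "0 <= r" "r <= r0" "g r = A"
  using IVT'[of g 0 A r0] r0T continuous_on_subset[OF gc, of "{0..r0}"] by auto
 then have "r0 = r" using r0(2)[of r] r0T by (auto simp: S_def)
 have "y t <= A" if "t : {- r0..r0}" for t
 proof -
  have "g \<bar>t\<bar> <= A"
  proof (cases "\<bar>t\<bar> : S")
   case True
   then have "\<bar>t\<bar> = r0" using r0(2) that by fastforce
   then show ?thesis using r \<open>r0 = r\<close> by simp
  qed (use that r0T in "auto simp: S_def")
  then show ?thesis by (auto simp: g_def abs_if split: if_splits)
 qed
 then have "y r0 <= B" "y (- r0) <= B" using step[of r0] r0T by auto
 then show False using r \<open>r0 = r\<close> BA by (auto simp: g_def max_def split: if_splits)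
qed

lemma cK_nonneg [simp]: "0 <= cK J" by (rule less_imp_le[OF cK_pos])

text \<open>Solutions are allowed the size 7 e in H^2, and 14 = 2 * 7 makes the correction at most
  half of the energy. Only the constant of order 2 occurs, so nothing here depends on
  \<open>k\<close>.\<close>

definition e1 :: real where "e1 = min 1 (1 / (14 * (CB 1 * c1 + 1)))"
text \<open>With 49 = 7^2, the corrected energy of order 2 at most doubles over a time
  \<open>al1 / e^2\<close>, apart from truncation errors.\<close>

definition al1 :: real where "al1 = ln 2 / (49 * cK 1)"

lemma small_CB: assumes "e <= 1 / (14 * (CB J * c1 + 1))" "0 <= e" shows "CB J * (c1 * (7 * e)) <= 1 / 2"
proof -
 have p: "0 < CB J * c1 + 1" by (intro add_nonneg_pos mult_nonneg_nonneg) auto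
 have "CB J * c1 * e <= (CB J * c1 + 1) * e" using assms by (intro mult_right_mono) auto
 also have "... <= (CB J * c1 + 1) * (1 / (14 * (CB J * c1 + 1)))" using p assms by (intro mult_left_mono) auto
 also have "... = 1 / 14" using p by (simp add: divide_simps)
 finally show ?thesis by (simp add: mult_ac)
qed

lemma e1_pos: "0 < e1" "e1 <= 1"
proof -
 have "0 < CB 1 * c1 + 1" by (intro add_nonneg_pos mult_nonneg_nonneg) auto
 then show "0 < e1" "e1 <= 1" by (auto simp: e1_def)
qed

lemma al1_pos: "0 < al1" using cK_pos[of 1] by (simp add: al1_def)

lemma gal_upper:
 assumes F: "gal n {- r..r} F" and n: "0 <= n" and b: "!!t. t : {- r..r} ==> nrm 2 (F t) <= b" and b0: "0 <= b"
  and t: "t : {- r..r}" and r: "r <= T"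
 shows "nrm (real (Suc J)) (F t) <= sqrt (2 ^ Suc J * ((nrm 0 (F 0))^2 + en (Suc J) (F 0) * exp ((CB J * (c1 * b) + 1) * T)))"
proof (rule real_le_rsqrt)
 have z: "0 : {- r..r}" using t by auto
 have tT: "\<bar>t\<bar> <= T" using t r by auto
 have "0 <= CB J * (c1 * b) + 1" using b0 by (intro add_nonneg_nonneg mult_nonneg_nonneg) auto
 then have "en (Suc J) (F 0) * exp ((CB J * (c1 * b) + 1) * \<bar>t\<bar>) <= en (Suc J) (F 0) * exp ((CB J * (c1 * b) + 1) * T)"
  using tT by (intro mult_left_mono) (auto intro: mult_left_mono)
 with gal_crude[OF F n b b0 t, of J] have e: "en (Suc J) (F t) <= en (Suc J) (F 0) * exp ((CB J * (c1 * b) + 1) * T)"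
  by linarith
 have "(nrm (real (Suc J)) (F t))^2 <= 2 ^ Suc J * ((nrm 0 (F t))^2 + en (Suc J) (F t))"
  by (rule nrm_en(1)[OF XSD[OF gal_XS[OF F n t]]])
 also have "... <= 2 ^ Suc J * ((nrm 0 (F 0))^2 + en (Suc J) (F 0) * exp ((CB J * (c1 * b) + 1) * T))"
  unfolding gal_L2[OF F n t z] by (intro mult_left_mono add_left_mono e) auto
 finally show "(nrm (real (Suc J)) (F t))^2 <= 2 ^ Suc J * ((nrm 0 (F 0))^2 + en (Suc J) (F 0) * exp ((CB J * (c1 * b) + 1) * T))" .
qed

text \<open>A bound that may grow with the length of time but not with the cutoff. It enters
  \<open>gal_modified'\<close> only through an error divided by the cutoff frequency, so its size is
  immaterial in the limit.\<close>

definition Up :: "nat => real => real => cfun => real" where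
 "Up J b T f0 = sqrt (2 ^ Suc J * ((nrm 0 f0)^2 + en (Suc J) f0 * exp ((CB J * (c1 * b) + 1) * T)))"

lemma SS_plus: "SS J + 2 = real (Suc (2 * J + 3))" by (simp add: SS_def)

lemma gal_modified':
 assumes F: "gal n {- r..r} F" and n: "0 < n" and b: "!!t. t : {- r..r} ==> nrm 2 (F t) <= 7 * d" and e: "0 < d" and t: "t : {- r..r}"
  and small: "d <= 1 / (14 * (CB J * c1 + 1))" and r: "r <= T" and a: "d^2 * T <= q" and f0: "F 0 = f0"
 shows "en (Suc J) (F t) <= (3 * en (Suc J) f0 + 2 * (eW J (Up (2 * J + 3) (7 * d) T f0) / n) / (cK J * (7 * d)^2)) * exp (cK J * 49 * q)"
proof -
 have b0: "0 < 7 * d" using e by simp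
 let ?x = "3 * en (Suc J) f0 + 2 * (eW J (Up (2 * J + 3) (7 * d) T f0) / n) / (cK J * (7 * d)^2)"
 have "en (Suc J) (F t) <= ?x * exp (cK J * (7 * d)^2 * \<bar>t\<bar>)"
  unfolding f0[symmetric]
 proof (rule gal_modified[OF F n b b0 t small_CB[OF small]])
  fix t assume t: "t : {- r..r}"
  show "nrm (SS J + 2) (F t) <= Up (2 * J + 3) (7 * d) T (F 0)"
   unfolding SS_plus Up_def by (rule gal_upper[OF F _ b _ t r]) (use n e in auto)
 qed (use e in auto)
 also have "... <= ?x * exp (cK J * 49 * q)"
 proof (rule mult_left_mono)
  have "d^2 * \<bar>t\<bar> <= d^2 * T" using t r by (intro mult_left_mono) auto
  then have "d^2 * \<bar>t\<bar> <= q" using a by linarith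
  then have "cK J * 49 * (d^2 * \<bar>t\<bar>) <= cK J * 49 * q" using cK_pos[of J] by (intro mult_left_mono) auto
  then show "exp (cK J * (7 * d)^2 * \<bar>t\<bar>) <= exp (cK J * 49 * q)" by (simp add: power_mult_distrib mult_ac)
  show "0 <= ?x" using n cK_pos[of J] by (intro add_nonneg_nonneg mult_nonneg_nonneg divide_nonneg_nonneg) auto
 qed
 finally show ?thesis .
qed

text \<open>The continuity argument improves 7 d to 6 d. From \<open>n1\<close> on the truncation
  error is at most d^2 / 2, so with growth factor 2 the energy of order 2 is at most 2 (3 + 1/2) d^2
  = 7 d^2, and adding the conserved L2 norm gives 4 (1 + 7) d^2 = 32 d^2 < 36 d^2. The threshold
  depends on the data \<open>f0\<close>.\<close>

lemma gal_H2:
 assumes e: "0 < d" "d <= e1" and a: "0 < q" "q <= al1" and f0: "nrm 2 f0 <= d" "f0 : X 2"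
 obtains n1 where "0 < n1" "!!n F t. n1 <= n ==> gal n {- (q / d^2)..q / d^2} F ==> F 0 = f0 ==> t : {- (q / d^2)..q / d^2} ==> nrm 2 (F t) <= 7 * d"
proof -
 define T where "T = q / d^2"
 have T: "0 < T" "d^2 * T = q" using e a by (auto simp: T_def)
 define W where "W = 2 * eW 1 (Up 5 (7 * d) T f0) / (cK 1 * (7 * d)^2)"
 have W0: "0 <= W" using cK_pos[of 1] by (simp add: W_def)
 define n1 where "n1 = 2 * W / d^2 + 1"
 have n1: "0 < n1" using W0 by (simp add: n1_def add_nonneg_pos)
 have "nrm 2 (F t) <= 7 * d" if n: "n1 <= n" and F: "gal n {- T..T} F" "F 0 = f0" and t: "t : {- T..T}" for n F t
 proof -
  have n0: "0 < n" using n n1 by linarith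
  have Wn: "W / n <= d^2 / 2"
  proof -
   have "2 * W / d^2 <= n" using n by (simp add: n1_def)
   then show ?thesis using e n0 by (simp add: field_simps)
  qed
  have f0n: "(nrm 2 f0)^2 <= d^2" using f0 by (intro power_mono) auto
  have f00: "(nrm 0 f0)^2 <= d^2" using X_mono(2)[OF f0(2), of 0] f0 by (intro power_mono) auto
  show ?thesis
  proof (rule bootstrap[where y="%t. nrm 2 (F t)" and T=T and B="6 * d"])
   show "continuous_on {- T..T} (%t. nrm 2 (F t))"
    by (rule Xcont_nrm[OF Xderiv_Xcont[OF gal_Xderiv[OF F(1)]]]) (use n0 in auto)
   show "nrm 2 (F 0) <= 6 * d" using f0 e F by simp
   fix r assume r: "0 <= r" "r <= T" and b: "!!t. t : {- r..r} ==> nrm 2 (F t) <= 7 * d"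
   fix t assume t: "t : {- r..r}"
   have Fr: "gal n {- r..r} F" by (rule gal_subset[OF F(1)]) (use r in auto)
   have "en (Suc 1) (F t) <= (3 * en (Suc 1) f0 + 2 * (eW 1 (Up (2 * 1 + 3) (7 * d) T f0) / n) / (cK 1 * (7 * d)^2)) * exp (cK 1 * 49 * q)"
    by (rule gal_modified'[OF Fr n0 b e(1) t _ r(2) _ F(2)]) (use e T in "auto simp: e1_def")
   also have "2 * (eW 1 (Up (2 * 1 + 3) (7 * d) T f0) / n) / (cK 1 * (7 * d)^2) = W / n" by (simp add: W_def)
   finally have 1: "en 2 (F t) <= (3 * en 2 f0 + W / n) * exp (cK 1 * 49 * q)" by (simp add: numeral_2_eq_2)
   have "cK 1 * 49 * q <= cK 1 * 49 * al1" using a cK_pos[of 1] by (intro mult_left_mono) auto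
   also have "... = ln 2" using cK_pos[of 1] by (simp add: al1_def del: cK_pos)
   finally have "exp (cK 1 * 49 * q) <= exp (ln 2)" by (subst exp_le_cancel_iff)
   then have "exp (cK 1 * 49 * q) <= 2" by simp
   then have "(3 * en 2 f0 + W / n) * exp (cK 1 * 49 * q) <= (3 * en 2 f0 + W / n) * 2"
    using W0 n0 by (intro mult_left_mono add_nonneg_nonneg) auto
   moreover have "en 2 f0 <= d^2" using nrm_en(2)[of f0 2] f0(2) f0n by simp
   ultimately have 2: "en 2 (F t) <= 7 * d^2" using order_trans[OF 1, of "(3 * en 2 f0 + W / n) * 2"] Wn by argo
   have "(nrm 2 (F t))^2 <= 4 * ((nrm 0 (F t))^2 + en 2 (F t))"
    using nrm_en(1)[of "F t" 2] XSD[OF gal_XS[OF Fr _ t]] n0 by simp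
   also have "nrm 0 (F t) = nrm 0 f0" using gal_L2[OF Fr _ t, of 0] n0 r F by simp
   finally have "(nrm 2 (F t))^2 <= 36 * d^2" using 2 f00 zero_le_power2[of d] by argo
   then have "(nrm 2 (F t))^2 <= (6 * d)^2" by (simp add: power_mult_distrib)
   then show "nrm 2 (F t) <= 6 * d" by (rule power2_le_imp_le) (use e in simp)
  qed (use e T t in auto)
 qed
 with n1 that[of n1] show ?thesis unfolding T_def by blast
qed

text \<open>One summand for each regime: the first for data small enough for the corrected energy of
  order \<open>Suc J\<close>, the second for larger data, where it is the exponential growth over
  the longest lifetime that is then possible.\<close>

definition EC :: "nat => real" where
 "EC J = 3 * exp (cK J * 49 * al1) + exp ((CB J * (c1 * 7) + 1) * (al1 * (14 * (CB J * c1 + 1))^2))"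

lemma EC_nonneg [simp]: "0 <= EC J" unfolding EC_def by (intro add_nonneg_nonneg mult_nonneg_nonneg) auto

lemma gal_energy:
 assumes e: "0 < q" "q <= e1" and a: "0 < r" "r <= al1" and n1: "0 < n1"
  and b: "!!n F t. n1 <= n ==> gal n {- (r / q^2)..r / q^2} F ==> F 0 = f0 ==> t : {- (r / q^2)..r / q^2} ==> nrm 2 (F t) <= 7 * q"
  and d: "0 < \<delta>"
 obtains n2 where "n1 <= n2" "!!n F t. n2 <= n ==> gal n {- (r / q^2)..r / q^2} F ==> F 0 = f0 ==> t : {- (r / q^2)..r / q^2}
  ==> en (Suc J) (F t) <= EC J * en (Suc J) f0 + \<delta>"
proof -
 define T where "T = r / q^2"
 have T: "0 < T" "q^2 * T = r" using e a by (auto simp: T_def)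
 have p: "0 < CB J * c1 + 1" by (intro add_nonneg_pos mult_nonneg_nonneg) auto
 show ?thesis
 proof (cases "q <= 1 / (14 * (CB J * c1 + 1))")
  case True
  define x where "x = exp (cK J * 49 * r)"
  have x: "0 < x" "x <= exp (cK J * 49 * al1)" using a cK_pos[of J] by (auto simp: x_def)
  define W where "W = 2 * eW J (Up (2 * J + 3) (7 * q) T f0) / (cK J * (7 * q)^2) * x"
  have W0: "0 <= W" using cK_pos[of J] x by (simp add: W_def)
  show ?thesis
  proof (rule that[of "max n1 (W / \<delta>)"])
   fix n F t assume n: "max n1 (W / \<delta>) <= n" and F: "gal n {- (r / q^2)..r / q^2} F" "F 0 = f0" and t: "t : {- (r / q^2)..r / q^2}"
   have n0: "0 < n" using n n1 by linarith
   have bF: "nrm 2 (F t) <= 7 * q" if "t : {- (r / q^2)..r / q^2}" for t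
    using b[of n F t] n F that by simp
   have Wn: "W / n <= \<delta>"
   proof -
    have "W / \<delta> <= n" using n by simp
    then show ?thesis using d n0 by (simp add: field_simps)
   qed
   have "en (Suc J) (F t) <= (3 * en (Suc J) f0 + 2 * (eW J (Up (2 * J + 3) (7 * q) T f0) / n) / (cK J * (7 * q)^2)) * x"
    unfolding x_def
    by (rule gal_modified'[OF F(1) n0 bF e(1) t True _ _ F(2)]) (use T in "auto simp: T_def")
   also have "... = 3 * x * en (Suc J) f0 + W / n" by (simp add: W_def distrib_right)
   also have "... <= EC J * en (Suc J) f0 + \<delta>"
    using x Wn by (intro add_mono mult_right_mono) (auto simp: EC_def intro: add_increasing2)
   finally show "en (Suc J) (F t) <= EC J * en (Suc J) f0 + \<delta>" .
  qed simp
 next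
  case False
  show ?thesis
  proof (rule that[of n1])
   fix n F t assume n: "n1 <= n" and F: "gal n {- (r / q^2)..r / q^2} F" "F 0 = f0" and t: "t : {- (r / q^2)..r / q^2}"
   have bF: "nrm 2 (F t) <= 7 * q" if "t : {- (r / q^2)..r / q^2}" for t
    using b[of n F t] n F that by simp
   \<comment> \<open>Here \<open>q\<close> is bounded below by a constant depending on
     \<open>J\<close>, so the lifetime r / q^2 is bounded above and the uncorrected rate is good
     enough.\<close>
   have "1 < q * (14 * (CB J * c1 + 1))" using False p by (simp add: field_simps)
   then have "1 <= (q * (14 * (CB J * c1 + 1)))^2" by (intro one_le_power) simp
   then have "r * 1 <= al1 * (q * (14 * (CB J * c1 + 1)))^2" using a by (intro mult_mono) auto
   then have "r <= (al1 * (14 * (CB J * c1 + 1))^2) * q^2" by (simp only: power_mult_distrib mult_ac mult_1_right)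
   then have "r / q^2 <= al1 * (14 * (CB J * c1 + 1))^2" using e by (simp add: pos_divide_le_eq)
   then have t': "\<bar>t\<bar> <= al1 * (14 * (CB J * c1 + 1))^2" using t by auto
   have "en (Suc J) (F t) <= en (Suc J) (F 0) * exp ((CB J * (c1 * (7 * q)) + 1) * \<bar>t\<bar>)"
    by (rule gal_crude[OF F(1) _ bF _ t]) (use n n1 e in auto)
   also have "... <= en (Suc J) f0 * EC J"
    unfolding F(2)
   proof (rule mult_left_mono)
    have "7 * q <= 7" using e e1_pos by simp
    then have "CB J * (c1 * (7 * q)) + 1 <= CB J * (c1 * 7) + 1" by (intro add_right_mono mult_left_mono) auto
    then have "(CB J * (c1 * (7 * q)) + 1) * \<bar>t\<bar> <= (CB J * (c1 * 7) + 1) * (al1 * (14 * (CB J * c1 + 1))^2)"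
     using t' by (intro mult_mono add_nonneg_nonneg mult_nonneg_nonneg) auto
    then have "exp ((CB J * (c1 * (7 * q)) + 1) * \<bar>t\<bar>) <= exp ((CB J * (c1 * 7) + 1) * (al1 * (14 * (CB J * c1 + 1))^2))" by simp
    also have "... <= EC J" by (simp add: EC_def)
    finally show "exp ((CB J * (c1 * (7 * q)) + 1) * \<bar>t\<bar>) <= EC J" .
   qed simp
   finally show "en (Suc J) (F t) <= EC J * en (Suc J) f0 + \<delta>" using d by (simp add: mult.commute)
  qed simp
 qed
qed

lemma sgnm_diff: "(%x. sgnm f x - sgnm g x) = sgnm (%x. f x - g x)"
 by (auto simp: sgnm_def right_diff_distrib)

section \<open>Smooth solutions\<close>

lemma Xderiv_diff:
 assumes "Xderiv I s f v" "Xderiv I s g w" shows "Xderiv I s (%t x. f t x - g t x) (%t x. v t x - w t x)"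
 using Xderiv_lin[OF assms, of 1 "-1"] by simp

text \<open>Two truncations of the same problem. The difference is transported without loss of a
  derivative by \<open>diff_cubic_bound\<close>; each cutoff adds an error 2 c1 b^2 / p, and pairing
  the two with a difference of norm at most 2 b and doubling gives 16 c1 b^3 / p. The bound
  deteriorates with time but tends to 0 with 1 / p, as convergence demands.\<close>

lemma gal_diff_L2:
 assumes F: "gal n {- T..T} F" and G: "gal m {- T..T} G" and p: "0 < p" "p <= n" "p <= m" and e: "F 0 = G 0"
  and b: "!!t. t : {- T..T} ==> nrm 2 (F t) <= b" "!!t. t : {- T..T} ==> nrm 2 (G t) <= b" and t: "t : {- T..T}"
 shows "(nd 0 (F t) (G t))^2 <= (16 * c1 * b ^ 3 / p) / (c1 * (2 * b) + 1) * exp ((c1 * (2 * b) + 1) * T)"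
proof -
 have n: "0 < n" "0 < m" "0 <= n" "0 <= m" using p by auto
 have b0: "0 <= b" using b(1)[OF t] nrm_nonneg[of 2 "F t"] by linarith
 let ?c = "c1 * (2 * b) + 1" and ?e = "16 * c1 * b ^ 3 / p"
 have c: "0 < ?c" using b0 by (intro add_nonneg_pos mult_nonneg_nonneg) auto
 have e0: "0 <= ?e" using b0 p by simp
 let ?k = "%x::real. 1::real"
 have k: "mult_le 0 ?k" by (simp add: mult_le_def)
 let ?V = "%n F t x. sgnm (F t) x + ct n (Nl (F t)) x"
 let ?D = "%t x. F t x - G t x"
 have D: "Xderiv {- T..T} 0 ?D (%t x. ?V n F t x - ?V m G t x)"
  by (intro Xderiv_diff gal_Xderiv[OF F n(3)] gal_Xderiv[OF G n(4)]) simp_all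
 have "kip ?k (?D t) (?D t) <= (kip ?k (?D 0) (?D 0) + ?e / ?c) * exp (?c * \<bar>t\<bar>)"
 proof (rule gronwall[OF kip_deriv[OF k D D] _ c e0 t])
  fix t assume t: "t : {- T..T}"
  note XF = XSD[OF gal_XS[OF F n(3) t]] and XG = XSD[OF gal_XS[OF G n(4) t]]
  have DX: "?D t : X s" for s by (intro X_diff XF XG)
  let ?S = "%x. F t x + G t x"
  have SX: "?S : X s" for s by (intro X_add XF XG)
  let ?w = "%n F x. ct n (Nl (F t)) x - Nl (F t) x"
  have wX: "?w n F : X 0" "?w m G : X 0" by (intro X_diff ct_X Nl_X(1) XF XG; simp)+
  have BX: "Bl (?D t) ?S : X 0" by (rule Bl_X(1)[OF _ DX SX]) simp
  have w: "nd 0 (ct n (Nl g)) (Nl g) <= 2 * c1 * b^2 / p" if "!!s. g : X s" "nrm 2 (g) <= b" "p <= n" for n g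
  proof -
   have "nd 0 (ct n (Nl g)) (Nl g) <= 1 / n * nrm (0 + 1) (Nl (g))" using p that by (intro ct_tail Nl_X(1)) auto
   also have "... <= 1 / p * (2 powr 1 * c1 * b^2)"
   proof (rule mult_mono)
    have "nrm 1 (Nl (g)) <= 2 powr 1 * c1 * (nrm (1 + 1) (g))^2" using that by (intro Nl_X(2)) auto
    also have "... <= 2 powr 1 * c1 * b^2" using that by (intro mult_left_mono power_mono) auto
    finally show "nrm (0 + 1) (Nl (g)) <= 2 powr 1 * c1 * b^2" by simp
   qed (use p that in "auto simp: frac_le")
   finally show ?thesis by simp
  qed
  have Deq: "(%x. ?V n F t x - ?V m G t x) = (%x. (sgnm (?D t) x + Bl (?D t) ?S x) + (?w n F x - ?w m G x))"
   using fun_cong[OF Nl_diff_Bl[OF XF XG]] fun_cong[OF sgnm_diff[of "F t" "G t"]]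
   by (auto simp: fun_eq_iff algebra_simps)
  have X1: "sgnm (?D t) : X 0" "(%x. ?w n F x - ?w m G x) : X 0" by (intro sgnm_X DX X_diff wX)+
  have "kip ?k (%x. ?V n F t x - ?V m G t x) (?D t) = kip ?k (Bl (?D t) ?S) (?D t) + kip ?k (%x. ?w n F x - ?w m G x) (?D t)"
   unfolding Deq using kip_add_left[OF k X_add[OF X1(1) BX] X1(2) DX] kip_add_left[OF k X1(1) BX DX] kip_sgnm[of ?k "?D t"] by simp
  then have e1: "kip ?k (%x. ?V n F t x - ?V m G t x) (?D t) + kip ?k (?D t) (%x. ?V n F t x - ?V m G t x)
   = 2 * kip ?k (Bl (?D t) ?S) (?D t) + 2 * kip ?k (%x. ?w n F x - ?w m G x) (?D t)"
   using kip_commute[of ?k "?D t"] by simp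
  have hD: "herm (?D t)"
   using galD(3)[OF F t] galD(3)[OF G t] unfolding herm_def by eventually_elim simp
  have 1: "\<bar>2 * kip ?k (Bl (?D t) ?S) (?D t)\<bar> <= c1 * (2 * b) * kip ?k (?D t) (?D t)"
  proof -
   have "\<bar>2 * kip ?k (Bl (?D t) ?S) (?D t)\<bar> <= c1 * nrm 2 ?S * (nrm 0 (?D t))^2" by (rule diff_cubic_bound[OF SX DX hD])
   also have "... <= c1 * (2 * b) * (nrm 0 (?D t))^2"
    using nrm_triangle[OF XF XG, of 2] b[OF t] by (intro mult_right_mono mult_left_mono) auto
   finally show ?thesis by (simp add: kip_self nrm_0)
  qed
  have 2: "\<bar>2 * kip ?k (%x. ?w n F x - ?w m G x) (?D t)\<bar> <= ?e"
  proof -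
   have "\<bar>kip ?k (%x. ?w n F x - ?w m G x) (?D t)\<bar> <= nd 0 (?w n F) (?w m G) * nrm 0 (?D t)"
    by (rule kip_bound[OF k X1(2) DX])
   also have "... <= (2 * c1 * b^2 / p + 2 * c1 * b^2 / p) * (2 * b)"
   proof (rule mult_mono)
    show "nd 0 (?w n F) (?w m G) <= 2 * c1 * b^2 / p + 2 * c1 * b^2 / p"
     by (rule order_trans[OF nrm_triangle_diff[OF wX] add_mono[OF w[OF XF b(1)[OF t] p(2)] w[OF XG b(2)[OF t] p(3)]]])
    have "nrm 0 (?D t) <= nrm 0 (F t) + nrm 0 (G t)" by (rule nrm_triangle_diff[OF XF XG])
    then show "nrm 0 (?D t) <= 2 * b"
     using X_mono(2)[OF XF, of 0 2] X_mono(2)[OF XG, of 0 2] b[OF t] by simp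
   qed (use b0 p in auto)
   also have "... = ?e / 2" by (simp add: power2_eq_square power3_eq_cube)
   finally show ?thesis by simp
  qed
  have kD: "0 <= kip ?k (?D t) (?D t)" by (simp add: kip_self)
  have "\<bar>2 * kip ?k (Bl (?D t) ?S) (?D t) + 2 * kip ?k (%x. ?w n F x - ?w m G x) (?D t)\<bar> <= c1 * (2 * b) * kip ?k (?D t) (?D t) + ?e"
   by (rule order_trans[OF abs_triangle_ineq add_mono[OF 1 2]])
  also have "... <= ?c * kip ?k (?D t) (?D t) + ?e" using kD by (simp add: distrib_right)
  finally show "\<bar>kip ?k (%x. ?V n F t x - ?V m G t x) (?D t) + kip ?k (?D t) (%x. ?V n F t x - ?V m G t x)\<bar> <= ?c * kip ?k (?D t) (?D t) + ?e"
   unfolding e1 .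
 qed
 also have "kip ?k (?D 0) (?D 0) = 0" by (simp add: e kip_self)
 also have "(0 + ?e / ?c) * exp (?c * \<bar>t\<bar>) <= ?e / ?c * exp (?c * T)"
 proof -
  have "?c * \<bar>t\<bar> <= ?c * T" using c t by (intro mult_left_mono) auto
  moreover have "0 <= ?e / ?c" by (rule divide_nonneg_pos[OF e0 c])
  ultimately show ?thesis unfolding add_0 by (intro mult_left_mono) (simp_all only: exp_le_cancel_iff)
 qed
 finally show ?thesis by (simp add: kip_self nrm_0)
qed

definition DK :: "nat => real" where "DK J = sqrt (2 ^ Suc J * (1 + EC J))"

lemma DK_nonneg [simp]: "0 <= DK J" using EC_nonneg[of J] by (simp add: DK_def)

abbreviation (input) bh :: "(real => cfun) => real => cfun" where
 "bh F \<equiv> %t x. sgnm (F t) x + Nl (F t) x"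

lemma bh_Lipschitz:
 assumes s: "0 <= s" and f: "f : X (s + 1)" "nrm (s + 1) f <= B" and g: "g : X (s + 1)" "nrm (s + 1) g <= B"
 shows "nrm s (%x. (sgnm f x + Nl f x) - (sgnm g x + Nl g x)) <= (1 + cA s * (2 * B)) * nd (s + 1) f g"
proof -
 let ?D = "%x. f x - g x" and ?N = "%x. Nl f x - Nl g x"
 have D: "?D : X (s + 1)" "?N : X s" by (intro X_diff f g Nl_X s)+
 have D0: "?D : X s" "nrm s ?D <= nrm (s + 1) ?D" by (intro X_mono[OF D(1)]; simp)+
 have "(%x. (sgnm f x + Nl f x) - (sgnm g x + Nl g x)) = (%x. sgnm ?D x + ?N x)" by (auto simp: sgnm_def algebra_simps)
 then have "nrm s (%x. (sgnm f x + Nl f x) - (sgnm g x + Nl g x)) <= nrm s (sgnm ?D) + nrm s ?N"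
  using nrm_triangle[OF sgnm_X(1)[OF D0(1)] D(2)] by simp
 also have "... <= nrm (s + 1) ?D + cA s * (nrm (s + 1) ?D * (2 * B))"
  using sgnm_X(2)[OF D0(1)] D0(2) f(2) g(2) by (intro add_mono order_trans[OF Nl_diff[OF s f(1) g(1)]] mult_left_mono) auto
 finally show ?thesis by (simp add: algebra_simps)
qed

lemma bh_X: "0 <= s ==> f : X (s + 1) ==> (%x. sgnm f x + Nl f x) : X s"
 using X_mono(1)[of f "s + 1" s] by (auto intro!: X_add sgnm_X Nl_X)

text \<open>The bounds reach order k + 1, one above the order of the theorem, because integrating
  tails requires a bound of an order at least s + 1 for every s <= k.\<close>

definition smooth_sol :: "nat => real => (real => cfun) => bool" where
 "smooth_sol k T F \<longleftrightarrow> (\<forall>t\<in>{- T..T}. F t : XS \<and> herm (F t)) \<and> Xcont {- T..T} (real k + 1) F \<and> Xderiv {- T..T} (real k) F (bh F)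
  \<and> (\<forall>t\<in>{- T..T}. nrm 0 (F t) <= nrm 0 (F 0)) \<and> (\<forall>J\<le>k. \<forall>t\<in>{- T..T}. nrm (real (Suc J)) (F t) <= DK J * nrm (real (Suc J)) (F 0))"

text \<open>The truncated solutions are Cauchy in L2 by \<open>gal_diff_L2\<close>, and in every
  other order by interpolation with the bounds \<open>Mb\<close>. All cutoffs exceed the band of the
  data, so the initial value is never altered. The sharp bounds are inherited from
  \<open>gal_energy\<close>, whose error vanishes in the limit.\<close>

lemma smooth_solution:
 assumes e: "0 < q" "q <= e1" and a: "0 < \<alpha>" "\<alpha> <= al1" 
  and f0: "f0 : X 0" "ct N f0 = f0" "herm f0" "nrm 2 f0 <= q" and N: "0 <= N"
 obtains F where "F 0 = f0" "smooth_sol k (\<alpha> / q^2) F"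
proof -
 define T where "T = \<alpha> / q^2"
 have T: "0 < T" using e a by (auto simp: T_def)
 have T0: "0 : {- T..T}" using T by auto
 have f0X: "f0 : X s" for s using ct_XS[OF f0(1) N] f0(2) XSD by metis
 obtain n1 where n1: "0 < n1"
  and b: "!!n F t. n1 <= n ==> gal n {- T..T} F ==> F 0 = f0 ==> t : {- T..T} ==> nrm 2 (F t) <= 7 * q"
  using gal_H2[OF e a f0(4) f0X] unfolding T_def by blast
 define nn where "nn i = max n1 N + 1 + real i" for i :: nat
 have nn: "0 < nn i" "0 <= nn i" "n1 <= nn i" "N <= nn i" "real i < nn i" for i using n1 by (auto simp: nn_def)
 have "\<exists>F. F 0 = f0 \<and> gal (nn i) {- T..T} F" for i
 proof -
  have "ct (nn i) f0 = f0"
  proof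
   fix x
   have "f0 x = 0" if "\<not> \<bar>x\<bar> <= N" using fun_cong[OF f0(2), of x] that by (simp add: ct_def)
   then show "ct (nn i) f0 x = f0 x" using nn(4)[of i] by (auto simp: ct_def)
  qed
  from gal_global[OF f0(1) this f0(3) nn(2)] show ?thesis by metis
 qed
 then obtain G where G: "!!i. G i 0 = f0" "!!i. gal (nn i) {- T..T} (G i)" by metis
 have GX: "G i t : X s" if "t : {- T..T}" for i t s using XSD[OF gal_XS[OF G(2) nn(2) that]] .
 have G2: "nrm 2 (G i t) <= 7 * q" if "t : {- T..T}" for i t by (rule b[OF nn(3) G(2) G(1) that])
 \<comment> \<open>Uniform in the truncation but growing with \<open>T\<close>: enough for
   interpolation and for the error of the cutoff, not for the bounds that are to be proved.\<close>
 define Mb where "Mb s = Up (nat \<lceil>s\<rceil>) (7 * q) T f0" for s :: real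
 have GM: "nrm s (G i t) <= Mb s" if t: "t : {- T..T}" for s i t
 proof -
  have "s <= real (Suc (nat \<lceil>s\<rceil>))" by linarith
  then have "nrm s (G i t) <= nrm (real (Suc (nat \<lceil>s\<rceil>))) (G i t)" by (intro X_mono(2)[OF GX[OF t]])
  also have "... <= Mb s"
   unfolding Mb_def Up_def G(1)[of i, symmetric] by (rule gal_upper[OF G(2) nn(2) G2 _ t order_refl]) (use e in auto)
  finally show ?thesis .
 qed
 have Mb0: "0 <= Mb s" for s using GM[OF T0, of s 0] nrm_nonneg[of s "G 0 0"] by linarith
 define P where "P = (16 * c1 * (7 * q) ^ 3) / (c1 * (2 * (7 * q)) + 1) * exp ((c1 * (2 * (7 * q)) + 1) * T)"
 have P0: "0 <= P" using e by (simp add: P_def)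
 have G0: "(nd 0 (G i t) (G j t))^2 <= P / p" if t: "t : {- T..T}" and p: "0 < p" "p <= nn i" "p <= nn j" for t i j p
  using gal_diff_L2[OF G(2) G(2) p _ G2 G2 t] by (simp add: G(1) P_def mult.commute[of p])
 have cauchy: "\<exists>K. \<forall>i\<ge>K. \<forall>j\<ge>K. \<forall>t\<in>{- T..T}. nd s (G i t) (G j t) < d" if s: "0 <= s" and d: "0 < d" for s d
 proof -
  define R where "R = 2 * Mb (2 * s) + 1"
  have R: "0 < R" using Mb0[of "2 * s"] by (simp add: R_def)
  obtain K :: nat where K: "P * (R^2 / d ^ 4) < real K" using reals_Archimedean2 by blast
  have "nd s (G i t) (G j t) < d" if ij: "K <= i" "K <= j" and t: "t : {- T..T}" for i j t
  proof -
   let ?D = "%x. G i t x - G j t x"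
   have DX: "?D : X r" for r by (intro X_diff GX t)
   have K0: "0 < real K" using K P0 R d by (smt (verit) divide_nonneg_pos mult_nonneg_nonneg zero_le_power2 zero_less_power)
   have "(nrm s ?D)^2 <= nrm 0 ?D * nrm (2 * s) ?D" by (rule nrm_interp[OF s DX])
   also have "... <= nrm 0 ?D * R"
   proof (rule mult_left_mono)
    show "nrm (2 * s) ?D <= R" using nrm_triangle_diff[OF GX[OF t, of i "2 * s"] GX[OF t, of j "2 * s"]] GM[OF t, of "2 * s" i] GM[OF t, of "2 * s" j]
     by (simp add: R_def)
   qed simp
   finally have "((nrm s ?D)^2)^2 <= (nrm 0 ?D * R)^2" by (intro power_mono) auto
   also have "... <= P / real K * R^2"
    unfolding power_mult_distrib using G0[OF t K0, of i j] nn(5)[of i] nn(5)[of j] ij by (intro mult_right_mono) auto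
   also have "... < d ^ 4"
   proof -
    have "P * R^2 < real K * d ^ 4" using K d by (simp add: field_simps)
    then show ?thesis using K0 by (simp add: field_simps)
   qed
   finally have "(nrm s ?D) ^ 4 < d ^ 4" by (simp add: power_mult[symmetric])
   from power_less_imp_less_base[OF this] d show ?thesis by simp
  qed
  then show ?thesis by blast
 qed
 let ?s = "real k"
 have s1: "0 <= ?s + 1" by simp
 have GD: "Xderiv {- T..T} s (G i) (%t x. sgnm (G i t) x + ct (nn i) (Nl (G i t)) x)" if "0 <= s" for s i by (rule gal_Xderiv[OF G(2) nn(2) that])
 obtain F where Fc: "Xcont {- T..T} (?s + 1) F" and FD: "Xderiv {- T..T} ?s F (bh F)" and Fh: "!!t. t : {- T..T} ==> herm (F t)"
  and lim: "!!d. 0 < d ==> \<exists>K. \<forall>i\<ge>K. \<forall>t\<in>{- T..T}. nd (?s + 1) (G i t) (F t) < d"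
  and fat: "!!t r h c N. t : {- T..T} ==> (!!i. G i t : X r) ==> h : X r ==> 0 <= c ==> (!!j. j \<ge> N ==> nd r (G j t) h <= c) ==> F t : X r \<and> nd r (F t) h <= c"
  and Fe: "!!t x c. t : {- T..T} ==> (!!i. G i t x = c) ==> F t x = c"
 proof (rule Xderiv_limit[where I="{- T..T}" and s="?s" and r="?s + 1" and P="%f x. sgnm f x + Nl f x",
    OF _ _ _ Xderiv_Xcont[OF GD[OF s1]] GM Mb0 galD(3)[OF G(2)] GD bh_X bh_Lipschitz _ cauchy])
  fix d :: real assume d: "0 < d"
  define W where "W = 2 powr (?s + 1) * c1 * (Mb (?s + 2))^2"
  obtain K :: nat where K: "W / d < real K" using reals_Archimedean2 by blast
  have "nrm ?s (%x. (sgnm (G i t) x + ct (nn i) (Nl (G i t)) x) - bh (G i) t x) < d" if i: "K <= i" and t: "t : {- T..T}" for i t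
  proof -
   have "nrm ?s (%x. ct (nn i) (Nl (G i t)) x - Nl (G i t) x) <= 1 / nn i * nrm (?s + 1) (Nl (G i t))" by (intro ct_tail nn Nl_X GX t) simp
   also have "... <= 1 / nn i * (2 powr (?s + 1) * c1 * (nrm (?s + 1 + 1) (G i t))^2)"
    using nn(2)[of i] by (intro mult_left_mono Nl_X(2) GX t) auto
   also have "... <= 1 / nn i * W"
    unfolding W_def using nn(2)[of i] GM[OF t, of "?s + 2" i] by (intro mult_left_mono power_mono) (auto simp: add.assoc)
   also have "... < d" 
   proof -
    have "W / d < nn i" using K i nn(5)[of i] by linarith
    then show ?thesis using d nn(1)[of i] by (simp add: field_simps)
   qed
   finally show ?thesis by simp
  qed
  then show "\<exists>K. \<forall>i\<ge>K. \<forall>t\<in>{- T..T}. nrm ?s (%x. (sgnm (G i t) x + ct (nn i) (Nl (G i t)) x) - bh (G i) t x) < d" by blast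
 qed (use s1 in auto)
 have F0: "F 0 = f0" by (rule ext, rule Fe[OF T0]) (simp add: G(1))
 have FX: "F t : X s" if "t : {- T..T}" for t s
  using fat[OF that GX[OF that] X_zero Mb0[of s], where N=0] GM[OF that, of s] by simp
 have F00: "nrm 0 (F t) <= nrm 0 (F 0)" if t: "t : {- T..T}" for t
  using fat[OF t GX[OF t] X_zero nrm_nonneg, of 0 0 0 f0] gal_L2[OF G(2) nn(2) t T0] by (simp add: G(1) F0)
 have FK: "nrm (real (Suc J)) (F t) <= DK J * nrm (real (Suc J)) (F 0)" if t: "t : {- T..T}" and Jk: "J <= k" for J t
 proof (rule field_le_epsilon)
  let ?K = "real (Suc J)"
  fix d :: real assume d: "0 < d"
  \<comment> \<open>Chosen so that the energy error contributes d / 2 to the norm; the other half of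
    \<open>d\<close> is left for the distance between the approximation and the limit.\<close>
  define \<delta> where "\<delta> = (d / 2)^2 / 2 ^ Suc J"
  have \<delta>: "0 < \<delta>" using d by (simp add: \<delta>_def)
  obtain n2 where n2: "!!n F t. n2 <= n ==> gal n {- T..T} F ==> F 0 = f0 ==> t : {- T..T} ==> en (Suc J) (F t) <= EC J * en (Suc J) f0 + \<delta>"
  proof (rule gal_energy[OF e a n1 _ \<delta>, where J=J and ?f0.0=f0, folded T_def])
   show "nrm 2 (F t) <= 7 * q" if "n1 <= n" "gal n {- T..T} F" "F 0 = f0" "t : {- T..T}" for n F t
    using that by (rule b)
  qed blast
  obtain K where K0: "\<forall>i\<ge>K. \<forall>t\<in>{- T..T}. nd (?s + 1) (G i t) (F t) < d / 2" using lim[of "d / 2"] d by auto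
  obtain K' :: nat where K': "n2 < real K'" using reals_Archimedean2 by blast
  define i where "i = max K K'"
  have "real K' <= real i" by (simp add: i_def)
  then have ni: "n2 <= nn i" using nn(5)[of i] K' by linarith
  have "nd ?K (G i t) (F t) <= nd (?s + 1) (G i t) (F t)"
   by (rule X_mono(2)[OF X_diff[OF GX[OF t] FX[OF t]]]) (use Jk in simp)
  then have Gd: "nd ?K (G i t) (F t) < d / 2" by (rule order_le_less_trans) (use K0 t in "simp add: i_def")
  have "(nrm ?K (G i t))^2 <= 2 ^ Suc J * ((nrm 0 (G i t))^2 + en (Suc J) (G i t))" by (rule nrm_en(1)[OF GX[OF t]])
  also have "... <= 2 ^ Suc J * ((nrm ?K f0)^2 + (EC J * (nrm ?K f0)^2 + \<delta>))"
  proof (intro mult_left_mono add_mono)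
   show "(nrm 0 (G i t))^2 <= (nrm ?K f0)^2"
    using gal_L2[OF G(2) nn(2) t T0, of i] X_mono(2)[OF f0X, of 0 ?K] by (intro power_mono) (auto simp: G(1))
   have "en (Suc J) (G i t) <= EC J * en (Suc J) f0 + \<delta>" by (rule n2[OF ni G(2) G(1) t])
   also have "... <= EC J * (nrm ?K f0)^2 + \<delta>" by (intro add_right_mono mult_left_mono nrm_en f0X) auto
   finally show "en (Suc J) (G i t) <= EC J * (nrm ?K f0)^2 + \<delta>" .
  qed auto
  also have "... = (DK J * nrm ?K f0)^2 + (d / 2)^2"
  proof -
   have "(DK J)^2 = 2 ^ Suc J * (1 + EC J)" unfolding DK_def using EC_nonneg[of J] by (intro real_sqrt_pow2) simp
   moreover have "2 ^ Suc J * \<delta> = (d / 2)^2" by (simp add: \<delta>_def)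
   ultimately show ?thesis unfolding power_mult_distrib by (simp only: distrib_left distrib_right mult_1 mult_1_right mult.assoc add.assoc)
  qed
  also have "... <= (DK J * nrm ?K f0 + d / 2)^2"
   using d DK_nonneg[of J] by (simp add: power2_sum)
  finally have "nrm ?K (G i t) <= DK J * nrm ?K f0 + d / 2"
   by (rule power2_le_imp_le) (use d in "simp add: add_nonneg_nonneg")
  then show "nrm ?K (F t) <= DK J * nrm ?K (F 0) + d"
   using Gd nrm_rev_triangle[OF GX[OF t, of i ?K] FX[OF t, of ?K]] unfolding F0 by linarith
 qed
 have "F t : XS \<and> herm (F t)" if "t : {- T..T}" for t using FX[OF that] Fh[OF that] by (auto intro: XSI)
 then have "smooth_sol k T F" unfolding smooth_sol_def using Fc FD F00 FK by blast
 then show ?thesis using that F0 unfolding T_def by blast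
qed

section \<open>Stability\<close>

text \<open>The correction for the equation of a difference of two solutions: the first slot is the sum of the solutions, and \<open>x\<close> is its frequency.\<close>

definition bs :: "real => cfun" where "bs x y = cr (x * sg3 x y (- x - y))"

lemma bs_meas [measurable]: "(%(x, y). bs x y) : borel_measurable M2" unfolding bs_def by measurable

lemma cmod_bs: "cmod (bs x y) <= 3 * \<bar>x\<bar>"
 unfolding bs_def norm_of_real by (rule mult_sg3_le)

lemma sym3_bs: "sym3 1 bs 3"
 unfolding sym3_def
proof (intro conjI allI bs_meas)
 fix x y
 have "cmod (bs x y) <= 3 * \<bar>x\<bar>" by (rule cmod_bs)
 also have "... <= 3 * (wt 1 x * wt 1 y * wt (1 - 1) (- x - y))"
  using mult_mono[OF abs_le_wt[of x] wt_ge1[of 1 y]] by simp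
 finally show "cmod (bs x y) <= 3 * (wt 1 x * wt 1 y * wt (1 - 1) (- x - y))" .
qed simp

text \<open>In contrast to \<open>TK_sg3\<close> the symbol vanishes only with \<open>x\<close>; for
  y = 0 or x + y = 0 the sign sum need not be 1 or -1, so the symbols agree merely off a null
  set.\<close>

lemma bs_linear:
 assumes f: "f : X 1" and g: "g : X 1"
 shows "L3 bs (sgnm f) g g + L3 bs f (sgnm g) g + L3 bs f g (sgnm g) = - \<i> * L3 (%x y. cr x) f g g"
proof -
 have [measurable]: "meas f" "meas g" using f g by (auto intro: X_meas)
 have "L3 (%x y. bs x y * cr (sg3 x y (- x - y))) f g g = L3 (%x y. cr x) f g g"
  unfolding L3_def
 proof (rule integral_cong_AE)
  have "AE z in M2. case z of (x, y) => y \<noteq> 0 \<and> - x - y \<noteq> 0"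
  proof (rule lborel_pair.AE_pair_measure)
   have "(%z::real \<times> real. snd z) : borel_measurable M2" "(%z::real \<times> real. - fst z - snd z) : borel_measurable M2" by measurable
   then show "{x : space M2. case x of (x, y) => y \<noteq> 0 \<and> - x - y \<noteq> 0} : sets M2" by measurable
   have "ae y. y \<noteq> 0 \<and> - x - y \<noteq> 0" for x :: real
    using AE_lborel_singleton[of "0::real"] AE_lborel_singleton[of "- x"] by eventually_elim auto
   then show "ae x. ae y. case (x :: real, y) of (x, y) => y \<noteq> 0 \<and> - x - y \<noteq> 0" by simp
  qed
  then show "AE z in M2. F3 (%x y. bs x y * cr (sg3 x y (- x - y))) f g g z = F3 (%x y. cr x) f g g z"
  proof eventually_elim
   case (elim z)
   obtain x y where z: "z = (x, y)" by (cases z)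
   have xs: "x * sg3 x y (- x - y) * sg3 x y (- x - y) = x"
   proof (cases "x = 0")
    case False
    then have "(sg3 x y (- x - y))^2 = 1" using elim z by (intro sg3_sq) auto
    then show ?thesis by (simp add: power2_eq_square mult.assoc)
   qed simp
   have "bs x y * cr (sg3 x y (- x - y)) = cr x"
    unfolding bs_def of_real_mult[symmetric] xs ..
   then show ?case unfolding z case_prod_conv by (simp only:)
  qed
 qed measurable
 then show ?thesis using L3_sgnm[OF sym3_bs f g g] by simp
qed

lemma X2_parts:
 assumes "f : X 2"
 shows "f : L2" "mx f : L2" "mx (mx f) : L2" "integrable lborel f" "integrable lborel (mx f)" "f : X 1" "mx f : X 1" "meas f" "meas (mx f)" "meas (mx (mx f))"
proof -
 show 1: "f : X 1" by (rule X_mono(1)[OF assms]) simp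
 show 2: "mx f : X 1" by (rule mx_X'[OF assms]) simp
 have "mx (mx f) : X 0" by (rule mx_X'[OF 2]) simp
 then show "f : L2" "mx f : L2" "mx (mx f) : L2"
  using X_mono(1)[OF 1, of 0] X_mono(1)[OF 2, of 0] by (simp_all add: X_0)
 then show "meas f" "meas (mx f)" "meas (mx (mx f))" by (auto intro: L2_meas)
 show "integrable lborel f" "integrable lborel (mx f)" by (rule X_L1(1)[OF 1], rule X_L1(1)[OF 2])
qed

lemma half_conv_square: assumes "f : X 1" shows "mx (conv f f) x = 2 * conv (mx f) f x"
 using conv_mx[OF assms assms, of x] by (simp add: conv_commute[of f "mx f"])

lemma bs_swap: assumes "meas f" "meas g" "meas w" shows "L3 bs f g w = L3 bs f w g"
proof -
 have "bs x (- x - y) = bs x y" for x y by (simp add: bs_def sg3_def add_ac)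
 then show ?thesis using L3_swap23[OF bs_meas assms] by simp
qed

lemma bs_shift_meas: "(%(h, x, y). bs (x + h) y) : borel_measurable M3" unfolding bs_def by measurable

text \<open>\<open>shift_int\<close> would ask for \<open>mx f : X 2\<close>, one order too many.
  Instead |x + h| <= |x| + |h| places the weight of the symbol on the two factors from
  \<open>f\<close>, and integrability follows by hand.\<close>

lemma bs_slot1:
 assumes f: "f : X 2" and g: "g : X 2"
 shows "integrable M3 (F4 (%h x y. bs (x + h) y) f (mx f) g g)" "L3 bs (conv (mx f) f) g g = L4 (%h x y. bs (x + h) y) f (mx f) g g"
proof -
 note F = X2_parts[OF f] and G = X2_parts[OF g]
 have "cmod (F4 (%h x y. bs (x + h) y) f (mx f) g g z) <= 3 * (\<Sum>u\<leftarrow>[P4 (mx f) (mx f) g g, P4 f (mx (mx f)) g g]. cmod (u z))" for z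
 proof -
  obtain h x y where z: "z = (h, x, y)" by (cases z)
  have "cmod (bs (x + h) y) <= 3 * (\<bar>x\<bar> + \<bar>h\<bar>)" by (rule order_trans[OF cmod_bs mult_left_mono[OF abs_triangle_ineq]]) simp
  from mult_right_mono[OF this norm_ge_zero[of "f h * mx f x * g y * g (- h - x - y)"]] show ?thesis
   by (simp add: z norm_mult norm_mx algebra_simps)
 qed
 from ib_dom(1)[OF F4_meas[OF bs_shift_meas F(8,9) G(8,8)] this, of "max (l1 (mx f) * l1 (mx f) * (n2 g * n2 g)) (l1 f * l1 g * (n2 (mx (mx f)) * n2 g))"]
 show i: "integrable M3 (F4 (%h x y. bs (x + h) y) f (mx f) g g)"
  using ib4(1)[OF F(5,5) G(1,1)] ib4(2)[OF F(4) G(4) F(3) G(1)] by (auto simp: ib_def le_max_iff_disj)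
 show "L3 bs (conv (mx f) f) g g = L4 (%h x y. bs (x + h) y) f (mx f) g g"
  by (rule L3_slot[OF bs_meas F(8,9) G(8,8) i])
qed

text \<open>The derivative outside the convolution and the factor \<open>x\<close> of
  \<open>bs\<close> change places: the derivative comes to rest on \<open>f\<close>, the symbol
  acquires the frequency of the convolution, and after a swap of slots it is \<open>bs\<close>
  again.\<close>

lemma bs_slot2:
 assumes f: "f : X 2" and g: "g : X 2"
 shows "integrable M3 (F4 (%h x y. bs (x + h) y) f g (mx f) g)" "L3 bs f (mx (conv g f)) g = L4 (%h x y. bs (x + h) y) f g (mx f) g"
proof -
 note F = X2_parts[OF f] and G = X2_parts[OF g]
 have "cmod (F4 (%h x y. bs (x + h) y) f g (mx f) g z) <= 3 * (\<Sum>u\<leftarrow>[P4 (mx f) g (mx f) g, P4 f (mx g) (mx f) g]. cmod (u z))" for z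
 proof -
  obtain h x y where z: "z = (h, x, y)" by (cases z)
  have "cmod (bs (x + h) y) <= 3 * (\<bar>x\<bar> + \<bar>h\<bar>)" by (rule order_trans[OF cmod_bs mult_left_mono[OF abs_triangle_ineq]]) simp
  from mult_right_mono[OF this norm_ge_zero[of "f h * g x * mx f y * g (- h - x - y)"]] show ?thesis
   by (simp add: z norm_mult norm_mx algebra_simps)
 qed
 from ib_dom(1)[OF F4_meas[OF bs_shift_meas F(8) G(8) F(9) G(8)] this, of "max (l1 (mx f) * l1 (mx f) * (n2 g * n2 g)) (l1 (mx g) * l1 (mx f) * (n2 f * n2 g))"]
 show i: "integrable M3 (F4 (%h x y. bs (x + h) y) f g (mx f) g)"
  using ib4(2)[OF F(5,5) G(1,1)] ib4(4)[OF G(5) F(5) F(1) G(1)] by (auto simp: ib_def le_max_iff_disj)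
 let ?b = "%x y. cr (y * sg3 x y (- x - y))"
 have [measurable]: "meas (conv g f)" using F G by measurable
 have "L3 bs f (mx (conv g f)) g = L3 ?b (mx f) (conv g f) g"
  by (rule L3_cong) (simp add: bs_def mx_def mult_ac)
 also have "... = L3 (%x y. ?b y x) (conv g f) (mx f) g" by (rule L3_swap12) (use F G in measurable)
 also have "(%x y. ?b y x) = bs" by (simp add: fun_eq_iff bs_def sg3_def minus_diff_commute(1)[of y x for x y] add_ac)
 also have "L3 bs (conv g f) (mx f) g = L4 (%h x y. bs (x + h) y) f g (mx f) g"
  by (rule L3_slot[OF bs_meas F(8) G(8) F(9) G(8) i])
 finally show "L3 bs f (mx (conv g f)) g = L4 (%h x y. bs (x + h) y) f g (mx f) g" .
qed

lemma Xderiv_cong_AE: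
 assumes d: "Xderiv I s f v" and w: "!!t. t : I ==> meas (w t)" "!!t. t : I ==> ae x. v t x = w t x"
 shows "Xderiv I s f w"
 unfolding Xderiv_def
proof (intro conjI ballI)
 fix t assume t: "t : I"
 show "f t : X s" "w t : X s" using XderivD[OF d t] X_cong_AE[OF _ w(1)[OF t] w(2)[OF t]] by auto
 have [measurable]: "meas (v t)" "meas (f t)" "meas (w t)" using XderivD[OF d t] X_meas w(1)[OF t] by auto
 have "((%r. nrm s (dq f v t r)) ---> 0) (at t within I)"
  using d t unfolding Xderiv_def by blast
 then show "((%r. nrm s (dq f w t r)) ---> 0) (at t within I)"
 proof (rule Lim_transform_eventually)
  show "\<forall>\<^sub>F r in at t within I. nrm s (dq f v t r) = nrm s (dq f w t r)"
   using eventually_within_in[of I t]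
  proof eventually_elim
   case (elim r)
   then have [measurable]: "meas (f r)" using XderivD(1)[OF d] X_meas by blast
   show ?case
   proof (rule nrm_cong_AE)
    show "ae x. (f r x - f t x) / cr (r - t) - v t x = (f r x - f t x) / cr (r - t) - w t x"
     using w(2)[OF t] by eventually_elim simp
   qed measurable
  qed
 qed
qed

lemma l1_sq_bound: "f : X 2 ==> nrm 2 f <= b ==> l1 (mx f) <= c1 * b"
 using mx_L1(2)[of f] mult_left_mono[of "nrm 2 f" b c1] by simp

text \<open>The three insertions describe transport by the same \<open>f\<close> in each slot.
  Symmetrized, their kernel is that of \<open>sg3_cancel\<close>, so its factor |h| falls on the
  second copy of \<open>f\<close> and \<open>g\<close> is not differentiated.\<close>

lemma bs_quartic:
 assumes f: "f : X 2" and g: "g : X 2"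
 shows "cmod (L3 bs (conv (mx f) f) g g + L3 bs f (mx (conv g f)) g + L3 bs f g (mx (conv g f))) <= 12 * ((l1 (mx f))^2 * (n2 g)^2)"
proof -
 note F = X2_parts[OF f] and G = X2_parts[OF g]
 note s = bs_slot1[OF f g] bs_slot2[OF f g]
 have mc: "meas (mx (conv g f))" using F G by measurable
 let ?k = "%h x y. bs (x + h) y"
 let ?K = "%h x y. ?k h x y + ?k h y x + ?k h (- h - x - y) x"
 have e: "L3 bs (conv (mx f) f) g g + L3 bs f (mx (conv g f)) g + L3 bs f g (mx (conv g f)) = L4 ?K f (mx f) g g"
  unfolding L4_symmetrize[OF bs_shift_meas F(8,9) G(8) s(1,3), symmetric] bs_swap[OF F(8) G(8) mc] s(2,4) by (simp only: mult_2 add.assoc)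
 have m: "(%(h, x, y). ?K h x y) : borel_measurable M3" unfolding bs_def by measurable
 have "cmod (F4 ?K f (mx f) g g w) <= 12 * (\<Sum>u\<leftarrow>[P4 (mx f) (mx f) g g]. cmod (u w))" for w
 proof -
  obtain h x y where w: "w = (h, x, y)" by (cases w)
  define z where "z = - h - x - y"
  have e: "- (x + h) - y = z" "- (y + h) - x = z" "- (z + h) - x = y" by (simp_all add: z_def)
  have "?K h x y = cr ((h + x) * sg3 (x + h) y z + (h + y) * sg3 x (y + h) z + (h + z) * sg3 x y (z + h))"
   unfolding bs_def z_def[symmetric] e of_real_add[symmetric] by (simp add: sg3_def add_ac)
  then have "cmod (?K h x y) <= 12 * \<bar>h\<bar>" using sg3_cancel[of h x y z] by (simp only: norm_of_real) (simp add: z_def)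
  from mult_right_mono[OF this norm_ge_zero[of "f h * mx f x * g y * g (- h - x - y)"]] show ?thesis
   by (simp add: w norm_mult norm_mx mult_ac)
 qed
 from ib_dom(2)[OF F4_meas[OF m F(8,9) G(8,8)] this, of "l1 (mx f) * l1 (mx f) * (n2 g * n2 g)"] ib4(1)[OF F(5,5) G(1,1)]
 show ?thesis unfolding e L4_def by (simp add: power2_eq_square)
qed

text \<open>This term comes from the square of the difference in the equation of the sum. It needs
  no cancellation: x + h is minus the sum of the two other frequencies and can be charged to one of
  those copies of \<open>g\<close>.\<close>

lemma bs_quartic':
 assumes g: "g : X 2"
 shows "cmod (L3 bs (conv (mx g) g) g g) <= 6 * ((l1 (mx g))^2 * (n2 g)^2)"
proof -
 note G = X2_parts[OF g]
 have "cmod (F4 (%h x y. bs (x + h) y) g (mx g) g g w) <= 3 * (\<Sum>u\<leftarrow>[P4 g (mx g) (mx g) g, P4 g (mx g) g (mx g)]. cmod (u w))" for w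
 proof -
  obtain h x y where w: "w = (h, x, y)" by (cases w)
  have "cmod (bs (x + h) y) <= 3 * (\<bar>y\<bar> + \<bar>- h - x - y\<bar>)" by (rule order_trans[OF cmod_bs mult_left_mono]) (smt (verit), simp)
  from mult_right_mono[OF this norm_ge_zero[of "g h * mx g x * g y * g (- h - x - y)"]] show ?thesis
   by (simp add: w norm_mult norm_mx algebra_simps)
 qed
 from ib_dom(2)[OF F4_meas[OF bs_shift_meas G(8,9,8,8)] this, of "l1 (mx g) * l1 (mx g) * (n2 g * n2 g)"] ib4(4,5)[OF G(5,5) G(1,1)]
 show ?thesis unfolding bs_slot1(2)[OF g g] L4_def by (simp add: power2_eq_square)
qed

text \<open>The coefficient -(m1 / 2) makes the linear rate of the correction cancel the cubic rate
  computed in \<open>diff_cubic\<close>. The quartic remainder is bounded by (12 + 6) / 4 = 4.5,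
  rounded up to 5.\<close>

lemma bs_rate:
 assumes f: "f : X 2" and g: "g : X 2" and h: "herm g" and b: "l1 (mx f) <= a" "l1 (mx g) <= a"
  and v: "v = (%z. sgnm f z + - (\<i> * cr (m1 / 2)) * (conv (mx f) f z + conv (mx g) g z))"
  and w: "w = (%z. sgnm g z + Bl g f z)"
 shows "\<bar>2 * kip (%z. 1) w g + - (m1 / 2) * Re (L3 bs v g g + L3 bs f w g + L3 bs f g w)\<bar> <= 5 * a^2 * (n2 g)^2"
proof -
 note F = X2_parts[OF f] and G = X2_parts[OF g]
 define c where "c = - (\<i> * cr (m1 / 2))"
 have k: "mult_le 0 (%z::real. 1::real)" by (simp add: mult_le_def)
 have c2: "conv (mx f) f : X 1" "conv (mx g) g : X 1" "mx (conv g f) : X 1"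
  using conv_X'(1)[of 1 f "mx f"] conv_X'(1)[of 1 g "mx g"] mx_conv_X(1)[of 1 g f] conv_commute[of f "mx f"] conv_commute[of g "mx g"] F G f g by simp_all
 have B: "Bl g f = (%z. c * mx (conv g f) z)" by (auto simp: Bl_def c_def)
 have BX: "Bl g f : X 1" unfolding B by (intro X_cmult c2)
 have sX: "sgnm f : X 1" "sgnm g : X 1" by (intro sgnm_X F G)+
 have cc: "(%z. c * (conv (mx f) f z + conv (mx g) g z)) : X 1" by (intro X_cmult X_add c2)
 note s = sym3_bs
 have Lv: "L3 bs v g g = L3 bs (sgnm f) g g + c * (L3 bs (conv (mx f) f) g g + L3 bs (conv (mx g) g) g g)"
  unfolding v c_def[symmetric] L3_add1[OF s sX(1) cc G(6,6)]
  using L3_cmult(1)[of bs c "%z. conv (mx f) f z + conv (mx g) g z" g g] L3_add1[OF s c2(1,2) G(6,6)] by simp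
 have Lw: "L3 bs f w g = L3 bs f (sgnm g) g + c * L3 bs f (mx (conv g f)) g" "L3 bs f g w = L3 bs f g (sgnm g) + c * L3 bs f g (mx (conv g f))"
  unfolding w L3_add2[OF s F(6) sX(2) BX G(6)] L3_add3[OF s F(6) G(6) sX(2) BX]
  using L3_cmult(2)[of bs f c "mx (conv g f)" g] L3_cmult(3)[of bs f g c "mx (conv g f)"] by (simp_all add: B)
 let ?T = "L3 bs (conv (mx f) f) g g + L3 bs f (mx (conv g f)) g + L3 bs f g (mx (conv g f))"
 let ?T' = "L3 bs (conv (mx g) g) g g"
 have "L3 bs v g g + L3 bs f w g + L3 bs f g w = (L3 bs (sgnm f) g g + L3 bs f (sgnm g) g + L3 bs f g (sgnm g)) + c * (?T + ?T')"
  unfolding Lv Lw by (simp add: algebra_simps)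
 then have L: "L3 bs v g g + L3 bs f w g + L3 bs f g w = - \<i> * L3 (%x y. cr x) f g g + c * (?T + ?T')"
  unfolding bs_linear[OF F(6) G(6)] .
 have "kip (%z. 1) w g = kip (%z. 1) (Bl g f) g"
  unfolding w using kip_add_left[OF k X_mono(1)[OF sX(2), of 0] X_mono(1)[OF BX, of 0] X_mono(1)[OF g, of 0]] kip_sgnm[of "%z. 1" g] by simp
 then have K: "2 * kip (%z. 1) w g = Re (c * L3 (%x y. cr x) f g g)"
  using diff_cubic[OF f g h] by (simp add: c_def)
 have "2 * kip (%z. 1) w g + - (m1 / 2) * Re (L3 bs v g g + L3 bs f w g + L3 bs f g w) = - (m1 / 2) * Re (c * (?T + ?T'))"
  unfolding K L by (simp add: c_def distrib_left)
 moreover have "\<bar>- (m1 / 2) * Re (c * (?T + ?T'))\<bar> <= 5 * a^2 * (n2 g)^2"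
 proof -
  have "\<bar>- (m1 / 2) * Re (c * (?T + ?T'))\<bar> <= (1 / 2) * cmod (c * (?T + ?T'))"
   unfolding abs_mult using m1_pos abs_Re_le_cmod[of "c * (?T + ?T')"] by (intro mult_mono) auto
  also have "... <= (1 / 2) * ((1 / 2) * cmod (?T + ?T'))"
   unfolding norm_mult[of c] using m1_pos by (intro mult_left_mono mult_right_mono) (auto simp: c_def norm_mult norm_divide)
  also have "... <= (1 / 2) * ((1 / 2) * (12 * ((l1 (mx f))^2 * (n2 g)^2) + 6 * ((l1 (mx g))^2 * (n2 g)^2)))"
   by (intro mult_left_mono order_trans[OF norm_triangle_ineq add_mono[OF bs_quartic[OF f g] bs_quartic'[OF g]]]) auto
  also have "... <= (1 / 2) * ((1 / 2) * (12 * (a^2 * (n2 g)^2) + 6 * (a^2 * (n2 g)^2)))"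
   using b by (intro mult_left_mono add_mono mult_right_mono power_mono) auto
  also have "... <= 5 * a^2 * (n2 g)^2" by (simp add: mult.assoc)
  finally show ?thesis .
 qed
 ultimately show ?thesis by simp
qed

text \<open>Sum and difference are the natural unknowns: the difference is transported by the sum,
  and both squares recombine in the equation of the sum. For 6 c1 b <= 1 the correction is at most
  half of the energy, so the factor 3 is 2 times 3/2, and 40 is 5 * 2^2 doubled. The exponent is
  quadratic in \<open>b\<close>, which is what a time of order b^(-2) tolerates.\<close>

lemma stability:
 assumes U: "Xderiv {- T..T} 1 U (%t z. sgnm (U t) z + Nl (U t) z)" and W: "Xderiv {- T..T} 1 W (%t z. sgnm (W t) z + Nl (W t) z)"
  and U2: "!!t. t : {- T..T} ==> U t : X 2 \<and> nrm 2 (U t) <= b \<and> herm (U t)"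
  and W2: "!!t. t : {- T..T} ==> W t : X 2 \<and> nrm 2 (W t) <= b \<and> herm (W t)"
  and b: "0 < b" "6 * c1 * b <= 1" and t: "t : {- T..T}"
 shows "(nd 0 (U t) (W t))^2 <= 3 * exp ((40 * c1^2 + 1) * b^2 * \<bar>t\<bar>) * (nd 0 (U 0) (W 0))^2"
proof -
 let ?I = "{- T..T}"
 let ?f = "%t z. U t z + W t z" and ?g = "%t z. U t z - W t z"
 \<comment> \<open>With f = U + W and g = U - W one has f^2 + g^2 = 2 (U^2 + W^2), and the
   derivative of a square is twice the convolution with one differentiated factor.\<close>
 define v where "v t z = sgnm (?f t) z + - (\<i> * cr (m1 / 2)) * (conv (mx (?f t)) (?f t) z + conv (mx (?g t)) (?g t) z)" for t z
 define w where "w t z = sgnm (?g t) z + Bl (?g t) (?f t) z" for t z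
 let ?k = "%z::real. 1::real"
 have k: "mult_le 1 ?k" by (simp add: mult_le_def wt_ge1)
 have fX: "?f t : X 2" "?g t : X 2" "nrm 2 (?f t) <= 2 * b" "nrm 2 (?g t) <= 2 * b" "herm (?g t)" if "t : ?I" for t
 proof -
  note u = U2[OF that] W2[OF that]
  show "?f t : X 2" "?g t : X 2" using u by (auto intro: X_add X_diff)
  show "nrm 2 (?f t) <= 2 * b" "nrm 2 (?g t) <= 2 * b" using nrm_triangle[of "U t" 2 "W t"] nrm_triangle_diff[of "U t" 2 "W t"] u by auto
  show "herm (?g t)" using u unfolding herm_def by (auto elim: eventually_elim2)
 qed
 have Df: "Xderiv ?I 1 ?f v"
 proof (rule Xderiv_cong_AE)
  fix t assume that: "t : ?I"
  have X1: "U t : X 1" "W t : X 1" using XderivD(1)[OF U that] XderivD(1)[OF W that] by auto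
  have [measurable]: "meas (U t)" "meas (W t)" using X1 by (auto intro: X_meas)
  show "meas (v t)" unfolding v_def sgnm_def mx_def by measurable
  have "(%t z. 1 * (sgnm (U t) z + Nl (U t) z) + 1 * (sgnm (W t) z + Nl (W t) z)) t = v t"
  proof
   fix z
   have L: "U t : L2" "W t : L2" using X_mono(1)[OF X1(1), of 0] X_mono(1)[OF X1(2), of 0] by (simp_all add: X_0)
   have f1: "?f t : X 1" "?g t : X 1" by (intro X_add X_diff X1)+
   have "conv (?f t) (?f t) z + conv (?g t) (?g t) z = 2 * (conv (U t) (U t) z + conv (W t) (W t) z)"
    using conv_add_left[OF L L2_add[OF L]] conv_diff_left[OF L L2_diff[OF L]] conv_add_right[OF L(1) L] conv_add_right[OF L(2) L]
     conv_diff_right[OF L(1) L] conv_diff_right[OF L(2) L] conv_commute[of "U t" "W t"] by simp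
   then have "cr z * (conv (?f t) (?f t) z + conv (?g t) (?g t) z) = cr z * (2 * (conv (U t) (U t) z + conv (W t) (W t) z))" by simp
   then have "mx (conv (?f t) (?f t)) z + mx (conv (?g t) (?g t)) z = 2 * (mx (conv (U t) (U t)) z + mx (conv (W t) (W t)) z)"
    by (simp add: mx_def algebra_simps)
   then have e: "conv (mx (?f t)) (?f t) z + conv (mx (?g t)) (?g t) z = mx (conv (U t) (U t)) z + mx (conv (W t) (W t)) z"
    unfolding half_conv_square[OF f1(1)] half_conv_square[OF f1(2)] distrib_left[of 2, symmetric] by (rule mult_left_cancel[THEN iffD1, rotated]) simp
   show "1 * (sgnm (U t) z + Nl (U t) z) + 1 * (sgnm (W t) z + Nl (W t) z) = v t z"
   proof -
    have a: "1 * (p + - (k * q)) + 1 * (p' + - (k * q')) = (p + p') + - k * (q + q')" for p p' q q' k :: complex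
     by (simp add: algebra_simps)
    have sl: "sgnm (?f t) z = sgnm (U t) z + sgnm (W t) z" using fun_cong[OF sgnm_lin[of 1 "U t" 1 "W t"], of z] by simp
    show ?thesis unfolding v_def e sl Nl_alt[OF X1(1)] Nl_alt[OF X1(2)] by (rule a)
   qed
  qed
  then show "ae z. 1 * (sgnm (U t) z + Nl (U t) z) + 1 * (sgnm (W t) z + Nl (W t) z) = v t z" by (intro AE_I2) (rule fun_cong)
 next
  show "Xderiv ?I 1 ?f (%t z. 1 * (sgnm (U t) z + Nl (U t) z) + 1 * (sgnm (W t) z + Nl (W t) z))"
   using Xderiv_lin[OF U W, of 1 1] by simp
 qed
 have Dg: "Xderiv ?I 1 ?g w"
 proof (rule Xderiv_cong_AE[OF Xderiv_diff[OF U W]])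
  fix t assume t: "t : ?I"
  have X1: "U t : X 1" "W t : X 1" using XderivD(1)[OF U t] XderivD(1)[OF W t] by auto
  have [measurable]: "meas (U t)" "meas (W t)" using X1 by (auto intro: X_meas)
  show "meas (w t)" unfolding w_def sgnm_def Bl_def mx_def by measurable
  show "ae z. (sgnm (U t) z + Nl (U t) z) - (sgnm (W t) z + Nl (W t) z) = w t z"
  proof (rule AE_I2)
   fix z
   show "(sgnm (U t) z + Nl (U t) z) - (sgnm (W t) z + Nl (W t) z) = w t z"
    unfolding w_def using fun_cong[OF sgnm_diff[of "U t" "W t"], of z] fun_cong[OF Nl_diff_Bl[OF X1], of z] by (simp add: algebra_simps)
  qed
 qed
 let ?E = "%t. kip ?k (?g t) (?g t)" and ?B = "%t. - (m1 / 2) * Re (L3 bs (?f t) (?g t) (?g t))"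
 let ?Y = "%t. ?E t + ?B t"
 let ?Y' = "%t. 2 * kip ?k (w t) (?g t) + - (m1 / 2) * Re (L3 bs (v t) (?g t) (?g t) + L3 bs (?f t) (w t) (?g t) + L3 bs (?f t) (?g t) (w t))"
 let ?c = "(40 * c1^2 + 1) * b^2"
 have c: "0 < ?c" using b by (intro mult_pos_pos add_nonneg_pos) auto
 have E: "?E t = (n2 (?g t))^2" for t by (simp add: kip_self)
 have l: "l1 (mx (?f t)) <= c1 * (2 * b)" "l1 (mx (?g t)) <= c1 * (2 * b)" if "t : ?I" for t
  using l1_sq_bound fX[OF that] by auto
 have Bb: "\<bar>?B t\<bar> <= 1 / 2 * ?E t" if t: "t : ?I" for t
 proof -
  note G = X2_parts[OF fX(2)[OF t]] and F = X2_parts[OF fX(1)[OF t]]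
  have "cmod (L3 bs (?f t) (?g t) (?g t)) <= 3 * (l1 (mx (?f t)) * (n2 (?g t) * n2 (?g t)))"
  proof (rule L3_l1_bound[OF F(5) G(1) G(1) bs_meas F(8)])
   fix x y
   show "cmod (bs x y * ?f t x) <= 3 * cmod (mx (?f t) x)"
    unfolding norm_mult norm_mx mult.assoc[symmetric] by (intro mult_right_mono cmod_bs) simp
  qed simp
  also have "... <= 3 * ((c1 * (2 * b)) * (n2 (?g t) * n2 (?g t)))" by (intro mult_left_mono mult_right_mono l t) auto
  also have "... = (6 * c1 * b) * ?E t" by (simp add: E power2_eq_square)
  also have "... <= 1 * ?E t" by (rule mult_right_mono[OF b(2)]) (simp add: E)
  finally have L: "cmod (L3 bs (?f t) (?g t) (?g t)) <= ?E t" by simp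
  have "\<bar>?B t\<bar> = m1 / 2 * \<bar>Re (L3 bs (?f t) (?g t) (?g t))\<bar>" using m1_pos by (simp add: abs_mult)
  also have "... <= 1 / 2 * ?E t"
   using m1_pos order_trans[OF abs_Re_le_cmod L] by (intro mult_mono) auto
  finally show ?thesis .
 qed
 have Y2: "?E t <= 2 * ?Y t" "?Y t <= 3 / 2 * ?E t" if "t : ?I" for t
  using abs_le_D1[OF Bb[OF that]] abs_le_D2[OF Bb[OF that]] by (simp_all add: field_simps)
 have "?Y t <= (?Y 0 + 0 / ?c) * exp (?c * \<bar>t\<bar>)"
 proof (rule gronwall[OF _ _ c order_refl t])
  fix t assume t: "t : ?I"
  have "(?E has_field_derivative 2 * kip ?k (w t) (?g t)) (at t within ?I)"
   using kip_deriv[OF k Dg Dg t] by (simp add: kip_commute[of ?k "?g t"])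
  then show "(?Y has_field_derivative ?Y' t) (at t within ?I)"
   by (intro DERIV_add DERIV_cmult L3_deriv[OF sym3_bs Df Dg Dg t])
  have "\<bar>?Y' t\<bar> <= 5 * (c1 * (2 * b))^2 * (n2 (?g t))^2"
   by (rule bs_rate[OF fX(1,2,5)[OF t] l[OF t]]) (auto simp: v_def w_def fun_eq_iff)
  also have "... = (20 * c1^2 * b^2) * ?E t" by (simp add: E power_mult_distrib)
  also have "... <= (20 * c1^2 * b^2) * (2 * ?Y t)" by (intro mult_left_mono Y2 t) simp
  also have "... = (40 * c1^2) * b^2 * ?Y t" by simp
  also have "... <= ?c * ?Y t"
  proof -
   have "0 <= ?E t" by (simp add: E)
   then have "0 <= 2 * ?Y t" using Y2(1)[OF t] by (rule order_trans)
   then have "0 <= ?Y t" by (rule zero_le_mult_iff[THEN iffD1, THEN disjE]) simp_all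
   then show ?thesis by (intro mult_right_mono) auto
  qed
  finally show "\<bar>?Y' t\<bar> <= ?c * ?Y t + 0" by simp
 qed
 then have Yt: "?Y t <= ?Y 0 * exp (?c * \<bar>t\<bar>)" by simp
 have "0 : ?I" using t by auto
 then have "?Y 0 * exp (?c * \<bar>t\<bar>) <= (3 / 2 * ?E 0) * exp (?c * \<bar>t\<bar>)" by (intro mult_right_mono Y2) auto
 with Yt have "?Y t <= (3 / 2 * ?E 0) * exp (?c * \<bar>t\<bar>)" by (rule order_trans)
 then have "2 * ?Y t <= 2 * ((3 / 2 * ?E 0) * exp (?c * \<bar>t\<bar>))" by (rule mult_left_mono) simp
 with Y2(1)[OF t] have "?E t <= 2 * ((3 / 2 * ?E 0) * exp (?c * \<bar>t\<bar>))" by (rule order_trans)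
 then show ?thesis unfolding E nrm_0 by (simp add: mult_ac)
qed

section \<open>Norms of non-integer order\<close>

definition hi :: "real => cfun => cfun" where
 "hi n f x = (if \<bar>x\<bar> <= n then 0 else f x)"

lemma hi_eq: "hi n f = (%x. cr (indicator (- {- n..n}) x) * f x)"
 by (rule ext) (auto simp: hi_def indicator_def abs_le_iff)

lemma hi_X: assumes "f : X s" shows "hi n f : X s" "nrm s (hi n f) <= nrm s f"
 unfolding hi_eq by (rule X_mult_le1[OF assms]; auto simp: indicator_def)+

lemma wt_measurable [measurable]: "wt a : borel_measurable borel" unfolding wt_def by measurable

lemma wt_abs_mono: "0 <= s ==> \<bar>x\<bar> <= \<bar>y\<bar> ==> wt s x <= wt s y"
 unfolding wt_def by (intro powr_mono2) (auto simp: abs_le_square_iff)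

lemma hi_decay:
 assumes f: "f : X r" and r: "s <= r" and n: "0 <= n" shows "nrm s (hi n f) <= wt (s - r) n * nrm r f"
proof (rule X_bound(2)[OF f])
 show "meas (hi n f)" by (rule X_meas[OF hi_X(1)[OF f]])
 show "ae x. wt s x * cmod (hi n f x) <= wt (s - r) n * (wt r x * cmod (f x))"
 proof (rule AE_I2)
  fix x
  have "wt s x * cmod (f x) <= (wt (s - r) n * wt r x) * cmod (f x)" if "n < \<bar>x\<bar>"
  proof (rule mult_right_mono)
   have "wt (r - s) n <= wt (r - s) x" using that n r by (intro wt_abs_mono) auto
   then have "wt (s - r) n * (wt (r - s) n * wt s x) <= wt (s - r) n * (wt (r - s) x * wt s x)" by (intro mult_left_mono mult_right_mono) auto
   also have "wt (s - r) n * (wt (r - s) n * wt s x) = wt s x" unfolding mult.assoc[symmetric] wt_add[symmetric] by simp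
   also have "wt (r - s) x * wt s x = wt r x" unfolding wt_add[symmetric] by simp
   finally show "wt s x <= wt (s - r) n * wt r x" .
  qed simp
  then show "wt s x * cmod (hi n f x) <= wt (s - r) n * (wt r x * cmod (f x))" by (auto simp: hi_def mult.assoc)
 qed
qed simp

lemma nn_nrm: assumes "f : X s" shows "(NN x. ennreal (wt (2 * s) x * (cmod (f x))^2)) = ennreal ((nrm s f)^2)"
 using nn_n2[OF X_L2[OF assms]] by (simp add: nrm_def norm_mult power_mult_distrib wt_sq')

lemma nrm_integrable: assumes "f : X s" shows "integrable lborel (%x. wt (2 * s) x * (cmod (f x))^2)"
 using L2_int[OF X_L2[OF assms]] by (simp add: norm_mult power_mult_distrib wt_sq')

lemma wt_deriv: "((%x. wt (2 * s) x) has_field_derivative 2 * s * x * wt (2 * s - 2) x) (at x)"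
proof -
 have "((%x. 1 + x^2) has_field_derivative 2 * x) (at x)" by (auto intro!: derivative_eq_intros)
 from DERIV_fun_powr[OF this one_plus_sq_pos, of s] show ?thesis by (simp add: wt_def mult_ac diff_divide_distrib)
qed

text \<open>Layer-cake formula: the weight is recovered from its derivative over the levels below
  |x|. Starting at \<open>R\<close> subtracts the constant wt (2 s) R and leaves only frequencies
  beyond \<open>R\<close>.\<close>

lemma layer_low:
 assumes s: "0 <= s" and R: "0 <= R"
 shows "(NN n. ennreal (2 * s * n * wt (2 * s - 2) n) * (indicator {R..} n * of_bool (n < \<bar>x\<bar>))) = ennreal (max 0 (wt (2 * s) x - wt (2 * s) R))"
proof -
 have "(NN n. ennreal (2 * s * n * wt (2 * s - 2) n) * (indicator {R..} n * of_bool (n < \<bar>x\<bar>))) = (NN n. ennreal (2 * s * n * wt (2 * s - 2) n) * indicator {R..\<bar>x\<bar>} n)"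
  by (rule nn_integral_cong_AE) (use AE_lborel_singleton[of "\<bar>x\<bar>"] in eventually_elim, auto simp: indicator_def)
 also have "... = ennreal (max 0 (wt (2 * s) x - wt (2 * s) R))"
 proof (cases "R <= \<bar>x\<bar>")
  case True
  have "(NN n. ennreal (2 * s * n * wt (2 * s - 2) n) * indicator {R..\<bar>x\<bar>} n) = wt (2 * s) \<bar>x\<bar> - wt (2 * s) R"
   by (rule nn_integral_FTC_Icc[OF _ wt_deriv]) (use s R True in auto)
  moreover have "wt (2 * s) R <= wt (2 * s) \<bar>x\<bar>" using True R s by (intro wt_abs_mono) auto
  ultimately show ?thesis by (simp add: wt_def)
 next
  case False
  then have "wt (2 * s) x <= wt (2 * s) R" using R s by (intro wt_abs_mono) auto
  then show ?thesis using False by simp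
 qed
 finally show ?thesis .
qed

lemma wt_at_top: "a < 0 ==> ((%x. wt a x) ---> 0) at_top"
 unfolding wt_def by real_asymp

text \<open>The same density against the decay of order -2 K, over the levels above |w|. The
  primitive vanishes at infinity because s < K, and integration leaves the factor s / (K -
  s).\<close>

lemma layer_high:
 assumes s: "0 <= s" "s < K" and R: "0 <= R"
 shows "(NN n. ennreal (2 * s * n * wt (2 * s - 2) n) * (indicator {R..} n * (ennreal (wt (- 2 * K) n) * of_bool (\<bar>w\<bar> <= n))))
  = ennreal (s / (K - s) * wt (2 * s - 2 * K) (max R \<bar>w\<bar>))"
proof -
 let ?F = "%n. - (s / (K - s)) * wt (2 * (s - K)) n"
 have e: "- (s / (K - s)) * 2 * (s - K) = 2 * s" using s by (simp add: field_simps)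
 have "(NN n. ennreal (2 * s * n * wt (2 * s - 2) n) * (indicator {R..} n * (ennreal (wt (- 2 * K) n) * of_bool (\<bar>w\<bar> <= n))))
  = (NN n. ennreal (2 * s * n * wt (2 * (s - K) - 2) n) * indicator {max R \<bar>w\<bar>..} n)"
 proof (rule nn_integral_cong)
  fix n :: real
  have "wt (2 * (s - K) - 2) n = wt (2 * s - 2) n * wt (- 2 * K) n" unfolding wt_add[symmetric] by (simp add: algebra_simps)
  then show "ennreal (2 * s * n * wt (2 * s - 2) n) * (indicator {R..} n * (ennreal (wt (- 2 * K) n) * of_bool (\<bar>w\<bar> <= n))) = ennreal (2 * s * n * wt (2 * (s - K) - 2) n) * indicator {max R \<bar>w\<bar>..} n"
   using R s by (auto simp: indicator_def ennreal_mult''[symmetric] mult_ac)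
 qed
 also have "... = ennreal (0 - ?F (max R \<bar>w\<bar>))"
 proof (rule nn_integral_FTC_atLeast)
  show "(?F has_field_derivative 2 * s * x * wt (2 * (s - K) - 2) x) (at x)" for x
   by (rule DERIV_cong[OF DERIV_cmult[OF wt_deriv]]) (simp only: mult.assoc[symmetric] e)
  show "(?F ---> 0) at_top" using tendsto_mult_left[OF wt_at_top[of "2 * (s - K)"], of "- (s / (K - s))"] s by simp
 qed (use s R in auto)
 finally show ?thesis by (simp add: right_diff_distrib)
qed

text \<open>Integrating the bound for the tails beyond the frequency \<open>n\<close> against the derivative of \<open>\<langle>n\<rangle>\<^sup>2\<^sup>s\<close> controls
  weighted norms of any order \<open>s < K\<close>.\<close>

lemma tail_transfer:
 assumes s: "0 <= s" "s + 1 <= K" and f: "f : X 0" and g: "g : X 0" and pq: "0 <= p" "0 <= q" and R: "0 <= R"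
  and H: "!!n. 0 <= n ==> (nrm 0 (hi n f))^2 <= p * (nrm 0 (hi n g))^2 + q * (wt (- 2 * K) n * (nrm K (ct n g))^2)"
 shows "(NN w. ennreal (max 0 (wt (2 * s) w - wt (2 * s) R) * (cmod (f w))^2))
  <= ennreal (p + q * s) * (NN w. ennreal (min 1 ((wt 1 w / wt 1 R)^2) * (wt (2 * s) w * (cmod (g w))^2)))"
proof -
 have [measurable]: "meas f" "meas g" using f g by (auto intro: X_meas)
 let ?D = "%n. ennreal (2 * s * n * wt (2 * s - 2) n)" and ?I = "%n. indicator {R..} n :: ennreal"
 let ?J = "%f n w. ?D n * (?I n * of_bool (n < \<bar>w\<bar>)) * ennreal ((cmod (f w))^2)"
 let ?L = "%n w. ?D n * (?I n * (ennreal (wt (- 2 * K) n) * of_bool (\<bar>w\<bar> <= n))) * ennreal (wt (2 * K) w * (cmod (g w))^2)"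
 have hn: "(NN w. of_bool (n < \<bar>w\<bar>) * ennreal ((cmod (f w))^2)) = ennreal ((nrm 0 (hi n f))^2)" if "f : X 0" for n f
  unfolding nn_nrm[OF hi_X(1)[OF that], symmetric] by (intro nn_integral_cong) (auto simp: hi_def)
 have cn: "(NN w. of_bool (\<bar>w\<bar> <= n) * ennreal (wt (2 * K) w * (cmod (g w))^2)) = ennreal ((nrm K (ct n g))^2)" if "0 <= n" for n
  unfolding nn_nrm[OF XSD[OF ct_XS[OF g that]], symmetric] by (intro nn_integral_cong) (auto simp: ct_def)
 have J: "(NN w. ennreal (max 0 (wt (2 * s) w - wt (2 * s) R) * (cmod (f w))^2)) = (NN n. (NN w. ?J f n w))" if [measurable]: "meas f" for f
 proof -
  have "(NN n. (NN w. ?J f n w)) = (NN w. (NN n. ?J f n w))" by (rule lborel_pair.Fubini') measurable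
  also have "... = (NN w. ennreal (max 0 (wt (2 * s) w - wt (2 * s) R) * (cmod (f w))^2))"
   by (rule nn_integral_cong, subst nn_integral_multc, measurable) (simp add: layer_low[OF s(1) R] ennreal_mult)
  finally show ?thesis ..
 qed
 have g0: "0 <= wt (2 * K) w * (cmod (g w))^2" for w by simp
 have L: "(NN n. (NN w. ?L n w)) = (NN w. ennreal (s / (K - s) * wt (2 * s - 2 * K) (max R \<bar>w\<bar>) * (wt (2 * K) w * (cmod (g w))^2)))"
 proof -
  have "(NN n. (NN w. ?L n w)) = (NN w. (NN n. ?L n w))" by (rule lborel_pair.Fubini') measurable
  also have "... = (NN w. ennreal (s / (K - s) * wt (2 * s - 2 * K) (max R \<bar>w\<bar>)) * ennreal (wt (2 * K) w * (cmod (g w))^2))"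
   by (rule nn_integral_cong, subst nn_integral_multc, measurable, subst layer_high[OF s(1) _ R]) (use s in auto)
  finally show ?thesis by (simp only: ennreal_mult''[OF g0])
 qed
 have "(NN n. (NN w. ?J f n w)) <= (NN n. ennreal p * (NN w. ?J g n w) + ennreal q * (NN w. ?L n w))"
 proof (rule nn_integral_mono)
  fix n :: real
  show "(NN w. ?J f n w) <= ennreal p * (NN w. ?J g n w) + ennreal q * (NN w. ?L n w)"
  proof (cases "R <= n")
   case True
   then have n: "0 <= n" using R by simp
   have "ennreal ((nrm 0 (hi n f))^2) <= ennreal p * ennreal ((nrm 0 (hi n g))^2) + ennreal q * (ennreal (wt (- 2 * K) n) * ennreal ((nrm K (ct n g))^2))"
    using ennreal_leI[OF H[OF n]] pq by (simp add: ennreal_mult ennreal_plus)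
   then have "?D n * ennreal ((nrm 0 (hi n f))^2) <= ?D n * (ennreal p * ennreal ((nrm 0 (hi n g))^2) + ennreal q * (ennreal (wt (- 2 * K) n) * ennreal ((nrm K (ct n g))^2)))"
    by (rule mult_left_mono) simp
   moreover have "(NN w. ?J f n w) = ?D n * ennreal ((nrm 0 (hi n f))^2)" if f: "f : X 0" for f
   proof -
    have [measurable]: "meas f" using f by (rule X_meas)
    show ?thesis unfolding hn[OF f, symmetric] using True by (subst nn_integral_cmult[symmetric]) (auto simp: mult.assoc)
   qed
   moreover have "(NN w. ?L n w) = ?D n * (ennreal (wt (- 2 * K) n) * ennreal ((nrm K (ct n g))^2))"
    unfolding cn[OF n, symmetric] using True by (subst nn_integral_cmult[symmetric], measurable)+ (simp add: mult.assoc)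
   ultimately show ?thesis using f g by (simp only: distrib_left mult.left_commute[of "?D n"])
  qed simp
 qed
 also have "... = ennreal p * (NN n. (NN w. ?J g n w)) + ennreal q * (NN n. (NN w. ?L n w))"
  by (simp add: nn_integral_add nn_integral_cmult)
 also have "... <= ennreal p * (NN w. ennreal (min 1 ((wt 1 w / wt 1 R)^2) * (wt (2 * s) w * (cmod (g w))^2)))
  + ennreal q * (NN w. ennreal s * ennreal (min 1 ((wt 1 w / wt 1 R)^2) * (wt (2 * s) w * (cmod (g w))^2)))"
  unfolding J[OF \<open>meas g\<close>, symmetric] L
 proof (intro add_mono mult_left_mono nn_integral_mono zero_le)
  fix w
  let ?m = "min 1 ((wt 1 w / wt 1 R)^2)"
  have m0: "0 <= ?m" by simp
  have w2: "(wt 1 x)^2 = wt 2 x" for x using wt_sq'[of 1 x] by simp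
  show "ennreal (max 0 (wt (2 * s) w - wt (2 * s) R) * (cmod (g w))^2) <= ennreal (?m * (wt (2 * s) w * (cmod (g w))^2))"
  proof (cases "wt (2 * s) R < wt (2 * s) w")
   case True
   then have "\<bar>R\<bar> <= \<bar>w\<bar>" using wt_abs_mono[of "2 * s" w R] s by fastforce
   then have "?m = 1" using wt_abs_mono[of 1 R w] by (simp add: min_def one_le_power)
   moreover have "(wt (2 * s) w - wt (2 * s) R) * (cmod (g w))^2 <= wt (2 * s) w * (cmod (g w))^2" by (intro mult_right_mono) auto
   ultimately show ?thesis using True by (simp add: ennreal_leI)
  qed (simp add: max_def)
  \<comment> \<open>Beyond \<open>R\<close> the weights combine to order 2 s. Below \<open>R\<close>
    the surplus 2 K - 2 s >= 2 yields the additional factor (wt 1 w / wt 1 R)^2, which makes the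
    right-hand side small for large \<open>R\<close>.\<close>
  have "wt (2 * s - 2 * K) (max R \<bar>w\<bar>) * wt (2 * K) w <= ?m * wt (2 * s) w"
  proof (cases "R <= \<bar>w\<bar>")
   case True
   then have "?m = 1" using wt_abs_mono[of 1 R w] R by (simp add: min_def one_le_power)
   moreover have "wt (2 * s - 2 * K) (max R \<bar>w\<bar>) = wt (2 * s - 2 * K) w" using True by (simp add: max_def wt_def)
   ultimately show ?thesis by (simp add: wt_add[symmetric])
  next
   case False
   have b: "wt a w <= wt a R" if "0 <= a" for a using False R that by (intro wt_abs_mono) auto
   have "wt (2 * s - 2 * K) R * wt (2 * K) w = wt (2 * s - 2 * K) R * (wt (2 * K - 2 * s - 2) w * (wt 2 w * wt (2 * s) w))" by (simp add: wt_add[symmetric])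
   also have "... <= wt (2 * s - 2 * K) R * (wt (2 * K - 2 * s - 2) R * (wt 2 w * wt (2 * s) w))"
    using s by (intro mult_left_mono mult_right_mono b) auto
   also have "... = (wt (2 * s - 2 * K) R * wt (2 * K - 2 * s - 2) R) * (wt 2 w * wt (2 * s) w)" by (simp add: mult_ac)
   also have "wt (2 * s - 2 * K) R * wt (2 * K - 2 * s - 2) R = 1 / wt 2 R" unfolding wt_add[symmetric] by (simp add: wt_neg divide_inverse)
   also have "1 / wt 2 R * (wt 2 w * wt (2 * s) w) = ?m * wt (2 * s) w" using b[of 2] by (simp add: power_divide w2 min_def)
   finally show ?thesis using False by (simp add: max_def)
  qed
  then have b: "wt (2 * s - 2 * K) (max R \<bar>w\<bar>) * wt (2 * K) w * (cmod (g w))^2 <= ?m * wt (2 * s) w * (cmod (g w))^2" by (rule mult_right_mono) simp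
  \<comment> \<open>The gap \<open>s + 1 <= K\<close> keeps the constant finite uniformly up to the
    largest admissible \<open>s\<close>.\<close>
  have "s / (K - s) <= s" using s by (simp add: divide_le_eq mult_left_mono[of 1 "K - s" s, simplified])
  from mult_mono[OF this b s(1)] have "s / (K - s) * (wt (2 * s - 2 * K) (max R \<bar>w\<bar>) * wt (2 * K) w * (cmod (g w))^2) <= s * (?m * wt (2 * s) w * (cmod (g w))^2)"
   by simp
  then show "ennreal (s / (K - s) * wt (2 * s - 2 * K) (max R \<bar>w\<bar>) * (wt (2 * K) w * (cmod (g w))^2)) <= ennreal s * ennreal (?m * (wt (2 * s) w * (cmod (g w))^2))"
   using s by (simp add: ennreal_mult'[symmetric] mult_ac ennreal_leI)
 qed
 also have "... = ennreal (p + q * s) * (NN w. ennreal (min 1 ((wt 1 w / wt 1 R)^2) * (wt (2 * s) w * (cmod (g w))^2)))"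
  using pq s by (subst nn_integral_cmult, measurable) (simp add: ennreal_plus ennreal_mult distrib_right mult.assoc)
 finally show ?thesis unfolding J[OF \<open>meas f\<close>] .
qed

section \<open>The constants of the theorem\<close>

definition b2 :: real where "b2 = max 1 (DK 1)"
text \<open>Solutions with data of size e2 have size at most b2 e2 in H^2, which meets the smallness
  condition of \<open>stability\<close>.\<close>

definition e2 :: real where "e2 = min e1 (1 / (6 * c1 * b2 + 1))"
definition SC :: real where "SC = sqrt (3 * exp ((40 * c1^2 + 1) * b2^2 * al1))"
text \<open>The constant p + q s of \<open>tail_transfer\<close>, with p from the stability of the
  comparison and q from the bound of order k + 1, plus 1 for the conserved L2 norm.\<close>

definition CC :: "nat => real => real" where "CC k s = 2 * SC^2 + 2 * (DK k)^2 * s + 1"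
text \<open>At s = 2 the value is \<open>b2\<close>, free of \<open>k\<close>: part (b) receives
  this very bound as a hypothesis, while the smallness \<open>e2\<close> is fixed before
  \<open>k\<close>.\<close>

definition CK :: "nat => real => real" where "CK k s = (if s = 2 then b2 else sqrt (CC k s))"

lemma b2_ge: "1 <= b2" "DK 1 <= b2" "0 < b2" by (auto simp: b2_def)

lemma e2_pos: "0 < e2"
proof -
 have "0 < 6 * c1 * b2 + 1" using b2_ge by (intro add_nonneg_pos mult_nonneg_nonneg) auto
 then show ?thesis using e1_pos by (simp add: e2_def)
qed

lemma e2_small: assumes "e <= e2" "0 <= e" shows "6 * c1 * (b2 * e) <= 1" "e <= e1"
proof -
 have p: "0 < 6 * c1 * b2 + 1" using b2_ge by (intro add_nonneg_pos mult_nonneg_nonneg) auto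
 have "6 * c1 * b2 * e <= (6 * c1 * b2 + 1) * e" using assms by (intro mult_right_mono) auto
 also have "... <= (6 * c1 * b2 + 1) * (1 / (6 * c1 * b2 + 1))" using p assms by (intro mult_left_mono) (auto simp: e2_def)
 also have "... = 1" using p by simp
 finally show "6 * c1 * (b2 * e) <= 1" by (simp add: mult_ac)
 show "e <= e1" using assms by (simp add: e2_def)
qed

lemma SC_nonneg [simp]: "0 <= SC" by (simp add: SC_def)

lemma CC_ge1: "0 <= s ==> 1 <= CC k s" by (simp add: CC_def)

lemma CK_ge1: "0 <= s ==> 1 <= CK k s" using CC_ge1[of s k] b2_ge by (simp add: CK_def)

lemma stability_const:
 assumes e: "0 < d" "d <= e2" and a: "0 < q" "q <= al1"
  and U: "Xderiv {- (q / d^2)..q / d^2} 1 U (bh U)" and W: "Xderiv {- (q / d^2)..q / d^2} 1 W (bh W)"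
  and U2: "!!t. t : {- (q / d^2)..q / d^2} ==> U t : X 2 \<and> nrm 2 (U t) <= b2 * d \<and> herm (U t)"
  and W2: "!!t. t : {- (q / d^2)..q / d^2} ==> W t : X 2 \<and> nrm 2 (W t) <= b2 * d \<and> herm (W t)"
  and t: "t : {- (q / d^2)..q / d^2}"
 shows "nd 0 (U t) (W t) <= SC * nd 0 (U 0) (W 0)"
proof (rule power2_le_imp_le)
 have b: "0 < b2 * d" using e b2_ge by simp
 have "(nd 0 (U t) (W t))^2 <= 3 * exp ((40 * c1^2 + 1) * (b2 * d)^2 * \<bar>t\<bar>) * (nd 0 (U 0) (W 0))^2"
  by (rule stability[OF U W U2 W2 b e2_small(1)[OF e(2)] t]) (use e in auto)
 also have "... <= SC^2 * (nd 0 (U 0) (W 0))^2"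
 proof (rule mult_right_mono)
  have "d^2 * \<bar>t\<bar> <= d^2 * (q / d^2)" using t by (intro mult_left_mono) auto
  then have "d^2 * \<bar>t\<bar> <= al1" using e a by simp
  then have "(40 * c1^2 + 1) * b2^2 * (d^2 * \<bar>t\<bar>) <= (40 * c1^2 + 1) * b2^2 * al1" by (intro mult_left_mono) auto
  then have "exp ((40 * c1^2 + 1) * (b2 * d)^2 * \<bar>t\<bar>) <= exp ((40 * c1^2 + 1) * b2^2 * al1)" by (simp add: power_mult_distrib mult_ac)
  then show "3 * exp ((40 * c1^2 + 1) * (b2 * d)^2 * \<bar>t\<bar>) <= SC^2" by (simp add: SC_def)
 qed simp
 finally show "(nd 0 (U t) (W t))^2 <= (SC * nd 0 (U 0) (W 0))^2" by (simp add: power_mult_distrib)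
qed simp

lemma smooth_solD:
 assumes "smooth_sol k T F" "t : {- T..T}" "1 <= k"
 shows "F t : X s" "herm (F t)" "nrm 0 (F t) <= nrm 0 (F 0)" "nrm (real (Suc k)) (F t) <= DK k * nrm (real (Suc k)) (F 0)" "nrm 2 (F t) <= b2 * nrm 2 (F 0)"
proof -
 have 1: "!!J. J <= k ==> nrm (real (Suc J)) (F t) <= DK J * nrm (real (Suc J)) (F 0)" using assms unfolding smooth_sol_def by blast
 show "F t : X s" "herm (F t)" "nrm 0 (F t) <= nrm 0 (F 0)" using assms unfolding smooth_sol_def by (auto intro: XSD)
 show "nrm (real (Suc k)) (F t) <= DK k * nrm (real (Suc k)) (F 0)" by (rule 1) simp
 have "nrm 2 (F t) <= DK 1 * nrm 2 (F 0)" using 1[of 1] assms(3) by simp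
 also have "... <= b2 * nrm 2 (F 0)" by (intro mult_right_mono b2_ge) simp
 finally show "nrm 2 (F t) <= b2 * nrm 2 (F 0)" .
qed

lemma smooth_stability:
 assumes e: "0 < d" "d <= e2" and a: "0 < q" "q <= al1" and k: "1 <= k"
  and F: "smooth_sol k (q / d^2) F" "nrm 2 (F 0) <= d" and G: "smooth_sol k (q / d^2) G" "nrm 2 (G 0) <= d" and t: "t : {- (q / d^2)..q / d^2}"
 shows "nd 0 (F t) (G t) <= SC * nd 0 (F 0) (G 0)"
proof (rule stability_const[OF e a _ _ _ _ t])
 show "Xderiv {- (q / d^2)..q / d^2} 1 F (bh F)" "Xderiv {- (q / d^2)..q / d^2} 1 G (bh G)"
  using F(1) G(1) k unfolding smooth_sol_def by (auto elim: Xderiv_mono)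
 have "b2 * x <= b2 * d" if "x <= d" for x using that b2_ge by (intro mult_left_mono) auto
 note b = order_trans[OF smooth_solD(5)[OF F(1) _ k] this[OF F(2)]] order_trans[OF smooth_solD(5)[OF G(1) _ k] this[OF G(2)]]
 show "F t : X 2 \<and> nrm 2 (F t) <= b2 * d \<and> herm (F t)" "G t : X 2 \<and> nrm 2 (G t) <= b2 * d \<and> herm (G t)" if "t : {- (q / d^2)..q / d^2}" for t
  using smooth_solD[OF F(1) that k] smooth_solD[OF G(1) that k] b that by auto
qed

lemma square_le: "0 <= a ==> a <= x + y ==> a^2 <= 2 * x^2 + 2 * (y::real)^2"
 using power_mono[of a "x + y" 2] zero_le_power2[of "x - y"] by (simp add: power2_sum power2_diff)

text \<open>High frequencies of a solution are split by comparing it with the solution whose data are truncated at the same frequency.\<close>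

lemma smooth_tail:
 assumes e: "0 < d" "d <= e2" and a: "0 < q" "q <= al1" and k: "1 <= k" and n: "0 <= n"
  and F: "smooth_sol k (q / d^2) F" "nrm 2 (F 0) <= d" and t: "t : {- (q / d^2)..q / d^2}"
 shows "(nrm 0 (hi n (F t)))^2 <= 2 * SC^2 * (nrm 0 (hi n (F 0)))^2 + 2 * (DK k)^2 * (wt (- 2 * real (Suc k)) n * (nrm (real (Suc k)) (ct n (F 0)))^2)"
proof -
 let ?T = "q / d^2" and ?K = "real (Suc k)"
 have T0: "0 : {- ?T..?T}" using a by auto
 note F0 = smooth_solD[OF F(1) T0 k] and Ft = smooth_solD[OF F(1) t k]
 have c2: "nrm 2 (ct n (F 0)) <= d" using ct_X(2)[OF F0(1), of 2 n] F(2) by linarith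
 obtain G where G: "G 0 = ct n (F 0)" "smooth_sol k ?T G"
  by (rule smooth_solution[OF e(1) e2_small(2)[OF e(2)] a ct_X(1)[OF F0(1)] ct_ct ct_herm[OF F0(2)] c2 n]) (use e in auto)
 note Gt = smooth_solD[OF G(2) t k]
 have "nrm 0 (hi n (F t)) <= nrm 0 (hi n (%x. F t x - G t x)) + nrm 0 (hi n (G t))"
  using nrm_triangle[OF hi_X(1)[OF X_diff[OF Ft(1) Gt(1)]] hi_X(1)[OF Gt(1)], of 0 n n] by (simp add: hi_eq algebra_simps)
 also have "nrm 0 (hi n (%x. F t x - G t x)) <= SC * nd 0 (F 0) (G 0)"
  by (rule order_trans[OF hi_X(2)[OF X_diff[OF Ft(1) Gt(1)]] smooth_stability[OF e a k F G(2) _ t]]) (simp add: G c2)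
 also have "(%x. F 0 x - G 0 x) = hi n (F 0)" by (auto simp: G ct_def hi_def)
 also have "nrm 0 (hi n (G t)) <= wt (- ?K) n * (DK k * nrm ?K (ct n (F 0)))"
 proof (rule order_trans)
  show "nrm 0 (hi n (G t)) <= wt (- ?K) n * nrm ?K (G t)" using hi_decay[OF Gt(1) _ n, of 0 ?K] by simp
  show "wt (- ?K) n * nrm ?K (G t) <= wt (- ?K) n * (DK k * nrm ?K (ct n (F 0)))" by (rule mult_left_mono[OF Gt(4)[unfolded G(1)]]) simp
 qed
 finally have "(nrm 0 (hi n (F t)))^2 <= 2 * (SC * nrm 0 (hi n (F 0)))^2 + 2 * (wt (- ?K) n * (DK k * nrm ?K (ct n (F 0))))^2"
  by (intro square_le) auto
 then show ?thesis by (simp add: power_mult_distrib wt_sq' mult_ac del: of_nat_Suc)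
qed

section \<open>Rough data\<close>

text \<open>A tail with a soft edge: frequencies below \<open>R\<close> are damped instead of
  removed, in the form that \<open>tail_transfer\<close> delivers. For a fixed function of
  \<open>X s\<close> it still tends to 0 as \<open>R\<close> grows, by dominated
  convergence.\<close>

definition tailw :: "real => real => cfun => real" where
 "tailw R s g = (LBINT x. min 1 ((wt 1 x / wt 1 R)^2) * (wt (2 * s) x * (cmod (g x))^2))"

lemma tailw:
 assumes g: "g : X s"
 shows "(NN x. ennreal (min 1 ((wt 1 x / wt 1 R)^2) * (wt (2 * s) x * (cmod (g x))^2))) = ennreal (tailw R s g)"
  "0 <= tailw R s g" "tailw R s g <= (nrm s g)^2" "(%J. tailw (real J) s g) ----> 0"
proof -
 have [measurable]: "meas g" using g by (rule X_meas)
 let ?h = "%R x. min 1 ((wt 1 x / wt 1 R)^2) * (wt (2 * s) x * (cmod (g x))^2)"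
 have b: "?h R x <= wt (2 * s) x * (cmod (g x))^2" for R x
  using mult_right_mono[of "min 1 ((wt 1 x / wt 1 R)^2)" 1 "wt (2 * s) x * (cmod (g x))^2"] by simp
 have i: "integrable lborel (?h R)" for R
  by (rule bi_bound[OF nrm_integrable[OF g]], measurable) (intro AE_I2, use b in simp)
 show 1: "(NN x. ennreal (?h R x)) = ennreal (tailw R s g)"
  unfolding tailw_def by (rule nn_integral_eq_integral[OF i]) simp
 show 0: "0 <= tailw R s g" unfolding tailw_def by (rule integral_nonneg_AE) simp
 have "ennreal (tailw R s g) <= ennreal ((nrm s g)^2)"
  unfolding 1[symmetric] nn_nrm[OF g, symmetric] by (intro nn_integral_mono ennreal_leI b)
 then show "tailw R s g <= (nrm s g)^2" by simp
 have "(%J. LINT x|lborel. ?h (real J) x) ----> (LINT x|(lborel :: real measure). 0)"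
 proof (rule integral_dominated_convergence[OF _ _ nrm_integrable[OF g]])
  show "ae x. (%J. ?h (real J) x) ----> 0"
  proof (rule AE_I2)
   fix x :: real
   have "(%J. wt (-1) (real J)) ----> 0"
    by (rule filterlim_compose[OF wt_at_top filterlim_real_sequentially]) simp
   then have "(%J. (wt 1 x * wt (-1) (real J))^2) ----> (wt 1 x * 0)^2" by (intro tendsto_intros)
   then have "(%J. min 1 ((wt 1 x / wt 1 (real J))^2)) ----> min 1 0"
    by (intro tendsto_min tendsto_const) (simp add: wt_neg divide_inverse)
   then show "(%J. ?h (real J) x) ----> 0" by (intro tendsto_mult_left_zero) simp
  qed
 qed (use b in auto)
 then show "(%J. tailw (real J) s g) ----> 0" by (simp add: tailw_def)
qed

context
 fixes d :: real and T :: real and k :: nat and F :: "real => cfun"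
 assumes e: "0 < d" "d <= e2" and T: "T = al1 / d^2" and k: "1 <= k"
  and F: "smooth_sol k T F" "nrm 2 (F 0) <= d"
begin

lemma zero_time: "0 : {- T..T}" using al1_pos by (simp add: T)

lemma smooth_high:
 assumes s: "0 <= s" "s <= real k" and R: "0 <= R" and t: "t : {- T..T}"
 shows "(NN x. ennreal (max 0 (wt (2 * s) x - wt (2 * s) R) * (cmod (F t x))^2)) <= ennreal ((CC k s - 1) * tailw R s (F 0))"
proof -
 note F0 = smooth_solD[OF F(1) zero_time k] and Ft = smooth_solD[OF F(1) t k]
 have "0 <= CC k s - 1" using CC_ge1[OF s(1), of k] by simp
 moreover have "(NN x. ennreal (max 0 (wt (2 * s) x - wt (2 * s) R) * (cmod (F t x))^2))
   <= ennreal (2 * SC^2 + 2 * (DK k)^2 * s) * (NN x. ennreal (min 1 ((wt 1 x / wt 1 R)^2) * (wt (2 * s) x * (cmod (F 0 x))^2)))"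
  by (rule tail_transfer[OF s(1) _ Ft(1) F0(1) _ _ R smooth_tail[OF e al1_pos order_refl k _ F[unfolded T] t[unfolded T]]]) (use s in auto)
 ultimately show ?thesis unfolding tailw(1)[OF F0(1)] using tailw(2)[OF F0(1)[of s], of R] by (simp add: CC_def ennreal_mult)
qed

text \<open>\<open>smooth_high\<close> with R = 0 controls the weight minus 1; the missing 1 is the
  L2 norm, which does not increase. Order 2 is read off the integer bounds directly, to obtain a
  constant free of \<open>k\<close>.\<close>

lemma smooth_norm:
 assumes s: "0 <= s" "s <= real k" and t: "t : {- T..T}"
 shows "nrm s (F t) <= CK k s * nrm s (F 0)"
proof (cases "s = 2")
 case False
 note F0 = smooth_solD[OF F(1) zero_time k] and Ft = smooth_solD[OF F(1) t k]
 have [measurable]: "meas (F t)" by (rule X_meas[OF Ft(1)])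
 have C: "0 <= CC k s - 1" using CC_ge1[OF s(1), of k] by simp
 have "ennreal ((nrm s (F t))^2) = (NN x. ennreal (max 0 (wt (2 * s) x - wt (2 * s) 0) * (cmod (F t x))^2) + ennreal (wt (2 * 0) x * (cmod (F t x))^2))"
  unfolding nn_nrm[OF Ft(1), symmetric]
 proof (rule nn_integral_cong)
  fix x
  have "1 <= wt (2 * s) x" using s by (intro wt_ge1) simp
  then show "ennreal (wt (2 * s) x * (cmod (F t x))^2) = ennreal (max 0 (wt (2 * s) x - wt (2 * s) 0) * (cmod (F t x))^2) + ennreal (wt (2 * 0) x * (cmod (F t x))^2)"
   using mult_right_mono[of 1 "wt (2 * s) x" "(cmod (F t x))^2"] by (subst ennreal_plus[symmetric]) (simp_all add: left_diff_distrib wt_def)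
 qed
 also have "... = (NN x. ennreal (max 0 (wt (2 * s) x - wt (2 * s) 0) * (cmod (F t x))^2)) + ennreal ((nrm 0 (F t))^2)"
  unfolding nn_nrm[OF Ft(1), symmetric] by (rule nn_integral_add) measurable
 also have "... <= ennreal ((CC k s - 1) * (nrm s (F 0))^2) + ennreal ((nrm s (F 0))^2)"
 proof (intro add_mono ennreal_leI)
  show "(NN x. ennreal (max 0 (wt (2 * s) x - wt (2 * s) 0) * (cmod (F t x))^2)) <= ennreal ((CC k s - 1) * (nrm s (F 0))^2)"
   by (rule order_trans[OF smooth_high[OF s order_refl t]]) (intro ennreal_leI mult_left_mono tailw F0 C)
  show "(nrm 0 (F t))^2 <= (nrm s (F 0))^2"
   using Ft(3) X_mono(2)[OF F0(1)[of s] s(1)] by (intro power_mono) auto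
 qed
 also have "... = ennreal (CC k s * (nrm s (F 0))^2)" unfolding ennreal_plus[OF mult_nonneg_nonneg[OF C zero_le_power2] zero_le_power2, symmetric] by (simp add: left_diff_distrib)
 finally have "(nrm s (F t))^2 <= CC k s * (nrm s (F 0))^2" using C by (subst (asm) ennreal_le_iff) auto
 also have "... = (CK k s * nrm s (F 0))^2" using False C by (simp add: CK_def power_mult_distrib)
 finally show ?thesis by (rule power2_le_imp_le) (use CK_ge1[OF s(1), of k] in simp)
qed (use smooth_solD[OF F(1) t k] in "simp add: CK_def")

text \<open>Beyond 2 R + 2 the weight is at least twice its value at \<open>R\<close>, so undoing
  the subtraction in \<open>smooth_high\<close> costs no more than a factor 2. The result is a sharp
  tail at order \<open>k\<close> itself.\<close>

lemma smooth_hi: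
 assumes R: "0 <= R" and t: "t : {- T..T}"
 shows "(nrm (real k) (hi (2 * R + 2) (F t)))^2 <= 2 * (CC k (real k) * tailw R (real k) (F 0))"
proof -
 note F0 = smooth_solD[OF F(1) zero_time k] and Ft = smooth_solD[OF F(1) t k]
 have [measurable]: "meas (F t)" by (rule X_meas[OF Ft(1)])
 let ?w = "wt (2 * real k)"
 have C: "0 <= CC k (real k) - 1" using CC_ge1[of "real k" k] by simp
 have le: "?w v <= 2 * (?w v - ?w R)" if "2 * R + 2 < \<bar>v\<bar>" for v
 proof -
  have p: "?w x = (1 + x^2) ^ k" for x using powr_realpow[of "1 + x^2" k] by (simp add: wt_def)
  have "2 * (1 + R^2) <= 2 * (1 + R^2) + (2 * R^2 + 8 * R + 2)" using R by simp
  also have "... = (2 * R + 2)^2" by (simp add: power2_eq_square algebra_simps)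
  also have "... <= \<bar>v\<bar>^2" by (rule power_mono[OF less_imp_le[OF that]]) (use R in simp)
  finally have "2 * (1 + R^2) <= 1 + v^2" by simp
  then have "(2 * (1 + R^2)) ^ k <= ?w v" unfolding p by (rule power_mono) simp
  moreover have "2 * ?w R <= (2 * (1 + R^2)) ^ k" unfolding p power_mult_distrib
   using k by (intro mult_right_mono) (auto simp: self_le_power)
  ultimately show ?thesis by simp
 qed
 have "ennreal ((nrm (real k) (hi (2 * R + 2) (F t)))^2) <= (NN v. ennreal 2 * ennreal (max 0 (?w v - ?w R) * (cmod (F t v))^2))"
  unfolding nn_nrm[OF hi_X(1)[OF Ft(1)], symmetric]
 proof (rule nn_integral_mono)
  fix v
  have "?w v * (cmod (F t v))^2 <= (2 * max 0 (?w v - ?w R)) * (cmod (F t v))^2" if "2 * R + 2 < \<bar>v\<bar>"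
   using le[OF that] by (intro mult_right_mono) (simp_all add: max_def)
  then show "ennreal (?w v * (cmod (hi (2 * R + 2) (F t) v))^2) <= ennreal 2 * ennreal (max 0 (?w v - ?w R) * (cmod (F t v))^2)"
   by (subst ennreal_mult[symmetric]) (auto simp: hi_def intro!: ennreal_leI)
 qed
 also have "... <= ennreal 2 * ennreal ((CC k (real k) - 1) * tailw R (real k) (F 0))"
  by (subst nn_integral_cmult, measurable) (intro mult_left_mono smooth_high R t, auto)
 also have "... = ennreal (2 * ((CC k (real k) - 1) * tailw R (real k) (F 0)))" by (subst ennreal_mult) (auto intro: mult_nonneg_nonneg C tailw F0)
 finally have "(nrm (real k) (hi (2 * R + 2) (F t)))^2 <= 2 * ((CC k (real k) - 1) * tailw R (real k) (F 0))"
  by (rule ennreal_le_iff[THEN iffD1, rotated]) (intro mult_nonneg_nonneg C tailw F0, simp)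
 then show ?thesis using tailw(2)[OF F0(1)[of "real k"], of R] by (simp add: left_diff_distrib)
qed

end

text \<open>The data are cut off at growing frequencies. Differences of two such solutions are small
  in \<open>X k\<close> because low frequencies are controlled by L2 stability times the weight of
  the band, and high ones by \<open>smooth_hi\<close>, uniformly, since a cutoff can only reduce the
  tail of the data. All bounds then pass to the limit.\<close>

lemma rough_solution:
 assumes e: "0 < q" "q <= e2" and k: "2 <= k" and f0: "f0 : X (real k)" "herm f0" "nrm 2 f0 <= q"
 defines "T \<equiv> al1 / q^2"
 obtains F where "ae x. F 0 x = f0 x" "Xcont {- T..T} (real k) F" "Xderiv {- T..T} (real k - 1) F (bh F)" "Xcont {- T..T} (real k - 1) (bh F)"
  "!!t. t : {- T..T} ==> herm (F t)" "!!t s. t : {- T..T} ==> 0 <= s ==> s <= real k ==> nrm s (F t) <= CK k s * nrm s f0"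
proof -
 have k1: "1 <= k" using k by simp
 have TT: "T = al1 / q^2" by (simp add: T_def)
 have T0: "0 : {- T..T}" using al1_pos by (simp add: T_def)
 have f0X: "f0 : X s" if "s <= real k" for s by (rule X_mono(1)[OF f0(1) that])
 have X0: "f0 : X 0" and X1: "f0 : X (0 + 1)" using k by (auto intro: f0X)
 define nn where "nn i = real (Suc i)" for i
 have nn: "0 < nn i" "0 <= nn i" for i by (simp_all add: nn_def)
 have c2: "nrm 2 (ct n f0) <= q" for n using ct_X(2)[OF f0X, of 2 n] f0(3) k by simp
 have "\<exists>F. F 0 = ct (nn i) f0 \<and> smooth_sol k T F" for i
  using smooth_solution[OF e(1) e2_small(2)[OF e(2)] al1_pos order_refl ct_X(1)[OF X0] ct_ct ct_herm[OF f0(2)] c2 nn(2)] e unfolding T_def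
  by (metis less_imp_le)
 then obtain G where G: "!!i. G i 0 = ct (nn i) f0" "!!i. smooth_sol k T (G i)" by metis
 have G2: "nrm 2 (G i 0) <= q" for i unfolding G(1) by (rule c2)
 have GX: "G i t : X s" if "t : {- T..T}" for i t s by (rule smooth_solD(1)[OF G(2) that k1])
 have GN: "nrm s (G i t) <= CK k s * nrm s f0" if t: "t : {- T..T}" and s: "0 <= s" "s <= real k" for i t s
 proof (rule order_trans[OF smooth_norm[OF e TT k1 G(2) G2 s t]])
  show "CK k s * nrm s (G i 0) <= CK k s * nrm s f0"
   unfolding G(1) by (rule mult_left_mono[OF ct_X(2)[OF f0X[OF s(2)]]]) (use CK_ge1[OF s(1), of k] in simp)
 qed
 have CK0: "0 <= CK k s * nrm s f0" if "0 <= s" for s using CK_ge1[OF that, of k] by simp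
 have ct0: "nd 0 (ct (nn i) f0) f0 <= 1 / nn j * nrm 1 f0" if "j <= i" for i j
  using order_trans[OF ct_tail[OF X1 nn(1)[of i]] mult_right_mono[of "1 / nn i" "1 / nn j" "nrm (0 + 1) f0"]] that by (simp add: nn_def frac_le)
 have G0: "nd 0 (G i t) (G j t) <= SC * (2 / nn K * nrm 1 f0)" if t: "t : {- T..T}" and ij: "K <= i" "K <= j" for i j t K
 proof -
  have "nd 0 (G i 0) (G j 0) <= 2 / nn K * nrm 1 f0"
   using nrm_triangle3[OF ct_X(1)[OF X0] X0 ct_X(1)[OF X0], of "nn i" "nn j"] nrm_minus_commute[of 0 f0 "ct (nn j) f0"] ct0[OF ij(1)] ct0[OF ij(2)] by (simp add: G(1))
  then show ?thesis
   by (intro order_trans[OF smooth_stability[OF e al1_pos order_refl k1 G(2)[unfolded T_def] G2 G(2)[unfolded T_def] G2 t[unfolded T_def]] mult_left_mono]) auto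
 qed
 define s where "s = real k - 1"
 have s: "0 <= s" "s + 1 = real k" using k by (auto simp: s_def)
 have cauchy: "\<exists>K. \<forall>i\<ge>K. \<forall>j\<ge>K. \<forall>t\<in>{- T..T}. nd (s + 1) (G i t) (G j t) < d" if d: "0 < d" for d
 proof -
  have "(%J. 2 * (CC k (real k) * tailw (real J) (real k) f0)) ----> 2 * (CC k (real k) * 0)" by (intro tendsto_intros tailw f0)
  from order_tendstoD(2)[OF this, of "(d / 4)^2"] have "\<forall>\<^sub>F J in sequentially. 2 * (CC k (real k) * tailw (real J) (real k) f0) < (d / 4)^2" using d by simp
  then obtain J :: nat where J: "2 * (CC k (real k) * tailw (real J) (real k) f0) < (d / 4)^2" by (auto simp: eventually_sequentially)
  let ?n = "2 * real J + 2"
  have h: "nrm (real k) (hi ?n (G i t)) <= d / 4" if t: "t : {- T..T}" for i t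
  proof (rule power2_le_imp_le)
   have "ennreal (tailw (real J) (real k) (G i 0)) <= ennreal (tailw (real J) (real k) f0)"
    unfolding tailw(1)[OF f0(1), symmetric] tailw(1)[OF GX[OF T0], symmetric]
    by (intro nn_integral_mono ennreal_leI mult_left_mono power_mono) (auto simp: ct_def G)
   then have "tailw (real J) (real k) (G i 0) <= tailw (real J) (real k) f0" using tailw(2)[OF f0(1)] by simp
   then have "2 * (CC k (real k) * tailw (real J) (real k) (G i 0)) <= 2 * (CC k (real k) * tailw (real J) (real k) f0)"
    using CC_ge1[of "real k" k] by (intro mult_left_mono) auto
   then show "(nrm (real k) (hi ?n (G i t)))^2 <= (d / 4)^2"
    using smooth_hi[OF e TT k1 G(2) G2 _ t, of "real J" i] J by simp
  qed (use d in simp)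
  define A where "A = wt (real k) ?n * (SC * (2 * nrm 1 f0))"
  obtain K :: nat where K: "2 * A / d < real K" using reals_Archimedean2 by blast
  have "nd (s + 1) (G i t) (G j t) < d" if ij: "K <= i" "K <= j" and t: "t : {- T..T}" for i j t
  proof -
   let ?D = "%x. G i t x - G j t x"
   have D: "?D : X r" for r by (intro X_diff GX t)
   have c: "ct ?n ?D : X (real k)" "nrm (real k) (ct ?n ?D) <= wt (real k) ?n * nrm 0 ?D" by (intro ct_up D; simp)+
   have "wt (real k) ?n * nrm 0 ?D <= wt (real k) ?n * (SC * (2 / nn K * nrm 1 f0))" by (intro mult_left_mono G0 t ij) simp
   also have "... = A / nn K" by (simp add: A_def)
   also have "... < d / 2"
   proof -
    have "2 * A / d < nn K" using K by (simp add: nn_def)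
    then show ?thesis using d nn(1)[of K] by (simp add: field_simps)
   qed
   finally have "nrm (real k) (ct ?n ?D) < d / 2" using c(2) by simp
   moreover have "nrm (real k) (%x. hi ?n (G i t) x - hi ?n (G j t) x) <= d / 4 + d / 4"
    by (rule order_trans[OF nrm_triangle_diff[OF hi_X(1)[OF GX[OF t]] hi_X(1)[OF GX[OF t]]] add_mono[OF h[OF t] h[OF t]]])
   moreover have "nrm (real k) ?D <= nrm (real k) (ct ?n ?D) + nrm (real k) (%x. hi ?n (G i t) x - hi ?n (G j t) x)"
    by (rule order_trans[OF eq_refl[OF arg_cong[of _ _ "nrm (real k)"]] nrm_triangle[OF c(1) X_diff[OF hi_X(1)[OF GX[OF t]] hi_X(1)[OF GX[OF t]]]]]) (auto simp: ct_def hi_def)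
   ultimately show ?thesis unfolding s by simp
  qed
  then show ?thesis by blast
 qed
 have GD: "Xcont {- T..T} (s + 1) (G i)" "Xderiv {- T..T} s (G i) (bh (G i))" for i
  using G(2)[of i] k unfolding smooth_sol_def s_def by (auto elim: Xcont_mono Xderiv_mono)
 obtain F where Fc: "Xcont {- T..T} (s + 1) F" and FD: "Xderiv {- T..T} s F (bh F)" and Vc: "Xcont {- T..T} s (bh F)" and Fh: "!!t. t : {- T..T} ==> herm (F t)"
  and fat: "!!t r h c N. t : {- T..T} ==> (!!i. G i t : X r) ==> h : X r ==> 0 <= c ==> (!!j. j \<ge> N ==> nd r (G j t) h <= c) ==> F t : X r \<and> nd r (F t) h <= c"
 proof (rule Xderiv_limit[where I="{- T..T}" and B="CK k (real k) * nrm (real k) f0" and s=s and r="s + 1" and P="%f x. sgnm f x + Nl f x",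
    OF _ s(1) less_imp_le[OF less_add_one] GD(1) _ CK0 smooth_solD(2)[OF G(2) _ k1] GD(2) bh_X[OF s(1)] bh_Lipschitz[OF s(1)] _ cauchy])
  show "\<exists>K. \<forall>i\<ge>K. \<forall>t\<in>{- T..T}. nd s (bh (G i) t) (bh (G i) t) < d" if "0 < d" for d using that by simp
 qed (use GN in "auto simp: s")
 have N: "nrm r (F t) <= CK k r * nrm r f0" if "t : {- T..T}" "0 <= r" "r <= real k" for t r
  using fat[OF that(1) GX[OF that(1)] X_zero CK0[OF that(2)], of 0] GN[OF that] by simp
 have d0: "F 0 : X 0 \<and> nd 0 (F 0) f0 <= 1 / nn N * nrm 1 f0" for N
  by (rule fat[OF T0 GX[OF T0] X0, of _ N]) (use ct0 nn(2)[of N] in "auto simp: G")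
 have "(%N. 1 / nn N * nrm 1 f0) ----> 0"
  unfolding nn_def using tendsto_mult_left_zero[OF LIMSEQ_inverse_real_of_nat, of "nrm 1 f0"] by (simp add: inverse_eq_divide)
 then have "nd 0 (F 0) f0 <= 0" by (rule LIMSEQ_le_const) (use d0 in blast)
 then have "ae x. F 0 x = f0 x" using n2_le_0_AE_eq d0 X0 by (simp add: nrm_0 X_0)
 then show ?thesis by (rule that) (use Fc FD Vc Fh N s in "auto simp: s_def")
qed

section \<open>The theorem in physical space\<close>

lemma Hs_norm_eq: "Hs_norm s f = nrm s (fourier_L2 f)"
proof -
 have "Hs_norm s f = sqrt ((nrm s (fourier_L2 f))^2)" unfolding Hs_norm_def nrm_sq ..
 then show ?thesis by simp
qed

lemma Hs_iff: "f : Hs s \<longleftrightarrow> f : L2 \<and> fourier_L2 f : X s"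
proof (cases "f : L2")
 case True
 then have [measurable]: "meas (fourier_L2 f)" using fourier_L2_in L2_meas by blast
 show ?thesis using True by (simp add: Hs_def X_def L2_iff norm_mult power_mult_distrib wt_sq)
qed (simp add: Hs_def)

lemma real_L2_lin:
 fixes f g :: "real => real"
 assumes "f : L2" "g : L2" shows "(%x. a * f x + b * g x) : L2"
proof -
 have "(%x. cr a * cr (f x) + cr b * cr (g x)) : L2"
  using assms by (intro L2_add L2_cmult) (simp_all add: L2_of_real)
 then have "(%x. cr (a * f x + b * g x)) : L2" by simp
 then show ?thesis by (simp only: L2_of_real)
qed

text \<open>\<open>F\<close> represents the Fourier transform of the curve \<open>u\<close>, at almost every frequency for each time.\<close>

definition repr :: "real set => (real => real => real) => (real => cfun) => bool" where
 "repr I u F \<longleftrightarrow> (\<forall>t\<in>I. u t : L2 \<and> meas (F t) \<and> (ae x. fourier_L2 (u t) x = F t x))"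

lemma reprD: "repr I u F ==> t : I ==> u t : L2" "repr I u F ==> t : I ==> meas (F t)"
 "repr I u F ==> t : I ==> ae x. fourier_L2 (u t) x = F t x" "repr I u F ==> t : I ==> meas (fourier_L2 (u t))"
 using fourier_L2_in L2_meas by (auto simp: repr_def)

lemma repr_self: "(!!t. t : I ==> u t : L2) ==> repr I u (%t. fourier_L2 (u t))"
 unfolding repr_def using fourier_L2_in L2_meas by auto

lemma repr_norm: "repr I u F ==> t : I ==> Hs_norm s (u t) = nrm s (F t)"
 unfolding Hs_norm_eq by (intro nrm_cong_AE reprD[of I u F])

lemma repr_X: assumes "repr I u F" "t : I" shows "u t : Hs s \<longleftrightarrow> F t : X s"
proof -
 have "ae x. F t x = fourier_L2 (u t) x" using reprD(3)[OF assms] by eventually_elim simp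
 then show ?thesis
  using X_cong_AE[OF _ reprD(2)[OF assms] reprD(3)[OF assms]] X_cong_AE[OF _ reprD(4)[OF assms]] reprD(1)[OF assms] by (auto simp: Hs_iff)
qed

lemma repr_lin: assumes "repr I u F" "repr I v G"
 shows "repr I (%t x. a * u t x + b * v t x) (%t w. cr a * F t w + cr b * G t w)"
 unfolding repr_def
proof (intro ballI conjI)
 fix t assume t: "t : I"
 note F = reprD[OF assms(1) t] and G = reprD[OF assms(2) t]
 note [measurable] = F(2) G(2)
 show "(%x. a * u t x + b * v t x) : L2" by (rule real_L2_lin[OF F(1) G(1)])
 show "meas (%w. cr a * F t w + cr b * G t w)" by measurable
 show "ae w. fourier_L2 (%x. a * u t x + b * v t x) w = cr a * F t w + cr b * G t w"
  using fourier_L2_lin[OF F(1) G(1), of a b] F(3) G(3) by eventually_elim simp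
qed

lemma repr_diff: assumes "repr I u F" "repr I v G" shows "repr I (%t x. u t x - v t x) (%t w. F t w - G t w)"
 using repr_lin[OF assms, of 1 "-1"] by simp

lemma repr_at: assumes "repr I u F" "t : I" shows "repr J (%_. u t) (%_. F t)"
 using assms by (auto simp: repr_def)

lemma continuous_into_Hs_iff:
 assumes r: "repr I u F" shows "continuous_into_Hs I s u \<longleftrightarrow> Xcont I s F"
proof -
 have "((%q. Hs_norm s (%x. u q x - u t x)) ---> 0) (at t within I) \<longleftrightarrow> ((%q. nd s (F q) (F t)) ---> 0) (at t within I)"
  if t: "t : I" for t
 proof (rule tendsto_cong)
  show "\<forall>\<^sub>F q in at t within I. Hs_norm s (%x. u q x - u t x) = nd s (F q) (F t)"
   using eventually_within_in[of I t]
  proof eventually_elim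
   case (elim q)
   show ?case using repr_norm[OF repr_diff[OF r repr_at[OF r t]], of q s] elim by simp
  qed
 qed
 then show ?thesis using repr_X[OF r] by (simp add: continuous_into_Hs_def Xcont_def)
qed

lemma C1_into_Hs_iff:
 assumes r: "repr I u F" and q: "repr I v G"
 shows "C1_into_Hs I s u v \<longleftrightarrow> Xcont I s F \<and> Xcont I s G \<and> Xderiv I s F G"
proof -
 have "((%p. Hs_norm s (%x. (u p x - u t x) / (p - t) - v t x)) ---> 0) (at t within I)
  \<longleftrightarrow> ((%p. nrm s (dq F G t p)) ---> 0) (at t within I)"
  if t: "t : I" for t
 proof (rule tendsto_cong)
  show "\<forall>\<^sub>F p in at t within I. Hs_norm s (%x. (u p x - u t x) / (p - t) - v t x) = nrm s (dq F G t p)"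
   using eventually_within_in[of I t]
  proof eventually_elim
   case (elim p)
   have "repr I (%p' x. (1 / (p - t)) * (u p' x - u t x) + (-1) * v t x)
    (%p' w. cr (1 / (p - t)) * (F p' w - F t w) + cr (-1) * G t w)"
    by (rule repr_lin[OF repr_diff[OF r repr_at[OF r t]] repr_at[OF q t]])
   from repr_norm[OF this, of p s] elim show ?case by simp
  qed
 qed
 then have "(\<forall>t\<in>I. ((%p. Hs_norm s (%x. (u p x - u t x) / (p - t) - v t x)) ---> 0) (at t within I))
  \<longleftrightarrow> (\<forall>t\<in>I. ((%p. nrm s (dq F G t p)) ---> 0) (at t within I))" by blast
 then show ?thesis
  unfolding C1_into_Hs_def continuous_into_Hs_iff[OF r] continuous_into_Hs_iff[OF q] by (auto simp: Xderiv_def Xcont_def)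
qed

text \<open>Both directions are used: existence carries a Fourier solution back to physical space,
  stability starts from a physical solution. Each side of the equation is an L2 function with a
  known transform, and the transform is injective up to null sets. Order 2 makes the product rule
  available.\<close>

lemma equation_fourier:
 assumes u: "u : L2" "ae y. fourier_L2 u y = F y" and F: "F : X 2"
  and v: "v : L2" "ae y. fourier_L2 v y = G y"
 shows "(ae x. v x + u x * weak_deriv u x = hilbert_transform u x) \<longleftrightarrow> (ae y. G y = sgnm F y + Nl F y)"
proof -
 have mF: "meas F" using F by (rule X_meas)
 have mu[measurable]: "meas (fourier_L2 u)" using u fourier_L2_in L2_meas by blast
 have "ae y. F y = fourier_L2 u y" using u(2) by eventually_elim simp
 then have uX: "fourier_L2 u : X 2" by (rule X_cong_AE[OF F mu])
 then have u1: "fourier_L2 u : X 1" by (rule X_mono(1)) simp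
 note w = weak_deriv_fourier[OF u(1) u1]
 let ?w = "weak_deriv u"
 have mw: "meas (fourier_L2 ?w)" using w(1) fourier_L2_in L2_meas by blast
 have "(%y. \<i> * mx (fourier_L2 u) y) : X 1" by (intro X_cmult mx_X'[OF uX]) simp
 moreover have "ae y. \<i> * mx (fourier_L2 u) y = fourier_L2 ?w y" using w(2) by eventually_elim (simp add: mx_def mult.assoc)
 ultimately have wX: "fourier_L2 ?w : X 1" by (rule X_cong_AE[OF _ mw])
 note p = fourier_product[OF u(1) uX w(1) wX]
 have c: "cr (1 / sqrt (2 * pi)) * conv (fourier_L2 u) (fourier_L2 ?w) y = - Nl F y" for y
 proof -
  have "conv (fourier_L2 u) (fourier_L2 ?w) = conv F (%y. \<i> * mx F y)"
  proof (rule conv_cong_AE[OF mu mw mF])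
   show "meas (%y. \<i> * mx F y)" unfolding mx_def using mF by measurable
   show "ae y. fourier_L2 ?w y = \<i> * mx F y" using w(2) u(2) by eventually_elim (simp add: mx_def mult.assoc)
  qed (rule u(2))
  then show ?thesis by (simp add: Nl_def conv_cmult_right m1_def)
 qed
 let ?L = "%x. 1 * v x + 1 * (u x * ?w x)"
 have L: "?L : L2" by (rule real_L2_lin[OF v(1) p(1)])
 note H = hilbert_transform_fourier[OF u(1)]
 have LF: "ae y. fourier_L2 ?L y = G y - Nl F y"
  using fourier_L2_lin[OF v(1) p(1), of 1 1] p(2) v(2)
 proof eventually_elim
  case (elim y)
  show ?case using elim c[of y] by simp
 qed
 have HF: "ae y. fourier_L2 (hilbert_transform u) y = sgnm F y"
  using H(2) u(2) by eventually_elim (simp add: sgnm_def mult.assoc)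
 show ?thesis
 proof
  assume "ae x. v x + u x * ?w x = hilbert_transform u x"
  then have e: "ae x. ?L x = hilbert_transform u x" by simp
  have "ae y. fourier_L2 (%x. ?L x - hilbert_transform u x) y = 0"
  proof -
   have z: "(%x. ?L x - hilbert_transform u x) : L2" using real_L2_lin[OF L H(1), of 1 "-1"] by simp
   have "n2 (fourier_L2 (%x. ?L x - hilbert_transform u x)) = n2 (%x. cr (?L x - hilbert_transform u x))" by (rule fourier_L2_norm[OF z])
   also have "... = n2 (%x. 0)"
   proof (rule n2_cong_AE)
    show "meas (%x. cr (?L x - hilbert_transform u x))" using z unfolding L2_of_real[symmetric] by (rule L2_meas)
    show "ae x. cr (?L x - hilbert_transform u x) = 0" using e by eventually_elim simp
   qed simp
   finally show ?thesis using n2_eq_0[OF fourier_L2_in[OF z]] by simp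
  qed
  moreover have "ae y. fourier_L2 (%x. ?L x - hilbert_transform u x) y = fourier_L2 ?L y - fourier_L2 (hilbert_transform u) y"
   using fourier_L2_lin[OF L H(1), of 1 "-1"] by simp
  ultimately show "ae y. G y = sgnm F y + Nl F y" using LF HF by eventually_elim (simp add: algebra_simps)
 next
  assume "ae y. G y = sgnm F y + Nl F y"
  then have "ae y. fourier_L2 ?L y = fourier_L2 (hilbert_transform u) y" using LF HF by eventually_elim simp
  from fourier_L2_inj[OF L H(1) this] show "ae x. v x + u x * ?w x = hilbert_transform u x" by simp
 qed
qed

text \<open>A violation at one time persists, by continuity, on a nondegenerate interval inside the
  time interval, which has positive measure; this is where 0 < T enters.\<close>

lemma continuous_AE_bound:
 fixes f :: "real => real"
 assumes c: "continuous_on {- T..T} f" and T: "0 < T" and ae: "ae t. t : {- T..T} \<longrightarrow> f t <= c" and t: "t : {- T..T}"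
 shows "f t <= c"
proof (rule ccontr)
 assume "\<not> f t <= c"
 then have "0 < f t - c" by simp
 with c t obtain d where d: "0 < d" "!!s. s : {- T..T} ==> dist s t < d ==> dist (f s) (f t) < f t - c"
  unfolding continuous_on_iff by blast
 define a where "a = max (- T) (t - d)"
 define b where "b = min T (t + d)"
 have ab: "a < b" using t d T by (auto simp: a_def b_def)
 have "ae s. s \<notin> {a<..<b}"
  using ae
 proof eventually_elim
  case (elim s)
  show ?case
  proof
   assume s: "s : {a<..<b}"
   then have "s : {- T..T}" "dist s t < d" by (auto simp: a_def b_def dist_real_def)
   then have "f s <= c" "dist (f s) (f t) < f t - c" using elim d(2) by auto
   then show False by (simp add: dist_real_def)
  qed
 qed
 moreover have "{x : space lborel. \<not> x \<notin> {a<..<b}} = {a<..<b}" by auto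
 ultimately have "emeasure lborel {a<..<b} = 0" by (subst (asm) AE_iff_measurable[of "{a<..<b}"]) auto
 then show False using ab by simp
qed

text \<open>Continuity in time identifies the essential supremum with a bound at every time;
  measurability on the restricted space comes from continuity as well.\<close>

lemma Linf_Hs_norm_le_iff:
 assumes c: "continuous_on {- T..T} (%t. Hs_norm s (u t))" and T: "0 < T"
 shows "Linf_Hs_norm {- T..T} s u <= ereal c \<longleftrightarrow> (\<forall>t\<in>{- T..T}. Hs_norm s (u t) <= c)"
proof
 let ?M = "restrict_space lborel {- T..T}"
 have I: "{- T..T} \<inter> space lborel : sets lborel" by simp
 have "(%t. Hs_norm s (u t)) : borel_measurable (restrict_space borel {- T..T})" by (rule borel_measurable_continuous_on_restrict[OF c])
 moreover have "sets (restrict_space borel {- T..T}) = sets ?M" by (simp add: sets_restrict_space)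
 ultimately have m: "(%t. Hs_norm s (u t)) : borel_measurable ?M" using measurable_cong_sets by blast
 {
  assume "Linf_Hs_norm {- T..T} s u <= ereal c"
  moreover have "AE t in ?M. ereal (Hs_norm s (u t)) <= Linf_Hs_norm {- T..T} s u" unfolding Linf_Hs_norm_def by (rule esssup_AE)
  ultimately have "AE t in ?M. Hs_norm s (u t) <= c"
   by (elim eventually_mono) (metis ereal_less_eq(3) order_trans)
  then have "ae t. t : {- T..T} \<longrightarrow> Hs_norm s (u t) <= c" unfolding AE_restrict_space_iff[OF I] .
  then show "\<forall>t\<in>{- T..T}. Hs_norm s (u t) <= c" using continuous_AE_bound[OF c T] by blast
 }
 assume b: "\<forall>t\<in>{- T..T}. Hs_norm s (u t) <= c"
 show "Linf_Hs_norm {- T..T} s u <= ereal c" unfolding Linf_Hs_norm_def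
 proof (rule esssup_I)
  show "(%t. ereal (Hs_norm s (u t))) : borel_measurable ?M" using m by measurable
  show "AE t in ?M. ereal (Hs_norm s (u t)) <= ereal c" unfolding AE_restrict_space_iff[OF I] using b by (intro AE_I2) simp
 qed
qed

lemma repr_continuous:
 assumes "repr I u F" "Xcont I r F" "s <= r" shows "continuous_on I (%t. Hs_norm s (u t))"
 using Xcont_nrm[OF Xcont_mono[OF assms(2,3)]] repr_norm[OF assms(1)] by (simp cong: continuous_on_cong)

lemma Nl_herm: assumes f: "f : X 1" and h: "herm f" shows "herm (Nl f)"
proof -
 have "meas f" using f by (rule X_meas)
 then show ?thesis unfolding herm_def Nl_alt[OF f] mx_def using conv_herm[OF h h] by simp
qed

theorem theorem1:
  "\<exists>(\<epsilon>0::real) (\<alpha>::real) (C :: nat \<Rightarrow> real \<Rightarrow> real) (C' :: nat \<Rightarrow> real). \<epsilon>0 > 0 \<and> \<alpha> > 0 \<and>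
     (\<forall>k::nat. \<forall>\<epsilon>::real. 2 \<le> k \<and> 0 < \<epsilon> \<and> \<epsilon> \<le> \<epsilon>0 \<longrightarrow>
        (\<forall>u0 :: real \<Rightarrow> real. u0 \<in> Hs (real k) \<and> Hs_norm 2 u0 \<le> \<epsilon> \<longrightarrow>
           (\<exists>u :: real \<Rightarrow> real \<Rightarrow> real.
              burgers_hilbert_solution k (life_span \<alpha> \<epsilon>) u \<and>
              (AE x in lborel. u 0 x = u0 x) \<and>
              Hs_bounds k (life_span \<alpha> \<epsilon>) (C k) u)) \<and>
        (\<forall>u1 u2 :: real \<Rightarrow> real \<Rightarrow> real.
           burgers_hilbert_solution k (life_span \<alpha> \<epsilon>) u1 \<and>
           burgers_hilbert_solution k (life_span \<alpha> \<epsilon>) u2 \<and>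
           Hs_norm 2 (u1 0) \<le> \<epsilon> \<and> Hs_norm 2 (u2 0) \<le> \<epsilon> \<and>
           Hs_bounds k (life_span \<alpha> \<epsilon>) (C k) u1 \<and>
           Hs_bounds k (life_span \<alpha> \<epsilon>) (C k) u2 \<longrightarrow>
           Linf_Hs_norm (life_span \<alpha> \<epsilon>) 0 (\<lambda>t x. u1 t x - u2 t x)
             \<le> ereal (C' k * Hs_norm 0 (\<lambda>x. u1 0 x - u2 0 x))))"
\<comment> \<open>The stability constant can be taken independent of \<open>k\<close>.\<close>
proof (rule exI[of _ e2], rule exI[of _ al1], rule exI[of _ CK], rule exI[of _ "%_. SC"], intro conjI allI impI e2_pos al1_pos)
 fix k :: nat and d :: real and u0 :: "real => real"
 assume "2 <= k \<and> 0 < d \<and> d <= e2" and u0: "u0 : Hs (real k) \<and> Hs_norm 2 u0 <= d"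
 then have k: "2 <= k" and e: "0 < d" "d <= e2" by auto
 define T where "T = al1 / d^2"
 let ?I = "{- T..T}"
 have I: "life_span al1 d = ?I" by (simp add: life_span_def T_def)
 have T: "0 < T" using e al1_pos by (simp add: T_def)
 have T0: "0 : ?I" using T by auto
 let ?f = "fourier_L2 u0"
 have uL: "u0 : L2" and fX: "?f : X (real k)" and f2: "nrm 2 ?f <= d" using u0 by (auto simp: Hs_iff Hs_norm_eq)
 have fh: "herm ?f" unfolding herm_def by (rule fourier_L2_hermitian[OF uL])
 obtain F where F0: "ae w. F 0 w = ?f w" and Fc: "Xcont ?I (real k) F"
  and FD: "Xderiv ?I (real k - 1) F (bh F)" and Vc: "Xcont ?I (real k - 1) (bh F)"
  and Fh: "!!t. t : ?I ==> herm (F t)"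
  and FN: "!!t s. t : ?I ==> 0 <= s ==> s <= real k ==> nrm s (F t) <= CK k s * nrm s ?f"
  using rough_solution[OF e k fX fh f2] unfolding T_def by blast
 let ?V = "bh F"
 have s0: "0 <= real k - 1" using k by simp
 have FX: "F t : X (real k)" if "t : ?I" for t by (rule XcontD[OF Fc that])
 have F2: "F t : X 2" "F t : X 1" "F t : L2" if "t : ?I" for t
  using X_mono(1)[OF FX[OF that], of 2] X_mono(1)[OF FX[OF that], of 1] X_mono(1)[OF FX[OF that], of 0] k by (simp_all add: X_0)
 have VL: "?V t : L2" if "t : ?I" for t using X_mono(1)[OF XderivD(2)[OF FD that], of 0] s0 by (simp add: X_0)
 \<comment> \<open>The curve is pulled back separately at each time; Hermitian symmetry makes the
   preimage real. The same is done below for its time derivative.\<close>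
 have "\<forall>t\<in>?I. \<exists>u. u : L2 \<and> (ae w. fourier_L2 u w = F t w)"
 proof
  fix t assume t: "t : ?I"
  show "\<exists>u. u : L2 \<and> (ae w. fourier_L2 u w = F t w)"
   using Fh[OF t] fourier_L2_surj[OF F2(3)[OF t]] unfolding herm_def by blast
 qed
 from bchoice[OF this] obtain u where u: "\<forall>t\<in>?I. u t : L2 \<and> (ae w. fourier_L2 (u t) w = F t w)" ..
 have Vh: "herm (?V t)" if "t : ?I" for t by (intro herm_add sgnm_herm Nl_herm Fh F2 that)
 have "\<forall>t\<in>?I. \<exists>u. u : L2 \<and> (ae w. fourier_L2 u w = ?V t w)"
 proof
  fix t assume t: "t : ?I"
  show "\<exists>u. u : L2 \<and> (ae w. fourier_L2 u w = ?V t w)"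
   using Vh[OF t] fourier_L2_surj[OF VL[OF t]] unfolding herm_def by blast
 qed
 from bchoice[OF this] obtain v where v: "\<forall>t\<in>?I. v t : L2 \<and> (ae w. fourier_L2 (v t) w = ?V t w)" ..
 have ru: "repr ?I u F" unfolding repr_def using u X_meas[OF FX] by blast
 have rv: "repr ?I v ?V" unfolding repr_def using v L2_meas[OF VL] by blast
 have sol: "burgers_hilbert_solution k ?I u"
  unfolding burgers_hilbert_solution_def
 proof (intro conjI exI[of _ v] ballI)
  show "continuous_into_Hs ?I (real k) u" unfolding continuous_into_Hs_iff[OF ru] by (rule Fc)
  show "C1_into_Hs ?I (real k - 1) u v" unfolding C1_into_Hs_iff[OF ru rv] using Xcont_mono[OF Fc, of "real k - 1"] Vc FD by simp
  fix t assume t: "t : ?I"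
  show "ae x. v t x + u t x * weak_deriv (u t) x = hilbert_transform (u t) x"
   by (rule equation_fourier[THEN iffD2, OF reprD(1)[OF ru t] reprD(3)[OF ru t] F2(1)[OF t] reprD(1)[OF rv t] reprD(3)[OF rv t]]) simp
 qed
 have eq0: "ae w. fourier_L2 (u 0) w = ?f w" using reprD(3)[OF ru T0] F0 by eventually_elim simp
 have n0: "Hs_norm s (u 0) = nrm s ?f" for s
  unfolding Hs_norm_eq by (rule nrm_cong_AE[OF reprD(4)[OF ru T0] X_meas[OF fX] eq0])
 have bounds: "Hs_bounds k ?I (CK k) u"
  unfolding Hs_bounds_def
 proof (intro allI impI)
  fix s :: real assume s: "0 <= s \<and> s <= real k"
  have "Linf_Hs_norm ?I s u <= ereal (CK k s * Hs_norm s (u 0)) \<longleftrightarrow> (\<forall>t\<in>?I. Hs_norm s (u t) <= CK k s * Hs_norm s (u 0))"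
   by (rule Linf_Hs_norm_le_iff[OF repr_continuous[OF ru Fc] T]) (use s in simp)
  then show "Linf_Hs_norm ?I s u <= ereal (CK k s * Hs_norm s (u 0))"
   unfolding n0 using FN s repr_norm[OF ru] by simp
 qed
 show "\<exists>u. burgers_hilbert_solution k (life_span al1 d) u \<and> (ae x. u 0 x = u0 x) \<and> Hs_bounds k (life_span al1 d) (CK k) u"
  unfolding I using sol bounds fourier_L2_inj[OF reprD(1)[OF ru T0] uL eq0] by blast
next
 fix k :: nat and d :: real and u1 u2 :: "real => real => real"
 assume "2 <= k \<and> 0 < d \<and> d <= e2"
  and A: "burgers_hilbert_solution k (life_span al1 d) u1 \<and> burgers_hilbert_solution k (life_span al1 d) u2 \<and>
   Hs_norm 2 (u1 0) <= d \<and> Hs_norm 2 (u2 0) <= d \<and> Hs_bounds k (life_span al1 d) (CK k) u1 \<and> Hs_bounds k (life_span al1 d) (CK k) u2"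
 then have k: "2 <= k" and e: "0 < d" "d <= e2" by auto
 define T where "T = al1 / d^2"
 let ?I = "{- T..T}"
 have I: "life_span al1 d = ?I" by (simp add: life_span_def T_def)
 have T: "0 < T" using e al1_pos by (simp add: T_def)
 have T0: "0 : ?I" using T by auto
 let ?g = "%u F. repr ?I u F \<and> Xcont ?I (real k) F \<and> Xderiv ?I 1 F (bh F) \<and> (\<forall>t\<in>?I. F t : X 2 \<and> nrm 2 (F t) <= b2 * d \<and> herm (F t))"
 have *: "?g u (%t. fourier_L2 (u t))" if sol: "burgers_hilbert_solution k ?I u" and n: "Hs_norm 2 (u 0) <= d" and b: "Hs_bounds k ?I (CK k) u" for u
 proof -
  let ?F = "%t. fourier_L2 (u t)"
  have cu: "continuous_into_Hs ?I (real k) u" using sol by (simp add: burgers_hilbert_solution_def)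
  obtain v where v: "C1_into_Hs ?I (real k - 1) u v" "!!t. t : ?I ==> ae x. v t x + u t x * weak_deriv (u t) x = hilbert_transform (u t) x"
   using sol unfolding burgers_hilbert_solution_def by blast
  have uL: "u t : L2" if "t : ?I" for t using cu that by (auto simp: continuous_into_Hs_def Hs_iff)
  have vL: "v t : L2" if "t : ?I" for t using v(1) that by (auto simp: C1_into_Hs_def continuous_into_Hs_def Hs_iff)
  have ru: "repr ?I u ?F" by (rule repr_self[OF uL])
  have rv: "repr ?I v (%t. fourier_L2 (v t))" by (rule repr_self[OF vL])
  have Fc: "Xcont ?I (real k) ?F" using cu unfolding continuous_into_Hs_iff[OF ru] .
  have F2: "?F t : X 2" if "t : ?I" for t by (rule X_mono(1)[OF XcontD[OF Fc that]]) (use k in simp)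
  have "Xderiv ?I (real k - 1) ?F (%t. fourier_L2 (v t))" using v(1) unfolding C1_into_Hs_iff[OF ru rv] by blast
  then have "Xderiv ?I 1 ?F (%t. fourier_L2 (v t))" by (rule Xderiv_mono) (use k in simp)
  \<comment> \<open>The derivative given with the solution is exchanged for the right-hand side of
    the equation, which agrees with it almost everywhere at each time.\<close>
  then have D: "Xderiv ?I 1 ?F (%t w. sgnm (?F t) w + Nl (?F t) w)"
  proof (rule Xderiv_cong_AE)
   fix t assume t: "t : ?I"
   have "sgnm (?F t) : X 1" "Nl (?F t) : X 1" using F2[OF t] X_mono(1)[OF F2[OF t], of 1] by (auto intro!: sgnm_X Nl_X)
   then show "meas (%w. sgnm (?F t) w + Nl (?F t) w)" by (intro X_meas X_add)
   show "ae w. fourier_L2 (v t) w = sgnm (?F t) w + Nl (?F t) w"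
    by (rule equation_fourier[THEN iffD1, OF reprD(1)[OF ru t] reprD(3)[OF ru t] F2[OF t] reprD(1)[OF rv t] reprD(3)[OF rv t] v(2)[OF t]])
  qed
  \<comment> \<open>At order 2 the assumed constant is \<open>b2\<close>, so the solution stays
    below \<open>b2 * d\<close> in H^2, the size that \<open>stability_const\<close> asks
    for.\<close>
  have "Linf_Hs_norm ?I 2 u <= ereal (CK k 2 * Hs_norm 2 (u 0))" using b k unfolding Hs_bounds_def by simp
  then have "\<forall>t\<in>?I. Hs_norm 2 (u t) <= CK k 2 * Hs_norm 2 (u 0)"
   by (subst (asm) Linf_Hs_norm_le_iff[OF repr_continuous[OF ru Fc] T]) (use k in simp_all)
  moreover have "CK k 2 * Hs_norm 2 (u 0) <= b2 * d" using n b2_ge by (simp add: CK_def)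
  ultimately have "nrm 2 (?F t) <= b2 * d" if "t : ?I" for t using that repr_norm[OF ru that, of 2] by fastforce
  moreover have "herm (?F t)" if "t : ?I" for t unfolding herm_def by (rule fourier_L2_hermitian[OF uL[OF that]])
  ultimately show ?thesis using ru Fc D F2 by blast
 qed
 have 1: "?g u1 (%t. fourier_L2 (u1 t))" by (rule *) (use A in "auto simp: I")
 have 2: "?g u2 (%t. fourier_L2 (u2 t))" by (rule *) (use A in "auto simp: I")
 let ?D = "%t w. fourier_L2 (u1 t) w - fourier_L2 (u2 t) w"
 have r: "repr ?I (%t x. u1 t x - u2 t x) ?D" using repr_diff 1 2 by blast
 have Dc: "Xcont ?I 1 ?D" using 1 2 by (intro Xderiv_Xcont[OF Xderiv_diff]) blast+
 have "nrm 0 (?D t) <= SC * nrm 0 (?D 0)" if t: "t : ?I" for t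
  using stability_const[OF e al1_pos order_refl, folded T_def, of "%t. fourier_L2 (u1 t)" "%t. fourier_L2 (u2 t)" t] 1 2 t by blast
 then have "\<forall>t\<in>?I. Hs_norm 0 (%x. u1 t x - u2 t x) <= SC * Hs_norm 0 (%x. u1 0 x - u2 0 x)"
  using repr_norm[OF r] T0 by simp
 then show "Linf_Hs_norm (life_span al1 d) 0 (%t x. u1 t x - u2 t x) <= ereal (SC * Hs_norm 0 (%x. u1 0 x - u2 0 x))"
  unfolding I by (subst Linf_Hs_norm_le_iff[OF repr_continuous[OF r Dc] T]) simp_all
qed

end
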